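(* Let $\mathbf a=(a_1,\dots,a_h)$ ($h\ge2$) be a composition of $n$, let $\mathcal T$ be a planar rooted binary tree with $h$ leaves, and let $\mathcal T_{\mathrm r}(\mathbf k)$ be a representation labeling of $\mathcal T$, with root label $k$ and with labels $i$ and $j$ at the left and right sons of the root. (1) We have $$\bigoplus_{m=k}^{n-k}\mathcal X_m\left[S^{n-k,k}\right]_{\mathcal T_{\mathrm r}(\mathbf k)}=V(\mathcal T(\mathbf a),\mathcal T_{\mathrm r}(\mathbf k)).$$ (2) For $0\le k\le\min\{n-m,m\}$ we have $\mathcal X_m\Psi(\mathcal T(\mathbf a),m,\mathcal T_{\mathrm r}(\mathbf k))=\lambda\,\psi(\mathcal T(\mathbf a),m,\mathcal T_{\mathrm r}(\mathbf k))$, where the constant $\lambda$ can be recursively computed by $$\lambda=\lambda'\lambda''\left[\frac{(w-j)!\,(m-i-w)!\,(\underline a_t-m-i+w)!\,(n-\underline a_t-w-j)!\,(n-k-i-j+1)!\,(k-i-j)!}{(m-k)!\,(n-m-k)!\,(n-\underline a_t-k-j+i)!\,(\underline a_t-k-i+j)!\,(n-2k+1)}\right]^{1/2},$$ and $\lambda'$ and $\lambda''$ are the constants for $\mathcal T'$ (with $m-w$ in place of $m$) and $\mathcal T''$ (with $w$ in place of $m$); here $w$ is the variable attached to the root, $\max\{j,i-\underline a_t+m\}\le w\le\min\{n-\underline a_t-j,m-i\}$.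
   Context: Composition and trees: $a_1,\dots,a_h$ are positive integers with sum $n$. Every internal vertex of $\mathcal T$ has exactly a left and a right son; the leaves from left to right carry $a_1,\dots,a_h$. $N_\tau$ is the sum of the parts at the leaves below the vertex $\tau$. A representation labeling assigns to each vertex an integer $k_\tau\ge0$, with $k_\tau=0$ at leaves, such that for every internal $\tau$ with left son $\beta$ and right son $\gamma$: $0\le k_\beta\le N_\beta/2$, $0\le k_\gamma\le N_\gamma/2$, $k_\tau-N_\beta\le k_\gamma-k_\beta\le N_\gamma-k_\tau$, $k_\beta+k_\gamma\le k_\tau$. $\mathcal T',\mathcal T''$ are the subtrees rooted at the left and right sons of the root with inherited labelings, $t$ is the number of leaves of $\mathcal T'$, $\underline a_t=a_1+\dots+a_t$, $\mathbf a'=(a_1,\dots,a_t)$, $\mathbf a''=(a_{t+1},\dots,a_h)$. Permutation modules: for a finite set $X$ with $|X|=n$, $\Omega_{\mathbf a}(X)$ is the set of $(B_1,\dots,B_h)$ of pairwise disjoint subsets of $X$ with $|B_r|=a_r$, $M^{\mathbf a}(X)$ the space of complex functions on it; $M^{\mathbf a}=M^{\mathbf a}(\{1,\dots,n\})$. For $0\le k\le n/2$, $S^{n-k,k}$ is the irreducible $S_n$-representation on the functions $f$ on $k$-subsets with $df=0$, where $d\delta_C=\sum_{x\in C}\delta_{C\setminus\{x\}}$. The subspace $[S^{n-k,k}(X)]_{\mathcal T_{\mathrm r}(\mathbf k)}\subseteq M^{\mathbf a}(X)$ is defined recursively: for a single leaf it is the one-dimensional space $M^{(a)}(X)$; otherwise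 it is the unique $\mathrm{Sym}(X)$-subspace isomorphic to $S^{n-k,k}$ of $$\bigoplus_{F\subseteq X,\,|F|=\underline a_t}[S^{\underline a_t-i,i}(F)]_{\mathcal T'_{\mathrm r}(\mathbf k)}\otimes[S^{n-\underline a_t-j,j}(X\setminus F)]_{\mathcal T''_{\mathrm r}(\mathbf k)}\subseteq\bigoplus_F M^{\mathbf a'}(F)\otimes M^{\mathbf a''}(X\setminus F)=M^{\mathbf a}(X).$$ For $X=\{1,\dots,n\}$ it is written $[S^{n-k,k}]_{\mathcal T_{\mathrm r}(\mathbf k)}$. The functions $\Psi$: for $x_r$ integers with $0\le x_r\le a_r$, $\sum x_r=m$, define $E_{\mathcal T}(\mathbf x)$ recursively: $1$ for a single leaf; otherwise, with $w=x_{t+1}+\dots+x_h$, $E_{\mathcal T}(\mathbf x)=E_{k-i-j}(n-\underline a_t-2j,\underline a_t-2i,m-i-j,w-j)E_{\mathcal T'}(x_1,\dots,x_t)E_{\mathcal T''}(x_{t+1},\dots,x_h)$ if $\max\{j,i-\underline a_t+m\}\le w\le\min\{n-\underline a_t-j,m-i\}$, and $0$ otherwise. Here $E_m(a,b,c,x)=\sum_{r=\max\{0,x-c+m\}}^{\min\{m,x\}}(-1)^r\binom{m}{r}(b-m+1)_r(-x)_r(a-m+1)_{m-r}(x-c)_{m-r}$, $(x)_s=x(x+1)\cdots(x+s-1)$. With $Y=\{1,\dots,m\}$, $\Psi(\mathcal T(\mathbf a),m,\mathcal T_{\mathrm r}(\mathbf k))\in M^{\mathbf a}$ is $(B_1,\dots,B_h)\mapsto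 E_{\mathcal T}(|B_1\cap Y|,\dots,|B_h\cap Y|)$. $SU(2)$ side: $V_l$ ($l\in\{0,\frac12,1,\dots\}$) is the space of homogeneous complex polynomials of degree $2l$ in $x,y$ with action $[T^l(g)P](x,y)=P(ax+cy,bx+dy)$, $g=\begin{pmatrix}a&b\\c&d\end{pmatrix}\in SU(2)$, and scalar product making $\psi^l_j=\sqrt{\binom{2l}{l-j}}x^{l-j}y^{l+j}$, $j=-l,\dots,l$, orthonormal. For $|l_1-l_2|\le l\le l_1+l_2$ (in integer steps), $\psi^l_j\mapsto\phi^{l_1,l_2,l}_j$ is the unique isometric $SU(2)$-embedding $V_l\to V_{l_1}\otimes V_{l_2}$ with $\langle\phi^{l_1,l_2,l}_l,\psi^{l_1}_{l_1}\otimes\psi^{l_2}_{l-l_1}\rangle>0$, and $\phi^{l_1,l_2,l}_j=\sum_{j_1,j_2}C^{l_1,l_2,l}_{j_1,j_2,j}\psi^{l_1}_{j_1}\otimes\psi^{l_2}_{j_2}$ defines the Clebsch–Gordan coefficients. Set $V_{\mathbf a}=V_{a_1/2}\otimes\cdots\otimes V_{a_h/2}$, the $r$-th factor having variables $x_r,y_r$. $V(\mathcal T(\mathbf a),\mathcal T_{\mathrm r}(\mathbf k))\subseteq V_{\mathbf a}$ is defined recursively: for a single leaf it is $V_{a/2}$; otherwise it is the unique subspace isomorphic to $V_{\frac n2-k}$ of $V(\mathcal T'(\mathbf a),\mathcal T'_{\mathrm r}(\mathbf k))\otimes V(\mathcal T''(\mathbf a),\mathcal T''_{\mathrm r}(\mathbf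 k))\cong V_{\frac{\underline a_t}2-i}\otimes V_{\frac{n-\underline a_t}2-j}$. The vector $\psi(\mathcal T(\mathbf a),m,\mathcal T_{\mathrm r}(\mathbf k))$, corresponding to $\psi^{\frac n2-k}_{\frac n2-m}$ in this subspace, is defined recursively: $\psi^{a/2}_{a/2-m}$ for a single leaf with part $a$; otherwise $$\psi(\mathcal T(\mathbf a),m,\mathcal T_{\mathrm r}(\mathbf k))=\sum_{w=\max\{j,i-\underline a_t+m\}}^{\min\{n-\underline a_t-j,m-i\}}C^{\frac{\underline a_t}2-i,\frac{n-\underline a_t}2-j,\frac n2-k}_{\frac{\underline a_t}2-m+w,\frac{n-\underline a_t}2-w,\frac n2-m}\,\psi(\mathcal T'(\mathbf a),m-w,\mathcal T'_{\mathrm r}(\mathbf k))\otimes\psi(\mathcal T''(\mathbf a),w,\mathcal T''_{\mathrm r}(\mathbf k)).$$ The linear map $\mathcal X_m:M^{\mathbf a}\to V_{\mathbf a}$ is given on Dirac functions by $\mathcal X_m\delta_{(B_1,\dots,B_h)}=x_1^{l_1}y_1^{a_1-l_1}\otimes\cdots\otimes x_h^{l_h}y_h^{a_h-l_h}$ with $l_r=|B_r\cap\{1,\dots,m\}|$.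
   Formalization: The printed recursion for λ is false (a=(2,1), all labels 0, m=1, w=0: λ=√3, but the formula gives √3/2); the right-hand side is corrected by the extra factor binom(m,w)·binom(n−m, n−a_t−w), where a_t is the underlined a_t. *)

theory Defs
  imports "HOL-Analysis.Analysis" "HOL-Library.Function_Algebras" "HOL-Combinatorics.Permutations"
begin

section \<open>Complex function spaces and representations on them\<close>

text \<open>
  All representation spaces below are complex subspaces of function spaces, with the pointwise
  operations. Functions living on a subset of the type are extended by zero.
\<close>

definition cscale :: "complex \<Rightarrow> ('a \<Rightarrow> complex) \<Rightarrow> 'a \<Rightarrow> complex" where
  "cscale c f = (\<lambda>x. c * f x)"

global_interpretation cfun: vector_space "cscale :: complex \<Rightarrow> ('a \<Rightarrow> complex) \<Rightarrow> 'a \<Rightarrow> complex"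
  by unfold_locales (auto simp: cscale_def fun_eq_iff algebra_simps)

definition invariant_under ::
  "'g set \<Rightarrow> ('g \<Rightarrow> ('a \<Rightarrow> complex) \<Rightarrow> 'a \<Rightarrow> complex) \<Rightarrow> ('a \<Rightarrow> complex) set \<Rightarrow> bool" where
  "invariant_under G \<rho> U \<longleftrightarrow> (\<forall>g\<in>G. \<forall>u\<in>U. \<rho> g u \<in> U)"

text \<open>
  The intertwiner is taken as a linear map on the whole function space; every linear map on a
  subspace extends to such a map, so this is no restriction.
\<close>

definition isomorphic_reps ::
  "'g set \<Rightarrow> ('g \<Rightarrow> ('a \<Rightarrow> complex) \<Rightarrow> 'a \<Rightarrow> complex) \<Rightarrow> ('a \<Rightarrow> complex) set
          \<Rightarrow> ('g \<Rightarrow> ('b \<Rightarrow> complex) \<Rightarrow> 'b \<Rightarrow> complex) \<Rightarrow> ('b \<Rightarrow> complex) set \<Rightarrow> bool" where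
  "isomorphic_reps G \<rho> U \<rho>' U' \<longleftrightarrow>
     (\<exists>\<Phi>. Vector_Spaces.linear cscale cscale \<Phi> \<and> bij_betw \<Phi> U U' \<and>
          (\<forall>g\<in>G. \<forall>u\<in>U. \<Phi> (\<rho> g u) = \<rho>' g (\<Phi> u)))"

definition internal_direct_sum ::
  "'i set \<Rightarrow> ('i \<Rightarrow> ('a \<Rightarrow> complex) set) \<Rightarrow> ('a \<Rightarrow> complex) set \<Rightarrow> bool" where
  "internal_direct_sum I U W \<longleftrightarrow>
     W = {\<Sum>m\<in>I. v m |v. \<forall>m\<in>I. v m \<in> U m} \<and>
     (\<forall>v. (\<forall>m\<in>I. v m \<in> U m) \<and> (\<Sum>m\<in>I. v m) = 0 \<longrightarrow> (\<forall>m\<in>I. v m = 0))"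

text \<open>
  Functions of a list of arguments: \<open>tens t f g\<close> is \<open>f \<otimes> g\<close>, where \<open>f\<close> takes the first \<open>t\<close>
  arguments and \<open>g\<close> the remaining ones.
\<close>

definition tens :: "nat \<Rightarrow> ('a list \<Rightarrow> complex) \<Rightarrow> ('a list \<Rightarrow> complex) \<Rightarrow> 'a list \<Rightarrow> complex" where
  "tens t f g = (\<lambda>xs. f (take t xs) * g (drop t xs))"

definition tens_space ::
  "nat \<Rightarrow> ('a list \<Rightarrow> complex) set \<Rightarrow> ('a list \<Rightarrow> complex) set \<Rightarrow> ('a list \<Rightarrow> complex) set" where
  "tens_space t U V = cfun.span {tens t f g |f g. f \<in> U \<and> g \<in> V}"


section \<open>Labeled trees\<close>

text \<open>
  An \<open>ltree\<close> packs together the planar binary tree, the composition (the parts sit at the leaves)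
  and the labeling (an integer at each internal vertex; leaves implicitly have label \<open>0\<close>).
\<close>

datatype ltree = Leaf nat | Node nat ltree ltree

primrec parts :: "ltree \<Rightarrow> nat list" where
  "parts (Leaf a) = [a]"
| "parts (Node k L R) = parts L @ parts R"

primrec label :: "ltree \<Rightarrow> nat" where
  "label (Leaf a) = 0"
| "label (Node k L R) = k"

definition weight :: "ltree \<Rightarrow> nat" where
  "weight T = sum_list (parts T)"

definition num_leaves :: "ltree \<Rightarrow> nat" where
  "num_leaves T = length (parts T)"

primrec rep_labeling :: "ltree \<Rightarrow> bool" where
  "rep_labeling (Leaf a) \<longleftrightarrow> True"
| "rep_labeling (Node k L R) \<longleftrightarrow> rep_labeling L \<and> rep_labeling R \<and>
     2 * label L \<le> weight L \<and> 2 * label R \<le> weight R \<and>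
     int k - int (weight L) \<le> int (label R) - int (label L) \<and>
     int (label R) - int (label L) \<le> int (weight R) - int k \<and>
     label L + label R \<le> k"

text \<open>The range of \<open>w\<close>, for a root with weight \<open>n\<close> whose left son has weight \<open>a_t\<close> and label \<open>i\<close>,
  and whose right son has label \<open>j\<close>.\<close>

definition w_range :: "nat \<Rightarrow> nat \<Rightarrow> nat \<Rightarrow> nat \<Rightarrow> nat \<Rightarrow> nat set" where
  "w_range n a_t i j m =
     {w. max (int j) (int i - int a_t + int m) \<le> int w \<and>
         int w \<le> min (int n - int a_t - int j) (int m - int i)}"


section \<open>Permutation modules and the Specht-type subspaces attached to a tree\<close>

definition Omega :: "nat list \<Rightarrow> 'x set \<Rightarrow> 'x set list set" where
  "Omega a X = {B. length B = length a \<and> (\<forall>r<length a. B ! r \<subseteq> X \<and> card (B ! r) = a ! r) \<and>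
                   (\<forall>r<length a. \<forall>s<length a. r \<noteq> s \<longrightarrow> B ! r \<inter> B ! s = {})}"

definition M :: "nat list \<Rightarrow> 'x set \<Rightarrow> ('x set list \<Rightarrow> complex) set" where
  "M a X = {f. \<forall>B. B \<notin> Omega a X \<longrightarrow> f B = 0}"

definition Sym :: "'x set \<Rightarrow> ('x \<Rightarrow> 'x) set" where
  "Sym X = {\<sigma>. \<sigma> permutes X}"

definition act_tuples :: "('x \<Rightarrow> 'x) \<Rightarrow> ('x set list \<Rightarrow> complex) \<Rightarrow> 'x set list \<Rightarrow> complex" where
  "act_tuples \<sigma> f = (\<lambda>B. f (map ((`) (inv \<sigma>)) B))"

definition act_subsets :: "('x \<Rightarrow> 'x) \<Rightarrow> ('x set \<Rightarrow> complex) \<Rightarrow> 'x set \<Rightarrow> complex" where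
  "act_subsets \<sigma> f = (\<lambda>C. f (inv \<sigma> ` C))"

definition ksubsets :: "nat \<Rightarrow> 'x set \<Rightarrow> 'x set set" where
  "ksubsets k X = {C. C \<subseteq> X \<and> card C = k}"

text \<open>\<open>dmap\<close> is the linear extension of \<open>\<delta>_C \<mapsto> \<Sum>x\<in>C. \<delta>_(C - {x})\<close>.\<close>

definition dmap :: "nat \<Rightarrow> 'x set \<Rightarrow> ('x set \<Rightarrow> complex) \<Rightarrow> 'x set \<Rightarrow> complex" where
  "dmap k X f = (\<lambda>D. \<Sum>C\<in>ksubsets k X. f C * (\<Sum>x\<in>C. if D = C - {x} then 1 else 0))"

text \<open>\<open>Specht k X\<close> is \<open>S\<^sup>(\<^sup>n\<^sup>-\<^sup>k\<^sup>,\<^sup>k\<^sup>)\<close> realized on the \<open>k\<close>-subsets of \<open>X\<close>, where \<open>n = card X\<close>.\<close>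

definition Specht :: "nat \<Rightarrow> 'x set \<Rightarrow> ('x set \<Rightarrow> complex) set" where
  "Specht k X = {f. (\<forall>C. C \<notin> ksubsets k X \<longrightarrow> f C = 0) \<and> dmap k X f = 0}"

primrec S_tree :: "ltree \<Rightarrow> 'x set \<Rightarrow> ('x set list \<Rightarrow> complex) set" where
  "S_tree (Leaf a) X = M [a] X"
| "S_tree (Node k L R) X =
     (THE U. cfun.subspace U \<and>
        U \<subseteq> cfun.span (\<Union>F\<in>ksubsets (weight L) X.
                          tens_space (num_leaves L) (S_tree L F) (S_tree R (X - F))) \<and>
        invariant_under (Sym X) act_tuples U \<and>
        isomorphic_reps (Sym X) act_subsets (Specht k X) act_tuples U)"


section \<open>The functions \<open>\<Psi>\<close>\<close>

definition Ehahn :: "nat \<Rightarrow> int \<Rightarrow> int \<Rightarrow> int \<Rightarrow> int \<Rightarrow> int" where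
  "Ehahn m a b c x =
     (\<Sum>r | max 0 (x - c + int m) \<le> int r \<and> int r \<le> min (int m) x.
        (-1) ^ r * int (m choose r) * pochhammer (b - int m + 1) r * pochhammer (- x) r *
        pochhammer (a - int m + 1) (m - r) * pochhammer (x - c) (m - r))"

primrec E_tree :: "ltree \<Rightarrow> nat list \<Rightarrow> int" where
  "E_tree (Leaf a) x = 1"
| "E_tree (Node k L R) x =
     (let t = num_leaves L; a_t = weight L; n = weight L + weight R;
          i = label L; j = label R; m = sum_list x; w = sum_list (drop t x)
      in if w \<in> w_range n a_t i j m
         then Ehahn (k - i - j) (int n - int a_t - 2 * int j) (int a_t - 2 * int i)
                    (int m - int i - int j) (int w - int j)
              * E_tree L (take t x) * E_tree R (drop t x)
         else 0)"

definition Psi :: "ltree \<Rightarrow> nat \<Rightarrow> nat set list \<Rightarrow> complex" where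
  "Psi T m = (\<lambda>B. if B \<in> Omega (parts T) {1..weight T}
                  then of_int (E_tree T (map (\<lambda>b. card (b \<inter> {1..m})) B)) else 0)"


section \<open>The \<open>SU(2)\<close> side\<close>

text \<open>
  Polynomials over the infinite field of complex numbers are identified with polynomial functions:
  an element of \<open>V_a\<close> is a function of the list \<open>[(x_1,y_1),\<dots>,(x_h,y_h)]\<close> (zero on lists of
  another length), multihomogeneous of degree \<open>a_r\<close> in \<open>(x_r,y_r)\<close>. Under this identification the
  tensor product of polynomials is \<open>tens\<close>. In particular \<open>V [d]\<close> is the space \<open>V_l\<close> with \<open>l = d/2\<close>.
\<close>

definition monomial :: "nat list \<Rightarrow> nat list \<Rightarrow> (complex \<times> complex) list \<Rightarrow> complex" where
  "monomial a l = (\<lambda>z. if length z = length a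
     then (\<Prod>r<length a. fst (z ! r) ^ (l ! r) * snd (z ! r) ^ (a ! r - l ! r)) else 0)"

definition V :: "nat list \<Rightarrow> ((complex \<times> complex) list \<Rightarrow> complex) set" where
  "V a = cfun.span {monomial a l |l. length l = length a \<and> (\<forall>r<length a. l ! r \<le> a ! r)}"

definition SU2 :: "(complex^2^2) set" where
  "SU2 = {g. g ** (\<chi> p q. cnj (g $ q $ p)) = mat 1 \<and> det g = 1}"

definition act_SU2 :: "complex^2^2 \<Rightarrow> ((complex \<times> complex) list \<Rightarrow> complex)
                         \<Rightarrow> (complex \<times> complex) list \<Rightarrow> complex" where
  "act_SU2 g P = (\<lambda>z. P (map (\<lambda>(x, y). (g$1$1 * x + g$2$1 * y, g$1$2 * x + g$2$2 * y)) z))"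

text \<open>
  Half-integral indices are avoided: for \<open>d = 2l\<close> and \<open>p = l - j\<close>, \<open>psi1 d p\<close> is
  \<open>\<psi>\<^sup>l_j = sqrt (2l choose l - j) x\<^sup>(\<^sup>l\<^sup>-\<^sup>j\<^sup>) y\<^sup>(\<^sup>l\<^sup>+\<^sup>j\<^sup>)\<close>; the condition \<open>-l \<le> j \<le> l\<close> becomes \<open>0 \<le> p \<le> d\<close>.
\<close>

definition psi1 :: "nat \<Rightarrow> nat \<Rightarrow> (complex \<times> complex) list \<Rightarrow> complex" where
  "psi1 d p = cscale (of_real (sqrt (real (d choose p)))) (monomial [d] [p])"

definition psi2 :: "nat \<Rightarrow> nat \<Rightarrow> nat \<Rightarrow> nat \<Rightarrow> (complex \<times> complex) list \<Rightarrow> complex" where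
  "psi2 d1 d2 p1 p2 = tens 1 (psi1 d1 p1) (psi1 d2 p2)"

definition basis1 :: "nat \<Rightarrow> ((complex \<times> complex) list \<Rightarrow> complex) set" where
  "basis1 d = psi1 d ` {..d}"

definition basis2 :: "nat \<Rightarrow> nat \<Rightarrow> ((complex \<times> complex) list \<Rightarrow> complex) set" where
  "basis2 d1 d2 = {psi2 d1 d2 p1 p2 |p1 p2. p1 \<le> d1 \<and> p2 \<le> d2}"

text \<open>The scalar product on the span of a finite independent set \<open>\<B>\<close> making \<open>\<B>\<close> orthonormal.\<close>

definition sprod :: "('a \<Rightarrow> complex) set \<Rightarrow> ('a \<Rightarrow> complex) \<Rightarrow> ('a \<Rightarrow> complex) \<Rightarrow> complex" where
  "sprod \<B> f g = (\<Sum>b\<in>\<B>. cfun.representation \<B> f b * cnj (cfun.representation \<B> g b))"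

text \<open>
  The isometric embedding \<open>V_l \<rightarrow> V_l1 \<otimes> V_l2\<close> for \<open>d = 2l\<close>, \<open>d1 = 2 l1\<close>, \<open>d2 = 2 l2\<close>. In the
  positivity condition \<open>\<psi>\<^sup>l_l = psi1 d 0\<close>, and \<open>\<psi>_(l - l1)\<close> in \<open>V_l2\<close> has exponent
  \<open>l2 - (l - l1) = (d1 + d2 - d)/2\<close>.
\<close>

definition is_CG_embedding :: "nat \<Rightarrow> nat \<Rightarrow> nat \<Rightarrow>
    (((complex \<times> complex) list \<Rightarrow> complex) \<Rightarrow> (complex \<times> complex) list \<Rightarrow> complex) \<Rightarrow> bool" where
  "is_CG_embedding d1 d2 d \<Phi> \<longleftrightarrow>
     Vector_Spaces.linear cscale cscale \<Phi> \<and> \<Phi> ` V [d] \<subseteq> V [d1, d2] \<and>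
     (\<forall>g\<in>SU2. \<forall>P\<in>V [d]. \<Phi> (act_SU2 g P) = act_SU2 g (\<Phi> P)) \<and>
     (\<forall>P\<in>V [d]. \<forall>Q\<in>V [d]. sprod (basis2 d1 d2) (\<Phi> P) (\<Phi> Q) = sprod (basis1 d) P Q) \<and>
     (\<exists>c>0. sprod (basis2 d1 d2) (\<Phi> (psi1 d 0)) (psi2 d1 d2 0 ((d1 + d2 - d) div 2)) =
            complex_of_real c)"

definition CG_phi :: "nat \<Rightarrow> nat \<Rightarrow> nat \<Rightarrow> nat \<Rightarrow> (complex \<times> complex) list \<Rightarrow> complex" where
  "CG_phi d1 d2 d p = (THE \<phi>. \<exists>\<Phi>. is_CG_embedding d1 d2 d \<Phi> \<and> \<phi> = \<Phi> (psi1 d p))"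

text \<open>
  \<open>CG d1 d2 d p1 p2 p\<close> is \<open>C\<close> with upper indices \<open>l1, l2, l = d1/2, d2/2, d/2\<close> and lower
  indices \<open>j1, j2, j = l1 - p1, l2 - p2, l - p\<close>.
\<close>

definition CG :: "nat \<Rightarrow> nat \<Rightarrow> nat \<Rightarrow> nat \<Rightarrow> nat \<Rightarrow> nat \<Rightarrow> complex" where
  "CG d1 d2 d p1 p2 p = cfun.representation (basis2 d1 d2) (CG_phi d1 d2 d p) (psi2 d1 d2 p1 p2)"

primrec V_tree :: "ltree \<Rightarrow> ((complex \<times> complex) list \<Rightarrow> complex) set" where
  "V_tree (Leaf a) = V [a]"
| "V_tree (Node k L R) =
     (THE U. cfun.subspace U \<and> U \<subseteq> tens_space (num_leaves L) (V_tree L) (V_tree R) \<and>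
        invariant_under SU2 act_SU2 U \<and>
        isomorphic_reps SU2 act_SU2 (V [weight L + weight R - 2 * k]) act_SU2 U)"

text \<open>
  With \<open>l1 = a_t/2 - i\<close>, \<open>l2 = (n - a_t)/2 - j\<close>, \<open>l = n/2 - k\<close> and lower indices \<open>a_t/2 - m + w\<close>,
  \<open>(n - a_t)/2 - w\<close>, \<open>n/2 - m\<close>, the exponents of the Clebsch-Gordan coefficient are
  \<open>m - w - i\<close>, \<open>w - j\<close>, \<open>m - k\<close>.
\<close>

primrec psi_tree :: "ltree \<Rightarrow> nat \<Rightarrow> (complex \<times> complex) list \<Rightarrow> complex" where
  "psi_tree (Leaf a) m = psi1 a m"
| "psi_tree (Node k L R) m =
     (let a_t = weight L; n = weight L + weight R; i = label L; j = label R
      in \<Sum>w\<in>w_range n a_t i j m.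
           cscale (CG (a_t - 2 * i) (n - a_t - 2 * j) (n - 2 * k) (m - w - i) (w - j) (m - k))
                  (tens (num_leaves L) (psi_tree L (m - w)) (psi_tree R w)))"


section \<open>The map \<open>\<X>_m\<close>\<close>

definition Xmap :: "nat list \<Rightarrow> nat \<Rightarrow> (nat set list \<Rightarrow> complex)
                      \<Rightarrow> (complex \<times> complex) list \<Rightarrow> complex" where
  "Xmap a m f = (\<Sum>B\<in>Omega a {1..sum_list a}.
                   cscale (f B) (monomial a (map (\<lambda>b. card (b \<inter> {1..m})) B)))"

text \<open>
  Decompose \<open>M\<^sup>a\<close> over the \<open>a_t\<close>-subsets \<open>F\<close> of \<open>{1..n}\<close>. All \<open>F\<close> with
  \<open>card ({1..m} - F) = w\<close> contribute the same vector to \<open>\<X>_m \<Psi>\<close>, and \<open>split_mult n a_t m w\<close> is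
  the number of such \<open>F\<close>. The recursion for the constant relating \<open>\<X>_m \<Psi>\<close> to \<open>\<psi>\<close> needs this
  factor, which the published formula omits: for the parts \<open>[2, 1]\<close>, all labels \<open>0\<close>, \<open>m = 1\<close> and
  \<open>w = 0\<close>, the constant is \<open>sqrt 3\<close>, the multiplicity is \<open>2\<close>, and the recursion without it gives
  \<open>sqrt 3 / 2\<close>.
\<close>

definition split_mult :: "nat \<Rightarrow> nat \<Rightarrow> nat \<Rightarrow> nat \<Rightarrow> nat" where
  "split_mult n a_t m w = (m choose w) * ((n - m) choose (n - a_t - w))"

end

theory Submission
  imports Defs
begin

text \<open>
  Let \<open>d = n - 2 * k\<close> at a vertex, and let \<open>\<alpha> + q\<close> and \<open>\<beta> + q\<close> be the corresponding numbers at its sons,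
  where \<open>d = \<alpha> + \<beta>\<close>. Everything rests on one generating function: the map
  \<open>(s * x + u * y) ^ d \<mapsto> (s * x1 + u * y1) ^ \<alpha> * (s * x2 + u * y2) ^ \<beta> * (x2 * y1 - x1 * y2) ^ q\<close>
  is equivariant, since the last factor is invariant under matrices of determinant one, and so it
  is the Clebsch-Gordan embedding up to a factor. Expanding it in two ways shows that its
  coefficients are the Hahn polynomials (\<open>tcoeff_eq_hcoeff\<close>, \<open>Ehahn_eq_tcoeff\<close>). Its norm follows from
  the adjointness of raising and lowering operators and Vandermonde's identity (\<open>tnorm_eq\<close>,
  \<open>tnorm_0\<close>); this is the source of the square root in the recursion for \<open>\<lambda>\<close>.

  On the side of \<open>SU(2)\<close>, an equivariant map from \<open>V [d]\<close> to \<open>V [\<alpha> + q, \<beta> + q]\<close> is a multiple of this one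
  (\<open>SU2_equivariant_unique\<close>). Hence \<open>V_tree T\<close> is the image of an explicit embedding \<open>tree_emb T\<close>,
  built up along the tree from Clebsch-Gordan maps, and \<open>psi_tree T\<close> is the image of the standard
  basis (\<open>V_tree_eq\<close>, \<open>psi_tree_eq\<close>).

  For the second part, replace \<open>{1..m}\<close> by a subset \<open>S\<close> of a finite set \<open>X\<close>. Decomposing over the unions
  \<open>F\<close> of the first blocks, the image of \<open>\<Psi>\<close> becomes a sum over \<open>w = card (S - F)\<close> of tensor products
  of the images for the subtrees. The weights in this sum are coefficients of the generating
  function, so by induction the image is a multiple of the image of a monomial under \<open>tree_emb T\<close>,
  with a known factor (\<open>XS_PsiS\<close>). The recursion for \<open>\<lambda>\<close> is then a computation with factorials.

  For the first part, the subspace attached to \<open>T\<close> turns out to be spanned by the functions \<open>\<Psi>\<close> of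
  the \<open>k\<close>-subsets of \<open>X\<close> (\<open>S_tree_eq\<close>). The bridge between the two groups is that a matrix sends the
  image of \<open>f\<close> for \<open>S\<close> to a combination of the images of \<open>f\<close> for other subsets \<open>S'\<close> (\<open>act_XS\<close>), while
  the map for \<open>S\<close> is injective on functions invariant under the stabilizer of \<open>S\<close>
  (\<open>XS_injective_on_invariants\<close>). So the lowering operator shows that \<open>\<Psi>\<close>, as a function of the
  \<open>k\<close>-subset, satisfies the equations of the Specht module (\<open>Psi_Specht_family\<close>), the raising operator
  produces the functions \<open>\<Psi>\<close> of larger sets (\<open>Psi_in_span\<close>), and the uniqueness of highest weight
  vectors gives the multiplicity one that makes the subspace well defined
  (\<open>XS_highest_weight\<close>, \<open>node_subspace_unique\<close>). Since vectors of the Specht module that are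
  invariant under the stabilizer of \<open>S\<close> are determined by one value (\<open>Specht_invariant_zero\<close>), the
  map for a set \<open>S\<close> of \<open>m\<close> points sends the subspace onto the line of \<open>psi_tree T m\<close>, and these lines
  span \<open>V_tree T\<close>.
\<close>

section \<open>Linear algebra of complex functions\<close>

lemma cscale_apply [simp]: "cscale c f x = c * f x"
  by (simp add: cscale_def)

lemma sum_functions_apply: "(\<Sum>i\<in>I. f i) x = (\<Sum>i\<in>I. f i x)"
  by (induction I rule: infinite_finite_induct) auto

abbreviation clinear :: "(('a \<Rightarrow> complex) \<Rightarrow> 'b \<Rightarrow> complex) \<Rightarrow> bool" where
  "clinear \<equiv> Vector_Spaces.linear cscale cscale"

lemma linear_cscale_iff:
  "clinear \<Phi> \<longleftrightarrow>
     (\<forall>f g. \<Phi> (f + g) = \<Phi> f + \<Phi> g) \<and> (\<forall>c f. \<Phi> (cscale c f) = cscale c (\<Phi> f))"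
  by (simp add: Vector_Spaces.linear_iff cfun.vector_space_axioms)

lemma vector_space_pair_cscale: "vector_space_pair cscale cscale"
  by (simp add: vector_space_pair_def cfun.vector_space_axioms)

lemma
  assumes "clinear \<Phi>"
  shows linear_cscale_add: "\<Phi> (f + g) = \<Phi> f + \<Phi> g"
    and linear_cscale_scale: "\<Phi> (cscale c f) = cscale c (\<Phi> f)"
    and linear_cscale_zero: "\<Phi> 0 = 0"
    and linear_cscale_diff: "\<Phi> (f - g) = \<Phi> f - \<Phi> g"
    and linear_cscale_sum: "\<Phi> (\<Sum>i\<in>I. h i) = (\<Sum>i\<in>I. \<Phi> (h i))"
proof -
  interpret vector_space_pair "cscale :: complex \<Rightarrow> ('a \<Rightarrow> complex) \<Rightarrow> _"
    "cscale :: complex \<Rightarrow> ('b \<Rightarrow> complex) \<Rightarrow> _" by (rule vector_space_pair_cscale)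
  note l = assms
  show "\<Phi> (f + g) = \<Phi> f + \<Phi> g" "\<Phi> (cscale c f) = cscale c (\<Phi> f)" "\<Phi> 0 = 0"
    "\<Phi> (f - g) = \<Phi> f - \<Phi> g" "\<Phi> (\<Sum>i\<in>I. h i) = (\<Sum>i\<in>I. \<Phi> (h i))"
    using linear_add[OF l] linear_scale[OF l] linear_0[OF l] linear_diff[OF l] linear_sum[OF l]
    by auto
qed

lemma span_family:
  assumes "finite I"
  shows "cfun.span (b ` I) = {\<Sum>i\<in>I. cscale (c i) (b i) |c. True}"
proof
  let ?S = "{\<Sum>i\<in>I. cscale (c i) (b i) |c. True}"
  have sub: "cfun.subspace ?S"
    unfolding cfun.subspace_def
  proof (intro conjI ballI allI)
    show "0 \<in> ?S"
      unfolding mem_Collect_eq by (intro exI[of _ "\<lambda>_. 0"]) simp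
  next
    fix x y assume "x \<in> ?S" "y \<in> ?S"
    then obtain c e where "x = (\<Sum>i\<in>I. cscale (c i) (b i))" "y = (\<Sum>i\<in>I. cscale (e i) (b i))"
      by blast
    then have "x + y = (\<Sum>i\<in>I. cscale (c i + e i) (b i))"
      by (simp add: cfun.scale_left_distrib sum.distrib)
    then show "x + y \<in> ?S" by (auto intro!: exI[of _ "\<lambda>i. c i + e i"])
  next
    fix k x assume "x \<in> ?S"
    then obtain c where "x = (\<Sum>i\<in>I. cscale (c i) (b i))" by blast
    then have "cscale k x = (\<Sum>i\<in>I. cscale (k * c i) (b i))"
      by (simp add: cfun.scale_sum_right)
    then show "cscale k x \<in> ?S" by (auto intro!: exI[of _ "\<lambda>i. k * c i"])
  qed
  have "b i \<in> ?S" if "i \<in> I" for i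
  proof -
    have "b i = (\<Sum>j\<in>I. cscale (if j = i then 1 else 0) (b j))"
      using assms that by (simp add: if_distrib[of "\<lambda>c. cscale c _"] cong: if_cong)
    then show ?thesis by (auto intro!: exI[of _ "\<lambda>j. if j = i then 1 else 0"])
  qed
  then show "cfun.span (b ` I) \<subseteq> ?S"
    by (intro cfun.span_minimal sub) auto
  show "?S \<subseteq> cfun.span (b ` I)"
    by (auto intro!: cfun.span_sum cfun.span_scale intro: cfun.span_base)
qed

lemma linear_cscale_image_span:
  assumes "clinear \<Phi>"
  shows "\<Phi> ` cfun.span S = cfun.span (\<Phi> ` S)"
proof -
  interpret vector_space_pair "cscale :: complex \<Rightarrow> ('a \<Rightarrow> complex) \<Rightarrow> _"
    "cscale :: complex \<Rightarrow> ('b \<Rightarrow> complex) \<Rightarrow> _" by (rule vector_space_pair_cscale)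
  show ?thesis using linear_span_image[OF assms] by simp
qed

lemma linear_cscale_image_subspace:
  assumes "clinear \<Phi>" "cfun.subspace S"
  shows "cfun.subspace (\<Phi> ` S)"
  using linear_cscale_image_span[OF assms(1), of S] assms(2) cfun.subspace_span cfun.span_eq_iff
  by metis

text \<open>
  Independence of an indexed family, as opposed to that of the set of its members, excludes
  repetitions, so that coefficients can be compared index by index.
\<close>

definition independent_family :: "'i set \<Rightarrow> ('i \<Rightarrow> 'a \<Rightarrow> complex) \<Rightarrow> bool" where
  "independent_family I b \<longleftrightarrow> (\<forall>c. (\<Sum>i\<in>I. cscale (c i) (b i)) = 0 \<longrightarrow> (\<forall>i\<in>I. c i = 0))"

lemma independent_familyD:
  assumes "independent_family I b" "(\<Sum>i\<in>I. cscale (c i) (b i)) = 0" "i \<in> I"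
  shows "c i = 0"
  using assms unfolding independent_family_def by blast

lemma independent_family_eqD:
  assumes "independent_family I b"
    "(\<Sum>i\<in>I. cscale (c i) (b i)) = (\<Sum>i\<in>I. cscale (e i) (b i))" "i \<in> I"
  shows "c i = e i"
proof -
  have "(\<Sum>i\<in>I. cscale (c i - e i) (b i)) = 0"
    using assms(2) by (simp add: cfun.scale_left_diff_distrib sum_subtractf)
  from independent_familyD[OF assms(1) this assms(3)] show ?thesis by simp
qed

lemma independent_family_inj_on:
  assumes "independent_family I b" "finite I"
  shows "inj_on b I"
proof (rule inj_onI, rule ccontr)
  fix i j assume ij: "i \<in> I" "j \<in> I" "b i = b j" "i \<noteq> j"
  have "(\<Sum>l\<in>I. cscale (if l = i then 1 else 0) (b l)) = b i"
    "(\<Sum>l\<in>I. cscale (if l = j then 1 else 0) (b l)) = b j"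
    using assms ij by (simp_all add: if_distrib[of "\<lambda>c. cscale c _"] cong: if_cong)
  then have "(\<Sum>l\<in>I. cscale (if l = i then 1 else 0) (b l)) =
    (\<Sum>l\<in>I. cscale (if l = j then 1 else 0) (b l))" using ij by simp
  from independent_family_eqD[OF assms(1) this ij(1)] ij(4) show False by simp
qed

lemma independent_family_independent:
  assumes "independent_family I b" "finite I"
  shows "cfun.independent (b ` I)"
proof -
  have "cfun.independent (b ` I) \<longleftrightarrow> (\<forall>u. (\<Sum>v\<in>b ` I. cscale (u v) v) = 0 \<longrightarrow> (\<forall>v\<in>b ` I. u v = 0))"
    using assms(2) by (subst cfun.dependent_finite) auto
  also have "\<dots>"
    using independent_familyD[OF assms(1)] 
    by (auto simp: sum.reindex[OF independent_family_inj_on[OF assms]])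
  finally show ?thesis .
qed

lemma representation_family:
  assumes "independent_family I b" "finite I" "i \<in> I"
  shows "cfun.representation (b ` I) (\<Sum>j\<in>I. cscale (c j) (b j)) (b i) = c i"
proof -
  note ind = independent_family_independent[OF assms(1,2)]
  have "cfun.representation (b ` I) (\<Sum>j\<in>I. cscale (c j) (b j)) (b i)
      = (\<Sum>j\<in>I. cfun.representation (b ` I) (cscale (c j) (b j)) (b i))"
    by (subst cfun.representation_sum[OF ind]) (auto intro: cfun.span_scale cfun.span_base)
  also have "\<dots> = (\<Sum>j\<in>I. c j * (if b i = b j then 1 else 0))"
    by (rule sum.cong[OF refl])
      (auto simp: cfun.representation_scale[OF ind] cfun.representation_basis[OF ind]
        cfun.span_base)
  also have "\<dots> = (\<Sum>j\<in>I. if j = i then c j else 0)"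
    using independent_family_inj_on[OF assms(1,2)] assms(3)
    by (intro sum.cong) (auto dest: inj_onD)
  also have "\<dots> = c i" using assms by simp
  finally show ?thesis .
qed

lemma sprod_family:
  assumes "independent_family I b" "finite I"
  shows "sprod (b ` I) (\<Sum>j\<in>I. cscale (c j) (b j)) (\<Sum>j\<in>I. cscale (e j) (b j))
       = (\<Sum>i\<in>I. c i * cnj (e i))"
  unfolding sprod_def
  by (subst sum.reindex[OF independent_family_inj_on[OF assms]])
    (auto intro!: sum.cong simp: representation_family[OF assms])

lemma linear_extension_family:
  fixes b :: "'i \<Rightarrow> 'a \<Rightarrow> complex" and e :: "'i \<Rightarrow> 'b \<Rightarrow> complex"
  assumes "independent_family I b" "finite I"
  obtains \<Phi> where "clinear \<Phi>" "\<And>i. i \<in> I \<Longrightarrow> \<Phi> (b i) = e i"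
proof -
  interpret vector_space_pair "cscale :: complex \<Rightarrow> ('a \<Rightarrow> complex) \<Rightarrow> _"
    "cscale :: complex \<Rightarrow> ('b \<Rightarrow> complex) \<Rightarrow> _" by (rule vector_space_pair_cscale)
  obtain g where g: "clinear g"
      "\<forall>x\<in>b ` I. g x = e (the_inv_into I b x)"
    using linear_independent_extend[OF independent_family_independent[OF assms],
      of "\<lambda>x. e (the_inv_into I b x)"] by blast
  then have "g (b i) = e i" if "i \<in> I" for i
    using that the_inv_into_f_f[OF independent_family_inj_on[OF assms] that] by auto
  with g show ?thesis using that by blast
qed

lemma linear_left_inverse_on:
  fixes f :: "('a \<Rightarrow> complex) \<Rightarrow> 'b \<Rightarrow> complex"
  assumes "clinear f" "cfun.subspace S" "inj_on f S"
  obtains g where "clinear g" "range g \<subseteq> S" "\<And>v. v \<in> S \<Longrightarrow> g (f v) = v"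
proof -
  interpret vector_space_pair "cscale :: complex \<Rightarrow> ('a \<Rightarrow> complex) \<Rightarrow> _"
    "cscale :: complex \<Rightarrow> ('b \<Rightarrow> complex) \<Rightarrow> _" by (rule vector_space_pair_cscale)
  show ?thesis using linear_exists_left_inverse_on[OF assms] that by blast
qed

lemma complex_polynomial_zero_on_infinite:
  fixes c :: "nat \<Rightarrow> complex"
  assumes "infinite Z" "\<And>z. z \<in> Z \<Longrightarrow> (\<Sum>i\<le>n. c i * z ^ i) = 0" "i \<le> n"
  shows "c i = 0"
proof (rule ccontr)
  assume "c i \<noteq> 0"
  then have "finite {z. (\<Sum>i\<le>n. c i * z ^ i) = 0}" using assms(3) by (intro polyfun_roots_finite)
  then show False using assms(1,2) by (metis (mono_tags, lifting) finite_subset mem_Collect_eq subsetI)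
qed

lemma infinite_of_real: "infinite (range (of_real :: real \<Rightarrow> complex))"
  using infinite_UNIV_char_0 finite_imageD[of "of_real :: real \<Rightarrow> complex" UNIV] inj_of_real by blast

lemma real_polynomial_zero:
  fixes c :: "nat \<Rightarrow> complex"
  assumes "\<And>x::real. (\<Sum>i\<le>n. c i * of_real x ^ i) = 0" "i \<le> n"
  shows "c i = 0"
  using complex_polynomial_zero_on_infinite[OF infinite_of_real _ assms(2)] assms(1) by blast

lemma real_polynomial2_zero:
  fixes c :: "nat \<Rightarrow> nat \<Rightarrow> complex"
  assumes "\<And>x y::real. (\<Sum>i\<le>m. \<Sum>j\<le>n. c i j * of_real x ^ i * of_real y ^ j) = 0" "i \<le> m" "j \<le> n"
  shows "c i j = 0"
proof -
  have "(\<Sum>j\<le>n. c i j * of_real y ^ j) = 0" for y :: real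
  proof (rule real_polynomial_zero[OF _ assms(2)])
    fix x :: real
    show "(\<Sum>i\<le>m. (\<Sum>j\<le>n. c i j * of_real y ^ j) * complex_of_real x ^ i) = 0"
      using assms(1)[of x y] by (simp add: sum_distrib_right sum_distrib_left mult_ac)
  qed
  then show ?thesis by (rule real_polynomial_zero[OF _ assms(3)])
qed

section \<open>Spaces of multihomogeneous polynomials\<close>

definition exps :: "nat list \<Rightarrow> nat list set" where
  "exps a = {l. length l = length a \<and> (\<forall>r<length a. l ! r \<le> a ! r)}"

lemma exps_Nil [simp]: "exps [] = {[]}"
  by (auto simp: exps_def)

lemma exps_Cons: "exps (a # as) = (\<lambda>(l, ls). l # ls) ` ({..a} \<times> exps as)"
proof (rule set_eqI)
  fix x
  show "x \<in> exps (a # as) \<longleftrightarrow> x \<in> (\<lambda>(l, ls). l # ls) ` ({..a} \<times> exps as)"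
    by (cases x) (auto simp: exps_def image_iff less_Suc_eq_0_disj)
qed

lemma finite_exps [simp]: "finite (exps a)"
  by (induction a) (auto simp: exps_Cons)

lemma V_eq_span: "V a = cfun.span (monomial a ` exps a)"
  unfolding V_def exps_def by (rule arg_cong[of _ _ cfun.span]) auto

lemma V_expand: "V a = {\<Sum>l\<in>exps a. cscale (c l) (monomial a l) |c. True}"
  unfolding V_eq_span by (rule span_family) simp

lemma subspace_V [simp]: "cfun.subspace (V a)"
  unfolding V_eq_span by simp

lemma tens_apply_append: "length u = t \<Longrightarrow> tens t f g (u @ v) = f u * g v"
  by (simp add: tens_def)

lemma monomial_wrong_length: "length z \<noteq> length a \<Longrightarrow> monomial a l z = 0"
  by (simp add: monomial_def)

lemma tens_monomial:
  assumes "length l = length a"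
  shows "tens (length a) (monomial a l) (monomial a' l') = monomial (a @ a') (l @ l')"
proof
  fix z :: "(complex \<times> complex) list"
  show "tens (length a) (monomial a l) (monomial a' l') z = monomial (a @ a') (l @ l') z"
  proof (cases "length z = length a + length a'")
    case True
    have "(\<Prod>r<length a + length a'. fst (z ! r) ^ ((l @ l') ! r) * snd (z ! r) ^ ((a @ a') ! r - (l @ l') ! r))
       = (\<Prod>r<length a. fst (z ! r) ^ (l ! r) * snd (z ! r) ^ (a ! r - l ! r)) *
         (\<Prod>r<length a'. fst (z ! (length a + r)) ^ (l' ! r) * snd (z ! (length a + r)) ^ (a' ! r - l' ! r))"
      by (subst prod.nat_group[symmetric, of "\<lambda>_. 1", simplified] | simp)?
        (simp add: prod.atLeast0_lessThan_Suc lessThan_atLeast0 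
          prod.atLeastLessThan_concat[of 0 "length a" "length a + length a'", symmetric]
          prod.atLeastLessThan_shift_0[of _ "length a"] nth_append assms)
    then show ?thesis using True by (simp add: tens_def monomial_def)
  next
    case False
    then have "length (take (length a) z) \<noteq> length a \<or> length (drop (length a) z) \<noteq> length a'"
      by auto
    then show ?thesis using False by (auto simp: tens_def monomial_def)
  qed
qed

text \<open>
  Fixing the second list of arguments turns a relation between tensors into a relation between
  their first factors. These vanish off the lists of length \<open>t\<close>, so it suffices to test such lists.
\<close>

lemma independent_family_tens:
  assumes b: "independent_family I b" and e: "independent_family J e"
    and len: "\<And>i z. i \<in> I \<Longrightarrow> length z \<noteq> t \<Longrightarrow> b i z = 0"
    and fin: "finite I" "finite J"
  shows "independent_family (I \<times> J) (\<lambda>(i, j). tens t (b i) (e j))"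
  unfolding independent_family_def
proof (intro allI impI)
  fix c assume 0: "(\<Sum>ij\<in>I \<times> J. cscale (c ij) (case ij of (i, j) \<Rightarrow> tens t (b i) (e j))) = 0"
  have "(\<Sum>j\<in>J. cscale (c (i, j)) (e j)) = 0" if i: "i \<in> I" for i
  proof
    fix v
    have "(\<Sum>i\<in>I. cscale (\<Sum>j\<in>J. c (i, j) * e j v) (b i)) = 0"
    proof
      fix u
      show "(\<Sum>i\<in>I. cscale (\<Sum>j\<in>J. c (i, j) * e j v) (b i)) u = 0 u"
      proof (cases "length u = t")
        case True
        have "(\<Sum>i\<in>I. cscale (\<Sum>j\<in>J. c (i, j) * e j v) (b i)) u
            = (\<Sum>ij\<in>I \<times> J. cscale (c ij) (case ij of (i, j) \<Rightarrow> tens t (b i) (e j))) (u @ v)"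
          by (simp add: sum_functions_apply sum.cartesian_product[symmetric] split_def
              sum_distrib_right sum_distrib_left tens_apply_append[OF True] mult_ac
              sum.cartesian_product')
        then show ?thesis using 0 by simp
      next
        case False
        then show ?thesis by (simp add: sum_functions_apply len)
      qed
    qed
    from independent_familyD[OF b this i]
    show "(\<Sum>j\<in>J. cscale (c (i, j)) (e j)) v = 0 v" by (simp add: sum_functions_apply)
  qed
  from independent_familyD[OF e this] show "\<forall>ij\<in>I \<times> J. c ij = 0" by auto
qed

lemma independent_family_reindex:
  assumes "bij_betw h J I"
  shows "independent_family J (\<lambda>j. b (h j)) \<longleftrightarrow> independent_family I b"
proof -
  have inj: "inj_on h J" and im: "h ` J = I" using assms by (auto simp: bij_betw_def)
  have sum: "(\<Sum>i\<in>I. cscale (c i) (b i)) = (\<Sum>j\<in>J. cscale (c (h j)) (b (h j)))" for c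
    unfolding im[symmetric] by (rule sum.reindex_cong[OF inj]) auto
  show ?thesis
  proof
    assume *: "independent_family J (\<lambda>j. b (h j))"
    show "independent_family I b"
      unfolding independent_family_def
    proof (intro allI impI)
      fix c assume "(\<Sum>i\<in>I. cscale (c i) (b i)) = 0"
      from independent_familyD[OF * this[unfolded sum]] show "\<forall>i\<in>I. c i = 0"
        using im by auto
    qed
  next
    assume *: "independent_family I b"
    show "independent_family J (\<lambda>j. b (h j))"
      unfolding independent_family_def
    proof (intro allI impI)
      fix c assume 0: "(\<Sum>j\<in>J. cscale (c j) (b (h j))) = 0"
      have "(\<Sum>i\<in>I. cscale (c (the_inv_into J h i)) (b i)) = 0"
        unfolding sum 0[symmetric] by (rule sum.cong) (auto simp: the_inv_into_f_f[OF inj])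
      from independent_familyD[OF * this] have "c (the_inv_into J h (h j)) = 0" if "j \<in> J" for j
        using im that by blast
      then show "\<forall>j\<in>J. c j = 0" by (simp add: the_inv_into_f_f[OF inj])
    qed
  qed
qed

lemma independent_family_scaled:
  assumes "independent_family I b" "\<And>i. i \<in> I \<Longrightarrow> k i \<noteq> 0"
  shows "independent_family I (\<lambda>i. cscale (k i) (b i))"
  unfolding independent_family_def
proof (intro allI impI)
  fix c assume "(\<Sum>i\<in>I. cscale (c i) (cscale (k i) (b i))) = 0"
  then have "(\<Sum>i\<in>I. cscale (c i * k i) (b i)) = 0" by simp
  from independent_familyD[OF assms(1) this] assms(2) show "\<forall>i\<in>I. c i = 0" by auto
qed

abbreviation mon1 :: "nat \<Rightarrow> nat \<Rightarrow> (complex \<times> complex) list \<Rightarrow> complex" where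
  "mon1 d p \<equiv> monomial [d] [p]"

abbreviation mon2 :: "nat \<Rightarrow> nat \<Rightarrow> nat \<Rightarrow> nat \<Rightarrow> (complex \<times> complex) list \<Rightarrow> complex" where
  "mon2 d1 d2 p1 p2 \<equiv> monomial [d1, d2] [p1, p2]"

lemma mon1_apply [simp]: "mon1 d p [(x, y)] = x ^ p * y ^ (d - p)"
  by (simp add: monomial_def)

lemma mon2_apply [simp]:
  "mon2 d1 d2 p1 p2 [(x1, y1), (x2, y2)] = x1 ^ p1 * y1 ^ (d1 - p1) * (x2 ^ p2 * y2 ^ (d2 - p2))"
  by (simp add: monomial_def lessThan_Suc)

lemma mon2_tens: "mon2 d1 d2 p1 p2 = tens 1 (mon1 d1 p1) (mon1 d2 p2)"
  using tens_monomial[of "[p1]" "[d1]" "[d2]" "[p2]"] by simp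

lemma ext_length1:
  fixes f g :: "(complex \<times> complex) list \<Rightarrow> complex"
  assumes "\<And>x y. f [(x, y)] = g [(x, y)]" "\<And>z. length z \<noteq> 1 \<Longrightarrow> f z = g z"
  shows "f = g"
proof
  fix z show "f z = g z"
    using assms by (cases "length z = 1") (auto simp: length_Suc_conv)
qed

lemma ext_length2:
  fixes f g :: "(complex \<times> complex) list \<Rightarrow> complex"
  assumes "\<And>x1 y1 x2 y2. f [(x1, y1), (x2, y2)] = g [(x1, y1), (x2, y2)]"
    "\<And>z. length z \<noteq> 2 \<Longrightarrow> f z = g z"
  shows "f = g"
proof
  fix z show "f z = g z"
    using assms by (cases "length z = 2") (auto simp: length_Suc_conv numeral_2_eq_2)
qed

lemma independent_mon1: "independent_family {..d} (mon1 d)"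
  unfolding independent_family_def
proof (intro allI impI ballI)
  fix c i assume 0: "(\<Sum>p\<le>d. cscale (c p) (mon1 d p)) = 0" and i: "i \<in> {..d}"
  have "(\<Sum>p\<le>d. c p * of_real x ^ p) = 0" for x :: real
    using fun_cong[OF 0, of "[(of_real x, 1)]"] by (simp add: sum_functions_apply)
  from real_polynomial_zero[OF this] i show "c i = 0" by simp
qed

lemma independent_monomials: "independent_family (exps a) (monomial a)"
proof (induction a)
  case Nil
  have "monomial [] [] [] = 1" by (simp add: monomial_def)
  then show ?case
    unfolding independent_family_def
    by (auto simp: fun_eq_iff sum_functions_apply dest!: spec[of _ "[]"])
next
  case (Cons a as)
  have "independent_family ({..a} \<times> exps as) (\<lambda>(p, l). tens 1 (mon1 a p) (monomial as l))"
    by (rule independent_family_tens[OF independent_mon1 Cons.IH])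
      (auto simp: monomial_wrong_length)
  also have "(\<lambda>(p, l). tens 1 (mon1 a p) (monomial as l)) = (\<lambda>pl. monomial (a # as) (case pl of (p, l) \<Rightarrow> p # l))"
    using tens_monomial[of "[_]" "[a]" as] by (auto simp: fun_eq_iff)
  finally show ?case
    by (subst (asm) independent_family_reindex) (auto simp: bij_betw_def exps_Cons inj_on_def)
qed

lemma independent_mon2: "independent_family ({..d1} \<times> {..d2}) (\<lambda>(p1, p2). mon2 d1 d2 p1 p2)"
  unfolding mon2_tens
  by (rule independent_family_tens[OF independent_mon1 independent_mon1])
    (auto simp: monomial_wrong_length)

lemma V1_eq: "V [d] = {\<Sum>p\<le>d. cscale (c p) (mon1 d p) |c. True}"
proof -
  have "monomial [d] ` exps [d] = mon1 d ` {..d}" by (force simp: exps_Cons)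
  then show ?thesis unfolding V_eq_span by (simp add: span_family)
qed

lemma V2_eq: "V [d1, d2] = {\<Sum>(p1, p2)\<in>{..d1} \<times> {..d2}. cscale (c p1 p2) (mon2 d1 d2 p1 p2) |c. True}"
proof -
  have "monomial [d1, d2] ` exps [d1, d2] = (\<lambda>(p1, p2). mon2 d1 d2 p1 p2) ` ({..d1} \<times> {..d2})"
    by (force simp: exps_Cons)
  then have "V [d1, d2] = {\<Sum>i\<in>{..d1} \<times> {..d2}. cscale (c i) (case i of (p1, p2) \<Rightarrow> mon2 d1 d2 p1 p2) |c. True}"
    unfolding V_eq_span by (simp add: span_family)
  also have "\<dots> = {\<Sum>(p1, p2)\<in>{..d1} \<times> {..d2}. cscale (c p1 p2) (mon2 d1 d2 p1 p2) |c. True}"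
    (is "?A = ?B")
  proof
    show "?A \<subseteq> ?B"
    proof
      fix f assume "f \<in> ?A"
      then obtain c where "f = (\<Sum>i\<in>{..d1} \<times> {..d2}. cscale (c i) (case i of (p1, p2) \<Rightarrow> mon2 d1 d2 p1 p2))" by blast
      then have "f = (\<Sum>(p1, p2)\<in>{..d1} \<times> {..d2}. cscale (c (p1, p2)) (mon2 d1 d2 p1 p2))"
        by (simp add: split_def)
      then show "f \<in> ?B"
        unfolding mem_Collect_eq by (intro exI[of _ "\<lambda>p1 p2. c (p1, p2)"]) simp
    qed
    show "?B \<subseteq> ?A"
    proof
      fix f assume "f \<in> ?B"
      then obtain c where "f = (\<Sum>(p1, p2)\<in>{..d1} \<times> {..d2}. cscale (c p1 p2) (mon2 d1 d2 p1 p2))" by blast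
      then have "f = (\<Sum>i\<in>{..d1} \<times> {..d2}. cscale ((\<lambda>(p1, p2). c p1 p2) i) (case i of (p1, p2) \<Rightarrow> mon2 d1 d2 p1 p2))"
        by (simp add: split_def)
      then show "f \<in> ?A"
        unfolding mem_Collect_eq by (intro exI[of _ "\<lambda>(p1, p2). c p1 p2"]) simp
    qed
  qed
  finally show ?thesis .
qed

lemma mon1_in_V: "p \<le> d \<Longrightarrow> mon1 d p \<in> V [d]"
  unfolding V_eq_span by (auto intro!: cfun.span_base imageI simp: exps_def)

lemma mon2_in_V: "p1 \<le> d1 \<Longrightarrow> p2 \<le> d2 \<Longrightarrow> mon2 d1 d2 p1 p2 \<in> V [d1, d2]"
  unfolding V_eq_span by (auto intro!: cfun.span_base imageI simp: exps_def less_Suc_eq)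

lemma V_wrong_length: "f \<in> V a \<Longrightarrow> length z \<noteq> length a \<Longrightarrow> f z = 0"
  by (auto simp: V_expand sum_functions_apply monomial_wrong_length)

lemma linear_eq_on_V1:
  assumes "clinear \<Phi>" "clinear \<Phi>'"
    "\<And>p. p \<le> d \<Longrightarrow> \<Phi> (mon1 d p) = \<Phi>' (mon1 d p)" "f \<in> V [d]"
  shows "\<Phi> f = \<Phi>' f"
  using assms(3,4) by (auto simp: V1_eq linear_cscale_sum[OF assms(1)] linear_cscale_sum[OF assms(2)]
    linear_cscale_scale[OF assms(1)] linear_cscale_scale[OF assms(2)])

lemma linear_eq_on_V2:
  assumes "clinear \<Phi>" "clinear \<Phi>'"
    "\<And>p1 p2. p1 \<le> d1 \<Longrightarrow> p2 \<le> d2 \<Longrightarrow> \<Phi> (mon2 d1 d2 p1 p2) = \<Phi>' (mon2 d1 d2 p1 p2)" "f \<in> V [d1, d2]"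
  shows "\<Phi> f = \<Phi>' f"
  using assms(3,4) by (auto simp: V2_eq linear_cscale_sum[OF assms(1)] linear_cscale_sum[OF assms(2)]
    linear_cscale_scale[OF assms(1)] linear_cscale_scale[OF assms(2)] split_def intro!: sum.cong)

subsection \<open>The two distinguished bases and their scalar products\<close>

lemma independent_psi1: "independent_family {..d} (psi1 d)"
  unfolding psi1_def by (rule independent_family_scaled[OF independent_mon1]) auto

lemma tens_cscale: "tens t (cscale c f) (cscale e g) = cscale (c * e) (tens t f g)"
  by (simp add: fun_eq_iff tens_def)

lemma psi2_eq: "psi2 d1 d2 p1 p2 =
  cscale (of_real (sqrt (real ((d1 choose p1) * (d2 choose p2))))) (mon2 d1 d2 p1 p2)"
  unfolding psi2_def psi1_def tens_cscale mon2_tens by (simp add: real_sqrt_mult)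

lemma independent_psi2: "independent_family ({..d1} \<times> {..d2}) (\<lambda>(p1, p2). psi2 d1 d2 p1 p2)"
  unfolding psi2_def
  by (rule independent_family_tens[OF independent_psi1 independent_psi1])
    (auto simp: psi1_def monomial_wrong_length)

lemma basis2_eq: "basis2 d1 d2 = (\<lambda>(p1, p2). psi2 d1 d2 p1 p2) ` ({..d1} \<times> {..d2})"
  by (force simp: basis2_def)

lemma mon1_psi1: "p \<le> d \<Longrightarrow> mon1 d p = cscale (of_real (1 / sqrt (real (d choose p)))) (psi1 d p)"
  by (simp add: psi1_def of_real_mult[symmetric] del: of_real_mult)

lemma sprod_basis1:
  "sprod (basis1 d) (\<Sum>p\<le>d. cscale (c p) (mon1 d p)) (\<Sum>p\<le>d. cscale (e p) (mon1 d p))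
     = (\<Sum>p\<le>d. c p * cnj (e p) / of_nat (d choose p))"
proof -
  have 1: "(\<Sum>p\<le>d. cscale (c p) (mon1 d p)) = (\<Sum>p\<le>d. cscale (c p * of_real (1 / sqrt (real (d choose p)))) (psi1 d p))" for c
    by (intro sum.cong refl) (simp add: mon1_psi1 del: of_real_divide)
  show ?thesis
    unfolding 1 basis1_def sprod_family[OF independent_psi1 finite_atMost]
    by (intro sum.cong refl)
      (simp add: of_real_mult[symmetric] del: of_real_mult)
qed

lemma sprod_basis2:
  "sprod (basis2 d1 d2) (\<Sum>(p1, p2)\<in>{..d1} \<times> {..d2}. cscale (c p1 p2) (mon2 d1 d2 p1 p2))
      (\<Sum>(p1, p2)\<in>{..d1} \<times> {..d2}. cscale (e p1 p2) (mon2 d1 d2 p1 p2))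
     = (\<Sum>(p1, p2)\<in>{..d1} \<times> {..d2}. c p1 p2 * cnj (e p1 p2) / of_nat ((d1 choose p1) * (d2 choose p2)))"
proof -
  have 1: "(\<Sum>(p1, p2)\<in>{..d1} \<times> {..d2}. cscale (c p1 p2) (mon2 d1 d2 p1 p2)) =
     (\<Sum>i\<in>{..d1} \<times> {..d2}. cscale (c (fst i) (snd i) * of_real (1 / sqrt (real ((d1 choose fst i) * (d2 choose snd i)))))
        ((\<lambda>(p1, p2). psi2 d1 d2 p1 p2) i))" for c
    by (intro sum.cong refl) (auto simp: psi2_eq simp flip: of_real_mult simp del: of_nat_mult)
  show ?thesis
    unfolding 1 basis2_eq sprod_family[OF independent_psi2 finite_cartesian_product[OF finite_atMost finite_atMost]]
    by (intro sum.cong refl) (auto simp: split_def simp flip: of_real_mult simp del: of_nat_mult)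
qed

section \<open>Coherent vectors and the transvectant\<close>

text \<open>
  The powers of linear forms determine linear maps on \<open>V [d]\<close>, and matrices act on them through the
  coefficients \<open>s\<close>, \<open>u\<close> alone. So equivariance only has to be checked on them.
\<close>

definition pw :: "nat \<Rightarrow> complex \<Rightarrow> complex \<Rightarrow> (complex \<times> complex) list \<Rightarrow> complex" where
  "pw d s u = (\<lambda>z. if length z = 1 then (s * fst (z ! 0) + u * snd (z ! 0)) ^ d else 0)"

text \<open>
  The polarization of \<open>(s * x + u * y) ^ (\<alpha> + \<beta>)\<close> to bidegree \<open>(\<alpha>, \<beta>)\<close>, multiplied by the \<open>q\<close>-th power
  of the bracket, the invariant of two vectors.
\<close>

definition transvectant :: "nat \<Rightarrow> nat \<Rightarrow> nat \<Rightarrow> complex \<Rightarrow> complex \<Rightarrow> (complex \<times> complex) list \<Rightarrow> complex" where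
  "transvectant \<alpha> \<beta> q s u = (\<lambda>z. if length z = 2 then
     (s * fst (z ! 0) + u * snd (z ! 0)) ^ \<alpha> * (s * fst (z ! 1) + u * snd (z ! 1)) ^ \<beta> *
     (fst (z ! 1) * snd (z ! 0) - fst (z ! 0) * snd (z ! 1)) ^ q else 0)"

lemma pw_apply [simp]: "pw d s u [(x, y)] = (s * x + u * y) ^ d"
  by (simp add: pw_def)

lemma transvectant_apply [simp]: "transvectant \<alpha> \<beta> q s u [(x1, y1), (x2, y2)] =
    (s * x1 + u * y1) ^ \<alpha> * (s * x2 + u * y2) ^ \<beta> * (x2 * y1 - x1 * y2) ^ q"
  by (simp add: transvectant_def)

lemma linear_act_SU2: "clinear (act_SU2 g)"
  by (simp add: linear_cscale_iff act_SU2_def fun_eq_iff)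

lemma act_SU2_tens: "act_SU2 g (tens t f h) = tens t (act_SU2 g f) (act_SU2 g h)"
  by (simp add: act_SU2_def tens_def take_map drop_map)

lemma act_SU2_pw: "act_SU2 g (pw d s u) = pw d (g$1$1 * s + g$1$2 * u) (g$2$1 * s + g$2$2 * u)"
  by (rule ext_length1) (auto simp: act_SU2_def algebra_simps pw_def)

text \<open>
  The bracket is a determinant, so the action multiplies it by \<open>det g\<close>.
\<close>

lemma act_SU2_transvectant:
  assumes "det g = 1"
  shows "act_SU2 g (transvectant \<alpha> \<beta> q s u) = transvectant \<alpha> \<beta> q (g$1$1 * s + g$1$2 * u) (g$2$1 * s + g$2$2 * u)"
proof (rule ext_length2)
  fix x1 y1 x2 y2
  have D: "(g$1$1 * x2 + g$2$1 * y2) * (g$1$2 * x1 + g$2$2 * y1) -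
      (g$1$1 * x1 + g$2$1 * y1) * (g$1$2 * x2 + g$2$2 * y2) = x2 * y1 - x1 * y2"
  proof -
    have "(g$1$1 * x2 + g$2$1 * y2) * (g$1$2 * x1 + g$2$2 * y1) -
      (g$1$1 * x1 + g$2$1 * y1) * (g$1$2 * x2 + g$2$2 * y2) = det g * (x2 * y1 - x1 * y2)"
      by (simp add: det_2 algebra_simps)
    then show ?thesis using assms by simp
  qed
  have lin: "s * (g$1$1 * x + g$2$1 * y) + u * (g$1$2 * x + g$2$2 * y) =
     (g$1$1 * s + g$1$2 * u) * x + (g$2$1 * s + g$2$2 * u) * y" for x y
    by (simp add: algebra_simps)
  show "act_SU2 g (transvectant \<alpha> \<beta> q s u) [(x1, y1), (x2, y2)] =
     transvectant \<alpha> \<beta> q (g$1$1 * s + g$1$2 * u) (g$2$1 * s + g$2$2 * u) [(x1, y1), (x2, y2)]"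
    by (simp only: act_SU2_def list.map prod.case transvectant_apply D lin)
qed (auto simp: act_SU2_def transvectant_def)

lemma pw_expand: "pw d s u = (\<Sum>p\<le>d. cscale (of_nat (d choose p) * s ^ p * u ^ (d - p)) (mon1 d p))"
  by (rule ext_length1)
    (auto simp: sum_functions_apply binomial_ring monomial_wrong_length power_mult_distrib mult_ac
      intro!: sum.cong, simp add: pw_def)

lemma pw_in_V: "pw d s u \<in> V [d]"
  unfolding pw_expand by (intro cfun.subspace_sum subspace_V cfun.subspace_scale mon1_in_V) auto

text \<open>
  At a fixed point both sides are polynomials in \<open>\<tau>\<close>, with the values of the maps on the monomials
  as coefficients, up to binomial factors.
\<close>

lemma linear_eq_if_eq_on_pw:
  assumes "clinear \<Phi>" "clinear \<Phi>'"
    "\<And>\<tau>::real. \<Phi> (pw d (of_real \<tau>) 1) = \<Phi>' (pw d (of_real \<tau>) 1)" "p \<le> d"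
  shows "\<Phi> (mon1 d p) = \<Phi>' (mon1 d p)"
proof
  fix z
  have "(of_nat (d choose p)) * (\<Phi> (mon1 d p) z - \<Phi>' (mon1 d p) z) = 0"
  proof (rule real_polynomial_zero[OF _ assms(4)])
    fix \<tau> :: real
    have "(\<Sum>p\<le>d. of_nat (d choose p) * (\<Phi> (mon1 d p) z - \<Phi>' (mon1 d p) z) * complex_of_real \<tau> ^ p)
        = \<Phi> (pw d (of_real \<tau>) 1) z - \<Phi>' (pw d (of_real \<tau>) 1) z"
      unfolding pw_expand linear_cscale_sum[OF assms(1)] linear_cscale_sum[OF assms(2)]
        linear_cscale_scale[OF assms(1)] linear_cscale_scale[OF assms(2)]
      by (simp add: sum_functions_apply algebra_simps sum_subtractf)
    then show "(\<Sum>p\<le>d. of_nat (d choose p) * (\<Phi> (mon1 d p) z - \<Phi>' (mon1 d p) z) * complex_of_real \<tau> ^ p) = 0"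
      using assms(3) by simp
  qed
  then show "\<Phi> (mon1 d p) z = \<Phi>' (mon1 d p) z" using assms(4) by simp
qed

lemma linear_eq_if_eq_on_pw_V:
  assumes "clinear \<Phi>" "clinear \<Phi>'"
    "\<And>\<tau>::real. \<Phi> (pw d (of_real \<tau>) 1) = \<Phi>' (pw d (of_real \<tau>) 1)" "f \<in> V [d]"
  shows "\<Phi> f = \<Phi>' f"
  by (rule linear_eq_on_V1[OF assms(1,2) _ assms(4)])
    (rule linear_eq_if_eq_on_pw[OF assms(1-3)], assumption)

text \<open>
  The coefficients of the transvectant in monomials, by expanding its three factors; \<open>r\<close> counts the
  terms \<open>x2 * y1\<close> chosen from the bracket.
\<close>

definition tcoeff :: "nat \<Rightarrow> nat \<Rightarrow> nat \<Rightarrow> nat \<Rightarrow> nat \<Rightarrow> int" where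
  "tcoeff \<alpha> \<beta> q p1 p2 = (\<Sum>r\<le>q. if q - r \<le> p1 \<and> r \<le> p2
     then (-1) ^ (q - r) * int (q choose r) * int (\<alpha> choose (p1 - (q - r))) * int (\<beta> choose (p2 - r)) else 0)"

lemma tcoeff_nonzeroD:
  assumes "tcoeff \<alpha> \<beta> q p1 p2 \<noteq> 0"
  shows "q \<le> p1 + p2" "p1 + p2 \<le> \<alpha> + \<beta> + q"
proof -
  obtain r where q: "r \<in> {..q}" and ne: "(if q - r \<le> p1 \<and> r \<le> p2
     then (-1) ^ (q - r) * int (q choose r) * int (\<alpha> choose (p1 - (q - r))) * int (\<beta> choose (p2 - r)) else 0) \<noteq> 0"
    by (rule sum.not_neutral_contains_not_neutral[OF assms[unfolded tcoeff_def]])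
  have r: "r \<le> q" "q - r \<le> p1" "r \<le> p2" "\<alpha> choose (p1 - (q - r)) \<noteq> 0" "\<beta> choose (p2 - r) \<noteq> 0"
    using q ne by (auto simp del: binomial_eq_0_iff split: if_splits)
  then have "p1 - (q - r) \<le> \<alpha>" "p2 - r \<le> \<beta>" by (auto simp: binomial_eq_0_iff)
  then show "q \<le> p1 + p2" "p1 + p2 \<le> \<alpha> + \<beta> + q" using r by linarith+
qed

lemma sum_swap3: "(\<Sum>i\<in>A. \<Sum>j\<in>B. \<Sum>r\<in>C. f i j r) = (\<Sum>r\<in>C. \<Sum>i\<in>A. \<Sum>j\<in>B. f i j r)"
proof -
  have "(\<Sum>i\<in>A. \<Sum>j\<in>B. \<Sum>r\<in>C. f i j r) = (\<Sum>i\<in>A. \<Sum>r\<in>C. \<Sum>j\<in>B. f i j r)"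
    by (intro sum.cong refl sum.swap)
  also have "\<dots> = (\<Sum>r\<in>C. \<Sum>i\<in>A. \<Sum>j\<in>B. f i j r)" by (rule sum.swap)
  finally show ?thesis .
qed

lemma sum_shifted_binomial:
  fixes h :: "nat \<Rightarrow> 'a :: comm_semiring_1"
  assumes "\<alpha> + e \<le> N"
  shows "(\<Sum>p\<le>N. if e \<le> p then of_nat (\<alpha> choose (p - e)) * h p else 0)
       = (\<Sum>i\<le>\<alpha>. of_nat (\<alpha> choose i) * h (i + e))"
proof -
  have "(\<Sum>p\<le>N. if e \<le> p then of_nat (\<alpha> choose (p - e)) * h p else 0)
      = (\<Sum>p\<in>{e..\<alpha> + e}. if e \<le> p then of_nat (\<alpha> choose (p - e)) * h p else 0)"
  proof (intro sum.mono_neutral_right ballI)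
    fix i assume "i \<in> {..N} - {e..\<alpha> + e}"
    then have "e \<le> i \<Longrightarrow> \<alpha> < i - e" by auto
    then show "(if e \<le> i then of_nat (\<alpha> choose (i - e)) * h i else 0) = 0"
      by (simp add: binomial_eq_0)
  qed (use assms in auto)
  also have "\<dots> = (\<Sum>i\<le>\<alpha>. of_nat (\<alpha> choose i) * h (i + e))"
    by (rule sum.reindex_bij_witness[of _ "\<lambda>i. i + e" "\<lambda>p. p - e"]) auto
  finally show ?thesis .
qed

lemma transvectant_expand:
  "transvectant \<alpha> \<beta> q s u = (\<Sum>(p1, p2)\<in>{..\<alpha> + q} \<times> {..\<beta> + q}.
     cscale (of_int (tcoeff \<alpha> \<beta> q p1 p2) * s ^ (p1 + p2 - q) * u ^ (\<alpha> + \<beta> + q - (p1 + p2)))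
       (mon2 (\<alpha> + q) (\<beta> + q) p1 p2))"
proof (rule ext_length2)
  fix x1 y1 x2 y2 :: complex
  let ?g = "\<lambda>p1 p2. s ^ (p1 + p2 - q) * u ^ (\<alpha> + \<beta> + q - (p1 + p2)) *
     (x1 ^ p1 * y1 ^ (\<alpha> + q - p1) * (x2 ^ p2 * y2 ^ (\<beta> + q - p2)))"
  have r: "(\<Sum>p1\<le>\<alpha> + q. \<Sum>p2\<le>\<beta> + q. (if q - r \<le> p1 \<and> r \<le> p2 then (-1) ^ (q - r) * of_nat (q choose r) *
        of_nat (\<alpha> choose (p1 - (q - r))) * of_nat (\<beta> choose (p2 - r)) else 0) * ?g p1 p2)
    = (s * x1 + u * y1) ^ \<alpha> * (s * x2 + u * y2) ^ \<beta> *
       (of_nat (q choose r) * (x2 * y1) ^ r * (- (x1 * y2)) ^ (q - r))" (is "?L = _") if "r \<le> q" for r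
  proof -
    have "?L = (-1) ^ (q - r) * of_nat (q choose r) * (\<Sum>p1\<le>\<alpha> + q. if q - r \<le> p1 then
        of_nat (\<alpha> choose (p1 - (q - r))) * (\<Sum>p2\<le>\<beta> + q. if r \<le> p2 then of_nat (\<beta> choose (p2 - r)) * ?g p1 p2 else 0) else 0)"
      unfolding sum_distrib_left by (intro sum.cong refl) (auto simp: sum_distrib_left mult_ac intro!: sum.cong)
    also have "\<dots> = (-1) ^ (q - r) * of_nat (q choose r) * (\<Sum>i\<le>\<alpha>. of_nat (\<alpha> choose i) *
        (\<Sum>j\<le>\<beta>. of_nat (\<beta> choose j) * ?g (i + (q - r)) (j + r)))"
      using that by (simp only: sum_shifted_binomial)
    also have "\<dots> = (-1) ^ (q - r) * of_nat (q choose r) * (\<Sum>i\<le>\<alpha>. of_nat (\<alpha> choose i) *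
        (\<Sum>j\<le>\<beta>. of_nat (\<beta> choose j) * ((s * x1) ^ i * (u * y1) ^ (\<alpha> - i) * ((s * x2) ^ j * (u * y2) ^ (\<beta> - j))
          * (x1 ^ (q - r) * y1 ^ r * x2 ^ r * y2 ^ (q - r)))))"
    proof (intro arg_cong[of _ _ "times _"] refl sum.cong)
      fix i j assume ij: "i \<in> {..\<alpha>}" "j \<in> {..\<beta>}"
      have e: "i + (q - r) + (j + r) - q = i + j" "\<alpha> + \<beta> + q - (i + (q - r) + (j + r)) = (\<alpha> - i) + (\<beta> - j)"
        "\<alpha> + q - (i + (q - r)) = (\<alpha> - i) + r" "\<beta> + q - (j + r) = (\<beta> - j) + (q - r)"
        using that ij by auto
      show "?g (i + (q - r)) (j + r) = (s * x1) ^ i * (u * y1) ^ (\<alpha> - i) * ((s * x2) ^ j * (u * y2) ^ (\<beta> - j))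
          * (x1 ^ (q - r) * y1 ^ r * x2 ^ r * y2 ^ (q - r))"
        unfolding e power_add power_mult_distrib by (simp add: mult_ac)
    qed
    also have "\<dots> = (-1) ^ (q - r) * of_nat (q choose r) * ((s * x1 + u * y1) ^ \<alpha> * (s * x2 + u * y2) ^ \<beta>
         * (x1 ^ (q - r) * y1 ^ r * x2 ^ r * y2 ^ (q - r)))"
      unfolding binomial_ring by (simp add: sum_product sum_distrib_left sum_distrib_right mult_ac) (rule sum.swap)
    also have "\<dots> = (s * x1 + u * y1) ^ \<alpha> * (s * x2 + u * y2) ^ \<beta> *
       (of_nat (q choose r) * (x2 * y1) ^ r * (- (x1 * y2)) ^ (q - r))"
      by (simp add: power_mult_distrib power_minus[of "x1 * y2"] mult_ac)
    finally show ?thesis .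
  qed
  have "(\<Sum>(p1, p2)\<in>{..\<alpha> + q} \<times> {..\<beta> + q}. cscale (of_int (tcoeff \<alpha> \<beta> q p1 p2) * s ^ (p1 + p2 - q) * u ^ (\<alpha> + \<beta> + q - (p1 + p2)))
       (mon2 (\<alpha> + q) (\<beta> + q) p1 p2)) [(x1, y1), (x2, y2)]
    = (\<Sum>p1\<le>\<alpha> + q. \<Sum>p2\<le>\<beta> + q. of_int (tcoeff \<alpha> \<beta> q p1 p2) * ?g p1 p2)"
    by (simp add: sum_functions_apply split_def sum.cartesian_product mult_ac)
  also have "\<dots> = (\<Sum>p1\<le>\<alpha> + q. \<Sum>p2\<le>\<beta> + q. \<Sum>r\<le>q. (if q - r \<le> p1 \<and> r \<le> p2 then (-1) ^ (q - r) * of_nat (q choose r) *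
        of_nat (\<alpha> choose (p1 - (q - r))) * of_nat (\<beta> choose (p2 - r)) else 0) * ?g p1 p2)"
    unfolding tcoeff_def of_int_sum sum_distrib_right
    by (intro sum.cong refl) (auto)
  also have "\<dots> = (\<Sum>r\<le>q. \<Sum>p1\<le>\<alpha> + q. \<Sum>p2\<le>\<beta> + q. (if q - r \<le> p1 \<and> r \<le> p2 then (-1) ^ (q - r) * of_nat (q choose r) *
        of_nat (\<alpha> choose (p1 - (q - r))) * of_nat (\<beta> choose (p2 - r)) else 0) * ?g p1 p2)"
    by (rule sum_swap3)
  also have "\<dots> = (\<Sum>r\<le>q. (s * x1 + u * y1) ^ \<alpha> * (s * x2 + u * y2) ^ \<beta> *
       (of_nat (q choose r) * (x2 * y1) ^ r * (- (x1 * y2)) ^ (q - r)))"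
    by (intro sum.cong refl r) auto
  also have "\<dots> = (s * x1 + u * y1) ^ \<alpha> * (s * x2 + u * y2) ^ \<beta> * (x2 * y1 + (- (x1 * y2))) ^ q"
    unfolding binomial_ring[of "x2 * y1"] by (simp add: sum_distrib_left)
  finally show "transvectant \<alpha> \<beta> q s u [(x1, y1), (x2, y2)] = (\<Sum>(p1, p2)\<in>{..\<alpha> + q} \<times> {..\<beta> + q}.
     cscale (of_int (tcoeff \<alpha> \<beta> q p1 p2) * s ^ (p1 + p2 - q) * u ^ (\<alpha> + \<beta> + q - (p1 + p2)))
       (mon2 (\<alpha> + q) (\<beta> + q) p1 p2)) [(x1, y1), (x2, y2)]" by simp
qed (simp add: transvectant_def sum_functions_apply monomial_wrong_length split_def)

lemma transvectant_in_V: "transvectant \<alpha> \<beta> q s u \<in> V [\<alpha> + q, \<beta> + q]"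
  unfolding transvectant_expand split_def
  by (intro cfun.subspace_sum subspace_V cfun.subspace_scale mon2_in_V) auto

text \<open>
  The same coefficients, obtained for \<open>s = u = 1\<close> by writing the bracket as
  \<open>x2 * (x1 + y1) - x1 * (x2 + y2)\<close>. This form is the one that matches the Hahn polynomials, and its
  terms satisfy the raising recursion one by one. The arguments \<open>e1\<close>, \<open>e2\<close> are the exponents of
  \<open>y1\<close>, \<open>y2\<close>, which removes all side conditions on the indices.
\<close>

definition hcoeff :: "nat \<Rightarrow> nat \<Rightarrow> nat \<Rightarrow> nat \<Rightarrow> nat \<Rightarrow> int" where
  "hcoeff \<alpha> \<beta> q e1 e2 = (\<Sum>r\<le>q. (-1) ^ (q - r) * int (q choose r) *
     int ((\<alpha> + r) choose e1) * int ((\<beta> + (q - r)) choose e2))"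

text \<open>
  Both are the coefficients of the transvectant for \<open>s = u = 1\<close>, read off at \<open>y1 = y2 = 1\<close>.
\<close>

lemma tcoeff_eq_hcoeff:
  assumes "p1 \<le> \<alpha> + q" "p2 \<le> \<beta> + q"
  shows "tcoeff \<alpha> \<beta> q p1 p2 = hcoeff \<alpha> \<beta> q (\<alpha> + q - p1) (\<beta> + q - p2)"
proof -
  have "complex_of_int (tcoeff \<alpha> \<beta> q p1 p2 - hcoeff \<alpha> \<beta> q (\<alpha> + q - p1) (\<beta> + q - p2)) = 0"
  proof (rule real_polynomial2_zero[OF _ assms])
    fix x y :: real
    have "(\<Sum>p1\<le>\<alpha> + q. \<Sum>p2\<le>\<beta> + q. complex_of_int (tcoeff \<alpha> \<beta> q p1 p2) * of_real x ^ p1 * of_real y ^ p2)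
       = transvectant \<alpha> \<beta> q 1 1 [(of_real x, 1), (of_real y, 1)]"
      unfolding transvectant_expand by (simp add: sum_functions_apply split_def sum.cartesian_product mult_ac)
    also have "\<dots> = (of_real x + 1) ^ \<alpha> * (of_real y + 1) ^ \<beta> * (of_real y * (of_real x + 1) + - (of_real x * (of_real y + 1))) ^ q"
      by (simp add: algebra_simps)
    also have "\<dots> = (\<Sum>r\<le>q. (-1) ^ (q - r) * of_nat (q choose r) * (of_real x ^ (q - r) * (of_real x + 1) ^ (\<alpha> + r))
        * (of_real y ^ r * (of_real y + 1) ^ (\<beta> + (q - r))))"
      unfolding binomial_ring[of "complex_of_real y * _"]
      by (simp only: sum_distrib_left power_add power_mult_distrib power_minus[of "complex_of_real x * _"] mult_ac)
    also have "\<dots> = (\<Sum>r\<le>q. (-1) ^ (q - r) * of_nat (q choose r) *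
        (\<Sum>p1\<le>\<alpha> + q. of_nat ((\<alpha> + r) choose (\<alpha> + q - p1)) * of_real x ^ p1)
        * (\<Sum>p2\<le>\<beta> + q. of_nat ((\<beta> + (q - r)) choose (\<beta> + q - p2)) * of_real y ^ p2))"
    proof -
      have *: "x ^ e * (x + 1) ^ \<gamma> = (\<Sum>p\<le>N. of_nat (\<gamma> choose (N - p)) * x ^ p)" if "\<gamma> + e = N" for x :: complex and \<gamma> e N
      proof -
        have "(\<Sum>p\<le>N. of_nat (\<gamma> choose (N - p)) * x ^ p) = (\<Sum>p\<le>N. if e \<le> p then of_nat (\<gamma> choose (p - e)) * x ^ p else 0)"
        proof (intro sum.cong refl)
          fix p assume p: "p \<in> {..N}"
          show "of_nat (\<gamma> choose (N - p)) * x ^ p = (if e \<le> p then of_nat (\<gamma> choose (p - e)) * x ^ p else 0)"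
          proof (cases "e \<le> p")
            case True
            then have "\<gamma> choose (N - p) = \<gamma> choose (p - e)"
              using p that binomial_symmetric[of "p - e" \<gamma>] by (simp add: add.commute)
            then show ?thesis using True by simp
          next
            case False
            then have "\<gamma> < N - p" using that by linarith
            then show ?thesis using False by (simp add: binomial_eq_0)
          qed
        qed
        also have "\<dots> = (\<Sum>i\<le>\<gamma>. of_nat (\<gamma> choose i) * x ^ (i + e))"
          using that by (intro sum_shifted_binomial) auto
        also have "\<dots> = x ^ e * (x + 1) ^ \<gamma>"
          unfolding binomial_ring by (simp add: sum_distrib_left power_add mult_ac)
        finally show ?thesis by simp
      qed
      have a: "complex_of_real x ^ (q - r) * (of_real x + 1) ^ (\<alpha> + r) = (\<Sum>p1\<le>\<alpha> + q. of_nat ((\<alpha> + r) choose (\<alpha> + q - p1)) * of_real x ^ p1)" if "r \<le> q" for r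
        using that by (intro *) simp
      have b: "complex_of_real y ^ r * (of_real y + 1) ^ (\<beta> + (q - r)) = (\<Sum>p2\<le>\<beta> + q. of_nat ((\<beta> + (q - r)) choose (\<beta> + q - p2)) * of_real y ^ p2)"
        if "r \<le> q" for r
        using that by (intro *) simp
      show ?thesis by (intro sum.cong refl) (simp only: atMost_iff a b)
    qed
    also have "\<dots> = (\<Sum>r\<le>q. \<Sum>p1\<le>\<alpha> + q. \<Sum>p2\<le>\<beta> + q. (-1) ^ (q - r) * of_nat (q choose r) *
        of_nat ((\<alpha> + r) choose (\<alpha> + q - p1)) * of_nat ((\<beta> + (q - r)) choose (\<beta> + q - p2)) * of_real x ^ p1 * of_real y ^ p2)"
      by (simp add: sum_product sum_distrib_left sum_distrib_right mult_ac)
    also have "\<dots> = (\<Sum>p1\<le>\<alpha> + q. \<Sum>p2\<le>\<beta> + q. \<Sum>r\<le>q. (-1) ^ (q - r) * of_nat (q choose r) *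
        of_nat ((\<alpha> + r) choose (\<alpha> + q - p1)) * of_nat ((\<beta> + (q - r)) choose (\<beta> + q - p2)) * of_real x ^ p1 * of_real y ^ p2)"
      by (rule sum_swap3[symmetric])
    also have "\<dots> = (\<Sum>p1\<le>\<alpha> + q. \<Sum>p2\<le>\<beta> + q. of_int (hcoeff \<alpha> \<beta> q (\<alpha> + q - p1) (\<beta> + q - p2)) * of_real x ^ p1 * of_real y ^ p2)"
      unfolding hcoeff_def of_int_sum sum_distrib_right by simp
    finally show "(\<Sum>i\<le>\<alpha> + q. \<Sum>j\<le>\<beta> + q. complex_of_int (tcoeff \<alpha> \<beta> q i j - hcoeff \<alpha> \<beta> q (\<alpha> + q - i) (\<beta> + q - j)) * of_real x ^ i * of_real y ^ j) = 0"
      by (simp add: algebra_simps sum_subtractf)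
  qed
  then show ?thesis by (simp only: of_int_eq_0_iff right_minus_eq)
qed

section \<open>The norm of the transvectant\<close>

lemma choose_Suc_real: "real (Suc e) * real (n choose Suc e) = (real n - real e) * real (n choose e)"
proof (cases "e \<le> n")
  case True
  have "Suc e * (n choose Suc e) = (n - e) * (n choose e)"
    using binomial_absorb_comp[of n e] binomial_absorption[of e n] by (cases n) (auto simp: Suc_times_binomial_eq)
  then have "real (Suc e * (n choose Suc e)) = real ((n - e) * (n choose e))" by simp
  then show ?thesis using True by (simp only: of_nat_mult of_nat_diff)
qed (simp add: binomial_eq_0)

text \<open>
  It holds for each \<open>r\<close> separately, by \<open>(e + 1) * (N choose (e + 1)) = (N - e) * (N choose e)\<close>.
\<close>

lemma hcoeff_raise:
  "real (Suc e1) * of_int (hcoeff \<alpha> \<beta> q (Suc e1) e2) + real (Suc e2) * of_int (hcoeff \<alpha> \<beta> q e1 (Suc e2))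
     = (real (\<alpha> + \<beta> + q) - real (e1 + e2)) * of_int (hcoeff \<alpha> \<beta> q e1 e2)"
proof -
  have "real (Suc e1) * ((-1) ^ (q - r) * real (q choose r) * real ((\<alpha> + r) choose Suc e1) * real ((\<beta> + (q - r)) choose e2))
     + real (Suc e2) * ((-1) ^ (q - r) * real (q choose r) * real ((\<alpha> + r) choose e1) * real ((\<beta> + (q - r)) choose Suc e2))
     = (real (\<alpha> + \<beta> + q) - real (e1 + e2)) *
       ((-1) ^ (q - r) * real (q choose r) * real ((\<alpha> + r) choose e1) * real ((\<beta> + (q - r)) choose e2))"
    (is "?l = ?r") if "r \<le> q" for r
  proof -
    have "?l = (-1) ^ (q - r) * real (q choose r) * ((real (Suc e1) * real ((\<alpha> + r) choose Suc e1)) * real ((\<beta> + (q - r)) choose e2)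
       + real ((\<alpha> + r) choose e1) * (real (Suc e2) * real ((\<beta> + (q - r)) choose Suc e2)))"
      by (simp only: algebra_simps)
    also have "\<dots> = ?r"
      unfolding choose_Suc_real using that by (simp add: of_nat_diff algebra_simps)
    finally show ?thesis .
  qed
  then show ?thesis
    unfolding hcoeff_def of_int_sum sum_distrib_left sum.distrib[symmetric]
    by (intro sum.cong) auto
qed

text \<open>
  Exchanging \<open>x\<close> and \<open>y\<close> fixes the transvectant for \<open>s = u = 1\<close> except for the sign of the bracket.
\<close>

lemma hcoeff_symmetric:
  assumes "e1 \<le> \<alpha> + q" "e2 \<le> \<beta> + q"
  shows "hcoeff \<alpha> \<beta> q (\<alpha> + q - e1) (\<beta> + q - e2) = (-1) ^ q * hcoeff \<alpha> \<beta> q e1 e2"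
proof -
  have "complex_of_int (hcoeff \<alpha> \<beta> q (\<alpha> + q - e1) (\<beta> + q - e2) - (-1) ^ q * hcoeff \<alpha> \<beta> q e1 e2) = 0"
  proof (rule real_polynomial2_zero[OF _ assms])
    fix x y :: real
    have h: "hcoeff \<alpha> \<beta> q (\<alpha> + q - i) (\<beta> + q - j) = tcoeff \<alpha> \<beta> q i j"
      "hcoeff \<alpha> \<beta> q i j = tcoeff \<alpha> \<beta> q (\<alpha> + q - i) (\<beta> + q - j)" if "i \<le> \<alpha> + q" "j \<le> \<beta> + q" for i j
      using that by (simp_all add: tcoeff_eq_hcoeff)
    have "(\<Sum>i\<le>\<alpha> + q. \<Sum>j\<le>\<beta> + q. complex_of_int (tcoeff \<alpha> \<beta> q (\<alpha> + q - i) (\<beta> + q - j)) * of_real x ^ i * of_real y ^ j)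
       = (\<Sum>i\<le>\<alpha> + q. \<Sum>j\<le>\<beta> + q. complex_of_int (tcoeff \<alpha> \<beta> q i j) * of_real x ^ (\<alpha> + q - i) * of_real y ^ (\<beta> + q - j))"
      unfolding sum.cartesian_product
      by (rule sum.reindex_bij_witness[of _ "\<lambda>(i, j). (\<alpha> + q - i, \<beta> + q - j)" "\<lambda>(i, j). (\<alpha> + q - i, \<beta> + q - j)"]) auto
    also have "\<dots> = transvectant \<alpha> \<beta> q 1 1 [(1, of_real x), (1, of_real y)]"
      unfolding transvectant_expand by (simp add: sum_functions_apply split_def sum.cartesian_product mult_ac)
    also have "\<dots> = (1 + of_real x) ^ \<alpha> * (1 + of_real y) ^ \<beta> * (- 1 * (of_real y - of_real x)) ^ q"
      by simp
    also have "\<dots> = (-1) ^ q * transvectant \<alpha> \<beta> q 1 1 [(of_real x, 1), (of_real y, 1)]"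
      unfolding power_mult_distrib by (simp add: add.commute)
    also have "\<dots> = (-1) ^ q * (\<Sum>i\<le>\<alpha> + q. \<Sum>j\<le>\<beta> + q. complex_of_int (tcoeff \<alpha> \<beta> q i j) * of_real x ^ i * of_real y ^ j)"
      unfolding transvectant_expand by (simp add: sum_functions_apply split_def sum.cartesian_product mult_ac)
    finally have "(\<Sum>i\<le>\<alpha> + q. \<Sum>j\<le>\<beta> + q. complex_of_int (hcoeff \<alpha> \<beta> q i j) * of_real x ^ i * of_real y ^ j) =
      (-1) ^ q * (\<Sum>i\<le>\<alpha> + q. \<Sum>j\<le>\<beta> + q. complex_of_int (hcoeff \<alpha> \<beta> q (\<alpha> + q - i) (\<beta> + q - j)) * of_real x ^ i * of_real y ^ j)"
      by (simp add: h)
    then have "(-1) ^ q * (\<Sum>i\<le>\<alpha> + q. \<Sum>j\<le>\<beta> + q. complex_of_int (hcoeff \<alpha> \<beta> q i j) * of_real x ^ i * of_real y ^ j) =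
      (\<Sum>i\<le>\<alpha> + q. \<Sum>j\<le>\<beta> + q. complex_of_int (hcoeff \<alpha> \<beta> q (\<alpha> + q - i) (\<beta> + q - j)) * of_real x ^ i * of_real y ^ j)"
      by (simp add: mult.assoc[symmetric] power_mult_distrib[symmetric])
    moreover have "(\<Sum>i\<le>\<alpha> + q. \<Sum>j\<le>\<beta> + q. complex_of_int (hcoeff \<alpha> \<beta> q (\<alpha> + q - i) (\<beta> + q - j) - (-1) ^ q * hcoeff \<alpha> \<beta> q i j) * of_real x ^ i * of_real y ^ j) =
      (\<Sum>i\<le>\<alpha> + q. \<Sum>j\<le>\<beta> + q. complex_of_int (hcoeff \<alpha> \<beta> q (\<alpha> + q - i) (\<beta> + q - j)) * of_real x ^ i * of_real y ^ j) -
      (-1) ^ q * (\<Sum>i\<le>\<alpha> + q. \<Sum>j\<le>\<beta> + q. complex_of_int (hcoeff \<alpha> \<beta> q i j) * of_real x ^ i * of_real y ^ j)"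
      unfolding sum_distrib_left sum_subtractf[symmetric]
      by (intro sum.cong refl) (simp add: algebra_simps)
    ultimately show "(\<Sum>i\<le>\<alpha> + q. \<Sum>j\<le>\<beta> + q. complex_of_int (hcoeff \<alpha> \<beta> q (\<alpha> + q - i) (\<beta> + q - j) - (-1) ^ q * hcoeff \<alpha> \<beta> q i j) * of_real x ^ i * of_real y ^ j) = 0"
      by simp
  qed
  then show ?thesis by (simp only: of_int_eq_0_iff right_minus_eq)
qed

lemma hcoeff_zero:
  assumes "\<alpha> + q < e1 \<or> \<beta> + q < e2"
  shows "hcoeff \<alpha> \<beta> q e1 e2 = 0"
  unfolding hcoeff_def using assms by (intro sum.neutral) (auto simp: binomial_eq_0)

text \<open>
  The raising recursion seen through the symmetry.
\<close>

lemma hcoeff_lower: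
  assumes "e1 \<le> \<alpha> + q" "e2 \<le> \<beta> + q"
  shows "(if e1 = 0 then 0 else (real (\<alpha> + q) - real e1 + 1) * of_int (hcoeff \<alpha> \<beta> q (e1 - 1) e2)) +
     (if e2 = 0 then 0 else (real (\<beta> + q) - real e2 + 1) * of_int (hcoeff \<alpha> \<beta> q e1 (e2 - 1))) =
     (real (e1 + e2) - real q) * of_int (hcoeff \<alpha> \<beta> q e1 e2)"
proof -
  let ?h = "\<lambda>i j. real_of_int (hcoeff \<alpha> \<beta> q i j)"
  have s: "(-1) ^ q * ?h (\<alpha> + q - i) (\<beta> + q - j) = ?h i j" if "i \<le> \<alpha> + q" "j \<le> \<beta> + q" for i j
    using hcoeff_symmetric[OF that] by (simp add: mult.assoc[symmetric] power_mult_distrib[symmetric])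
  have 1: "(-1) ^ q * (real (Suc (\<alpha> + q - e1)) * ?h (Suc (\<alpha> + q - e1)) (\<beta> + q - e2)) =
    (if e1 = 0 then 0 else (real (\<alpha> + q) - real e1 + 1) * ?h (e1 - 1) e2)"
  proof (cases "e1 = 0")
    case True then show ?thesis by (simp add: hcoeff_zero)
  next
    case False
    then have e: "Suc (\<alpha> + q - e1) = \<alpha> + q - (e1 - 1)" using assms by auto
    have r: "real (\<alpha> + q - (e1 - 1)) = real (\<alpha> + q) - real e1 + 1" using False assms by (simp add: of_nat_diff)
    have "(-1) ^ q * ?h (\<alpha> + q - (e1 - 1)) (\<beta> + q - e2) = ?h (e1 - 1) e2"
      using assms by (intro s) auto
    then show ?thesis unfolding e r mult.left_commute[of "(-1 :: real) ^ q"] using False by simp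
  qed
  have 2: "(-1) ^ q * (real (Suc (\<beta> + q - e2)) * ?h (\<alpha> + q - e1) (Suc (\<beta> + q - e2))) =
    (if e2 = 0 then 0 else (real (\<beta> + q) - real e2 + 1) * ?h e1 (e2 - 1))"
  proof (cases "e2 = 0")
    case True then show ?thesis by (simp add: hcoeff_zero)
  next
    case False
    then have e: "Suc (\<beta> + q - e2) = \<beta> + q - (e2 - 1)" using assms by auto
    have r: "real (\<beta> + q - (e2 - 1)) = real (\<beta> + q) - real e2 + 1" using False assms by (simp add: of_nat_diff)
    have "(-1) ^ q * ?h (\<alpha> + q - e1) (\<beta> + q - (e2 - 1)) = ?h e1 (e2 - 1)"
      using assms by (intro s) auto
    then show ?thesis unfolding e r mult.left_commute[of "(-1 :: real) ^ q"] using False by simp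
  qed
  have "(-1) ^ q * ((real (\<alpha> + \<beta> + q) - real ((\<alpha> + q - e1) + (\<beta> + q - e2))) * ?h (\<alpha> + q - e1) (\<beta> + q - e2))
      = (real (e1 + e2) - real q) * ?h e1 e2"
    using s[OF assms] assms by (simp add: of_nat_diff algebra_simps)
  then show ?thesis
    unfolding hcoeff_raise[symmetric] distrib_left 1 2 .
qed

text \<open>
  The squared norm of the component of degree \<open>e\<close> of the transvectant, for the scalar product in
  which \<open>x ^ p * y ^ (d - p)\<close> has squared norm \<open>1 / (d choose p)\<close>.
\<close>

definition tnorm :: "nat \<Rightarrow> nat \<Rightarrow> nat \<Rightarrow> nat \<Rightarrow> real" where
  "tnorm \<alpha> \<beta> q e = (\<Sum>e1\<le>\<alpha> + q. \<Sum>e2\<le>\<beta> + q. if e1 + e2 = e + q then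
     (of_int (hcoeff \<alpha> \<beta> q e1 e2))\<^sup>2 / (real ((\<alpha> + q) choose e1) * real ((\<beta> + q) choose e2)) else 0)"

lemma sum_shift_if:
  fixes f :: "nat \<Rightarrow> real"
  assumes "f (Suc n) = 0"
  shows "(\<Sum>i\<le>n. f (Suc i)) = (\<Sum>i\<le>n. if i = 0 then 0 else f i)"
proof -
  have "(\<Sum>i\<le>n. f (Suc i)) = (\<Sum>i<n. f (Suc i))"
    using assms by (simp add: lessThan_Suc_atMost[symmetric])
  also have "\<dots> = (\<Sum>i\<le>n. if i = 0 then 0 else f i)"
    by (subst sum.atMost_shift) simp
  finally show ?thesis .
qed

lemma div_choose_shift:
  assumes "i \<le> n" "i \<noteq> 0"
  shows "real i / real (n choose (i - 1)) = (real n - real i + 1) / real (n choose i)"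
proof -
  obtain k where k: "i = Suc k" using assms by (cases i) auto
  have "real (n choose i) > 0" "real (n choose k) > 0" using assms k by auto
  then show ?thesis using choose_Suc_real[of k n] k by (simp add: field_simps)
qed

text \<open>
  For this scalar product the raising and the lowering operator are adjoint: a shift of the
  summation index, with \<open>div_choose_shift\<close>, turns the recursion for one into that for the other.
\<close>

lemma tnorm_Suc: "(real (\<alpha> + \<beta>) - real e) * tnorm \<alpha> \<beta> q e = real (Suc e) * tnorm \<alpha> \<beta> q (Suc e)"
proof -
  let ?h = "\<lambda>i j. real_of_int (hcoeff \<alpha> \<beta> q i j)"
  let ?c1 = "\<lambda>i. real ((\<alpha> + q) choose i)" and ?c2 = "\<lambda>j. real ((\<beta> + q) choose j)"
  have "(real (\<alpha> + \<beta>) - real e) * tnorm \<alpha> \<beta> q e = (\<Sum>i\<le>\<alpha> + q. \<Sum>j\<le>\<beta> + q. if i + j = e + q then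
     ?h i j * (real (Suc i) * ?h (Suc i) j + real (Suc j) * ?h i (Suc j)) / (?c1 i * ?c2 j) else 0)"
    unfolding tnorm_def sum_distrib_left hcoeff_raise
    by (intro sum.cong refl) (auto simp: power2_eq_square)
  also have "\<dots> = (\<Sum>j\<le>\<beta> + q. \<Sum>i\<le>\<alpha> + q. if Suc i + j = Suc e + q then
       ?h i j * (real (Suc i) * ?h (Suc i) j) / (?c1 i * ?c2 j) else 0) +
     (\<Sum>i\<le>\<alpha> + q. \<Sum>j\<le>\<beta> + q. if i + Suc j = Suc e + q then
       ?h i j * (real (Suc j) * ?h i (Suc j)) / (?c1 i * ?c2 j) else 0)"
    by (subst sum.swap[of _ "{..\<alpha> + q}"])
      (auto simp: sum.distrib[symmetric] distrib_left add_divide_distrib intro!: sum.cong)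
  also have "(\<Sum>j\<le>\<beta> + q. \<Sum>i\<le>\<alpha> + q. if Suc i + j = Suc e + q then
       ?h i j * (real (Suc i) * ?h (Suc i) j) / (?c1 i * ?c2 j) else 0) =
     (\<Sum>j\<le>\<beta> + q. \<Sum>i\<le>\<alpha> + q. if i = 0 then 0 else if i + j = Suc e + q then
       ?h (i - 1) j * (real i * ?h i j) / (?c1 (i - 1) * ?c2 j) else 0)"
    by (rule sum.cong[OF refl], subst sum_shift_if[symmetric], auto simp: hcoeff_zero cong: if_cong)
  also have "\<dots> = (\<Sum>j\<le>\<beta> + q. \<Sum>i\<le>\<alpha> + q. if i + j = Suc e + q then ?h i j *
     (if i = 0 then 0 else (real (\<alpha> + q) - real i + 1) * ?h (i - 1) j) / (?c1 i * ?c2 j) else 0)"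
  proof (intro sum.cong refl)
    fix i j assume ij: "i \<in> {..\<alpha> + q}" "j \<in> {..\<beta> + q}"
    have "?h (i - 1) j * (real i * ?h i j) / (?c1 (i - 1) * ?c2 j) =
      ?h i j * ((real (\<alpha> + q) - real i + 1) * ?h (i - 1) j) / (?c1 i * ?c2 j)" if "i \<noteq> 0"
    proof -
      have "?h (i - 1) j * (real i * ?h i j) / (?c1 (i - 1) * ?c2 j) =
        ?h (i - 1) j * ?h i j / ?c2 j * (real i / ?c1 (i - 1))" by (simp add: mult_ac)
      also have "\<dots> = ?h i j * ((real (\<alpha> + q) - real i + 1) * ?h (i - 1) j) / (?c1 i * ?c2 j)"
        using ij that by (subst div_choose_shift) (auto simp: mult_ac)
      finally show ?thesis .
    qed
    then show "(if i = 0 then 0 else if i + j = Suc e + q then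
       ?h (i - 1) j * (real i * ?h i j) / (?c1 (i - 1) * ?c2 j) else 0) = (if i + j = Suc e + q then ?h i j *
     (if i = 0 then 0 else (real (\<alpha> + q) - real i + 1) * ?h (i - 1) j) / (?c1 i * ?c2 j) else 0)" by simp
  qed
  also have "(\<Sum>i\<le>\<alpha> + q. \<Sum>j\<le>\<beta> + q. if i + Suc j = Suc e + q then
       ?h i j * (real (Suc j) * ?h i (Suc j)) / (?c1 i * ?c2 j) else 0) =
     (\<Sum>i\<le>\<alpha> + q. \<Sum>j\<le>\<beta> + q. if j = 0 then 0 else if i + j = Suc e + q then
       ?h i (j - 1) * (real j * ?h i j) / (?c1 i * ?c2 (j - 1)) else 0)"
    by (rule sum.cong[OF refl], subst sum_shift_if[symmetric], auto simp: hcoeff_zero cong: if_cong)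
  also have "\<dots> = (\<Sum>i\<le>\<alpha> + q. \<Sum>j\<le>\<beta> + q. if i + j = Suc e + q then ?h i j *
     (if j = 0 then 0 else (real (\<beta> + q) - real j + 1) * ?h i (j - 1)) / (?c1 i * ?c2 j) else 0)"
  proof (intro sum.cong refl)
    fix i j assume ij: "i \<in> {..\<alpha> + q}" "j \<in> {..\<beta> + q}"
    have "?h i (j - 1) * (real j * ?h i j) / (?c1 i * ?c2 (j - 1)) =
      ?h i j * ((real (\<beta> + q) - real j + 1) * ?h i (j - 1)) / (?c1 i * ?c2 j)" if "j \<noteq> 0"
    proof -
      have "?h i (j - 1) * (real j * ?h i j) / (?c1 i * ?c2 (j - 1)) =
        ?h i (j - 1) * ?h i j / ?c1 i * (real j / ?c2 (j - 1))" by (simp add: mult_ac)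
      also have "\<dots> = ?h i j * ((real (\<beta> + q) - real j + 1) * ?h i (j - 1)) / (?c1 i * ?c2 j)"
        using ij that by (subst div_choose_shift) (auto simp: mult_ac)
      finally show ?thesis .
    qed
    then show "(if j = 0 then 0 else if i + j = Suc e + q then
       ?h i (j - 1) * (real j * ?h i j) / (?c1 i * ?c2 (j - 1)) else 0) = (if i + j = Suc e + q then ?h i j *
     (if j = 0 then 0 else (real (\<beta> + q) - real j + 1) * ?h i (j - 1)) / (?c1 i * ?c2 j) else 0)" by simp
  qed
  also have "(\<Sum>j\<le>\<beta> + q. \<Sum>i\<le>\<alpha> + q. if i + j = Suc e + q then ?h i j *
     (if i = 0 then 0 else (real (\<alpha> + q) - real i + 1) * ?h (i - 1) j) / (?c1 i * ?c2 j) else 0) +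
     (\<Sum>i\<le>\<alpha> + q. \<Sum>j\<le>\<beta> + q. if i + j = Suc e + q then ?h i j *
     (if j = 0 then 0 else (real (\<beta> + q) - real j + 1) * ?h i (j - 1)) / (?c1 i * ?c2 j) else 0)
    = (\<Sum>i\<le>\<alpha> + q. \<Sum>j\<le>\<beta> + q. if i + j = Suc e + q then ?h i j *
        ((if i = 0 then 0 else (real (\<alpha> + q) - real i + 1) * ?h (i - 1) j) +
         (if j = 0 then 0 else (real (\<beta> + q) - real j + 1) * ?h i (j - 1))) / (?c1 i * ?c2 j) else 0)"
    unfolding sum.swap[of _ "{..\<alpha> + q}" "{..\<beta> + q}"] sum.distrib[symmetric]
    by (intro sum.cong refl) (simp add: distrib_left add_divide_distrib)
  also have "\<dots> = (\<Sum>i\<le>\<alpha> + q. \<Sum>j\<le>\<beta> + q. if i + j = Suc e + q then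
      real (Suc e) * ((?h i j)\<^sup>2 / (?c1 i * ?c2 j)) else 0)"
  proof (intro sum.cong refl)
    fix i j assume ij: "i \<in> {..\<alpha> + q}" "j \<in> {..\<beta> + q}"
    have 1: "real (i + j) - real q = real (Suc e)" if "i + j = Suc e + q" using that by simp
    have 2: "((if i = 0 then 0 else (real (\<alpha> + q) - real i + 1) * ?h (i - 1) j) +
         (if j = 0 then 0 else (real (\<beta> + q) - real j + 1) * ?h i (j - 1))) = (real (i + j) - real q) * ?h i j"
      using ij by (intro hcoeff_lower) auto
    show "(if i + j = Suc e + q then ?h i j *
        ((if i = 0 then 0 else (real (\<alpha> + q) - real i + 1) * ?h (i - 1) j) +
         (if j = 0 then 0 else (real (\<beta> + q) - real j + 1) * ?h i (j - 1))) / (?c1 i * ?c2 j) else 0) =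
       (if i + j = Suc e + q then real (Suc e) * ((?h i j)\<^sup>2 / (?c1 i * ?c2 j)) else 0)"
      unfolding 2 using 1 by (auto simp: power2_eq_square)
  qed
  also have "\<dots> = real (Suc e) * tnorm \<alpha> \<beta> q (Suc e)"
    unfolding tnorm_def sum_distrib_left by (intro sum.cong refl) auto
  finally show ?thesis .
qed

lemma tnorm_eq: "e \<le> \<alpha> + \<beta> \<Longrightarrow> tnorm \<alpha> \<beta> q e = real ((\<alpha> + \<beta>) choose e) * tnorm \<alpha> \<beta> q 0"
proof (induction e)
  case (Suc e)
  have "real (Suc e) * tnorm \<alpha> \<beta> q (Suc e) = (real (\<alpha> + \<beta>) - real e) * (real ((\<alpha> + \<beta>) choose e) * tnorm \<alpha> \<beta> q 0)"
    using tnorm_Suc[of \<alpha> \<beta> e q] Suc by simp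
  also have "\<dots> = real (Suc e) * (real ((\<alpha> + \<beta>) choose Suc e) * tnorm \<alpha> \<beta> q 0)"
    unfolding mult.assoc[symmetric] choose_Suc_real ..
  finally show ?case by (simp only: mult_cancel_left of_nat_eq_0_iff) simp
qed simp

text \<open>
  Vandermonde's identity with negative upper arguments.
\<close>

lemma sum_choose_product:
  "(\<Sum>r\<le>q. real ((\<alpha> + r) choose r) * real ((\<beta> + (q - r)) choose (q - r))) = real ((\<alpha> + \<beta> + q + 1) choose q)"
proof -
  have g: "(- real \<gamma> - 1) gchoose r = (-1) ^ r * real ((\<gamma> + r) choose r)" for \<gamma> r
  proof -
    have "(- real (\<gamma> + 1)) gchoose r = (-1) ^ r * ((real (\<gamma> + 1) + of_nat r - 1) gchoose r)"
      by (rule gbinomial_minus)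
    also have "real (\<gamma> + 1) + of_nat r - 1 = real (\<gamma> + r)" by simp
    also have "- real (\<gamma> + 1) = - real \<gamma> - 1" by simp
    finally show ?thesis by (simp only: binomial_gbinomial)
  qed
  have "(-1) ^ q * (\<Sum>r\<le>q. real ((\<alpha> + r) choose r) * real ((\<beta> + (q - r)) choose (q - r)))
      = (\<Sum>r\<le>q. (- real \<alpha> - 1 gchoose r) * (- real \<beta> - 1 gchoose (q - r)))"
    unfolding g sum_distrib_left
  proof (intro sum.cong refl)
    fix r assume "r \<in> {..q}"
    then have "(-1) ^ q = ((-1) ^ r * (-1) ^ (q - r) :: real)" by (simp flip: power_add)
    then show "(-1) ^ q * (real ((\<alpha> + r) choose r) * real ((\<beta> + (q - r)) choose (q - r))) =
      (-1) ^ r * real ((\<alpha> + r) choose r) * ((-1) ^ (q - r) * real ((\<beta> + (q - r)) choose (q - r)))" by simp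
  qed
  also have "\<dots> = (- real \<alpha> - 1 + (- real \<beta> - 1)) gchoose q"
    unfolding atMost_atLeast0 by (rule gbinomial_Vandermonde)
  also have "\<dots> = (- real (\<alpha> + \<beta> + 1) - 1) gchoose q" by (simp add: algebra_simps)
  also have "\<dots> = (-1) ^ q * real ((\<alpha> + \<beta> + q + 1) choose q)"
    unfolding g by (simp add: add_ac)
  finally show ?thesis by simp
qed

lemma hcoeff_bottom:
  assumes "e1 + e2 = q"
  shows "hcoeff \<alpha> \<beta> q e1 e2 = (-1) ^ e2 * int (q choose e1)"
proof -
  have e: "e1 \<le> \<alpha> + q" "e2 \<le> \<beta> + q" "e1 \<le> q" using assms by auto
  have "tcoeff \<alpha> \<beta> q e1 e2 = (\<Sum>r\<in>{e2}. if q - r \<le> e1 \<and> r \<le> e2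
     then (-1) ^ (q - r) * int (q choose r) * int (\<alpha> choose (e1 - (q - r))) * int (\<beta> choose (e2 - r)) else 0)"
    unfolding tcoeff_def using assms by (intro sum.mono_neutral_right) auto
  also have "\<dots> = (-1) ^ e1 * int (q choose e1)"
    using assms binomial_symmetric[of e1 q] by auto
  finally have "(-1) ^ q * hcoeff \<alpha> \<beta> q e1 e2 = (-1) ^ e1 * int (q choose e1)"
    unfolding tcoeff_eq_hcoeff[OF e(1,2)] hcoeff_symmetric[OF e(1,2)] .
  then have "(-1) ^ q * ((-1) ^ q * hcoeff \<alpha> \<beta> q e1 e2) = (-1) ^ q * ((-1) ^ e1 * int (q choose e1))" by simp
  moreover have "(-1) ^ q * (-1) ^ e1 = ((-1) ^ e2 :: int)"
    unfolding assms[symmetric] power_add by (simp flip: power_mult_distrib)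
  ultimately show ?thesis by (simp add: mult.assoc[symmetric] power_mult_distrib[symmetric])
qed

text \<open>
  In lowest degree each coefficient is a single binomial, up to sign.
\<close>

lemma tnorm_0:
  "tnorm \<alpha> \<beta> q 0 = fact q * fact \<alpha> * fact \<beta> * fact (\<alpha> + \<beta> + q + 1) /
     (fact (\<alpha> + q) * fact (\<beta> + q) * fact (\<alpha> + \<beta> + 1))"
proof -
  have "tnorm \<alpha> \<beta> q 0 = (\<Sum>(e1, e2)\<in>{..\<alpha> + q} \<times> {..\<beta> + q}. if e1 + e2 = q then
     (of_int (hcoeff \<alpha> \<beta> q e1 e2))\<^sup>2 / (real ((\<alpha> + q) choose e1) * real ((\<beta> + q) choose e2)) else 0)"
    by (simp add: tnorm_def sum.cartesian_product)
  also have "\<dots> = (\<Sum>(e1, e2)\<in>{(e1, e2). e1 + e2 = q}. 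
     (of_int (hcoeff \<alpha> \<beta> q e1 e2))\<^sup>2 / (real ((\<alpha> + q) choose e1) * real ((\<beta> + q) choose e2)))"
    by (rule sum.mono_neutral_cong_right) (auto split: if_splits)
  also have "\<dots> = (\<Sum>r\<le>q. (of_int (hcoeff \<alpha> \<beta> q (q - r) r))\<^sup>2 / (real ((\<alpha> + q) choose (q - r)) * real ((\<beta> + q) choose r)))"
    by (rule sum.reindex_bij_witness[of _ "\<lambda>r. (q - r, r)" snd]) auto
  also have "\<dots> = (\<Sum>r\<le>q. fact q * fact \<alpha> * fact \<beta> * fact q / (fact (\<alpha> + q) * fact (\<beta> + q)) *
     (real ((\<alpha> + r) choose r) * real ((\<beta> + (q - r)) choose (q - r))))"
  proof (intro sum.cong refl)
    fix r assume "r \<in> {..q}"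
    then have r: "r \<le> q" by simp
    have "hcoeff \<alpha> \<beta> q (q - r) r = (-1) ^ r * int (q choose (q - r))"
      using r by (intro hcoeff_bottom) auto
    then have "(real_of_int (hcoeff \<alpha> \<beta> q (q - r) r))\<^sup>2 = (real (q choose (q - r)))\<^sup>2"
      by (simp add: power_mult_distrib flip: power_mult)
    moreover have "real (q choose (q - r)) = fact q / (fact (q - r) * fact r)"
      using r by (subst binomial_fact) auto
    moreover have "real ((\<alpha> + q) choose (q - r)) = fact (\<alpha> + q) / (fact (q - r) * fact (\<alpha> + r))"
      using r by (subst binomial_fact) auto
    moreover have "real ((\<beta> + q) choose r) = fact (\<beta> + q) / (fact r * fact (\<beta> + (q - r)))"
      using r by (subst binomial_fact) auto
    moreover have "real ((\<alpha> + r) choose r) = fact (\<alpha> + r) / (fact r * fact \<alpha>)"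
      "real ((\<beta> + (q - r)) choose (q - r)) = fact (\<beta> + (q - r)) / (fact (q - r) * fact \<beta>)"
      by (subst binomial_fact; simp)+
    ultimately show "(real_of_int (hcoeff \<alpha> \<beta> q (q - r) r))\<^sup>2 / (real ((\<alpha> + q) choose (q - r)) * real ((\<beta> + q) choose r)) =
      fact q * fact \<alpha> * fact \<beta> * fact q / (fact (\<alpha> + q) * fact (\<beta> + q)) *
     (real ((\<alpha> + r) choose r) * real ((\<beta> + (q - r)) choose (q - r)))"
      by (simp only:) (simp add: power2_eq_square field_simps)
  qed
  also have "\<dots> = fact q * fact \<alpha> * fact \<beta> * fact q / (fact (\<alpha> + q) * fact (\<beta> + q)) * real ((\<alpha> + \<beta> + q + 1) choose q)"
    unfolding sum_distrib_left[symmetric] sum_choose_product ..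
  also have "real ((\<alpha> + \<beta> + q + 1) choose q) = fact (\<alpha> + \<beta> + q + 1) / (fact q * fact (\<alpha> + \<beta> + 1))"
    by (subst binomial_fact) auto
  finally show ?thesis by (simp add: mult_ac del: fact_Suc)
qed

lemma tnorm_0_pos: "tnorm \<alpha> \<beta> q 0 > 0"
  unfolding tnorm_0 by simp

section \<open>Clebsch-Gordan embeddings\<close>

lemma exists_SU2_matrix:
  assumes "cmod a ^ 2 + cmod b ^ 2 = 1"
  shows "\<exists>g\<in>SU2. g$1$1 = a \<and> g$1$2 = b \<and> g$2$1 = - cnj b \<and> g$2$2 = cnj a"
proof -
  define g :: "complex^2^2" where "g = (\<chi> p q. if p = 1 then (if q = 1 then a else b) else (if q = 1 then - cnj b else cnj a))"
  have e: "g$1$1 = a" "g$1$2 = b" "g$2$1 = - cnj b" "g$2$2 = cnj a" by (simp_all add: g_def)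
  have n: "a * cnj a + b * cnj b = 1"
    using assms by (simp add: complex_norm_square[symmetric] flip: of_real_power of_real_add)
  have "g \<in> SU2"
    unfolding SU2_def mem_Collect_eq
  proof
    show "g ** (\<chi> p q. cnj (g $ q $ p)) = mat 1"
      using n by (simp add: vec_eq_iff matrix_matrix_mult_def sum_2 forall_2 mat_def e algebra_simps)
    show "det g = 1" using n by (simp add: det_2 e algebra_simps)
  qed
  with e show ?thesis by blast
qed

lemma SU2_det: "g \<in> SU2 \<Longrightarrow> det g = 1"
  by (simp add: SU2_def)

lemma transvectant_weight:
  "transvectant \<alpha> \<beta> q s u = (\<Sum>p\<le>\<alpha> + \<beta>. cscale (s ^ p * u ^ (\<alpha> + \<beta> - p))
     (\<Sum>(p1, p2)\<in>{..\<alpha> + q} \<times> {..\<beta> + q}. cscale (if p1 + p2 = p + q then of_int (tcoeff \<alpha> \<beta> q p1 p2) else 0)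
       (mon2 (\<alpha> + q) (\<beta> + q) p1 p2)))"
proof -
  have "(\<Sum>p\<le>\<alpha> + \<beta>. s ^ p * u ^ (\<alpha> + \<beta> - p) * (if p1 + p2 = p + q then of_int (tcoeff \<alpha> \<beta> q p1 p2) else 0))
     = of_int (tcoeff \<alpha> \<beta> q p1 p2) * s ^ (p1 + p2 - q) * u ^ (\<alpha> + \<beta> + q - (p1 + p2))" for p1 p2
  proof (cases "tcoeff \<alpha> \<beta> q p1 p2 = 0")
    case False
    note b = tcoeff_nonzeroD[OF this]
    have "(\<Sum>p\<le>\<alpha> + \<beta>. s ^ p * u ^ (\<alpha> + \<beta> - p) * (if p1 + p2 = p + q then of_int (tcoeff \<alpha> \<beta> q p1 p2) else 0)) =
      (\<Sum>p\<in>{p1 + p2 - q}. s ^ p * u ^ (\<alpha> + \<beta> - p) * (if p1 + p2 = p + q then of_int (tcoeff \<alpha> \<beta> q p1 p2) else 0))"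
      using b by (intro sum.mono_neutral_right) auto
    moreover have "\<alpha> + \<beta> - (p1 + p2 - q) = \<alpha> + \<beta> + q - (p1 + p2)" using b by auto
    ultimately show ?thesis using b by simp
  qed (simp cong: if_cong)
  note c = this
  show ?thesis
    unfolding transvectant_expand cfun.scale_sum_right split_def
    by (subst sum.swap) (simp add: cfun.scale_sum_left[symmetric] c)
qed

text \<open>
  The image of \<open>x ^ p * y ^ (d - p)\<close>, where \<open>d = \<alpha> + \<beta>\<close>, under the Clebsch-Gordan embedding. In
  \<open>(s * x + u * y) ^ d\<close> this monomial carries the factor \<open>d choose p\<close>, which is divided out of the
  corresponding component of the transvectant, together with its norm.
\<close>

definition cg_image :: "nat \<Rightarrow> nat \<Rightarrow> nat \<Rightarrow> nat \<Rightarrow> (complex \<times> complex) list \<Rightarrow> complex" where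
  "cg_image \<alpha> \<beta> q p = (\<Sum>(p1, p2)\<in>{..\<alpha> + q} \<times> {..\<beta> + q}.
     cscale (if p1 + p2 = p + q then of_int (tcoeff \<alpha> \<beta> q p1 p2) / of_nat ((\<alpha> + \<beta>) choose p) / of_real (sqrt (tnorm \<alpha> \<beta> q 0)) else 0)
       (mon2 (\<alpha> + q) (\<beta> + q) p1 p2))"

lemma transvectant_cg_image:
  "transvectant \<alpha> \<beta> q s u = (\<Sum>p\<le>\<alpha> + \<beta>. cscale (s ^ p * u ^ (\<alpha> + \<beta> - p) * of_nat ((\<alpha> + \<beta>) choose p) * of_real (sqrt (tnorm \<alpha> \<beta> q 0)))
      (cg_image \<alpha> \<beta> q p))"
  unfolding transvectant_weight cg_image_def cfun.scale_sum_right split_def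
  using tnorm_0_pos[of \<alpha> \<beta> q] by (intro sum.cong refl) auto

lemma equivariant_if_on_pw:
  assumes lin: "clinear \<Phi>"
    and pw: "\<And>s u. act_SU2 g (\<Phi> (pw d s u)) = \<Phi> (act_SU2 g (pw d s u))" and f: "f \<in> V [d]"
  shows "act_SU2 g (\<Phi> f) = \<Phi> (act_SU2 g f)"
proof -
  have 1: "clinear (\<lambda>f. act_SU2 g (\<Phi> f))"
    and 2: "clinear (\<lambda>f. \<Phi> (act_SU2 g f))"
    using lin linear_act_SU2[of g] by (auto simp: linear_cscale_iff)
  show ?thesis by (rule linear_eq_if_eq_on_pw_V[OF 1 2 pw f])
qed

text \<open>
  The linear map that takes powers to normalized transvectants is equivariant on powers, hence
  equivariant. It is isometric since components of different degree involve different monomials,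
  while within one degree the norm is given by \<open>tnorm_eq\<close>. The positivity condition concerns the
  coefficient of \<open>y1 ^ (\<alpha> + q) * x2 ^ q * y2 ^ \<beta>\<close>, which is one before normalization.
\<close>

lemma cg_embedding_exists:
  obtains \<Phi> where "clinear \<Phi>"
    "\<And>p. p \<le> \<alpha> + \<beta> \<Longrightarrow> \<Phi> (mon1 (\<alpha> + \<beta>) p) = cg_image \<alpha> \<beta> q p"
    "\<And>g f. det g = 1 \<Longrightarrow> f \<in> V [\<alpha> + \<beta>] \<Longrightarrow> act_SU2 g (\<Phi> f) = \<Phi> (act_SU2 g f)"
    "is_CG_embedding (\<alpha> + q) (\<beta> + q) (\<alpha> + \<beta>) \<Phi>"
proof -
  let ?N = "sqrt (tnorm \<alpha> \<beta> q 0)"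
  have N: "?N > 0" "?N * ?N = tnorm \<alpha> \<beta> q 0" using tnorm_0_pos[of \<alpha> \<beta> q] by auto
  have NN: "complex_of_real ?N * complex_of_real ?N = complex_of_real \<bar>tnorm \<alpha> \<beta> q 0\<bar>"
    by (simp flip: of_real_mult)
  obtain \<Phi> where lin: "clinear \<Phi>"
    and im: "\<And>p. p \<in> {..\<alpha> + \<beta>} \<Longrightarrow> \<Phi> (mon1 (\<alpha> + \<beta>) p) = cg_image \<alpha> \<beta> q p"
    by (rule linear_extension_family[where I = "{..\<alpha> + \<beta>}" and b = "mon1 (\<alpha> + \<beta>)" and e = "cg_image \<alpha> \<beta> q",
        OF independent_mon1 finite_atMost]) blast
  have pw: "\<Phi> (pw (\<alpha> + \<beta>) s u) = cscale (1 / of_real ?N) (transvectant \<alpha> \<beta> q s u)" for s u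
    unfolding pw_expand linear_cscale_sum[OF lin] linear_cscale_scale[OF lin] transvectant_cg_image cfun.scale_sum_right
    using N by (intro sum.cong refl) (simp add: im mult_ac)
  have eq: "act_SU2 g (\<Phi> f) = \<Phi> (act_SU2 g f)" if "det g = 1" "f \<in> V [\<alpha> + \<beta>]" for g f
    by (rule equivariant_if_on_pw[OF lin _ that(2)])
      (simp add: that(1) pw act_SU2_pw linear_cscale_scale[OF linear_act_SU2] act_SU2_transvectant)
  have expand: "\<Phi> (\<Sum>p\<le>\<alpha> + \<beta>. cscale (c p) (mon1 (\<alpha> + \<beta>) p)) = (\<Sum>(p1, p2)\<in>{..\<alpha> + q} \<times> {..\<beta> + q}. cscale
       (if q \<le> p1 + p2 \<and> p1 + p2 \<le> \<alpha> + \<beta> + q then c (p1 + p2 - q) * of_int (tcoeff \<alpha> \<beta> q p1 p2) / of_nat ((\<alpha> + \<beta>) choose (p1 + p2 - q)) / of_real ?N else 0)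
       (mon2 (\<alpha> + q) (\<beta> + q) p1 p2))" for c
  proof -
    have "(\<Sum>p\<le>\<alpha> + \<beta>. c p * (if p1 + p2 = p + q then of_int (tcoeff \<alpha> \<beta> q p1 p2) / of_nat ((\<alpha> + \<beta>) choose p) / of_real ?N else 0))
      = (if q \<le> p1 + p2 \<and> p1 + p2 \<le> \<alpha> + \<beta> + q then c (p1 + p2 - q) * of_int (tcoeff \<alpha> \<beta> q p1 p2) / of_nat ((\<alpha> + \<beta>) choose (p1 + p2 - q)) / of_real ?N else 0)"
      (is "?l = ?r") for p1 p2
    proof (cases "q \<le> p1 + p2 \<and> p1 + p2 \<le> \<alpha> + \<beta> + q")
      case True
      then have "?l = (\<Sum>p\<in>{p1 + p2 - q}. c p * (if p1 + p2 = p + q then of_int (tcoeff \<alpha> \<beta> q p1 p2) / of_nat ((\<alpha> + \<beta>) choose p) / of_real ?N else 0))"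
        by (intro sum.mono_neutral_right) auto
      with True show ?thesis by simp
    next
      case False
      then have "?l = 0" by (intro sum.neutral) auto
      with False show ?thesis by auto
    qed
    note c = this
    have "\<Phi> (\<Sum>p\<le>\<alpha> + \<beta>. cscale (c p) (mon1 (\<alpha> + \<beta>) p)) = (\<Sum>p\<le>\<alpha> + \<beta>. cscale (c p) (cg_image \<alpha> \<beta> q p))"
      unfolding linear_cscale_sum[OF lin] linear_cscale_scale[OF lin] by (intro sum.cong refl) (simp add: im)
    then show ?thesis
      unfolding cg_image_def cfun.scale_sum_right split_def
      by (subst (asm) sum.swap) (simp add: cfun.scale_sum_left[symmetric] c)
  qed
  have inV: "\<Phi> f \<in> V [\<alpha> + q, \<beta> + q]" if f: "f \<in> V [\<alpha> + \<beta>]" for f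
  proof -
    obtain c where "f = (\<Sum>p\<le>\<alpha> + \<beta>. cscale (c p) (mon1 (\<alpha> + \<beta>) p))" using f unfolding V1_eq by blast
    then show ?thesis
      by (simp only: expand split_def)
        (intro cfun.subspace_sum subspace_V cfun.subspace_scale mon2_in_V, auto)
  qed
  have iso: "sprod (basis2 (\<alpha> + q) (\<beta> + q)) (\<Phi> P) (\<Phi> Q) = sprod (basis1 (\<alpha> + \<beta>)) P Q"
    if PQ: "P \<in> V [\<alpha> + \<beta>]" "Q \<in> V [\<alpha> + \<beta>]" for P Q
  proof -
    obtain c where P: "P = (\<Sum>p\<le>\<alpha> + \<beta>. cscale (c p) (mon1 (\<alpha> + \<beta>) p))" using PQ unfolding V1_eq by blast
    obtain e where Q: "Q = (\<Sum>p\<le>\<alpha> + \<beta>. cscale (e p) (mon1 (\<alpha> + \<beta>) p))" using PQ unfolding V1_eq by blast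
    let ?b = "\<lambda>p1 p2. real (((\<alpha> + q) choose p1) * ((\<beta> + q) choose p2))"
    let ?I = "{..\<alpha> + q} \<times> {..\<beta> + q}"
    have T: "(\<Sum>(p1, p2)\<in>?I. if p1 + p2 = p + q then (real_of_int (tcoeff \<alpha> \<beta> q p1 p2))\<^sup>2 / ?b p1 p2 else 0) = tnorm \<alpha> \<beta> q p"
      if "p \<le> \<alpha> + \<beta>" for p
    proof -
      have "(real_of_int (tcoeff \<alpha> \<beta> q p1 p2))\<^sup>2 = (real_of_int (hcoeff \<alpha> \<beta> q p1 p2))\<^sup>2" if "p1 \<le> \<alpha> + q" "p2 \<le> \<beta> + q" for p1 p2
        using that by (simp add: tcoeff_eq_hcoeff hcoeff_symmetric power_mult_distrib flip: power_mult)
      then show ?thesis unfolding tnorm_def sum.cartesian_product by (intro sum.cong refl) auto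
    qed
    have "sprod (basis2 (\<alpha> + q) (\<beta> + q)) (\<Phi> P) (\<Phi> Q) = (\<Sum>(p1, p2)\<in>?I. \<Sum>p\<le>\<alpha> + \<beta>. if p1 + p2 = p + q then
       c p * cnj (e p) / of_nat ((\<alpha> + \<beta>) choose p) ^ 2 / of_real (?N * ?N) * of_real ((of_int (tcoeff \<alpha> \<beta> q p1 p2))\<^sup>2 / ?b p1 p2) else 0)"
      unfolding P Q expand sprod_basis2
    proof (intro sum.cong refl, unfold split_def)
      fix x assume "x \<in> ?I"
      let ?p1 = "fst x" and ?p2 = "snd x"
      let ?r = "\<lambda>p. c p * cnj (e p) / of_nat ((\<alpha> + \<beta>) choose p) ^ 2 / of_real (?N * ?N) * of_real ((of_int (tcoeff \<alpha> \<beta> q ?p1 ?p2))\<^sup>2 / ?b ?p1 ?p2)"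
      have "(\<Sum>p\<le>\<alpha> + \<beta>. if ?p1 + ?p2 = p + q then ?r p else 0) = (if q \<le> ?p1 + ?p2 \<and> ?p1 + ?p2 \<le> \<alpha> + \<beta> + q then ?r (?p1 + ?p2 - q) else 0)"
        (is "?l = ?rr")
      proof (cases "q \<le> ?p1 + ?p2 \<and> ?p1 + ?p2 \<le> \<alpha> + \<beta> + q")
        case True
        then have "?l = (\<Sum>p\<in>{?p1 + ?p2 - q}. if ?p1 + ?p2 = p + q then ?r p else 0)"
          by (intro sum.mono_neutral_right) auto
        with True show ?thesis by simp
      next
        case False
        then have "?l = 0" by (intro sum.neutral) auto
        with False show ?thesis by auto
      qed
      then show "(if q \<le> ?p1 + ?p2 \<and> ?p1 + ?p2 \<le> \<alpha> + \<beta> + q then c (?p1 + ?p2 - q) * of_int (tcoeff \<alpha> \<beta> q ?p1 ?p2) / of_nat ((\<alpha> + \<beta>) choose (?p1 + ?p2 - q)) / of_real ?N else 0) *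
        cnj (if q \<le> ?p1 + ?p2 \<and> ?p1 + ?p2 \<le> \<alpha> + \<beta> + q then e (?p1 + ?p2 - q) * of_int (tcoeff \<alpha> \<beta> q ?p1 ?p2) / of_nat ((\<alpha> + \<beta>) choose (?p1 + ?p2 - q)) / of_real ?N else 0) /
        of_nat (((\<alpha> + q) choose ?p1) * ((\<beta> + q) choose ?p2)) = ?l"
        using NN by (simp add: power2_eq_square mult_ac)
    qed
    also have "\<dots> = (\<Sum>p\<le>\<alpha> + \<beta>. c p * cnj (e p) / of_nat ((\<alpha> + \<beta>) choose p) ^ 2 / of_real (?N * ?N) *
       of_real (\<Sum>(p1, p2)\<in>?I. if p1 + p2 = p + q then (of_int (tcoeff \<alpha> \<beta> q p1 p2))\<^sup>2 / ?b p1 p2 else 0))"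
      unfolding split_def
      by (subst sum.swap) (auto simp: of_real_sum sum_distrib_left intro!: sum.cong)
    also have "\<dots> = (\<Sum>p\<le>\<alpha> + \<beta>. c p * cnj (e p) / of_nat ((\<alpha> + \<beta>) choose p))"
    proof (intro sum.cong refl)
      fix p assume "p \<in> {..\<alpha> + \<beta>}"
      then have p: "p \<le> \<alpha> + \<beta>" by simp
      then have "((\<alpha> + \<beta>) choose p) \<noteq> 0" by simp
      then have nz: "complex_of_nat ((\<alpha> + \<beta>) choose p) \<noteq> 0" by simp
      have tz: "complex_of_real (tnorm \<alpha> \<beta> q 0) \<noteq> 0" using tnorm_0_pos[of \<alpha> \<beta> q] by simp
      show "c p * cnj (e p) / of_nat ((\<alpha> + \<beta>) choose p) ^ 2 / of_real (?N * ?N) *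
       of_real (\<Sum>(p1, p2)\<in>?I. if p1 + p2 = p + q then (of_int (tcoeff \<alpha> \<beta> q p1 p2))\<^sup>2 / ?b p1 p2 else 0) =
        c p * cnj (e p) / of_nat ((\<alpha> + \<beta>) choose p)"
        unfolding T[OF p] tnorm_eq[OF p] N(2) of_real_mult of_real_of_nat_eq using nz tz
        by (simp add: power2_eq_square field_simps)
    qed
    finally show ?thesis unfolding P Q sprod_basis1 .
  qed
  have pos: "\<exists>c>0. sprod (basis2 (\<alpha> + q) (\<beta> + q)) (\<Phi> (psi1 (\<alpha> + \<beta>) 0)) (psi2 (\<alpha> + q) (\<beta> + q) 0 ((\<alpha> + q + (\<beta> + q) - (\<alpha> + \<beta>)) div 2)) = complex_of_real c"
  proof -
    have q: "(\<alpha> + q + (\<beta> + q) - (\<alpha> + \<beta>)) div 2 = q" by simp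
    have t: "tcoeff \<alpha> \<beta> q 0 q = 1"
    proof -
      have "tcoeff \<alpha> \<beta> q 0 q = (\<Sum>r\<in>{q}. if q - r \<le> 0 \<and> r \<le> q
     then (-1) ^ (q - r) * int (q choose r) * int (\<alpha> choose (0 - (q - r))) * int (\<beta> choose (q - r)) else 0)"
        unfolding tcoeff_def by (intro sum.mono_neutral_right) auto
      then show ?thesis by simp
    qed
    let ?b = "real ((\<beta> + q) choose q)"
    have 1: "\<Phi> (psi1 (\<alpha> + \<beta>) 0) = (\<Sum>(p1, p2)\<in>{..\<alpha> + q} \<times> {..\<beta> + q}.
       cscale (if p1 + p2 = 0 + q then of_int (tcoeff \<alpha> \<beta> q p1 p2) / of_nat ((\<alpha> + \<beta>) choose 0) / of_real ?N else 0)
       (mon2 (\<alpha> + q) (\<beta> + q) p1 p2))"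
      using im[of 0] by (simp add: psi1_def cg_image_def)
    have 2: "psi2 (\<alpha> + q) (\<beta> + q) 0 q = (\<Sum>(p1, p2)\<in>{..\<alpha> + q} \<times> {..\<beta> + q}.
       cscale (if (p1, p2) = (0, q) then of_real (sqrt ?b) else 0) (mon2 (\<alpha> + q) (\<beta> + q) p1 p2))"
    proof -
      have "(\<Sum>x\<in>{..\<alpha> + q} \<times> {..\<beta> + q}.
       cscale (if x = (0, q) then of_real (sqrt ?b) else 0) (mon2 (\<alpha> + q) (\<beta> + q) (fst x) (snd x)))
       = (\<Sum>x\<in>{(0, q)}. cscale (if x = (0, q) then of_real (sqrt ?b) else 0) (mon2 (\<alpha> + q) (\<beta> + q) (fst x) (snd x)))"
        by (intro sum.mono_neutral_right) auto
      then show ?thesis by (simp add: psi2_eq split_def prod_eq_iff)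
    qed
    have "sprod (basis2 (\<alpha> + q) (\<beta> + q)) (\<Phi> (psi1 (\<alpha> + \<beta>) 0)) (psi2 (\<alpha> + q) (\<beta> + q) 0 q) =
      (\<Sum>(p1, p2)\<in>{(0, q)}. of_int (tcoeff \<alpha> \<beta> q p1 p2) / of_real ?N * of_real (sqrt ?b) / of_nat (((\<alpha> + q) choose p1) * ((\<beta> + q) choose p2)))"
      unfolding 1 2 sprod_basis2 by (rule sum.mono_neutral_cong_right) (auto split: if_splits)
    also have "\<dots> = complex_of_real (1 / ?N * sqrt ?b / ?b)" by (simp add: t)
    finally show ?thesis unfolding q using N(1) by (intro exI[of _ "1 / ?N * sqrt ?b / ?b"]) auto
  qed
  have "is_CG_embedding (\<alpha> + q) (\<beta> + q) (\<alpha> + \<beta>) \<Phi>"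
    unfolding is_CG_embedding_def using lin inV eq SU2_det iso pos by auto
  with lin im eq that show ?thesis by blast
qed

section \<open>Uniqueness of equivariant maps\<close>

lemma transvectant_01:
  "transvectant \<alpha> \<beta> q 0 1 [(x1, y1), (x2, y2)] = y1 ^ \<alpha> * y2 ^ \<beta> * (x2 * y1 - x1 * y2) ^ q"
  by simp

text \<open>
  Put \<open>y1 = y2 = 1\<close>. Invariance under simultaneous translations of \<open>x1\<close>, \<open>x2\<close> and homogeneity leave
  only the multiples of \<open>(x2 - x1) ^ q\<close>.
\<close>

lemma highest_weight_vector:
  assumes v: "v \<in> V [\<alpha> + q, \<beta> + q]"
    and weight: "\<And>\<epsilon> x1 y1 x2 y2. v [(of_real \<epsilon> * x1, y1), (of_real \<epsilon> * x2, y2)] = of_real \<epsilon> ^ q * v [(x1, y1), (x2, y2)]"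
    and unip: "\<And>(\<tau>::real) x1 y1 x2 y2. v [(x1 - of_real \<tau> * y1, y1), (x2 - of_real \<tau> * y2, y2)] = v [(x1, y1), (x2, y2)]"
  shows "\<exists>c. v = cscale c (transvectant \<alpha> \<beta> q 0 1)"
proof -
  obtain e where e: "v = (\<Sum>(p1, p2)\<in>{..\<alpha> + q} \<times> {..\<beta> + q}. cscale (e p1 p2) (mon2 (\<alpha> + q) (\<beta> + q) p1 p2))"
    using v unfolding V2_eq by blast
  obtain f where f: "transvectant \<alpha> \<beta> q 0 1 = (\<Sum>(p1, p2)\<in>{..\<alpha> + q} \<times> {..\<beta> + q}. cscale (f p1 p2) (mon2 (\<alpha> + q) (\<beta> + q) p1 p2))"
    using transvectant_in_V[of \<alpha> \<beta> q 0 1] unfolding V2_eq by blast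
  define c where "c = v [(0, 1), (1, 1)]"
  have vxy: "v [(of_real x, 1), (of_real y, 1)] = c * (of_real y - of_real x) ^ q" for x y :: real
  proof -
    have "v [(of_real x, 1), (of_real y, 1)] = v [(of_real x - of_real x * 1, 1), (of_real y - of_real x * 1, 1)]"
      by (rule unip[symmetric])
    also have "\<dots> = v [(of_real (y - x) * 0, 1), (of_real (y - x) * 1, 1)]" by simp
    also have "\<dots> = of_real (y - x) ^ q * c" unfolding weight c_def ..
    finally show ?thesis by (simp add: mult.commute)
  qed
  have "e p1 p2 - c * f p1 p2 = 0" if "p1 \<le> \<alpha> + q" "p2 \<le> \<beta> + q" for p1 p2
  proof (rule real_polynomial2_zero[OF _ that])
    fix x y :: real
    have "v [(of_real x, 1), (of_real y, 1)] - c * transvectant \<alpha> \<beta> q 0 1 [(of_real x, 1), (of_real y, 1)] = 0"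
      unfolding vxy transvectant_01 by simp
    then show "(\<Sum>i\<le>\<alpha> + q. \<Sum>j\<le>\<beta> + q. (e i j - c * f i j) * complex_of_real x ^ i * complex_of_real y ^ j) = 0"
      unfolding e f by (simp add: sum_functions_apply split_def sum.cartesian_product sum_distrib_left sum_subtractf[symmetric] algebra_simps)
  qed
  then have "v = cscale c (transvectant \<alpha> \<beta> q 0 1)"
    unfolding e f cfun.scale_sum_right by (intro sum.cong refl) auto
  then show ?thesis ..
qed

lemma homogeneous_scale:
  assumes "\<And>p1 p2. e p1 p2 \<noteq> 0 \<Longrightarrow> p1 + p2 = r"
  shows "(\<Sum>(p1, p2)\<in>I. cscale (e p1 p2) (mon2 d1 d2 p1 p2)) [(\<epsilon> * x1, y1), (\<epsilon> * x2, y2)] =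
     \<epsilon> ^ r * (\<Sum>(p1, p2)\<in>I. cscale (e p1 p2) (mon2 d1 d2 p1 p2)) [(x1, y1), (x2, y2)]"
proof -
  have m: "e p1 p2 * mon2 d1 d2 p1 p2 [(\<epsilon> * x1, y1), (\<epsilon> * x2, y2)] = \<epsilon> ^ r * (e p1 p2 * mon2 d1 d2 p1 p2 [(x1, y1), (x2, y2)])" for p1 p2
  proof (cases "e p1 p2 = 0")
    case False
    from assms[OF this] have "\<epsilon> ^ r = \<epsilon> ^ p1 * \<epsilon> ^ p2" by (metis power_add)
    then show ?thesis by (simp add: power_mult_distrib)
  qed simp
  show ?thesis unfolding sum_functions_apply sum_distrib_left split_def cscale_apply
    by (intro sum.cong refl m)
qed

text \<open>
  A root of unity of large order distinguishes all weights that occur.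
\<close>

lemma cis_separates:
  obtains \<omega> where "cmod \<omega> = 1" "\<And>i j. i \<le> n \<Longrightarrow> j \<le> n \<Longrightarrow> \<omega> ^ (2 * i) = \<omega> ^ (2 * j) \<Longrightarrow> i = j"
proof
  let ?w = "cis (pi / real (Suc n))"
  show "cmod ?w = 1" by simp
  fix i j assume ij: "i \<le> n" "j \<le> n" "?w ^ (2 * i) = ?w ^ (2 * j)"
  have p: "?w ^ (2 * k) = cis (2 * pi * real k / real (Suc n))" for k
    by (simp add: Complex.DeMoivre mult_ac)
  have "inj_on (\<lambda>k. cis (2 * pi * real k / real (Suc n))) {..<Suc n}"
    using Complex.bij_betw_roots_unity[of "Suc n"] by (simp add: bij_betw_def)
  from inj_onD[OF this, of i j] ij show "i = j" unfolding p by auto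
qed

lemma act_torus:
  assumes "g$1$1 = a" "g$1$2 = 0" "g$2$1 = 0" "g$2$2 = b"
  shows "p \<le> d \<Longrightarrow> act_SU2 g (mon1 d p) = cscale (a ^ p * b ^ (d - p)) (mon1 d p)"
    and "p1 \<le> d1 \<Longrightarrow> p2 \<le> d2 \<Longrightarrow> act_SU2 g (mon2 d1 d2 p1 p2) = cscale (a ^ (p1 + p2) * b ^ (d1 + d2 - (p1 + p2))) (mon2 d1 d2 p1 p2)"
proof -
  show 1: "act_SU2 g (mon1 d p) = cscale (a ^ p * b ^ (d - p)) (mon1 d p)" for d p
    by (rule ext_length1)
      (auto simp: act_SU2_def assms power_mult_distrib mult_ac monomial_wrong_length)
  assume "p1 \<le> d1" "p2 \<le> d2"
  then have "d1 + d2 - (p1 + p2) = (d1 - p1) + (d2 - p2)" by auto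
  then show "act_SU2 g (mon2 d1 d2 p1 p2) = cscale (a ^ (p1 + p2) * b ^ (d1 + d2 - (p1 + p2))) (mon2 d1 d2 p1 p2)"
    unfolding mon2_tens act_SU2_tens 1 tens_cscale by (simp add: power_add mult_ac)
qed

text \<open>
  The image \<open>v\<close> of \<open>y ^ d\<close> determines the map, because rotations carry \<open>y ^ d\<close> to multiples of all powers
  \<open>(\<tau> * x + y) ^ d\<close> with \<open>\<tau>\<close> real. The torus gives the degree of \<open>v\<close>. To see that the unipotent
  matrices, which do not belong to \<open>SU(2)\<close>, fix \<open>v\<close>, rescale \<open>x\<close> by \<open>\<epsilon>\<close> and the tangent \<open>\<tau>\<close> of the
  angle by \<open>\<epsilon>\<close> as well: in the limit \<open>\<epsilon> = 0\<close> the equation for rotations becomes the one for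
  unipotent matrices.
\<close>

lemma SU2_equivariant_unique:
  assumes lin: "clinear \<Phi>"
    and inV: "\<And>f. f \<in> V [\<alpha> + \<beta>] \<Longrightarrow> \<Phi> f \<in> V [\<alpha> + q, \<beta> + q]"
    and eq: "\<And>g f. g \<in> SU2 \<Longrightarrow> f \<in> V [\<alpha> + \<beta>] \<Longrightarrow> \<Phi> (act_SU2 g f) = act_SU2 g (\<Phi> f)"
  shows "\<exists>c. \<forall>s u. \<Phi> (pw (\<alpha> + \<beta>) s u) = cscale c (transvectant \<alpha> \<beta> q s u)"
proof -
  let ?d = "\<alpha> + \<beta>" and ?I = "{..\<alpha> + q} \<times> {..\<beta> + q}"
  let ?m = "mon2 (\<alpha> + q) (\<beta> + q)"
  define w where "w p = \<Phi> (mon1 ?d p)" for p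
  \<comment> \<open>The torus of diagonal matrices forces the images of monomials to be homogeneous.\<close>
  have weight: "\<exists>e. w p = (\<Sum>(p1, p2)\<in>?I. cscale (e p1 p2) (?m p1 p2)) \<and> (\<forall>p1 p2. e p1 p2 \<noteq> 0 \<longrightarrow> p1 + p2 = p + q)"
    if p: "p \<le> ?d" for p
  proof -
    obtain e where e: "w p = (\<Sum>(p1, p2)\<in>?I. cscale (e p1 p2) (?m p1 p2))"
      using inV[OF mon1_in_V[OF p]] unfolding V2_eq w_def by blast
    obtain \<omega> where w: "cmod \<omega> = 1"
      "\<And>i j. i \<le> ?d + 2 * q \<Longrightarrow> j \<le> ?d + 2 * q \<Longrightarrow> \<omega> ^ (2 * i) = \<omega> ^ (2 * j) \<Longrightarrow> i = j"
      using cis_separates[of "?d + 2 * q"] by blast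
    obtain g where g: "g \<in> SU2" "g$1$1 = \<omega>" "g$1$2 = 0" "g$2$1 = 0" "g$2$2 = cnj \<omega>"
      using exists_SU2_matrix[of \<omega> 0] w(1) by auto
    have cn: "\<omega> * cnj \<omega> = 1" using w(1) by (simp add: complex_norm_square[symmetric])
    have "(\<Sum>x\<in>?I. cscale (\<omega> ^ p * cnj \<omega> ^ (?d - p) * e (fst x) (snd x)) (case x of (p1, p2) \<Rightarrow> ?m p1 p2))
      = cscale (\<omega> ^ p * cnj \<omega> ^ (?d - p)) (w p)"
      unfolding e cfun.scale_sum_right by (simp add: split_def)
    also have "\<dots> = \<Phi> (act_SU2 g (mon1 ?d p))"
      unfolding w_def by (simp add: act_torus(1)[OF g(2-5) p] linear_cscale_scale[OF lin])
    also have "\<dots> = act_SU2 g (w p)" unfolding w_def by (rule eq[OF g(1) mon1_in_V[OF p]])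
    also have "\<dots> = (\<Sum>x\<in>?I. cscale (e (fst x) (snd x) * (\<omega> ^ (fst x + snd x) * cnj \<omega> ^ (?d + 2 * q - (fst x + snd x)))) (case x of (p1, p2) \<Rightarrow> ?m p1 p2))"
      unfolding e linear_cscale_sum[OF linear_act_SU2]
    proof (intro sum.cong refl)
      fix x assume x: "x \<in> ?I"
      have n: "\<alpha> + q + (\<beta> + q) = ?d + 2 * q" by simp
      show "act_SU2 g (case x of (p1, p2) \<Rightarrow> cscale (e p1 p2) (?m p1 p2)) =
         cscale (e (fst x) (snd x) * (\<omega> ^ (fst x + snd x) * cnj \<omega> ^ (?d + 2 * q - (fst x + snd x)))) (case x of (p1, p2) \<Rightarrow> ?m p1 p2)"
        using x act_torus(2)[OF g(2-5), of "fst x" "\<alpha> + q" "snd x" "\<beta> + q", unfolded n]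
        by (auto simp: linear_cscale_scale[OF linear_act_SU2])
    qed
    finally have sums: "(\<Sum>x\<in>?I. cscale (\<omega> ^ p * cnj \<omega> ^ (?d - p) * e (fst x) (snd x)) (case x of (p1, p2) \<Rightarrow> ?m p1 p2)) =
       (\<Sum>x\<in>?I. cscale (e (fst x) (snd x) * (\<omega> ^ (fst x + snd x) * cnj \<omega> ^ (?d + 2 * q - (fst x + snd x)))) (case x of (p1, p2) \<Rightarrow> ?m p1 p2))" .
    have "p1 + p2 = p + q" if I: "(p1, p2) \<in> ?I" and nz: "e p1 p2 \<noteq> 0" for p1 p2
    proof -
      have "\<omega> ^ p * cnj \<omega> ^ (?d - p) = \<omega> ^ (p1 + p2) * cnj \<omega> ^ (?d + 2 * q - (p1 + p2))"
        using independent_family_eqD[OF independent_mon2 sums I] nz by simp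
      then have "\<omega> ^ (?d + 2 * q) * (\<omega> ^ p * cnj \<omega> ^ (?d - p)) = \<omega> ^ (?d + 2 * q) * (\<omega> ^ (p1 + p2) * cnj \<omega> ^ (?d + 2 * q - (p1 + p2)))" by simp
      moreover have "\<omega> ^ (?d + 2 * q) * (\<omega> ^ p * cnj \<omega> ^ (?d - p)) = \<omega> ^ (2 * (p + q))"
      proof -
        have "?d + 2 * q = 2 * q + p + (?d - p)" using p by simp
        then have "\<omega> ^ (?d + 2 * q) * (\<omega> ^ p * cnj \<omega> ^ (?d - p)) = \<omega> ^ (2 * q) * \<omega> ^ p * \<omega> ^ p * (\<omega> * cnj \<omega>) ^ (?d - p)"
          by (simp only: power_add power_mult_distrib mult_ac)
        also have "\<dots> = \<omega> ^ (2 * (p + q))"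
          using power_add[of \<omega> "2 * q + p" p] by (simp add: cn power_add mult_2_right mult_ac)
        finally show ?thesis .
      qed
      moreover have "\<omega> ^ (?d + 2 * q) * (\<omega> ^ (p1 + p2) * cnj \<omega> ^ (?d + 2 * q - (p1 + p2))) = \<omega> ^ (2 * (p1 + p2))"
      proof -
        have "?d + 2 * q = (p1 + p2) + (?d + 2 * q - (p1 + p2))" using I by auto
        then have "\<omega> ^ (?d + 2 * q) = \<omega> ^ (p1 + p2) * \<omega> ^ (?d + 2 * q - (p1 + p2))" by (metis power_add)
        then have "\<omega> ^ (?d + 2 * q) * (\<omega> ^ (p1 + p2) * cnj \<omega> ^ (?d + 2 * q - (p1 + p2))) = \<omega> ^ (p1 + p2) * \<omega> ^ (p1 + p2) * (\<omega> * cnj \<omega>) ^ (?d + 2 * q - (p1 + p2))"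
          by (simp only: power_mult_distrib mult_ac)
        also have "\<dots> = \<omega> ^ (2 * (p1 + p2))"
          by (simp only: cn mult_2 power_add power_one mult_1_right)
        finally show ?thesis .
      qed
      ultimately have "\<omega> ^ (2 * (p1 + p2)) = \<omega> ^ (2 * (p + q))" by simp
      then show ?thesis using I p by (intro w(2)) auto
    qed
    note wt = this
    define e' where "e' p1 p2 = (if (p1, p2) \<in> ?I then e p1 p2 else 0)" for p1 p2
    have "w p = (\<Sum>(p1, p2)\<in>?I. cscale (e' p1 p2) (?m p1 p2))"
      unfolding e by (intro sum.cong refl) (auto simp: e'_def)
    moreover have "p1 + p2 = p + q" if "e' p1 p2 \<noteq> 0" for p1 p2
      using that wt[of p1 p2] unfolding e'_def by meson
    ultimately show ?thesis by blast
  qed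
  have scale: "w p [(\<epsilon> * x1, y1), (\<epsilon> * x2, y2)] = \<epsilon> ^ (p + q) * w p [(x1, y1), (x2, y2)]"
    if p: "p \<le> ?d" for p \<epsilon> x1 y1 x2 y2
  proof -
    obtain e where e: "w p = (\<Sum>(p1, p2)\<in>?I. cscale (e p1 p2) (?m p1 p2))" "\<And>p1 p2. e p1 p2 \<noteq> 0 \<Longrightarrow> p1 + p2 = p + q"
      using weight[OF p] by blast
    show ?thesis unfolding e(1) by (rule homogeneous_scale[OF e(2)])
  qed
  have wV: "w p \<in> V [\<alpha> + q, \<beta> + q]" if "p \<le> ?d" for p
    unfolding w_def by (rule inV[OF mon1_in_V[OF that]])
  have homog: "f [(c * x1, c * y1), (c * x2, c * y2)] = c ^ (?d + 2 * q) * f [(x1, y1), (x2, y2)]"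
    if "f \<in> V [\<alpha> + q, \<beta> + q]" for f c x1 y1 x2 y2
  proof -
    obtain e where e: "f = (\<Sum>(p1, p2)\<in>?I. cscale (e p1 p2) (?m p1 p2))" using \<open>f \<in> _\<close> unfolding V2_eq by blast
    have "?m p1 p2 [(c * x1, c * y1), (c * x2, c * y2)] = c ^ (?d + 2 * q) * ?m p1 p2 [(x1, y1), (x2, y2)]"
      if "(p1, p2) \<in> ?I" for p1 p2
    proof -
      have "?d + 2 * q = p1 + (\<alpha> + q - p1) + (p2 + (\<beta> + q - p2))" using that by auto
      then have "c ^ (?d + 2 * q) = c ^ p1 * c ^ (\<alpha> + q - p1) * (c ^ p2 * c ^ (\<beta> + q - p2))" by (metis power_add)
      then show ?thesis by (simp add: power_mult_distrib mult_ac)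
    qed
    then show ?thesis unfolding e
      by (auto simp: sum_functions_apply split_def sum_distrib_left simp del: mon2_apply intro!: sum.cong)
  qed
  \<comment> \<open>Rotations by a small angle; the factor comes from normalizing the matrix.\<close>
  have rot: "of_real (1 + \<tau>\<^sup>2) ^ q * \<Phi> (pw ?d (of_real \<tau>) 1) [(x1, y1), (x2, y2)] =
     w 0 [(x1 - of_real \<tau> * y1, y1 + of_real \<tau> * x1), (x2 - of_real \<tau> * y2, y2 + of_real \<tau> * x2)]"
    for \<tau> :: real and x1 y1 x2 y2
  proof -
    define C where "C = 1 / sqrt (1 + \<tau>\<^sup>2)"
    have pos: "1 + \<tau>\<^sup>2 > 0" by (simp add: add_pos_nonneg)
    have C2: "C\<^sup>2 * (1 + \<tau>\<^sup>2) = 1" and C0: "C \<noteq> 0"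
      unfolding C_def using pos by (auto simp: power_divide)
    have "C\<^sup>2 + (\<tau> * C)\<^sup>2 = 1" using C2 by (simp add: power_mult_distrib algebra_simps)
    then have "cmod (of_real C) ^ 2 + cmod (of_real (\<tau> * C)) ^ 2 = 1" by (simp only: norm_of_real power2_abs)
    from exists_SU2_matrix[OF this] obtain g where g: "g \<in> SU2" "g$1$1 = of_real C" "g$1$2 = of_real (\<tau> * C)"
      "g$2$1 = - of_real (\<tau> * C)" "g$2$2 = of_real C" by auto
    have pw0: "mon1 ?d 0 = pw ?d 0 1"
      by (rule ext_length1) (auto simp: monomial_wrong_length pw_def)
    have "\<Phi> (act_SU2 g (mon1 ?d 0)) = act_SU2 g (w 0)"
      unfolding w_def by (rule eq[OF g(1) mon1_in_V]) simp
    moreover have "act_SU2 g (mon1 ?d 0) = cscale (of_real C ^ ?d) (pw ?d (of_real \<tau>) 1)"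
      unfolding pw0 act_SU2_pw g
      by (rule ext_length1) (auto simp: pw_def power_mult_distrib[symmetric] algebra_simps)
    ultimately have "of_real C ^ ?d * \<Phi> (pw ?d (of_real \<tau>) 1) [(x1, y1), (x2, y2)] = act_SU2 g (w 0) [(x1, y1), (x2, y2)]"
      by (metis cscale_apply linear_cscale_scale[OF lin])
    also have "\<dots> = w 0 [(of_real C * (x1 - of_real \<tau> * y1), of_real C * (y1 + of_real \<tau> * x1)), (of_real C * (x2 - of_real \<tau> * y2), of_real C * (y2 + of_real \<tau> * x2))]"
      by (simp add: act_SU2_def g algebra_simps)
    also have "\<dots> = of_real C ^ (?d + 2 * q) * w 0 [(x1 - of_real \<tau> * y1, y1 + of_real \<tau> * x1), (x2 - of_real \<tau> * y2, y2 + of_real \<tau> * x2)]"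
      by (rule homog[OF wV]) simp
    finally have "\<Phi> (pw ?d (of_real \<tau>) 1) [(x1, y1), (x2, y2)] =
      of_real C ^ (2 * q) * w 0 [(x1 - of_real \<tau> * y1, y1 + of_real \<tau> * x1), (x2 - of_real \<tau> * y2, y2 + of_real \<tau> * x2)]"
      using C0 by (simp add: power_add mult.assoc)
    moreover have "of_real (1 + \<tau>\<^sup>2) ^ q * complex_of_real C ^ (2 * q) = 1"
    proof -
      have "(1 + \<tau>\<^sup>2) ^ q * C ^ (2 * q) = (C\<^sup>2 * (1 + \<tau>\<^sup>2)) ^ q" by (simp add: power_mult_distrib power_mult)
      also have "\<dots> = 1" unfolding C2 by simp
      finally show ?thesis by (metis of_real_1 of_real_mult of_real_power)
    qed
    ultimately show ?thesis by (simp add: mult.assoc[symmetric])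
  qed
  have unip: "w 0 [(x1 - of_real \<tau> * y1, y1), (x2 - of_real \<tau> * y2, y2)] = w 0 [(x1, y1), (x2, y2)]"
    for \<tau> :: real and x1 y1 x2 y2
  proof -
    define L where "L \<epsilon> = of_real (1 + (\<epsilon> * \<tau>)\<^sup>2) ^ q * (\<Sum>p\<le>?d. of_nat (?d choose p) * of_real (\<epsilon> * \<tau>) ^ p * of_real \<epsilon> ^ p * w p [(x1, y1), (x2, y2)])" for \<epsilon> :: real
    define R where "R \<epsilon> = w 0 [(x1 - of_real \<tau> * y1, y1 + of_real (\<epsilon> * \<tau>) * (of_real \<epsilon> * x1)), (x2 - of_real \<tau> * y2, y2 + of_real (\<epsilon> * \<tau>) * (of_real \<epsilon> * x2))]" for \<epsilon> :: real
    have LR: "L \<epsilon> = R \<epsilon>" if "\<epsilon> \<noteq> 0" for \<epsilon>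
    proof -
      have "of_real \<epsilon> ^ q * L \<epsilon> = of_real (1 + (\<epsilon> * \<tau>)\<^sup>2) ^ q * \<Phi> (pw ?d (of_real (\<epsilon> * \<tau>)) 1) [(of_real \<epsilon> * x1, y1), (of_real \<epsilon> * x2, y2)]"
        unfolding pw_expand linear_cscale_sum[OF lin] linear_cscale_scale[OF lin] w_def[symmetric] L_def
          sum_functions_apply sum_distrib_left cscale_apply
        by (intro sum.cong refl, subst scale, simp, simp add: power_add mult_ac)
      also have "\<dots> = w 0 [(of_real \<epsilon> * x1 - of_real (\<epsilon> * \<tau>) * y1, y1 + of_real (\<epsilon> * \<tau>) * (of_real \<epsilon> * x1)), (of_real \<epsilon> * x2 - of_real (\<epsilon> * \<tau>) * y2, y2 + of_real (\<epsilon> * \<tau>) * (of_real \<epsilon> * x2))]"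
        by (rule rot)
      also have "\<dots> = w 0 [(of_real \<epsilon> * (x1 - of_real \<tau> * y1), y1 + of_real (\<epsilon> * \<tau>) * (of_real \<epsilon> * x1)), (of_real \<epsilon> * (x2 - of_real \<tau> * y2), y2 + of_real (\<epsilon> * \<tau>) * (of_real \<epsilon> * x2))]"
        by (simp add: algebra_simps)
      also have "\<dots> = of_real \<epsilon> ^ q * R \<epsilon>" unfolding R_def using scale[of 0] by simp
      finally show ?thesis using that by simp
    qed
    have cL: "continuous (at 0) L" unfolding L_def by (intro continuous_intros)
    obtain e where e: "w 0 = (\<Sum>(p1, p2)\<in>?I. cscale (e p1 p2) (?m p1 p2))" using wV[of 0] unfolding V2_eq by blast
    have cR: "continuous (at 0) R"
      unfolding R_def e sum_functions_apply split_def cscale_apply mon2_apply by (intro continuous_intros)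
    have "eventually (\<lambda>\<epsilon>. L \<epsilon> = R \<epsilon>) (at 0)" using LR by (auto simp: eventually_at_filter)
    then have "(R \<longlongrightarrow> L 0) (at 0)" using cL by (auto simp: continuous_at intro: Lim_transform_eventually)
    from LIM_unique[OF this cR[unfolded continuous_at]] have "L 0 = R 0" .
    moreover have "L 0 = w 0 [(x1, y1), (x2, y2)]"
    proof -
      have "(\<Sum>p\<le>?d. of_nat (?d choose p) * complex_of_real (0 * \<tau>) ^ p * of_real 0 ^ p * w p [(x1, y1), (x2, y2)]) =
        (\<Sum>p\<in>{0}. of_nat (?d choose p) * complex_of_real (0 * \<tau>) ^ p * of_real 0 ^ p * w p [(x1, y1), (x2, y2)])"
        by (rule sum.mono_neutral_right) auto
      then show ?thesis unfolding L_def by simp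
    qed
    ultimately show ?thesis by (simp add: R_def)
  qed
  obtain c where c: "w 0 = cscale c (transvectant \<alpha> \<beta> q 0 1)"
    using highest_weight_vector[OF wV[of 0]] scale[of 0] unip by auto
  have real: "\<Phi> (pw ?d (of_real \<tau>) 1) = cscale c (transvectant \<alpha> \<beta> q (of_real \<tau>) 1)" for \<tau> :: real
  proof (rule ext_length2)
    fix x1 y1 x2 y2 :: complex
    let ?t = "complex_of_real \<tau>"
    have "of_real (1 + \<tau>\<^sup>2) ^ q * \<Phi> (pw ?d ?t 1) [(x1, y1), (x2, y2)] =
      c * ((y1 + ?t * x1) ^ \<alpha> * (y2 + ?t * x2) ^ \<beta> * ((x2 - ?t * y2) * (y1 + ?t * x1) - (x1 - ?t * y1) * (y2 + ?t * x2)) ^ q)"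
      unfolding rot c cscale_apply transvectant_01 ..
    also have "(x2 - ?t * y2) * (y1 + ?t * x1) - (x1 - ?t * y1) * (y2 + ?t * x2) = of_real (1 + \<tau>\<^sup>2) * (x2 * y1 - x1 * y2)"
      by (simp add: algebra_simps power2_eq_square)
    also have "c * ((y1 + ?t * x1) ^ \<alpha> * (y2 + ?t * x2) ^ \<beta> * (of_real (1 + \<tau>\<^sup>2) * (x2 * y1 - x1 * y2)) ^ q) =
      of_real (1 + \<tau>\<^sup>2) ^ q * cscale c (transvectant \<alpha> \<beta> q ?t 1) [(x1, y1), (x2, y2)]"
      by (simp only: power_mult_distrib cscale_apply transvectant_apply mult_1 add.commute mult_ac)
    finally have fin: "of_real (1 + \<tau>\<^sup>2) ^ q * \<Phi> (pw ?d ?t 1) [(x1, y1), (x2, y2)] =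
       of_real (1 + \<tau>\<^sup>2) ^ q * cscale c (transvectant \<alpha> \<beta> q ?t 1) [(x1, y1), (x2, y2)]" .
    have "1 + \<tau>\<^sup>2 > 0" by (simp add: add_pos_nonneg)
    then have "complex_of_real (1 + \<tau>\<^sup>2) \<noteq> 0" by (metis less_irrefl of_real_eq_0_iff)
    then have "complex_of_real (1 + \<tau>\<^sup>2) ^ q \<noteq> 0" by (rule power_not_zero)
    with fin show "\<Phi> (pw ?d ?t 1) [(x1, y1), (x2, y2)] = cscale c (transvectant \<alpha> \<beta> q ?t 1) [(x1, y1), (x2, y2)]"
      by (metis mult_cancel_left)
  next
    fix z :: "(complex \<times> complex) list" assume "length z \<noteq> 2"
    then have "\<Phi> (pw ?d (of_real \<tau>) 1) z = 0" "transvectant \<alpha> \<beta> q (of_real \<tau>) 1 z = 0"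
      by (auto simp: transvectant_def intro!: V_wrong_length[OF inV[OF pw_in_V]])
    then show "\<Phi> (pw ?d (of_real \<tau>) 1) z = cscale c (transvectant \<alpha> \<beta> q (of_real \<tau>) 1) z"
      by simp
  qed
  obtain \<Psi> where \<Psi>: "clinear \<Psi>"
    "\<And>p. p \<le> ?d \<Longrightarrow> \<Psi> (mon1 ?d p) = cg_image \<alpha> \<beta> q p"
    by (rule cg_embedding_exists[of \<alpha> \<beta> q]) blast
  define \<Psi>' where "\<Psi>' f = cscale (c * of_real (sqrt (tnorm \<alpha> \<beta> q 0))) (\<Psi> f)" for f
  have lin': "clinear \<Psi>'"
    using \<Psi>(1) by (auto simp: linear_cscale_iff \<Psi>'_def cfun.scale_right_distrib mult_ac)
  have pw': "\<Psi>' (pw ?d s u) = cscale c (transvectant \<alpha> \<beta> q s u)" for s u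
    unfolding \<Psi>'_def pw_expand linear_cscale_sum[OF \<Psi>(1)] linear_cscale_scale[OF \<Psi>(1)] transvectant_cg_image cfun.scale_sum_right
    by (intro sum.cong refl) (simp add: \<Psi>(2) mult_ac)
  have "\<Phi> (pw ?d s u) = cscale c (transvectant \<alpha> \<beta> q s u)" for s u
    unfolding pw'[symmetric]
    by (rule linear_eq_if_eq_on_pw_V[OF lin lin' _ pw_in_V]) (simp add: real pw')
  then show ?thesis by blast
qed

section \<open>Tensor products of embeddings\<close>

text \<open>
  The tensor product of two operators, applied to functions of lists: \<open>\<psi>\<close> acts on the arguments after
  the first, then \<open>\<phi>\<close> on the first one. Cutting off at lists \<open>u\<close> of length one puts the intermediate
  function into the space on which \<open>\<phi>\<close> is controlled.
\<close>

definition tensor_map ::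
  "nat \<Rightarrow> (((complex \<times> complex) list \<Rightarrow> complex) \<Rightarrow> (complex \<times> complex) list \<Rightarrow> complex) \<Rightarrow>
   (((complex \<times> complex) list \<Rightarrow> complex) \<Rightarrow> (complex \<times> complex) list \<Rightarrow> complex) \<Rightarrow>
   ((complex \<times> complex) list \<Rightarrow> complex) \<Rightarrow> (complex \<times> complex) list \<Rightarrow> complex" where
  "tensor_map t \<phi> \<psi> f =
     (\<lambda>z. \<phi> (\<lambda>u. if length u = 1 then \<psi> (\<lambda>v. f (u @ v)) (drop t z) else 0) (take t z))"

lemma linear_tensor_map:
  assumes "clinear \<phi>" "clinear \<psi>"
  shows "clinear (tensor_map t \<phi> \<psi>)"
  unfolding linear_cscale_iff
proof (intro conjI allI)
  fix f g :: "(complex \<times> complex) list \<Rightarrow> complex" and c :: complex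
  have 1: "(\<lambda>v. (f + g) (u @ v)) = (\<lambda>v. f (u @ v)) + (\<lambda>v. g (u @ v))" for u by auto
  have "(\<lambda>u. if length u = 1 then \<psi> (\<lambda>v. (f + g) (u @ v)) y else 0) =
    (\<lambda>u. if length u = 1 then \<psi> (\<lambda>v. f (u @ v)) y else 0) + (\<lambda>u. if length u = 1 then \<psi> (\<lambda>v. g (u @ v)) y else 0)" for y
    unfolding 1 linear_cscale_add[OF assms(2)] by auto
  then show "tensor_map t \<phi> \<psi> (f + g) = tensor_map t \<phi> \<psi> f + tensor_map t \<phi> \<psi> g"
    unfolding tensor_map_def by (auto simp: linear_cscale_add[OF assms(1)])
  have 2: "(\<lambda>v. cscale c f (u @ v)) = cscale c (\<lambda>v. f (u @ v))" for u by auto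
  have "(\<lambda>u. if length u = 1 then \<psi> (\<lambda>v. cscale c f (u @ v)) y else 0) =
    cscale c (\<lambda>u. if length u = 1 then \<psi> (\<lambda>v. f (u @ v)) y else 0)" for y
    unfolding 2 linear_cscale_scale[OF assms(2)] by auto
  then show "tensor_map t \<phi> \<psi> (cscale c f) = cscale c (tensor_map t \<phi> \<psi> f)"
    unfolding tensor_map_def by (auto simp: linear_cscale_scale[OF assms(1)])
qed

lemma tensor_map_tens:
  assumes "clinear \<phi>" "clinear \<psi>"
    "\<And>u. length u \<noteq> 1 \<Longrightarrow> f u = 0"
  shows "tensor_map t \<phi> \<psi> (tens 1 f h) = tens t (\<phi> f) (\<psi> h)"
proof
  fix z
  have "(\<lambda>u. if length u = 1 then \<psi> (\<lambda>v. tens 1 f h (u @ v)) (drop t z) else 0) = cscale (\<psi> h (drop t z)) f"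
  proof
    fix u :: "(complex \<times> complex) list"
    show "(if length u = 1 then \<psi> (\<lambda>v. tens 1 f h (u @ v)) (drop t z) else 0) = cscale (\<psi> h (drop t z)) f u"
    proof (cases "length u = 1")
      case True
      then have "(\<lambda>v. tens 1 f h (u @ v)) = cscale (f u) h" by (auto simp: tens_apply_append)
      with True show ?thesis by (simp add: linear_cscale_scale[OF assms(2)])
    qed (simp add: assms(3))
  qed
  then show "tensor_map t \<phi> \<psi> (tens 1 f h) z = tens t (\<phi> f) (\<psi> h) z"
    unfolding tensor_map_def by (simp add: linear_cscale_scale[OF assms(1)] tens_def)
qed

text \<open>
  Equivariance is required for all complex matrices of determinant one, not only for \<open>SU(2)\<close>: the
  unipotent matrices are needed to compare with the permutation modules.
\<close>

definition equivariant_embedding :: "nat \<Rightarrow> nat \<Rightarrow>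
   (((complex \<times> complex) list \<Rightarrow> complex) \<Rightarrow> (complex \<times> complex) list \<Rightarrow> complex) \<Rightarrow> bool" where
  "equivariant_embedding d t \<phi> \<longleftrightarrow> clinear \<phi> \<and>
     (\<forall>g f. det g = 1 \<longrightarrow> f \<in> V [d] \<longrightarrow> act_SU2 g (\<phi> f) = \<phi> (act_SU2 g f)) \<and>
     independent_family {..d} (\<lambda>p. \<phi> (mon1 d p)) \<and>
     (\<forall>f z. f \<in> V [d] \<longrightarrow> length z \<noteq> t \<longrightarrow> \<phi> f z = 0)"

lemma equivariant_embedding_id: "equivariant_embedding d 1 (\<lambda>f. f)"
  by (auto simp: equivariant_embedding_def linear_cscale_iff independent_mon1 V_wrong_length)

text \<open>
  Composing with a projection onto \<open>V [d]\<close> does not change the action on powers, hence not on \<open>V [d]\<close>.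
\<close>

lemma act_SU2_in_V1:
  assumes "f \<in> V [d]"
  shows "act_SU2 g f \<in> V [d]"
proof -
  have "clinear (\<lambda>f :: (complex \<times> complex) list \<Rightarrow> complex. f)"
    by (simp add: linear_cscale_iff)
  then obtain h where h: "clinear h" "range h \<subseteq> V [d]" "\<And>v. v \<in> V [d] \<Longrightarrow> h v = v"
    using linear_left_inverse_on[of "\<lambda>f. f" "V [d]"] by auto
  have "clinear (\<lambda>f. h (act_SU2 g f))"
    using h(1) linear_act_SU2[of g] by (auto simp: linear_cscale_iff)
  then have "act_SU2 g f = h (act_SU2 g f)"
    by (rule linear_eq_if_eq_on_pw_V[OF linear_act_SU2 _ _ assms]) (simp add: act_SU2_pw h(3) pw_in_V)
  then show ?thesis using h(2) by auto
qed

lemma tens_in_V2: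
  assumes "f \<in> V [d1]" "h \<in> V [d2]"
  shows "tens 1 f h \<in> V [d1, d2]"
proof -
  obtain c where c: "f = (\<Sum>p\<le>d1. cscale (c p) (mon1 d1 p))" using assms(1) unfolding V1_eq by blast
  obtain e where e: "h = (\<Sum>p\<le>d2. cscale (e p) (mon1 d2 p))" using assms(2) unfolding V1_eq by blast
  have "tens 1 f h = (\<Sum>p1\<le>d1. \<Sum>p2\<le>d2. cscale (c p1 * e p2) (mon2 d1 d2 p1 p2))"
    unfolding c e mon2_tens by (simp add: fun_eq_iff tens_def sum_functions_apply sum_product mult_ac)
  then show ?thesis
    by (simp only:) (intro cfun.subspace_sum subspace_V cfun.subspace_scale mon2_in_V, auto)
qed

lemma act_SU2_in_V2:
  assumes "f \<in> V [d1, d2]"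
  shows "act_SU2 g f \<in> V [d1, d2]"
proof -
  obtain c where c: "f = (\<Sum>(p1, p2)\<in>{..d1} \<times> {..d2}. cscale (c p1 p2) (mon2 d1 d2 p1 p2))"
    using assms unfolding V2_eq by blast
  have "act_SU2 g f = (\<Sum>(p1, p2)\<in>{..d1} \<times> {..d2}. cscale (c p1 p2) (tens 1 (act_SU2 g (mon1 d1 p1)) (act_SU2 g (mon1 d2 p2))))"
    unfolding c mon2_tens linear_cscale_sum[OF linear_act_SU2]
    by (simp only: linear_cscale_scale[OF linear_act_SU2] split_def act_SU2_tens)
  then show ?thesis
    by (simp only: split_def) (intro cfun.subspace_sum subspace_V cfun.subspace_scale tens_in_V2 act_SU2_in_V1 mon1_in_V, auto)
qed

lemma linear_inj_on_V1:
  assumes "clinear \<phi>" "independent_family {..d} (\<lambda>p. \<phi> (mon1 d p))"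
  shows "inj_on \<phi> (V [d])"
proof (rule inj_onI)
  fix f g assume fg: "f \<in> V [d]" "g \<in> V [d]" "\<phi> f = \<phi> g"
  obtain c where c: "f = (\<Sum>p\<le>d. cscale (c p) (mon1 d p))" using fg(1) unfolding V1_eq by blast
  obtain e where e: "g = (\<Sum>p\<le>d. cscale (e p) (mon1 d p))" using fg(2) unfolding V1_eq by blast
  have "c p = e p" if "p \<in> {..d}" for p
    by (rule independent_family_eqD[OF assms(2) _ that])
      (use fg(3) in \<open>simp only: c e linear_cscale_sum[OF assms(1)] linear_cscale_scale[OF assms(1)]\<close>)
  then show "f = g" unfolding c e by (intro sum.cong) auto
qed

lemma linear_inj_on_V2:
  assumes "clinear \<theta>"
    "independent_family ({..d1} \<times> {..d2}) (\<lambda>(p1, p2). \<theta> (mon2 d1 d2 p1 p2))"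
  shows "inj_on \<theta> (V [d1, d2])"
proof (rule inj_onI)
  fix f g assume fg: "f \<in> V [d1, d2]" "g \<in> V [d1, d2]" "\<theta> f = \<theta> g"
  obtain c where c: "f = (\<Sum>(p1, p2)\<in>{..d1} \<times> {..d2}. cscale (c p1 p2) (mon2 d1 d2 p1 p2))" using fg(1) unfolding V2_eq by blast
  obtain e where e: "g = (\<Sum>(p1, p2)\<in>{..d1} \<times> {..d2}. cscale (e p1 p2) (mon2 d1 d2 p1 p2))" using fg(2) unfolding V2_eq by blast
  have "c (fst p) (snd p) = e (fst p) (snd p)" if "p \<in> {..d1} \<times> {..d2}" for p
    by (rule independent_family_eqD[OF assms(2) _ that, where c = "\<lambda>p. c (fst p) (snd p)" and e = "\<lambda>p. e (fst p) (snd p)"])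
      (use fg(3) in \<open>simp add: c e linear_cscale_sum[OF assms(1)] linear_cscale_scale[OF assms(1)] split_def\<close>)
  then show "f = g" unfolding c e by (intro sum.cong) auto
qed

lemma
  assumes \<phi>: "equivariant_embedding d1 t \<phi>" and \<psi>: "equivariant_embedding d2 t' \<psi>"
  shows tensor_map_linear: "clinear (tensor_map t \<phi> \<psi>)"
    and tensor_map_mon2: "tensor_map t \<phi> \<psi> (mon2 d1 d2 p1 p2) = tens t (\<phi> (mon1 d1 p1)) (\<psi> (mon1 d2 p2))"
    and tensor_map_psi2: "tensor_map t \<phi> \<psi> (psi2 d1 d2 p1 p2) = tens t (\<phi> (psi1 d1 p1)) (\<psi> (psi1 d2 p2))"
    and tensor_map_equivariant: "det g = 1 \<Longrightarrow> f \<in> V [d1, d2] \<Longrightarrow>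
      act_SU2 g (tensor_map t \<phi> \<psi> f) = tensor_map t \<phi> \<psi> (act_SU2 g f)"
    and tensor_map_independent: "independent_family ({..d1} \<times> {..d2}) (\<lambda>(p1, p2). tensor_map t \<phi> \<psi> (mon2 d1 d2 p1 p2))"
    and tensor_map_wrong_length: "f \<in> V [d1, d2] \<Longrightarrow> length z \<noteq> t + t' \<Longrightarrow> tensor_map t \<phi> \<psi> f z = 0"
    and tens_space_eq_image: "tens_space t (\<phi> ` V [d1]) (\<psi> ` V [d2]) = tensor_map t \<phi> \<psi> ` V [d1, d2]"
proof -
  have l\<phi>: "clinear \<phi>" and l\<psi>: "clinear \<psi>"
    and i\<phi>: "independent_family {..d1} (\<lambda>p. \<phi> (mon1 d1 p))" and i\<psi>: "independent_family {..d2} (\<lambda>p. \<psi> (mon1 d2 p))"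
    and z\<phi>: "\<And>f z. f \<in> V [d1] \<Longrightarrow> length z \<noteq> t \<Longrightarrow> \<phi> f z = 0" and z\<psi>: "\<And>f z. f \<in> V [d2] \<Longrightarrow> length z \<noteq> t' \<Longrightarrow> \<psi> f z = 0"
    and e\<phi>: "\<And>g f. det g = 1 \<Longrightarrow> f \<in> V [d1] \<Longrightarrow> act_SU2 g (\<phi> f) = \<phi> (act_SU2 g f)"
    and e\<psi>: "\<And>g f. det g = 1 \<Longrightarrow> f \<in> V [d2] \<Longrightarrow> act_SU2 g (\<psi> f) = \<psi> (act_SU2 g f)"
    using \<phi> \<psi> unfolding equivariant_embedding_def by blast+
  show lin: "clinear (tensor_map t \<phi> \<psi>)"
    by (rule linear_tensor_map[OF l\<phi> l\<psi>])
  have tens: "tensor_map t \<phi> \<psi> (tens 1 f h) = tens t (\<phi> f) (\<psi> h)" if "f \<in> V [d1]" for f h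
    by (rule tensor_map_tens[OF l\<phi> l\<psi>]) (use V_wrong_length[OF that] in simp)
  show mon2: "tensor_map t \<phi> \<psi> (mon2 d1 d2 p1 p2) = tens t (\<phi> (mon1 d1 p1)) (\<psi> (mon1 d2 p2))" for p1 p2
    unfolding mon2_tens by (rule tensor_map_tens[OF l\<phi> l\<psi>]) (simp add: monomial_wrong_length)
  show "tensor_map t \<phi> \<psi> (psi2 d1 d2 p1 p2) = tens t (\<phi> (psi1 d1 p1)) (\<psi> (psi1 d2 p2))"
    unfolding psi2_def by (rule tensor_map_tens[OF l\<phi> l\<psi>]) (simp add: psi1_def monomial_wrong_length)
  show "act_SU2 g (tensor_map t \<phi> \<psi> f) = tensor_map t \<phi> \<psi> (act_SU2 g f)" if g: "det g = 1" and f: "f \<in> V [d1, d2]"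
  proof (rule linear_eq_on_V2[OF _ _ _ f])
    show "clinear (\<lambda>f. act_SU2 g (tensor_map t \<phi> \<psi> f))"
      "clinear (\<lambda>f. tensor_map t \<phi> \<psi> (act_SU2 g f))"
      using lin linear_act_SU2[of g] by (auto simp: linear_cscale_iff)
    fix p1 p2 assume p: "p1 \<le> d1" "p2 \<le> d2"
    show "act_SU2 g (tensor_map t \<phi> \<psi> (mon2 d1 d2 p1 p2)) = tensor_map t \<phi> \<psi> (act_SU2 g (mon2 d1 d2 p1 p2))"
      unfolding mon2
      unfolding mon2_tens act_SU2_tens
      by (simp only: e\<phi>[OF g mon1_in_V[OF p(1)]] e\<psi>[OF g mon1_in_V[OF p(2)]] tens[OF act_SU2_in_V1[OF mon1_in_V[OF p(1)]]])
  qed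
  show ind: "independent_family ({..d1} \<times> {..d2}) (\<lambda>(p1, p2). tensor_map t \<phi> \<psi> (mon2 d1 d2 p1 p2))"
    unfolding mon2
    by (rule independent_family_tens[OF i\<phi> i\<psi>]) (auto intro: z\<phi> mon1_in_V)
  show "tensor_map t \<phi> \<psi> f z = 0" if f: "f \<in> V [d1, d2]" and z: "length z \<noteq> t + t'"
  proof -
    obtain c where c: "f = (\<Sum>(p1, p2)\<in>{..d1} \<times> {..d2}. cscale (c p1 p2) (mon2 d1 d2 p1 p2))" using f unfolding V2_eq by blast
    have "tens t (\<phi> (mon1 d1 p1)) (\<psi> (mon1 d2 p2)) z = 0" if "p1 \<le> d1" "p2 \<le> d2" for p1 p2
    proof -
      have "length (take t z) \<noteq> t \<or> length (drop t z) \<noteq> t'" using z by auto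
      then show ?thesis unfolding tens_def using z\<phi>[OF mon1_in_V[OF that(1)]] z\<psi>[OF mon1_in_V[OF that(2)]] by auto
    qed
    then show ?thesis
      unfolding c linear_cscale_sum[OF lin] sum_functions_apply
      by (intro sum.neutral) (auto simp: linear_cscale_scale[OF lin] mon2)
  qed
  show "tens_space t (\<phi> ` V [d1]) (\<psi> ` V [d2]) = tensor_map t \<phi> \<psi> ` V [d1, d2]"
  proof
    show "tens_space t (\<phi> ` V [d1]) (\<psi> ` V [d2]) \<subseteq> tensor_map t \<phi> \<psi> ` V [d1, d2]"
      unfolding tens_space_def
    proof (rule cfun.span_minimal)
      show "cfun.subspace (tensor_map t \<phi> \<psi> ` V [d1, d2])"
        by (rule linear_cscale_image_subspace[OF lin subspace_V])
      show "{tens t f g |f g. f \<in> \<phi> ` V [d1] \<and> g \<in> \<psi> ` V [d2]} \<subseteq> tensor_map t \<phi> \<psi> ` V [d1, d2]"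
        using tens tens_in_V2 by (auto simp flip: tens)
    qed
    show "tensor_map t \<phi> \<psi> ` V [d1, d2] \<subseteq> tens_space t (\<phi> ` V [d1]) (\<psi> ` V [d2])"
    proof
      fix v assume "v \<in> tensor_map t \<phi> \<psi> ` V [d1, d2]"
      then obtain c where "v = tensor_map t \<phi> \<psi> (\<Sum>(p1, p2)\<in>{..d1} \<times> {..d2}. cscale (c p1 p2) (mon2 d1 d2 p1 p2))"
        unfolding V2_eq by blast
      then have "v = (\<Sum>p\<in>{..d1} \<times> {..d2}. cscale (c (fst p) (snd p)) (tens t (\<phi> (mon1 d1 (fst p))) (\<psi> (mon1 d2 (snd p)))))"
        by (simp add: linear_cscale_sum[OF lin] linear_cscale_scale[OF lin] mon2 split_def)
      moreover have "tens t (\<phi> (mon1 d1 p1)) (\<psi> (mon1 d2 p2)) \<in> tens_space t (\<phi> ` V [d1]) (\<psi> ` V [d2])" if "p1 \<le> d1" "p2 \<le> d2" for p1 p2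
        unfolding tens_space_def using that mon1_in_V by (intro cfun.span_base) blast
      ultimately show "v \<in> tens_space t (\<phi> ` V [d1]) (\<psi> ` V [d2])"
        unfolding tens_space_def by (auto intro!: cfun.span_sum cfun.span_scale)
    qed
  qed
qed

section \<open>The Clebsch-Gordan map\<close>

definition cg_map :: "nat \<Rightarrow> nat \<Rightarrow> nat \<Rightarrow>
    ((complex \<times> complex) list \<Rightarrow> complex) \<Rightarrow> (complex \<times> complex) list \<Rightarrow> complex" where
  "cg_map \<alpha> \<beta> q = (SOME \<Phi>. clinear \<Phi> \<and>
     (\<forall>p\<le>\<alpha> + \<beta>. \<Phi> (mon1 (\<alpha> + \<beta>) p) = cg_image \<alpha> \<beta> q p) \<and>
     (\<forall>g f. det g = 1 \<longrightarrow> f \<in> V [\<alpha> + \<beta>] \<longrightarrow> act_SU2 g (\<Phi> f) = \<Phi> (act_SU2 g f)) \<and>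
     is_CG_embedding (\<alpha> + q) (\<beta> + q) (\<alpha> + \<beta>) \<Phi>)"

lemma
  shows linear_cg_map: "clinear (cg_map \<alpha> \<beta> q)"
    and cg_map_mon1: "p \<le> \<alpha> + \<beta> \<Longrightarrow> cg_map \<alpha> \<beta> q (mon1 (\<alpha> + \<beta>) p) = cg_image \<alpha> \<beta> q p"
    and cg_map_equivariant: "det g = 1 \<Longrightarrow> f \<in> V [\<alpha> + \<beta>] \<Longrightarrow> act_SU2 g (cg_map \<alpha> \<beta> q f) = cg_map \<alpha> \<beta> q (act_SU2 g f)"
    and cg_map_embedding: "is_CG_embedding (\<alpha> + q) (\<beta> + q) (\<alpha> + \<beta>) (cg_map \<alpha> \<beta> q)"
proof -
  have "\<exists>\<Phi>. clinear \<Phi> \<and>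
     (\<forall>p\<le>\<alpha> + \<beta>. \<Phi> (mon1 (\<alpha> + \<beta>) p) = cg_image \<alpha> \<beta> q p) \<and>
     (\<forall>g f. det g = 1 \<longrightarrow> f \<in> V [\<alpha> + \<beta>] \<longrightarrow> act_SU2 g (\<Phi> f) = \<Phi> (act_SU2 g f)) \<and>
     is_CG_embedding (\<alpha> + q) (\<beta> + q) (\<alpha> + \<beta>) \<Phi>"
    using cg_embedding_exists[of \<alpha> \<beta> q] by metis
  from someI_ex[OF this] show "clinear (cg_map \<alpha> \<beta> q)"
    "p \<le> \<alpha> + \<beta> \<Longrightarrow> cg_map \<alpha> \<beta> q (mon1 (\<alpha> + \<beta>) p) = cg_image \<alpha> \<beta> q p"
    "det g = 1 \<Longrightarrow> f \<in> V [\<alpha> + \<beta>] \<Longrightarrow> act_SU2 g (cg_map \<alpha> \<beta> q f) = cg_map \<alpha> \<beta> q (act_SU2 g f)"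
    "is_CG_embedding (\<alpha> + q) (\<beta> + q) (\<alpha> + \<beta>) (cg_map \<alpha> \<beta> q)"
    unfolding cg_map_def by blast+
qed

lemma CG_embedding_isometric:
  assumes "is_CG_embedding d1 d2 d \<Phi>" "P \<in> V [d]" "Q \<in> V [d]"
  shows "sprod (basis2 d1 d2) (\<Phi> P) (\<Phi> Q) = sprod (basis1 d) P Q"
  using assms unfolding is_CG_embedding_def by blast

lemma cg_map_in_V: "f \<in> V [\<alpha> + \<beta>] \<Longrightarrow> cg_map \<alpha> \<beta> q f \<in> V [\<alpha> + q, \<beta> + q]"
  using cg_map_embedding[of \<alpha> q \<beta>] unfolding is_CG_embedding_def by blast

lemma cg_map_pw: "cg_map \<alpha> \<beta> q (pw (\<alpha> + \<beta>) s u) = cscale (1 / of_real (sqrt (tnorm \<alpha> \<beta> q 0))) (transvectant \<alpha> \<beta> q s u)"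
  unfolding pw_expand linear_cscale_sum[OF linear_cg_map] linear_cscale_scale[OF linear_cg_map] transvectant_cg_image cfun.scale_sum_right
  using tnorm_0_pos[of \<alpha> \<beta> q] by (intro sum.cong refl) (simp add: cg_map_mon1 mult_ac)

lemma SU2_equivariant_multiple_of_cg_map:
  assumes lin: "clinear \<Phi>"
    and inV: "\<And>f. f \<in> V [\<alpha> + \<beta>] \<Longrightarrow> \<Phi> f \<in> V [\<alpha> + q, \<beta> + q]"
    and eq: "\<And>g f. g \<in> SU2 \<Longrightarrow> f \<in> V [\<alpha> + \<beta>] \<Longrightarrow> \<Phi> (act_SU2 g f) = act_SU2 g (\<Phi> f)"
  obtains c where "\<And>f. f \<in> V [\<alpha> + \<beta>] \<Longrightarrow> \<Phi> f = cscale c (cg_map \<alpha> \<beta> q f)"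
proof -
  obtain c where c: "\<And>s u. \<Phi> (pw (\<alpha> + \<beta>) s u) = cscale c (transvectant \<alpha> \<beta> q s u)"
    using SU2_equivariant_unique[OF assms] by blast
  define e where "e = c * of_real (sqrt (tnorm \<alpha> \<beta> q 0))"
  have lin': "clinear (\<lambda>f. cscale e (cg_map \<alpha> \<beta> q f))"
    using linear_cg_map[of \<alpha> \<beta> q] by (auto simp: linear_cscale_iff cfun.scale_right_distrib mult_ac)
  have "\<Phi> f = cscale e (cg_map \<alpha> \<beta> q f)" if "f \<in> V [\<alpha> + \<beta>]" for f
    by (rule linear_eq_if_eq_on_pw_V[OF lin lin' _ that])
      (use tnorm_0_pos[of \<alpha> \<beta> q] in \<open>simp add: c cg_map_pw e_def\<close>)
  then show ?thesis by (rule that)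
qed

text \<open>
  An isometry is injective: the squared norm of a relation among the images is that of the same
  combination of monomials.
\<close>

lemma independent_cg_image: "independent_family {..\<alpha> + \<beta>} (cg_image \<alpha> \<beta> q)"
  unfolding independent_family_def
proof (intro allI impI ballI)
  fix c p assume 0: "(\<Sum>p\<le>\<alpha> + \<beta>. cscale (c p) (cg_image \<alpha> \<beta> q p)) = 0" and p: "p \<in> {..\<alpha> + \<beta>}"
  let ?P = "\<Sum>p\<le>\<alpha> + \<beta>. cscale (c p) (mon1 (\<alpha> + \<beta>) p)"
  have P: "?P \<in> V [\<alpha> + \<beta>]" unfolding V1_eq by blast
  have "cg_map \<alpha> \<beta> q ?P = (\<Sum>p\<le>\<alpha> + \<beta>. cscale (c p) (cg_image \<alpha> \<beta> q p))"
    unfolding linear_cscale_sum[OF linear_cg_map] linear_cscale_scale[OF linear_cg_map] by (intro sum.cong refl) (simp add: cg_map_mon1)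
  then have z: "cg_map \<alpha> \<beta> q ?P = 0" using 0 by simp
  have "sprod (basis1 (\<alpha> + \<beta>)) ?P ?P = sprod (basis2 (\<alpha> + q) (\<beta> + q)) (cg_map \<alpha> \<beta> q ?P) (cg_map \<alpha> \<beta> q ?P)"
    by (rule CG_embedding_isometric[OF cg_map_embedding P P, symmetric])
  also have "\<dots> = 0" unfolding z by (simp add: sprod_def cfun.representation_zero)
  finally have "(\<Sum>p\<le>\<alpha> + \<beta>. c p * cnj (c p) / of_nat ((\<alpha> + \<beta>) choose p)) = 0"
    unfolding sprod_basis1 .
  then have "complex_of_real (\<Sum>p\<le>\<alpha> + \<beta>. (cmod (c p))\<^sup>2 / real ((\<alpha> + \<beta>) choose p)) = 0"
    by (simp add: complex_norm_square[symmetric])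
  then have "(\<Sum>p\<le>\<alpha> + \<beta>. (cmod (c p))\<^sup>2 / real ((\<alpha> + \<beta>) choose p)) = 0" by (simp only: of_real_eq_0_iff)
  then have "(cmod (c p))\<^sup>2 / real ((\<alpha> + \<beta>) choose p) = 0"
    using p by (subst (asm) sum_nonneg_eq_0_iff) auto
  then show "c p = 0" using p by simp
qed

lemma equivariant_embedding_Node:
  assumes \<phi>: "equivariant_embedding (\<alpha> + q) t \<phi>" and \<psi>: "equivariant_embedding (\<beta> + q) t' \<psi>"
  shows "equivariant_embedding (\<alpha> + \<beta>) (t + t') (\<lambda>f. tensor_map t \<phi> \<psi> (cg_map \<alpha> \<beta> q f))"
  unfolding equivariant_embedding_def
proof (intro conjI allI impI)
  note lin = tensor_map_linear[OF \<phi> \<psi>]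
  show "clinear (\<lambda>f. tensor_map t \<phi> \<psi> (cg_map \<alpha> \<beta> q f))"
    using lin linear_cg_map[of \<alpha> \<beta> q] by (auto simp: linear_cscale_iff)
  show "act_SU2 g (tensor_map t \<phi> \<psi> (cg_map \<alpha> \<beta> q f)) = tensor_map t \<phi> \<psi> (cg_map \<alpha> \<beta> q (act_SU2 g f))"
    if "det g = 1" "f \<in> V [\<alpha> + \<beta>]" for g f
    by (simp add: tensor_map_equivariant[OF \<phi> \<psi> that(1) cg_map_in_V[OF that(2)]] cg_map_equivariant[OF that])
  show "tensor_map t \<phi> \<psi> (cg_map \<alpha> \<beta> q f) z = 0" if "f \<in> V [\<alpha> + \<beta>]" "length z \<noteq> t + t'" for f z
    by (rule tensor_map_wrong_length[OF \<phi> \<psi> cg_map_in_V[OF that(1)] that(2)])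
  show "independent_family {..\<alpha> + \<beta>} (\<lambda>p. tensor_map t \<phi> \<psi> (cg_map \<alpha> \<beta> q (mon1 (\<alpha> + \<beta>) p)))"
    unfolding independent_family_def
  proof (intro allI impI)
    fix c assume 0: "(\<Sum>p\<le>\<alpha> + \<beta>. cscale (c p) (tensor_map t \<phi> \<psi> (cg_map \<alpha> \<beta> q (mon1 (\<alpha> + \<beta>) p)))) = 0"
    have "tensor_map t \<phi> \<psi> (\<Sum>p\<le>\<alpha> + \<beta>. cscale (c p) (cg_image \<alpha> \<beta> q p)) =
        (\<Sum>p\<le>\<alpha> + \<beta>. cscale (c p) (tensor_map t \<phi> \<psi> (cg_map \<alpha> \<beta> q (mon1 (\<alpha> + \<beta>) p))))"
      unfolding linear_cscale_sum[OF lin] linear_cscale_scale[OF lin]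
      by (intro sum.cong refl) (simp add: cg_map_mon1)
    also have "\<dots> = tensor_map t \<phi> \<psi> 0" unfolding 0 linear_cscale_zero[OF lin] ..
    finally have "tensor_map t \<phi> \<psi> (\<Sum>p\<le>\<alpha> + \<beta>. cscale (c p) (cg_image \<alpha> \<beta> q p)) = tensor_map t \<phi> \<psi> 0" .
    moreover have "(\<Sum>p\<le>\<alpha> + \<beta>. cscale (c p) (cg_image \<alpha> \<beta> q p)) \<in> V [\<alpha> + q, \<beta> + q]"
      by (intro cfun.subspace_sum subspace_V cfun.subspace_scale)
        (metis atMost_iff cg_map_in_V cg_map_mon1 mon1_in_V)
    ultimately have "(\<Sum>p\<le>\<alpha> + \<beta>. cscale (c p) (cg_image \<alpha> \<beta> q p)) = 0"
      using inj_onD[OF linear_inj_on_V2[OF lin tensor_map_independent[OF \<phi> \<psi>]]] cfun.subspace_0[OF subspace_V] by blast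
    from independent_familyD[OF independent_cg_image this] show "\<forall>p\<in>{..\<alpha> + \<beta>}. c p = 0" by blast
  qed
qed

lemma sprod_basis2_scale:
  assumes "f \<in> V [d1, d2]" "g \<in> V [d1, d2]"
  shows "sprod (basis2 d1 d2) (cscale c f) (cscale e g) = c * cnj e * sprod (basis2 d1 d2) f g"
proof -
  let ?I = "{..d1} \<times> {..d2}"
  obtain a where a: "f = (\<Sum>(p1, p2)\<in>?I. cscale (a p1 p2) (mon2 d1 d2 p1 p2))" using assms unfolding V2_eq by blast
  obtain b where b: "g = (\<Sum>(p1, p2)\<in>?I. cscale (b p1 p2) (mon2 d1 d2 p1 p2))" using assms unfolding V2_eq by blast
  have s: "cscale k (\<Sum>(p1, p2)\<in>?I. cscale (h p1 p2) (mon2 d1 d2 p1 p2)) = (\<Sum>(p1, p2)\<in>?I. cscale (k * h p1 p2) (mon2 d1 d2 p1 p2))" for k h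
    by (simp add: cfun.scale_sum_right split_def)
  show ?thesis unfolding a b s sprod_basis2 by (simp add: sum_distrib_left split_def mult_ac)
qed

lemma psi1_in_V: "p \<le> d \<Longrightarrow> psi1 d p \<in> V [d]"
  unfolding psi1_def by (intro cfun.subspace_scale subspace_V mon1_in_V)

lemma psi2_in_V: "p1 \<le> d1 \<Longrightarrow> p2 \<le> d2 \<Longrightarrow> psi2 d1 d2 p1 p2 \<in> V [d1, d2]"
  unfolding psi2_eq by (intro cfun.subspace_scale subspace_V mon2_in_V)

text \<open>
  The two maps differ by a factor. It has absolute value one since both are isometric, and it is
  positive by the normalization of the leading coefficient.
\<close>

lemma CG_embedding_unique:
  assumes \<Phi>: "is_CG_embedding (\<alpha> + q) (\<beta> + q) (\<alpha> + \<beta>) \<Phi>" and f: "f \<in> V [\<alpha> + \<beta>]"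
  shows "\<Phi> f = cg_map \<alpha> \<beta> q f"
proof -
  let ?C = "cg_map \<alpha> \<beta> q" and ?b = "basis2 (\<alpha> + q) (\<beta> + q)" and ?p = "psi1 (\<alpha> + \<beta>) 0" and ?d = "\<alpha> + \<beta>"
  have q: "(\<alpha> + q + (\<beta> + q) - (\<alpha> + \<beta>)) div 2 = q" by simp
  let ?s = "psi2 (\<alpha> + q) (\<beta> + q) 0 q"
  obtain c where c: "\<And>f. f \<in> V [?d] \<Longrightarrow> \<Phi> f = cscale c (?C f)"
    using SU2_equivariant_multiple_of_cg_map[of \<Phi> \<alpha> \<beta> q] \<Phi> unfolding is_CG_embedding_def by (metis image_subset_iff)
  have p: "?p \<in> V [?d]" by (rule psi1_in_V) simp
  have s: "?s \<in> V [\<alpha> + q, \<beta> + q]" by (rule psi2_in_V) auto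
  have pp: "sprod (basis1 ?d) ?p ?p = 1"
  proof -
    have "?p = (\<Sum>p\<le>?d. cscale (if p = 0 then 1 else 0) (mon1 ?d p))"
      by (simp add: psi1_def if_distrib[of "\<lambda>c. cscale c _"] cong: if_cong)
    then show ?thesis by (simp only: sprod_basis1) (simp add: if_distrib[of "\<lambda>c. c * _"] if_distrib[of "\<lambda>c. c / _"] cong: if_cong)
  qed
  have "1 = sprod ?b (\<Phi> ?p) (\<Phi> ?p)" using CG_embedding_isometric[OF \<Phi> p p] pp by simp
  also have "\<dots> = c * cnj c * sprod ?b (?C ?p) (?C ?p)"
    unfolding c[OF p] by (rule sprod_basis2_scale[OF cg_map_in_V[OF p] cg_map_in_V[OF p]])
  also have "sprod ?b (?C ?p) (?C ?p) = 1" using CG_embedding_isometric[OF cg_map_embedding p p] pp by simp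
  finally have "complex_of_real ((cmod c)\<^sup>2) = 1" by (simp only: complex_norm_square mult_1_right)
  then have "(cmod c)\<^sup>2 = 1" by (simp only: of_real_eq_1_iff)
  then have norm: "cmod c = 1" using norm_ge_zero[of c] by (simp add: power2_eq_1_iff del: norm_ge_zero)
  obtain r where r: "r > 0" "sprod ?b (\<Phi> ?p) ?s = complex_of_real r" using \<Phi> q unfolding is_CG_embedding_def by auto
  obtain r' where r': "r' > 0" "sprod ?b (?C ?p) ?s = complex_of_real r'" using cg_map_embedding[of \<alpha> q \<beta>] q unfolding is_CG_embedding_def by auto
  have "sprod ?b (\<Phi> ?p) ?s = c * cnj 1 * sprod ?b (?C ?p) ?s"
    unfolding c[OF p] using sprod_basis2_scale[OF cg_map_in_V[OF p] s, where c = c and e = 1] by simp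
  then have "complex_of_real r = c * complex_of_real r'" unfolding r r' by simp
  then have "c = complex_of_real (r / r')" using r' by (simp add: field_simps)
  moreover from this norm have "r / r' = 1" using r(1) r'(1) by (simp add: norm_divide)
  ultimately have "c = 1" by simp
  then show ?thesis using c[OF f] by simp
qed

lemma CG_phi_eq:
  assumes "p \<le> \<alpha> + \<beta>"
  shows "CG_phi (\<alpha> + q) (\<beta> + q) (\<alpha> + \<beta>) p = cg_map \<alpha> \<beta> q (psi1 (\<alpha> + \<beta>) p)"
  unfolding CG_phi_def
proof (rule the_equality)
  show "\<exists>\<Phi>. is_CG_embedding (\<alpha> + q) (\<beta> + q) (\<alpha> + \<beta>) \<Phi> \<and> cg_map \<alpha> \<beta> q (psi1 (\<alpha> + \<beta>) p) = \<Phi> (psi1 (\<alpha> + \<beta>) p)"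
    using cg_map_embedding by blast
qed (use CG_embedding_unique psi1_in_V[OF assms] in blast)

section \<open>The embedding attached to a labeled tree\<close>

definition tdim :: "ltree \<Rightarrow> nat" where
  "tdim T = weight T - 2 * label T"

lemma weight_simps [simp]: "weight (Leaf a) = a" "weight (Node k L R) = weight L + weight R"
  by (simp_all add: weight_def)

lemma num_leaves_simps [simp]: "num_leaves (Leaf a) = 1" "num_leaves (Node k L R) = num_leaves L + num_leaves R"
  by (simp_all add: num_leaves_def)

lemma length_parts [simp]: "length (parts T) = num_leaves T"
  by (simp add: num_leaves_def)

lemma sum_list_parts [simp]: "sum_list (parts T) = weight T"
  by (simp add: weight_def)

lemma rep_labeling_label_le: "rep_labeling T \<Longrightarrow> 2 * label T \<le> weight T"
  by (cases T) auto

text \<open>The labels of a node determine the order \<open>q\<close> of the transvectant, and the dimensions satisfy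
  \<open>d = \<alpha> + \<beta>\<close>, \<open>d1 = \<alpha> + q\<close>, \<open>d2 = \<beta> + q\<close>.\<close>

lemma node_dims:
  assumes "rep_labeling (Node k L R)"
  obtains \<alpha> \<beta> q where "k = label L + label R + q" "tdim L = \<alpha> + q" "tdim R = \<beta> + q" "tdim (Node k L R) = \<alpha> + \<beta>"
    "weight L = \<alpha> + q + 2 * label L" "weight R = \<beta> + q + 2 * label R"
    "rep_labeling L" "rep_labeling R"
proof
  let ?q = "k - (label L + label R)"
  show "k = label L + label R + ?q" "tdim L = (tdim L - ?q) + ?q" "tdim R = (tdim R - ?q) + ?q"
    "tdim (Node k L R) = (tdim L - ?q) + (tdim R - ?q)"
    "weight L = (tdim L - ?q) + ?q + 2 * label L" "weight R = (tdim R - ?q) + ?q + 2 * label R"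
    using assms by (auto simp: tdim_def)
qed (use assms in auto)

text \<open>
  The embedding of \<open>V [tdim T]\<close> whose image is \<open>V_tree T\<close>. Having it as an explicit map, and not only
  its image, fixes a basis of \<open>V_tree T\<close> that is compatible with the one of \<open>V [tdim T]\<close>.
\<close>

primrec tree_emb :: "ltree \<Rightarrow> ((complex \<times> complex) list \<Rightarrow> complex) \<Rightarrow> (complex \<times> complex) list \<Rightarrow> complex" where
  "tree_emb (Leaf a) = (\<lambda>f. f)"
| "tree_emb (Node k L R) = (\<lambda>f. tensor_map (num_leaves L) (tree_emb L) (tree_emb R)
     (cg_map (tdim L - (k - label L - label R)) (tdim R - (k - label L - label R)) (k - label L - label R) f))"

lemma tree_emb_Node:
  assumes "k = label L + label R + q" "tdim L = \<alpha> + q" "tdim R = \<beta> + q"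
  shows "tree_emb (Node k L R) f = tensor_map (num_leaves L) (tree_emb L) (tree_emb R) (cg_map \<alpha> \<beta> q f)"
  using assms by simp

lemma tree_emb_embedding: "rep_labeling T \<Longrightarrow> equivariant_embedding (tdim T) (num_leaves T) (tree_emb T)"
proof (induction T)
  case (Leaf a)
  then show ?case using equivariant_embedding_id by (simp add: tdim_def)
next
  case (Node k L R)
  obtain \<alpha> \<beta> q where *: "k = label L + label R + q" "tdim L = \<alpha> + q" "tdim R = \<beta> + q" "tdim (Node k L R) = \<alpha> + \<beta>"
    "rep_labeling L" "rep_labeling R"
    using node_dims[OF Node.prems] by metis
  have "equivariant_embedding (\<alpha> + \<beta>) (num_leaves L + num_leaves R)
      (\<lambda>f. tensor_map (num_leaves L) (tree_emb L) (tree_emb R) (cg_map \<alpha> \<beta> q f))"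
    using Node.IH * by (intro equivariant_embedding_Node) auto
  then show ?case unfolding tree_emb_Node[OF *(1-3), symmetric] *(4)[symmetric] num_leaves_simps .
qed

lemma
  assumes "rep_labeling T"
  shows linear_tree_emb: "clinear (tree_emb T)"
    and tree_emb_equivariant: "\<And>g f. det g = 1 \<Longrightarrow> f \<in> V [tdim T] \<Longrightarrow> act_SU2 g (tree_emb T f) = tree_emb T (act_SU2 g f)"
    and tree_emb_independent: "independent_family {..tdim T} (\<lambda>p. tree_emb T (mon1 (tdim T) p))"
  using tree_emb_embedding[OF assms] unfolding equivariant_embedding_def by blast+

lemma inj_on_tree_emb: "rep_labeling T \<Longrightarrow> inj_on (tree_emb T) (V [tdim T])"
  by (rule linear_inj_on_V1[OF linear_tree_emb tree_emb_independent])

text \<open>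
  Composed with a left inverse of the tensor product of the embeddings of the sons, an isomorphism
  from \<open>V [d]\<close> to \<open>U\<close> becomes an equivariant map to \<open>V [d1, d2]\<close>, hence a multiple of the
  Clebsch-Gordan map.
\<close>

lemma V_tree_Node_unique:
  assumes T: "rep_labeling (Node k L R)"
    and VL: "V_tree L = tree_emb L ` V [tdim L]" and VR: "V_tree R = tree_emb R ` V [tdim R]"
    and U: "cfun.subspace U" "U \<subseteq> tens_space (num_leaves L) (V_tree L) (V_tree R)"
      "invariant_under SU2 act_SU2 U"
      "isomorphic_reps SU2 act_SU2 (V [tdim (Node k L R)]) act_SU2 U"
  shows "U = tree_emb (Node k L R) ` V [tdim (Node k L R)]"
proof -
  obtain \<alpha> \<beta> q where *: "k = label L + label R + q" "tdim L = \<alpha> + q" "tdim R = \<beta> + q" "tdim (Node k L R) = \<alpha> + \<beta>"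
    "rep_labeling L" "rep_labeling R"
    using node_dims[OF T] by metis
  let ?\<theta> = "tensor_map (num_leaves L) (tree_emb L) (tree_emb R)" and ?W = "V [\<alpha> + q, \<beta> + q]"
  have eL: "equivariant_embedding (\<alpha> + q) (num_leaves L) (tree_emb L)" and eR: "equivariant_embedding (\<beta> + q) (num_leaves R) (tree_emb R)"
    using tree_emb_embedding[OF *(5)] tree_emb_embedding[OF *(6)] * by auto
  note lin = tensor_map_linear[OF eL eR]
  have ts: "tens_space (num_leaves L) (V_tree L) (V_tree R) = ?\<theta> ` ?W"
    unfolding VL VR *(2,3) by (rule tens_space_eq_image[OF eL eR])
  obtain h where h: "clinear h" "range h \<subseteq> ?W" "\<And>v. v \<in> ?W \<Longrightarrow> h (?\<theta> v) = v"
    using linear_left_inverse_on[OF lin subspace_V linear_inj_on_V2[OF lin tensor_map_independent[OF eL eR]]] by blast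
  obtain \<Xi> where \<Xi>: "clinear \<Xi>" "bij_betw \<Xi> (V [\<alpha> + \<beta>]) U"
    "\<And>g f. g \<in> SU2 \<Longrightarrow> f \<in> V [\<alpha> + \<beta>] \<Longrightarrow> \<Xi> (act_SU2 g f) = act_SU2 g (\<Xi> f)"
    using U(4) unfolding isomorphic_reps_def *(4) by blast
  have \<Xi>\<theta>: "\<exists>v\<in>?W. \<Xi> f = ?\<theta> v" if "f \<in> V [\<alpha> + \<beta>]" for f
    using bij_betwE[OF \<Xi>(2)] that U(2) unfolding ts by blast
  have h\<Xi>: "?\<theta> (h (\<Xi> f)) = \<Xi> f" if "f \<in> V [\<alpha> + \<beta>]" for f
    using \<Xi>\<theta>[OF that] h(3) by auto
  have act_W: "h (act_SU2 g (?\<theta> v)) = act_SU2 g v" if g: "g \<in> SU2" and f: "f \<in> V [\<alpha> + \<beta>]" "\<Xi> f = ?\<theta> v" and v: "v \<in> ?W" for g f v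
  proof -
    obtain v' where v': "v' \<in> ?W" "\<Xi> (act_SU2 g f) = ?\<theta> v'" using \<Xi>\<theta>[OF act_SU2_in_V1[OF f(1)]] by blast
    have "act_SU2 g (?\<theta> v) = ?\<theta> v'" using \<Xi>(3)[OF g f(1)] f(2) v' by simp
    then have "h (act_SU2 g (?\<theta> v)) = v'" using h(3)[OF v'(1)] by simp
    moreover have "act_SU2 g v \<in> ?W" by (rule act_SU2_in_V2[OF v])
    moreover have "act_SU2 g (?\<theta> v) = ?\<theta> (act_SU2 g v)"
      by (rule tensor_map_equivariant[OF eL eR SU2_det[OF g] v])
    ultimately show ?thesis using h(3) by simp
  qed
  obtain c where c: "\<And>f. f \<in> V [\<alpha> + \<beta>] \<Longrightarrow> h (\<Xi> f) = cscale c (cg_map \<alpha> \<beta> q f)"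
  proof (rule SU2_equivariant_multiple_of_cg_map[of "\<lambda>f. h (\<Xi> f)"])
    show "clinear (\<lambda>f. h (\<Xi> f))" using h(1) \<Xi>(1) by (auto simp: linear_cscale_iff)
    show "h (\<Xi> f) \<in> ?W" for f using h(2) by auto
    show "h (\<Xi> (act_SU2 g f)) = act_SU2 g (h (\<Xi> f))" if "g \<in> SU2" "f \<in> V [\<alpha> + \<beta>]" for g f
      using \<Xi>\<theta>[OF that(2)] act_W[OF that] h(3) \<Xi>(3)[OF that] by auto
  qed blast
  have \<Xi>c: "\<Xi> f = cscale c (tree_emb (Node k L R) f)" if "f \<in> V [\<alpha> + \<beta>]" for f
    using h\<Xi>[OF that] c[OF that] unfolding tree_emb_Node[OF *(1-3)] by (simp add: linear_cscale_scale[OF lin])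
  have "c \<noteq> 0"
  proof
    assume "c = 0"
    then have "\<Xi> f = 0" if "f \<in> V [\<alpha> + \<beta>]" for f using \<Xi>c[OF that] by simp
    moreover have inj: "inj_on \<Xi> (V [\<alpha> + \<beta>])" using \<Xi>(2) by (simp add: bij_betw_def)
    moreover have "mon1 (\<alpha> + \<beta>) 0 \<in> V [\<alpha> + \<beta>]" "0 \<in> V [\<alpha> + \<beta>]"
      by (simp_all add: mon1_in_V cfun.subspace_0)
    ultimately have "mon1 (\<alpha> + \<beta>) 0 = 0" using inj_onD[OF inj, of "mon1 (\<alpha> + \<beta>) 0" 0] by simp
    then have "mon1 (\<alpha> + \<beta>) 0 [(0, 1)] = 0" by simp
    then show False by simp
  qed
  show ?thesis
  proof
    show "U \<subseteq> tree_emb (Node k L R) ` V [tdim (Node k L R)]"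
    proof
      fix u assume "u \<in> U"
      then obtain f where f: "f \<in> V [\<alpha> + \<beta>]" "u = \<Xi> f" using \<Xi>(2) unfolding bij_betw_def by blast
      then have "u = tree_emb (Node k L R) (cscale c f)"
        using \<Xi>c linear_cscale_scale[OF linear_tree_emb[OF T]] by simp
      then show "u \<in> tree_emb (Node k L R) ` V [tdim (Node k L R)]"
        using f(1) cfun.subspace_scale[OF subspace_V] unfolding *(4) by blast
    qed
    show "tree_emb (Node k L R) ` V [tdim (Node k L R)] \<subseteq> U"
    proof
      fix u assume "u \<in> tree_emb (Node k L R) ` V [tdim (Node k L R)]"
      then obtain f where f: "f \<in> V [\<alpha> + \<beta>]" "u = tree_emb (Node k L R) f" unfolding *(4) by blast
      then have "u = cscale (1 / c) (\<Xi> f)" using \<Xi>c[OF f(1)] \<open>c \<noteq> 0\<close> by simp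
      then show "u \<in> U" using bij_betwE[OF \<Xi>(2)] f(1) cfun.subspace_scale[OF U(1)] by blast
    qed
  qed
qed

lemma V_tree_eq: "rep_labeling T \<Longrightarrow> V_tree T = tree_emb T ` V [tdim T]"
proof (induction T)
  case (Leaf a)
  then show ?case by (simp add: tdim_def)
next
  case (Node k L R)
  note T = Node.prems
  obtain \<alpha> \<beta> q where *: "k = label L + label R + q" "tdim L = \<alpha> + q" "tdim R = \<beta> + q" "tdim (Node k L R) = \<alpha> + \<beta>"
    "rep_labeling L" "rep_labeling R"
    using node_dims[OF T] by metis
  have VL: "V_tree L = tree_emb L ` V [tdim L]" and VR: "V_tree R = tree_emb R ` V [tdim R]"
    using Node.IH * by auto
  have eL: "equivariant_embedding (\<alpha> + q) (num_leaves L) (tree_emb L)" and eR: "equivariant_embedding (\<beta> + q) (num_leaves R) (tree_emb R)"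
    using tree_emb_embedding[OF *(5)] tree_emb_embedding[OF *(6)] * by auto
  have d: "weight L + weight R - 2 * k = tdim (Node k L R)" by (simp add: tdim_def)
  let ?U = "tree_emb (Node k L R) ` V [tdim (Node k L R)]"
  show ?case
    unfolding V_tree.simps d
  proof (rule the_equality)
    have "cfun.subspace ?U" by (rule linear_cscale_image_subspace[OF linear_tree_emb[OF T] subspace_V])
    moreover have "?U \<subseteq> tens_space (num_leaves L) (V_tree L) (V_tree R)"
    proof -
      have "tens_space (num_leaves L) (V_tree L) (V_tree R) = tensor_map (num_leaves L) (tree_emb L) (tree_emb R) ` V [\<alpha> + q, \<beta> + q]"
        unfolding VL VR *(2,3) by (rule tens_space_eq_image[OF eL eR])
      then show ?thesis unfolding tree_emb_Node[OF *(1-3)] *(4) using cg_map_in_V by blast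
    qed
    moreover have eq: "act_SU2 g (tree_emb (Node k L R) f) = tree_emb (Node k L R) (act_SU2 g f)"
      if "g \<in> SU2" "f \<in> V [tdim (Node k L R)]" for g f
      by (rule tree_emb_equivariant[OF T SU2_det[OF that(1)] that(2)])
    then have "invariant_under SU2 act_SU2 ?U"
      unfolding invariant_under_def using act_SU2_in_V1 by blast
    moreover have "isomorphic_reps SU2 act_SU2 (V [tdim (Node k L R)]) act_SU2 ?U"
      unfolding isomorphic_reps_def bij_betw_def
      using eq linear_tree_emb[OF T] inj_on_tree_emb[OF T] by (intro exI[of _ "tree_emb (Node k L R)"]) (simp del: tree_emb.simps)
    ultimately show "cfun.subspace ?U \<and> ?U \<subseteq> tens_space (num_leaves L) (V_tree L) (V_tree R) \<and>
      invariant_under SU2 act_SU2 ?U \<and> isomorphic_reps SU2 act_SU2 (V [tdim (Node k L R)]) act_SU2 ?U" by blast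
  qed (use V_tree_Node_unique[OF T VL VR] in blast)
qed

lemma w_range_iff:
  "w \<in> w_range (a + b) a i j m \<longleftrightarrow> j \<le> w \<and> w + j \<le> b \<and> w + i \<le> m \<and> m + i \<le> a + w"
  by (auto simp: w_range_def)

lemma finite_w_range [simp]: "finite (w_range n a i j m)"
proof -
  have "w_range n a i j m \<subseteq> {..m}" by (auto simp: w_range_def)
  then show ?thesis by (rule finite_subset) simp
qed

lemma psi2_expand:
  assumes "f \<in> V [d1, d2]"
  shows "f = (\<Sum>(p1, p2)\<in>{..d1} \<times> {..d2}. cscale (cfun.representation (basis2 d1 d2) f (psi2 d1 d2 p1 p2)) (psi2 d1 d2 p1 p2))"
proof -
  obtain e where e: "f = (\<Sum>(p1, p2)\<in>{..d1} \<times> {..d2}. cscale (e p1 p2) (mon2 d1 d2 p1 p2))" using assms unfolding V2_eq by blast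
  define e' where "e' p = e (fst p) (snd p) * of_real (1 / sqrt (real ((d1 choose fst p) * (d2 choose snd p))))" for p
  have f: "f = (\<Sum>p\<in>{..d1} \<times> {..d2}. cscale (e' p) ((\<lambda>(p1, p2). psi2 d1 d2 p1 p2) p))"
    unfolding e e'_def
    by (intro sum.cong refl) (auto simp: psi2_eq simp flip: of_real_mult simp del: of_nat_mult)
  have "cfun.representation (basis2 d1 d2) f ((\<lambda>(p1, p2). psi2 d1 d2 p1 p2) p) = e' p" if "p \<in> {..d1} \<times> {..d2}" for p
    unfolding basis2_eq by (subst f) (rule representation_family[OF independent_psi2 _ that], simp)
  then have "(\<Sum>(p1, p2)\<in>{..d1} \<times> {..d2}. cscale (cfun.representation (basis2 d1 d2) f (psi2 d1 d2 p1 p2)) (psi2 d1 d2 p1 p2))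
     = (\<Sum>p\<in>{..d1} \<times> {..d2}. cscale (e' p) ((\<lambda>(p1, p2). psi2 d1 d2 p1 p2) p))"
    by (intro sum.cong refl) auto
  then show ?thesis using f by simp
qed

lemma CG_zero:
  assumes "p1 \<le> \<alpha> + q" "p2 \<le> \<beta> + q" "p \<le> \<alpha> + \<beta>" "p1 + p2 \<noteq> p + q"
  shows "CG (\<alpha> + q) (\<beta> + q) (\<alpha> + \<beta>) p1 p2 p = 0"
proof -
  let ?d1 = "\<alpha> + q" and ?d2 = "\<beta> + q"
  define e where "e p' = (if fst p' + snd p' = p + q then complex_of_int (tcoeff \<alpha> \<beta> q (fst p') (snd p')) / of_nat ((\<alpha> + \<beta>) choose p) / of_real (sqrt (tnorm \<alpha> \<beta> q 0)) *
     of_real (sqrt (real ((\<alpha> + \<beta>) choose p))) * of_real (1 / sqrt (real ((?d1 choose fst p') * (?d2 choose snd p')))) else 0)" for p' :: "nat \<times> nat"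
  have "CG_phi ?d1 ?d2 (\<alpha> + \<beta>) p = cscale (of_real (sqrt (real ((\<alpha> + \<beta>) choose p)))) (cg_image \<alpha> \<beta> q p)"
    unfolding CG_phi_eq[OF assms(3)] psi1_def linear_cscale_scale[OF linear_cg_map] cg_map_mon1[OF assms(3)] ..
  also have "\<dots> = (\<Sum>p'\<in>{..?d1} \<times> {..?d2}. cscale (e p') ((\<lambda>(p1, p2). psi2 ?d1 ?d2 p1 p2) p'))"
    unfolding cg_image_def cfun.scale_sum_right e_def
    by (intro sum.cong refl) (auto simp: psi2_eq simp flip: of_real_mult simp del: of_nat_mult)
  finally have phi: "CG_phi ?d1 ?d2 (\<alpha> + \<beta>) p = (\<Sum>p'\<in>{..?d1} \<times> {..?d2}. cscale (e p') ((\<lambda>(p1, p2). psi2 ?d1 ?d2 p1 p2) p'))" .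
  have "CG ?d1 ?d2 (\<alpha> + \<beta>) p1 p2 p = cfun.representation ((\<lambda>(p1, p2). psi2 ?d1 ?d2 p1 p2) ` ({..?d1} \<times> {..?d2}))
      (\<Sum>p'\<in>{..?d1} \<times> {..?d2}. cscale (e p') ((\<lambda>(p1, p2). psi2 ?d1 ?d2 p1 p2) p')) ((\<lambda>(p1, p2). psi2 ?d1 ?d2 p1 p2) (p1, p2))"
    unfolding CG_def phi basis2_eq by simp
  also have "\<dots> = e (p1, p2)"
    using assms by (intro representation_family[OF independent_psi2]) auto
  also have "\<dots> = 0" using assms by (simp add: e_def)
  finally show ?thesis .
qed

text \<open>
  The range of \<open>w\<close> parametrizes exactly those pairs of exponents for which the Clebsch-Gordan
  coefficient can be nonzero.
\<close>

lemma psi_tree_eq: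
  "rep_labeling T \<Longrightarrow> label T \<le> m \<Longrightarrow> m + label T \<le> weight T \<Longrightarrow>
     psi_tree T m = tree_emb T (psi1 (tdim T) (m - label T))"
proof (induction T arbitrary: m)
  case (Leaf a)
  then show ?case by (simp add: tdim_def)
next
  case (Node k L R)
  note T = Node.prems(1)
  obtain \<alpha> \<beta> q where *: "k = label L + label R + q" "tdim L = \<alpha> + q" "tdim R = \<beta> + q" "tdim (Node k L R) = \<alpha> + \<beta>"
    "weight L = \<alpha> + q + 2 * label L" "weight R = \<beta> + q + 2 * label R" "rep_labeling L" "rep_labeling R"
    using node_dims[OF T] by metis
  have eL: "equivariant_embedding (\<alpha> + q) (num_leaves L) (tree_emb L)" and eR: "equivariant_embedding (\<beta> + q) (num_leaves R) (tree_emb R)"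
    using tree_emb_embedding[OF *(7)] tree_emb_embedding[OF *(8)] * by auto
  let ?\<theta> = "tensor_map (num_leaves L) (tree_emb L) (tree_emb R)"
  note lin = tensor_map_linear[OF eL eR]
  let ?i = "label L" and ?j = "label R" and ?p = "m - k"
  let ?I = "w_range (weight L + weight R) (weight L) ?i ?j m"
  let ?C = "CG (\<alpha> + q) (\<beta> + q) (\<alpha> + \<beta>)"
  have p: "?p \<le> \<alpha> + \<beta>" and m: "k \<le> m" using Node.prems(2,3) *(1,5,6) by auto
  have dims: "weight L - 2 * ?i = \<alpha> + q" "weight L + weight R - weight L - 2 * ?j = \<beta> + q" "weight L + weight R - 2 * k = \<alpha> + \<beta>"
    using * by auto
  have f: "cg_map \<alpha> \<beta> q (psi1 (\<alpha> + \<beta>) ?p) \<in> V [\<alpha> + q, \<beta> + q]" by (intro cg_map_in_V psi1_in_V p)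
  have "psi_tree (Node k L R) m = (\<Sum>w\<in>?I. cscale (?C (m - w - ?i) (w - ?j) ?p) (tens (num_leaves L) (psi_tree L (m - w)) (psi_tree R w)))"
    by (simp only: psi_tree.simps Let_def dims)
  also have "\<dots> = (\<Sum>w\<in>?I. cscale (?C (m - w - ?i) (w - ?j) ?p) (?\<theta> (psi2 (\<alpha> + q) (\<beta> + q) (m - w - ?i) (w - ?j))))"
  proof (intro sum.cong refl)
    fix w assume "w \<in> ?I"
    then have w: "?j \<le> w" "w + ?j \<le> weight R" "w + ?i \<le> m" "m + ?i \<le> weight L + w" unfolding w_range_iff by auto
    have "psi_tree L (m - w) = tree_emb L (psi1 (\<alpha> + q) (m - w - ?i))"
      using Node.IH(1)[of "m - w"] *(2,7) w by simp
    moreover have "psi_tree R w = tree_emb R (psi1 (\<beta> + q) (w - ?j))"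
      using Node.IH(2)[of w] *(3,8) w by simp
    ultimately show "cscale (?C (m - w - ?i) (w - ?j) ?p) (tens (num_leaves L) (psi_tree L (m - w)) (psi_tree R w)) =
       cscale (?C (m - w - ?i) (w - ?j) ?p) (?\<theta> (psi2 (\<alpha> + q) (\<beta> + q) (m - w - ?i) (w - ?j)))"
      by (simp only: tensor_map_psi2[OF eL eR])
  qed
  also have "\<dots> = (\<Sum>(p1, p2)\<in>(\<lambda>w. (m - w - ?i, w - ?j)) ` ?I. cscale (?C p1 p2 ?p) (?\<theta> (psi2 (\<alpha> + q) (\<beta> + q) p1 p2)))"
  proof (subst sum.reindex)
    show "inj_on (\<lambda>w. (m - w - ?i, w - ?j)) ?I"
      unfolding inj_on_def by (auto simp: w_range_iff)
  qed simp
  also have "\<dots> = (\<Sum>(p1, p2)\<in>{..\<alpha> + q} \<times> {..\<beta> + q}. cscale (?C p1 p2 ?p) (?\<theta> (psi2 (\<alpha> + q) (\<beta> + q) p1 p2)))"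
  proof (rule sum.mono_neutral_left)
    show "(\<lambda>w. (m - w - ?i, w - ?j)) ` ?I \<subseteq> {..\<alpha> + q} \<times> {..\<beta> + q}"
    proof (rule image_subsetI)
      fix w assume "w \<in> ?I"
      then show "(m - w - ?i, w - ?j) \<in> {..\<alpha> + q} \<times> {..\<beta> + q}"
        unfolding w_range_iff using *(5,6) by auto
    qed
    show "\<forall>x\<in>{..\<alpha> + q} \<times> {..\<beta> + q} - (\<lambda>w. (m - w - ?i, w - ?j)) ` ?I.
        (case x of (p1, p2) \<Rightarrow> cscale (?C p1 p2 ?p) (?\<theta> (psi2 (\<alpha> + q) (\<beta> + q) p1 p2))) = 0"
    proof (rule ballI)
      fix x assume x': "x \<in> {..\<alpha> + q} \<times> {..\<beta> + q} - (\<lambda>w. (m - w - ?i, w - ?j)) ` ?I"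
      obtain p1 p2 where xp: "x = (p1, p2)" by (cases x)
      have x: "p1 \<in> {..\<alpha> + q}" "p2 \<in> {..\<beta> + q}" "(p1, p2) \<notin> (\<lambda>w. (m - w - ?i, w - ?j)) ` ?I"
        using x' unfolding xp by auto
      have "p1 + p2 \<noteq> ?p + q"
      proof
        assume s: "p1 + p2 = ?p + q"
        have "p2 + ?j \<in> ?I"
          unfolding w_range_iff using x(1,2) s m *(1,5,6) by auto
        moreover have "(p1, p2) = (m - (p2 + ?j) - ?i, p2 + ?j - ?j)"
          using x(1,2) s m *(1) by auto
        ultimately have "(p1, p2) \<in> (\<lambda>w. (m - w - ?i, w - ?j)) ` ?I" by blast
        then show False using x(3) by contradiction
      qed
      then have "?C p1 p2 ?p = 0" using x p by (intro CG_zero) auto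
      then show "(case x of (p1, p2) \<Rightarrow> cscale (?C p1 p2 ?p) (?\<theta> (psi2 (\<alpha> + q) (\<beta> + q) p1 p2))) = 0"
        unfolding xp by simp
    qed
  qed simp
  also have "\<dots> = ?\<theta> (\<Sum>(p1, p2)\<in>{..\<alpha> + q} \<times> {..\<beta> + q}. cscale (?C p1 p2 ?p) (psi2 (\<alpha> + q) (\<beta> + q) p1 p2))"
    by (simp add: linear_cscale_sum[OF lin] linear_cscale_scale[OF lin] split_def)
  also have "\<dots> = ?\<theta> (cg_map \<alpha> \<beta> q (psi1 (\<alpha> + \<beta>) ?p))"
    unfolding CG_def CG_phi_eq[OF p] psi2_expand[OF f, symmetric] ..
  also have "\<dots> = tree_emb (Node k L R) (psi1 (\<alpha> + \<beta>) ?p)"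
    unfolding tree_emb_Node[OF *(1-3)] ..
  finally show ?case unfolding *(4) by simp
qed

section \<open>From permutation modules to polynomials\<close>

text \<open>
  \<open>Xmap\<close> and \<open>Psi\<close> for an arbitrary ground set \<open>X\<close> with a subset \<open>S\<close> in the role of \<open>{1..m}\<close>: the recursion
  over the tree passes to subsets of the ground set, and permutations move \<open>S\<close>.
\<close>

definition XS :: "nat list \<Rightarrow> 'x set \<Rightarrow> 'x set \<Rightarrow> ('x set list \<Rightarrow> complex) \<Rightarrow> (complex \<times> complex) list \<Rightarrow> complex" where
  "XS a X S f = (\<Sum>B\<in>Omega a X. cscale (f B) (monomial a (map (\<lambda>b. card (b \<inter> S)) B)))"

definition PsiS :: "ltree \<Rightarrow> 'x set \<Rightarrow> 'x set \<Rightarrow> 'x set list \<Rightarrow> complex" where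
  "PsiS T X S = (\<lambda>B. if B \<in> Omega (parts T) X then of_int (E_tree T (map (\<lambda>b. card (b \<inter> S)) B)) else 0)"

lemma Xmap_eq_XS: "Xmap a m f = XS a {1..sum_list a} {1..m} f"
  by (simp add: Xmap_def XS_def)

lemma Psi_eq_PsiS: "Psi T m = PsiS T {1..weight T} {1..m}"
  by (simp only: Psi_def PsiS_def)

lemma linear_XS: "clinear (XS a X S)"
  unfolding linear_cscale_iff XS_def
  by (simp add: cfun.scale_left_distrib sum.distrib cfun.scale_sum_right)

lemma finite_Omega: "finite X \<Longrightarrow> finite (Omega a X)"
proof -
  assume "finite X"
  then have "finite {B. set B \<subseteq> Pow X \<and> length B = length a}" by (intro finite_lists_length_eq) auto
  moreover have "Omega a X \<subseteq> {B. set B \<subseteq> Pow X \<and> length B = length a}"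
    by (auto simp: Omega_def in_set_conv_nth) blast
  ultimately show ?thesis by (rule rev_finite_subset)
qed

lemma OmegaD:
  assumes "B \<in> Omega a X"
  shows "length B = length a" "\<And>r. r < length a \<Longrightarrow> B ! r \<subseteq> X" "\<And>r. r < length a \<Longrightarrow> card (B ! r) = a ! r"
    "\<And>r s. r < length a \<Longrightarrow> s < length a \<Longrightarrow> r \<noteq> s \<Longrightarrow> B ! r \<inter> B ! s = {}"
  using assms by (auto simp: Omega_def)

lemma sum_card_Omega:
  assumes "finite X" "B \<in> Omega a X"
  shows "sum_list (map (\<lambda>b. card (b \<inter> S)) B) = card (\<Union> (set B) \<inter> S)"
proof -
  note B = OmegaD[OF assms(2)]
  have fin: "finite (B ! r)" if "r < length a" for r using B(2)[OF that] assms(1) finite_subset by blast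
  have "set B = (\<lambda>r. B ! r) ` {..<length a}" using B(1) by (auto simp: set_conv_nth)
  then have U: "\<Union> (set B) = (\<Union>r<length a. B ! r)" by simp
  have "card (\<Union> (set B) \<inter> S) = card (\<Union>r<length a. B ! r \<inter> S)" unfolding U by (rule arg_cong[of _ _ card]) auto
  also have "\<dots> = (\<Sum>r<length a. card (B ! r \<inter> S))"
  proof (rule card_UN_disjoint)
    show "\<forall>i\<in>{..<length a}. finite (B ! i \<inter> S)" using fin by auto
    show "\<forall>i\<in>{..<length a}. \<forall>j\<in>{..<length a}. i \<noteq> j \<longrightarrow> B ! i \<inter> S \<inter> (B ! j \<inter> S) = {}"
      using B(4) by (metis Int_assoc Int_commute Int_empty_right lessThan_iff)
  qed simp
  also have "\<dots> = sum_list (map (\<lambda>b. card (b \<inter> S)) B)"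
    unfolding sum_list_sum_nth using B(1) by (auto simp: lessThan_atLeast0 intro!: sum.cong)
  finally show ?thesis by simp
qed

lemma Union_Omega:
  assumes "finite X" "B \<in> Omega a X" "sum_list a = card X"
  shows "\<Union> (set B) = X"
proof (rule card_subset_eq[OF assms(1)])
  note B = OmegaD[OF assms(2)]
  have "set B = (\<lambda>r. B ! r) ` {..<length a}" using B(1) by (auto simp: set_conv_nth)
  then show "\<Union> (set B) \<subseteq> X" using B(2) by auto
  have "map card B = a" using B(1,3) by (auto intro: nth_equalityI)
  then show "card (\<Union> (set B)) = card X"
    using sum_card_Omega[OF assms(1,2), of UNIV] assms(3) by simp
qed

lemma prod_if_mem:
  fixes u v :: "'a :: comm_monoid_mult"
  assumes "finite b"
  shows "(\<Prod>x\<in>b. if x \<in> S then u else v) = u ^ card (b \<inter> S) * v ^ (card b - card (b \<inter> S))"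
proof -
  have "(\<Prod>x\<in>b. if x \<in> S then u else v) = u ^ card (b \<inter> S) * v ^ card (b - S)"
    using assms by (subst prod.If_cases) (simp_all add: Diff_eq)
  then show ?thesis using assms by (simp add: card_Diff_subset_Int)
qed

text \<open>
  One factor for each point of \<open>X\<close>: in this form a substitution of the variables can be expanded
  over all subsets of \<open>X\<close>. The function \<open>\<rho>\<close> gives the block that contains a point.
\<close>

lemma monomial_as_product:
  assumes X: "finite X" and B: "B \<in> Omega a X" and sum: "sum_list a = card X"
  obtains \<rho> where "\<And>S z. length z = length a \<Longrightarrow> monomial a (map (\<lambda>b. card (b \<inter> S)) B) z =
     (\<Prod>x\<in>X. if x \<in> S then fst (z ! \<rho> x) else snd (z ! \<rho> x))" "\<And>x. x \<in> X \<Longrightarrow> \<rho> x < length a"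
proof
  note O = OmegaD[OF B]
  define \<rho> where "\<rho> x = (THE r. r < length a \<and> x \<in> B ! r)" for x
  have \<rho>: "\<rho> x = r" if "r < length a" "x \<in> B ! r" for x r
    unfolding \<rho>_def using that O(4) by (intro the_equality) blast+
  have fin: "finite (B ! r)" if "r < length a" for r using O(2)[OF that] X finite_subset by blast
  have "set B = (\<lambda>r. B ! r) ` {..<length a}" using O(1) by (auto simp: set_conv_nth)
  then have U: "X = (\<Union>r<length a. B ! r)" using Union_Omega[OF X B sum] by simp
  show "\<rho> x < length a" if "x \<in> X" for x using that \<rho> unfolding U by auto
  show "monomial a (map (\<lambda>b. card (b \<inter> S)) B) z = (\<Prod>x\<in>X. if x \<in> S then fst (z ! \<rho> x) else snd (z ! \<rho> x))"
    if z: "length z = length a" for S and z :: "(complex \<times> complex) list"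
  proof -
    have "(\<Prod>x\<in>X. if x \<in> S then fst (z ! \<rho> x) else snd (z ! \<rho> x)) = (\<Prod>r<length a. \<Prod>x\<in>B ! r. if x \<in> S then fst (z ! \<rho> x) else snd (z ! \<rho> x))"
      unfolding U by (rule prod.UNION_disjoint) (use fin O(4) in auto)
    also have "\<dots> = (\<Prod>r<length a. \<Prod>x\<in>B ! r. if x \<in> S then fst (z ! r) else snd (z ! r))"
      by (intro prod.cong refl) (simp add: \<rho>)
    also have "\<dots> = (\<Prod>r<length a. fst (z ! r) ^ card (B ! r \<inter> S) * snd (z ! r) ^ (a ! r - card (B ! r \<inter> S)))"
      by (intro prod.cong refl) (simp add: prod_if_mem fin O(3))
    also have "\<dots> = monomial a (map (\<lambda>b. card (b \<inter> S)) B) z"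
      unfolding monomial_def using z O(1) by auto
    finally show ?thesis ..
  qed
qed

definition act_coeff :: "complex^2^2 \<Rightarrow> 'x set \<Rightarrow> 'x set \<Rightarrow> 'x set \<Rightarrow> complex" where
  "act_coeff g X S S' = (\<Prod>x\<in>S'. if x \<in> S then g$1$1 else g$1$2) * (\<Prod>x\<in>X - S'. if x \<in> S then g$2$1 else g$2$2)"

text \<open>
  Every factor of \<open>monomial_as_product\<close> becomes a linear form in \<open>x\<close> and \<open>y\<close>; expanding the product,
  \<open>S'\<close> is the set of points where \<open>x\<close> is chosen.
\<close>

lemma act_XS:
  assumes X: "finite X" and sum: "sum_list a = card X"
  shows "act_SU2 g (XS a X S f) = (\<Sum>S'\<in>Pow X. cscale (act_coeff g X S S') (XS a X S' f))"
proof -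
  have "act_SU2 g (monomial a (map (\<lambda>b. card (b \<inter> S)) B)) = (\<Sum>S'\<in>Pow X. cscale (act_coeff g X S S') (monomial a (map (\<lambda>b. card (b \<inter> S')) B)))"
    if B: "B \<in> Omega a X" for B
  proof
    fix z :: "(complex \<times> complex) list"
    obtain \<rho> where \<rho>: "\<And>S z. length z = length a \<Longrightarrow> monomial a (map (\<lambda>b. card (b \<inter> S)) B) z =
     (\<Prod>x\<in>X. if x \<in> S then fst (z ! \<rho> x) else snd (z ! \<rho> x))" "\<And>x. x \<in> X \<Longrightarrow> \<rho> x < length a"
      by (rule monomial_as_product[OF X B sum]) blast
    show "act_SU2 g (monomial a (map (\<lambda>b. card (b \<inter> S)) B)) z = (\<Sum>S'\<in>Pow X. cscale (act_coeff g X S S') (monomial a (map (\<lambda>b. card (b \<inter> S')) B))) z"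
    proof (cases "length z = length a")
      case True
      let ?A = "\<lambda>x. if x \<in> S then g$1$1 else g$1$2" and ?D = "\<lambda>x. if x \<in> S then g$2$1 else g$2$2"
      have "act_SU2 g (monomial a (map (\<lambda>b. card (b \<inter> S)) B)) z = (\<Prod>x\<in>X. ?A x * fst (z ! \<rho> x) + ?D x * snd (z ! \<rho> x))"
        unfolding act_SU2_def using True
        by (subst \<rho>(1)) (auto intro!: prod.cong simp: \<rho>(2) split_def)
      also have "\<dots> = (\<Sum>S'\<in>Pow X. (\<Prod>x\<in>S'. ?A x * fst (z ! \<rho> x)) * (\<Prod>x\<in>X - S'. ?D x * snd (z ! \<rho> x)))"
        by (rule prod_add[OF X])
      also have "\<dots> = (\<Sum>S'\<in>Pow X. act_coeff g X S S' * (\<Prod>x\<in>X. if x \<in> S' then fst (z ! \<rho> x) else snd (z ! \<rho> x)))"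
      proof (intro sum.cong refl)
        fix S' assume S': "S' \<in> Pow X"
        have "(\<Prod>x\<in>X. if x \<in> S' then fst (z ! \<rho> x) else snd (z ! \<rho> x)) = (\<Prod>x\<in>S'. fst (z ! \<rho> x)) * (\<Prod>x\<in>X - S'. snd (z ! \<rho> x))"
        proof -
          have "X \<inter> {x. x \<in> S'} = S'" "X \<inter> - {x. x \<in> S'} = X - S'" using S' by auto
          then show ?thesis using X by (subst prod.If_cases) simp_all
        qed
        then show "(\<Prod>x\<in>S'. ?A x * fst (z ! \<rho> x)) * (\<Prod>x\<in>X - S'. ?D x * snd (z ! \<rho> x)) =
            act_coeff g X S S' * (\<Prod>x\<in>X. if x \<in> S' then fst (z ! \<rho> x) else snd (z ! \<rho> x))"
          unfolding act_coeff_def prod.distrib by (simp add: mult_ac)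
      qed
      also have "\<dots> = (\<Sum>S'\<in>Pow X. cscale (act_coeff g X S S') (monomial a (map (\<lambda>b. card (b \<inter> S')) B))) z"
        using True by (simp add: sum_functions_apply \<rho>(1))
      finally show ?thesis .
    qed (simp add: act_SU2_def sum_functions_apply monomial_wrong_length)
  qed
  note mon = this
  have "act_SU2 g (XS a X S f) = (\<Sum>B\<in>Omega a X. \<Sum>S'\<in>Pow X. cscale (f B * act_coeff g X S S') (monomial a (map (\<lambda>b. card (b \<inter> S')) B)))"
    unfolding XS_def linear_cscale_sum[OF linear_act_SU2] linear_cscale_scale[OF linear_act_SU2]
    by (intro sum.cong refl) (simp add: mon cfun.scale_sum_right)
  also have "\<dots> = (\<Sum>S'\<in>Pow X. cscale (act_coeff g X S S') (XS a X S' f))"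
    by (subst sum.swap) (simp add: XS_def cfun.scale_sum_right mult.commute)
  finally show ?thesis .
qed

lemma act_coeff_torus:
  assumes "finite X" "S \<subseteq> X" "S' \<subseteq> X" "g$1$2 = 0" "g$2$1 = 0"
  shows "act_coeff g X S S' = (if S' = S then g$1$1 ^ card S * g$2$2 ^ card (X - S) else 0)"
proof (cases "S' = S")
  case True
  have "(\<Prod>x\<in>S. if x \<in> S then g$1$1 else g$1$2) = (\<Prod>x\<in>S. g$1$1)" by (rule prod.cong) auto
  moreover have "(\<Prod>x\<in>X - S. if x \<in> S then g$2$1 else g$2$2) = (\<Prod>x\<in>X - S. g$2$2)" by (rule prod.cong) auto
  ultimately show ?thesis unfolding act_coeff_def True by simp
next
  case False
  then consider x where "x \<in> S'" "x \<notin> S" | x where "x \<in> S" "x \<notin> S'" by blast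
  then show ?thesis
  proof cases
    case 1
    then have "(\<Prod>x\<in>S'. if x \<in> S then g$1$1 else g$1$2) = 0"
      using assms finite_subset[OF assms(3,1)] by (intro prod_zero) (auto intro!: bexI[of _ x])
    then show ?thesis using False by (simp add: act_coeff_def)
  next
    case 2
    then have "(\<Prod>x\<in>X - S'. if x \<in> S then g$2$1 else g$2$2) = 0"
      using assms by (intro prod_zero) (auto intro!: bexI[of _ x])
    then show ?thesis using False by (simp add: act_coeff_def)
  qed
qed

lemma act_coeff_lower:
  assumes "finite X" "S \<subseteq> X" "S' \<subseteq> X" "g$1$1 = 1" "g$1$2 = 0" "g$2$1 = \<tau>" "g$2$2 = 1"
  shows "act_coeff g X S S' = (if S' \<subseteq> S then \<tau> ^ card (S - S') else 0)"
proof (cases "S' \<subseteq> S")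
  case True
  have "(\<Prod>x\<in>S'. if x \<in> S then g$1$1 else g$1$2) = 1" using True assms by (intro prod.neutral) auto
  moreover have "(\<Prod>x\<in>X - S'. if x \<in> S then g$2$1 else g$2$2) = \<tau> ^ card (S - S')"
  proof -
    have "(X - S') \<inter> {x. x \<in> S} = S - S'" using assms(2) by auto
    then show ?thesis using assms by (subst prod.If_cases) simp_all
  qed
  ultimately show ?thesis using True by (simp add: act_coeff_def)
next
  case False
  then obtain x where "x \<in> S'" "x \<notin> S" by blast
  then have "(\<Prod>x\<in>S'. if x \<in> S then g$1$1 else g$1$2) = 0"
    using assms finite_subset[OF assms(3,1)] by (intro prod_zero) (auto intro!: bexI[of _ x])
  then show ?thesis using False by (simp add: act_coeff_def)
qed

lemma act_coeff_raise:
  assumes "finite X" "S \<subseteq> X" "S' \<subseteq> X" "g$1$1 = 1" "g$1$2 = \<tau>" "g$2$1 = 0" "g$2$2 = 1"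
  shows "act_coeff g X S S' = (if S \<subseteq> S' then \<tau> ^ card (S' - S) else 0)"
proof (cases "S \<subseteq> S'")
  case True
  have "(\<Prod>x\<in>X - S'. if x \<in> S then g$2$1 else g$2$2) = 1" using True assms by (intro prod.neutral) auto
  moreover have "(\<Prod>x\<in>S'. if x \<in> S then g$1$1 else g$1$2) = \<tau> ^ card (S' - S)"
  proof -
    have "S' \<inter> - {x. x \<in> S} = S' - S" by auto
    then show ?thesis using assms finite_subset[OF assms(3,1)] by (subst prod.If_cases) simp_all
  qed
  ultimately show ?thesis using True by (simp add: act_coeff_def)
next
  case False
  then obtain x where "x \<in> S" "x \<notin> S'" by blast
  then have "(\<Prod>x\<in>X - S'. if x \<in> S then g$2$1 else g$2$2) = 0"
    using assms by (intro prod_zero) (auto intro!: bexI[of _ x])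
  then show ?thesis using False by (simp add: act_coeff_def)
qed

subsection \<open>Permutations\<close>

lemma Omega_permute:
  assumes "\<sigma> permutes X"
  shows "map ((`) \<sigma>) B \<in> Omega a X \<longleftrightarrow> B \<in> Omega a X"
proof -
  have inj: "inj \<sigma>" by (rule permutes_inj[OF assms])
  have 1: "\<sigma> ` b \<subseteq> X \<longleftrightarrow> b \<subseteq> X" for b using permutes_in_image[OF assms] by auto
  have 2: "card (\<sigma> ` b) = card b" for b by (rule card_image) (meson inj inj_on_subset subset_UNIV)
  have 3: "\<sigma> ` b \<inter> \<sigma> ` c = {} \<longleftrightarrow> b \<inter> c = {}" for b c using image_Int[OF inj, of b c] by auto
  have imp: "map ((`) \<sigma>) B \<in> Omega a X" if "B \<in> Omega a X"
    unfolding Omega_def mem_Collect_eq using OmegaD[OF that]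
    by (intro conjI allI impI) (simp_all add: 1 2 3)
  have "B \<in> Omega a X" if "map ((`) \<sigma>) B \<in> Omega a X"
    unfolding Omega_def mem_Collect_eq using OmegaD[OF that]
    by (intro conjI allI impI) (simp_all add: 1 2 3)
  with imp show ?thesis by blast
qed

lemma map_image_inv:
  assumes "\<sigma> permutes X"
  shows "map ((`) (inv \<sigma>)) (map ((`) \<sigma>) B) = B" "map ((`) \<sigma>) (map ((`) (inv \<sigma>)) B) = B"
  using permutes_inverses[OF assms] by (simp_all add: map_idI image_image)

lemma card_image_permutes:
  assumes "\<sigma> permutes X"
  shows "card (\<sigma> ` b) = card b"
  using card_image[OF inj_on_subset[OF permutes_inj[OF assms] subset_UNIV]] .

lemma card_inv_image_Int:
  assumes "\<sigma> permutes X"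
  shows "card (inv \<sigma> ` b \<inter> S) = card (b \<inter> \<sigma> ` S)"
proof -
  have "\<sigma> ` (inv \<sigma> ` b \<inter> S) = b \<inter> \<sigma> ` S"
    using permutes_inverses[OF assms] by (auto simp: image_Int[OF permutes_inj[OF assms]] image_image)
  then show ?thesis using card_image_permutes[OF assms, of "inv \<sigma> ` b \<inter> S"] by simp
qed

lemma XS_permute:
  assumes "\<sigma> permutes X"
  shows "XS a X (\<sigma> ` S) (act_tuples \<sigma> f) = XS a X S f"
  unfolding XS_def
proof (rule sum.reindex_bij_witness[of _ "map ((`) \<sigma>)" "map ((`) (inv \<sigma>))"])
  have inj: "inj \<sigma>" by (rule permutes_inj[OF assms])
  fix B assume B: "B \<in> Omega a X"
  show "map ((`) \<sigma>) B \<in> Omega a X" using B Omega_permute[OF assms] by blast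
  show "map ((`) (inv \<sigma>)) (map ((`) \<sigma>) B) = B" by (rule map_image_inv[OF assms])
next
  have inj: "inj \<sigma>" by (rule permutes_inj[OF assms])
  fix B assume B: "B \<in> Omega a X"
  show B': "map ((`) \<sigma>) (map ((`) (inv \<sigma>)) B) = B" by (rule map_image_inv[OF assms])
  show "map ((`) (inv \<sigma>)) B \<in> Omega a X" using B Omega_permute[OF permutes_inv[OF assms]] by blast
  have "card (inv \<sigma> ` b \<inter> S) = card (b \<inter> \<sigma> ` S)" for b by (rule card_inv_image_Int[OF assms])
  then show "cscale (f (map ((`) (inv \<sigma>)) B)) (monomial a (map (\<lambda>b. card (b \<inter> S)) (map ((`) (inv \<sigma>)) B))) =
    cscale (act_tuples \<sigma> f B) (monomial a (map (\<lambda>b. card (b \<inter> \<sigma> ` S)) B))"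
    by (simp add: act_tuples_def comp_def)
qed

lemma PsiS_permute:
  assumes "\<sigma> permutes X"
  shows "act_tuples \<sigma> (PsiS T X S) = PsiS T X (\<sigma> ` S)"
proof
  fix B
  have inj: "inj \<sigma>" by (rule permutes_inj[OF assms])
  have "card (inv \<sigma> ` b \<inter> S) = card (b \<inter> \<sigma> ` S)" for b by (rule card_inv_image_Int[OF assms])
  then show "act_tuples \<sigma> (PsiS T X S) B = PsiS T X (\<sigma> ` S) B"
    unfolding act_tuples_def PsiS_def Omega_permute[OF permutes_inv[OF assms]] by (simp add: comp_def)
qed

text \<open>
  Orbits of the symmetric group on configurations of subsets are recognized by cardinalities; a
  configuration is encoded by the function that tells for each point where it lies.
\<close>

lemma exists_permutation_of_coloring:
  assumes X: "finite X" and cards: "\<And>c. card {x \<in> X. f x = c} = card {x \<in> X. g x = c}"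
  obtains \<sigma> where "\<sigma> permutes X" "\<And>x. x \<in> X \<Longrightarrow> g (\<sigma> x) = f x"
proof -
  have "image_mset f (mset_set X) = image_mset g (mset_set X)"
  proof (rule multiset_eqI)
    fix c
    have "count (image_mset h (mset_set X)) c = card {x \<in> X. h x = c}" for h :: "'a \<Rightarrow> 'b"
      using X by (simp add: count_image_mset' eq_commute[of c])
    then show "count (image_mset f (mset_set X)) c = count (image_mset g (mset_set X)) c" using cards by simp
  qed
  from image_mset_eq_implies_permutes[OF X this] obtain p where "p permutes X" "\<forall>x\<in>X. f x = g (p x)" by blast
  then show ?thesis using that by force
qed

lemma permutes_image_eqI:
  assumes \<sigma>: "\<sigma> permutes X" and sub: "A \<subseteq> X" "A' \<subseteq> X" and iff: "\<And>x. x \<in> X \<Longrightarrow> \<sigma> x \<in> A' \<longleftrightarrow> x \<in> A"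
  shows "\<sigma> ` A = A'"
proof
  show "\<sigma> ` A \<subseteq> A'" using sub iff by auto
  show "A' \<subseteq> \<sigma> ` A"
  proof
    fix y assume y: "y \<in> A'"
    then have "y \<in> \<sigma> ` X" unfolding permutes_image[OF \<sigma>] using sub(2) by blast
    then obtain x where x: "x \<in> X" "y = \<sigma> x" by (rule imageE)
    then show "y \<in> \<sigma> ` A" using iff[OF x(1)] y by simp
  qed
qed

lemma exists_permutation_pair:
  assumes X: "finite X" and sub: "S \<subseteq> X" "C \<subseteq> X" "S' \<subseteq> X" "C' \<subseteq> X"
    and card: "card S = card S'" "card C = card C'" "card (C \<inter> S) = card (C' \<inter> S')"
  obtains \<sigma> where "\<sigma> permutes X" "\<sigma> ` S = S'" "\<sigma> ` C = C'"
proof -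
  have fin: "finite S" "finite C" "finite S'" "finite C'" using sub X finite_subset by blast+
  have c1: "card (C - S) = card (C' - S')" "card (S - C) = card (S' - C')"
    using card card_Diff_subset_Int[of C S] card_Diff_subset_Int[of C' S'] card_Diff_subset_Int[of S C]
      card_Diff_subset_Int[of S' C'] fin Int_commute[of S C] Int_commute[of S' C'] by simp_all
  have "card (C \<union> S) = card (C' \<union> S')"
    using card card_Un_Int[OF fin(2,1)] card_Un_Int[OF fin(4,3)] by linarith
  then have c2: "card (X - (C \<union> S)) = card (X - (C' \<union> S'))" using sub X fin by (simp add: card_Diff_subset)
  obtain \<sigma> where \<sigma>: "\<sigma> permutes X" "\<And>x. x \<in> X \<Longrightarrow> (\<sigma> x \<in> C', \<sigma> x \<in> S') = (x \<in> C, x \<in> S)"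
  proof (rule exists_permutation_of_coloring[OF X, of "\<lambda>x. (x \<in> C, x \<in> S)" "\<lambda>x. (x \<in> C', x \<in> S')"])
    fix c :: "bool \<times> bool"
    have "{x \<in> X. (x \<in> A, x \<in> B) = c} = (if fst c then if snd c then A \<inter> B else A - B else if snd c then B - A else X - (A \<union> B))"
      if "A \<subseteq> X" "B \<subseteq> X" for A B using that by (cases c) auto
    then show "card {x \<in> X. (x \<in> C, x \<in> S) = c} = card {x \<in> X. (x \<in> C', x \<in> S') = c}"
      using sub card c1 c2 by simp
  qed blast
  have "\<sigma> ` S = S'" "\<sigma> ` C = C'"
    by (rule permutes_image_eqI[OF \<sigma>(1)]; use sub \<sigma>(2) in auto)+
  with \<sigma>(1) that show ?thesis by blast
qed

lemma exists_permutation_tuples: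
  assumes X: "finite X" and B: "B \<in> Omega a X" and B': "B' \<in> Omega a X" and sum: "sum_list a = card X"
    and S: "S \<subseteq> X" and card: "map (\<lambda>b. card (b \<inter> S)) B = map (\<lambda>b. card (b \<inter> S)) B'"
  obtains \<sigma> where "\<sigma> permutes X" "\<sigma> ` S = S" "map ((`) \<sigma>) B = B'"
proof -
  note O = OmegaD[OF B] and O' = OmegaD[OF B']
  define \<rho> where "\<rho> B x = (THE r. r < length a \<and> x \<in> B ! r)" for B :: "'a set list" and x
  have \<rho>: "\<rho> B x = r" if "B \<in> Omega a X" "r < length a" "x \<in> B ! r" for x r B
    unfolding \<rho>_def using that OmegaD(4)[OF that(1)] by (intro the_equality) blast+
  have ex: "\<exists>r<length a. x \<in> B ! r" if B: "B \<in> Omega a X" and x: "x \<in> X" for x B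
  proof -
    obtain b where "b \<in> set B" "x \<in> b" using Union_Omega[OF X B sum] x by blast
    then show ?thesis using OmegaD(1)[OF B] by (auto simp: in_set_conv_nth)
  qed
  have \<rho>': "\<rho> B x < length a" "x \<in> B ! \<rho> B x" if "B \<in> Omega a X" "x \<in> X" for x B
    using ex[OF that] \<rho>[OF that(1)] by auto
  have iff: "\<rho> B x = r \<longleftrightarrow> x \<in> B ! r" if "B \<in> Omega a X" "x \<in> X" "r < length a" for x B r
    using \<rho>[OF that(1,3)] \<rho>'[OF that(1,2)] by auto
  have cnt: "{x \<in> X. (\<rho> B x, x \<in> S) = c} = (if fst c < length a then if snd c then B ! fst c \<inter> S else B ! fst c - S else {})"
    if "B \<in> Omega a X" for B c
    using iff[OF that] \<rho>'(1)[OF that] OmegaD(2)[OF that] by (cases c) (auto split: if_splits, blast+)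
  have cardeq: "card (B ! r \<inter> S) = card (B' ! r \<inter> S)" if "r < length a" for r
    using arg_cong[OF card, of "\<lambda>l. l ! r"] that O(1) O'(1) by simp
  obtain \<sigma> where \<sigma>: "\<sigma> permutes X" "\<And>x. x \<in> X \<Longrightarrow> (\<rho> B' (\<sigma> x), \<sigma> x \<in> S) = (\<rho> B x, x \<in> S)"
  proof (rule exists_permutation_of_coloring[OF X, of "\<lambda>x. (\<rho> B x, x \<in> S)" "\<lambda>x. (\<rho> B' x, x \<in> S)"])
    fix c
    have "card (B ! r - S) = card (B' ! r - S)" if "r < length a" for r
      using cardeq[OF that] O(2,3)[OF that] O'(2,3)[OF that] X by (simp add: card_Diff_subset_Int finite_subset)
    then show "card {x \<in> X. (\<rho> B x, x \<in> S) = c} = card {x \<in> X. (\<rho> B' x, x \<in> S) = c}"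
      unfolding cnt[OF B] cnt[OF B'] using cardeq by simp
  qed blast
  have "\<sigma> ` S = S" by (rule permutes_image_eqI[OF \<sigma>(1)]) (use S \<sigma>(2) in auto)
  moreover have "map ((`) \<sigma>) B = B'"
  proof (rule nth_equalityI)
    fix r assume "r < length (map ((`) \<sigma>) B)"
    then have r: "r < length a" using O(1) by simp
    have "\<sigma> x \<in> B' ! r \<longleftrightarrow> x \<in> B ! r" if "x \<in> X" for x
      using \<sigma>(2)[OF that] iff[OF B that r] iff[OF B' _ r, of "\<sigma> x"] permutes_in_image[OF \<sigma>(1)] that by auto
    then have "\<sigma> ` (B ! r) = B' ! r" by (intro permutes_image_eqI[OF \<sigma>(1)]) (use O(2) O'(2) r in auto)
    then show "map ((`) \<sigma>) B ! r = B' ! r" using r O(1) by simp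
  qed (simp add: O(1) O'(1))
  ultimately show ?thesis using \<sigma>(1) that by blast
qed

text \<open>On functions that are invariant under the stabilizer of \<open>S\<close> the map is injective, since
  distinct orbits contribute distinct monomials.\<close>

lemma XS_injective_on_invariants:
  assumes X: "finite X" and S: "S \<subseteq> X" and sum: "sum_list a = card X" and u: "u \<in> M a X"
    and inv: "\<And>\<sigma>. \<sigma> permutes X \<Longrightarrow> \<sigma> ` S = S \<Longrightarrow> act_tuples \<sigma> u = u"
    and 0: "XS a X S u = 0"
  shows "u = 0"
proof
  fix B0
  let ?c = "\<lambda>B. map (\<lambda>b. card (b \<inter> S)) B"
  show "u B0 = 0 B0"
  proof (cases "B0 \<in> Omega a X")
    case True
    have fin: "finite (Omega a X)" by (rule finite_Omega[OF X])
    have cexps: "?c B \<in> exps a" if "B \<in> Omega a X" for B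
      using OmegaD(1-3)[OF that] X
      by (auto simp: exps_def) (metis Int_lower1 card_mono finite_subset)
    have "XS a X S u = (\<Sum>l\<in>exps a. \<Sum>B\<in>{B \<in> Omega a X. ?c B = l}. cscale (u B) (monomial a (?c B)))"
      unfolding XS_def by (rule sum.group[symmetric]) (use fin cexps in auto)
    also have "\<dots> = (\<Sum>l\<in>exps a. cscale (\<Sum>B\<in>{B \<in> Omega a X. ?c B = l}. u B) (monomial a l))"
      by (intro sum.cong refl) (simp add: cfun.scale_sum_left)
    finally have "(\<Sum>B\<in>{B \<in> Omega a X. ?c B = ?c B0}. u B) = 0"
      using independent_familyD[OF independent_monomials _ cexps[OF True]] 0 by simp
    moreover have "u B = u B0" if B: "B \<in> Omega a X" "?c B = ?c B0" for B
    proof -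
      obtain \<sigma> where \<sigma>: "\<sigma> permutes X" "\<sigma> ` S = S" "map ((`) \<sigma>) B0 = B"
        using exists_permutation_tuples[OF X True B(1) sum S] B(2) by metis
      have "u B = act_tuples \<sigma> u B" using inv[OF \<sigma>(1,2)] by simp
      also have "\<dots> = u B0" unfolding act_tuples_def \<sigma>(3)[symmetric] map_image_inv[OF \<sigma>(1)] ..
      finally show ?thesis .
    qed
    ultimately have "of_nat (card {B \<in> Omega a X. ?c B = ?c B0}) * u B0 = 0" by simp
    moreover have "card {B \<in> Omega a X. ?c B = ?c B0} \<noteq> 0" using fin True by auto
    ultimately show ?thesis by simp
  next
    case False
    then show ?thesis using u by (simp add: M_def)
  qed
qed

section \<open>The image of \<open>\<Psi>\<close>\<close>

subsection \<open>Decomposition over the subsets \<open>F\<close>\<close>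

lemma Omega_appendI:
  assumes "F \<subseteq> X" "B1 \<in> Omega a F" "B2 \<in> Omega a' (X - F)"
  shows "B1 @ B2 \<in> Omega (a @ a') X"
proof -
  note O = OmegaD[OF assms(2)] and O' = OmegaD[OF assms(3)]
  have disj: "B1 ! r \<inter> B2 ! s = {}" if "r < length a" "s < length a'" for r s
    using O(2)[OF that(1)] O'(2)[OF that(2)] by blast
  show ?thesis
    unfolding Omega_def mem_Collect_eq
  proof (intro conjI allI impI)
    show "length (B1 @ B2) = length (a @ a')" using O(1) O'(1) by simp
  next
    fix r assume r: "r < length (a @ a')"
    show "(B1 @ B2) ! r \<subseteq> X"
    proof (cases "r < length a")
      case True then show ?thesis using O(1,2) assms(1) by (auto simp: nth_append)
    next
      case False
      then have "r - length a < length a'" using r by auto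
      then show ?thesis using O'(2) O(1) False by (auto simp: nth_append)
    qed
    show "card ((B1 @ B2) ! r) = (a @ a') ! r"
    proof (cases "r < length a")
      case True then show ?thesis using O(1,3) by (auto simp: nth_append)
    next
      case False
      then have "r - length a < length a'" using r by auto
      then show ?thesis using O'(3) O(1) False by (auto simp: nth_append)
    qed
  next
    fix r s assume rs: "r < length (a @ a')" "s < length (a @ a')" "r \<noteq> s"
    consider "r < length a" "s < length a" | "r < length a" "\<not> s < length a" | "\<not> r < length a" "s < length a"
      | "\<not> r < length a" "\<not> s < length a" by blast
    then show "(B1 @ B2) ! r \<inter> (B1 @ B2) ! s = {}"
    proof cases
      case 1 then show ?thesis using O(1) O(4)[of r s] rs by (simp add: nth_append)
    next
      case 2 then show ?thesis using O(1) disj[of r "s - length a"] rs by (simp add: nth_append)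
    next
      case 3 then show ?thesis using O(1) disj[of s "r - length a"] rs by (simp add: nth_append Int_commute)
    next
      case 4 then show ?thesis using O(1) O'(4)[of "r - length a" "s - length a"] rs by (simp add: nth_append)
    qed
  qed
qed

lemma Omega_append_split:
  assumes X: "finite X" and B: "B \<in> Omega (a @ a') X"
  defines "F \<equiv> \<Union> (set (take (length a) B))"
  shows "F \<subseteq> X" "card F = sum_list a" "take (length a) B \<in> Omega a F" "drop (length a) B \<in> Omega a' (X - F)"
proof -
  note O = OmegaD[OF B]
  have len: "length (take (length a) B) = length a" using O(1) by simp
  have nt: "take (length a) B ! r = B ! r" if "r < length a" for r using that by simp
  have F: "F = (\<Union>r<length a. B ! r)"
    unfolding F_def set_conv_nth len by (auto simp: nt)
  have "B ! r \<subseteq> X" if "r < length a" for r using O(2)[of r] that by simp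
  then show "F \<subseteq> X" unfolding F by auto
  show 1: "take (length a) B \<in> Omega a F"
    unfolding Omega_def mem_Collect_eq
  proof (intro conjI allI impI)
    fix r assume r: "r < length a"
    show "take (length a) B ! r \<subseteq> F" unfolding F using r by auto
    show "card (take (length a) B ! r) = a ! r" using r O(3)[of r] by (simp add: nth_append)
  next
    fix r s assume "r < length a" "s < length a" "r \<noteq> s"
    then show "take (length a) B ! r \<inter> take (length a) B ! s = {}" using O(4)[of r s] by simp
  qed (rule len)
  have "map card (take (length a) B) = a" using OmegaD(1,3)[OF 1] by (auto intro: nth_equalityI)
  then show "card F = sum_list a"
    using sum_card_Omega[OF X B] sum_card_Omega[OF finite_subset[OF \<open>F \<subseteq> X\<close> X] 1, of UNIV] F_def by simp
  show "drop (length a) B \<in> Omega a' (X - F)"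
    unfolding Omega_def mem_Collect_eq
  proof (intro conjI allI impI)
    show "length (drop (length a) B) = length a'" using O(1) by simp
  next
    fix r assume r: "r < length a'"
    have d: "drop (length a) B ! r = B ! (length a + r)" using O(1) r by simp
    have "B ! (length a + r) \<inter> B ! s = {}" if "s < length a" for s using O(4)[of "length a + r" s] r that by simp
    then show "drop (length a) B ! r \<subseteq> X - F" unfolding F d using O(2)[of "length a + r"] r by auto
    show "card (drop (length a) B ! r) = a' ! r" unfolding d using O(3)[of "length a + r"] r by (simp add: nth_append)
  next
    fix r s assume "r < length a'" "s < length a'" "r \<noteq> s"
    then show "drop (length a) B ! r \<inter> drop (length a) B ! s = {}" using O(4)[of "length a + r" "length a + s"] O(1) by simp
  qed
qed

text \<open>
  Only the tuples whose first blocks lie in \<open>F\<close> and whose other blocks avoid \<open>F\<close> contribute, and for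
  them the monomial factors.
\<close>

lemma XS_tens:
  assumes X: "finite X" and F: "F \<subseteq> X" and f: "f \<in> M a F" and h: "h \<in> M a' (X - F)"
  shows "XS (a @ a') X S (tens (length a) f h) = tens (length a) (XS a F (S \<inter> F) f) (XS a' (X - F) (S - F) h)"
proof -
  let ?t = "length a" and ?m = "\<lambda>S B. map (\<lambda>b. card (b \<inter> S)) B"
  let ?P = "(\<lambda>(B1, B2). B1 @ B2) ` (Omega a F \<times> Omega a' (X - F))"
  have sub: "?P \<subseteq> Omega (a @ a') X" using Omega_appendI[OF F] by auto
  have inj: "inj_on (\<lambda>(B1, B2). B1 @ B2) (Omega a F \<times> Omega a' (X - F))"
    by (auto simp: inj_on_def dest!: OmegaD(1))
  have zero: "tens ?t f h B = 0" if B: "B \<in> Omega (a @ a') X - ?P" for B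
  proof (rule ccontr)
    assume "tens ?t f h B \<noteq> 0"
    then have "take ?t B \<in> Omega a F" "drop ?t B \<in> Omega a' (X - F)" using f h by (auto simp: tens_def M_def)
    then have "(take ?t B, drop ?t B) \<in> Omega a F \<times> Omega a' (X - F)" by simp
    then have "take ?t B @ drop ?t B \<in> ?P" by (rule rev_image_eqI) simp
    then show False using B by simp
  qed
  have mon: "monomial (a @ a') (?m S (B1 @ B2)) = tens ?t (monomial a (?m (S \<inter> F) B1)) (monomial a' (?m (S - F) B2))"
    if B: "B1 \<in> Omega a F" "B2 \<in> Omega a' (X - F)" for B1 B2
  proof -
    have "b \<subseteq> F" if "b \<in> set B1" for b using that OmegaD(1,2)[OF B(1)] by (auto simp: in_set_conv_nth)
    then have m1: "?m S B1 = ?m (S \<inter> F) B1" by (auto intro!: arg_cong[of _ _ card])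
    have "b \<subseteq> X - F" if b: "b \<in> set B2" for b
    proof -
      obtain r where "r < length a'" "b = B2 ! r" using b OmegaD(1)[OF B(2)] by (auto simp: in_set_conv_nth)
      then show ?thesis using OmegaD(2)[OF B(2)] by simp
    qed
    then have m2: "?m S B2 = ?m (S - F) B2" by (fastforce intro!: arg_cong[of _ _ card])
    show ?thesis unfolding map_append m1 m2
      by (rule tens_monomial[symmetric]) (simp add: OmegaD(1)[OF B(1)])
  qed
  have "XS (a @ a') X S (tens ?t f h) = (\<Sum>B\<in>?P. cscale (tens ?t f h B) (monomial (a @ a') (?m S B)))"
    unfolding XS_def using sub zero finite_Omega[OF X] by (intro sum.mono_neutral_right) auto
  also have "\<dots> = (\<Sum>(B1, B2)\<in>Omega a F \<times> Omega a' (X - F). cscale (tens ?t f h (B1 @ B2)) (monomial (a @ a') (?m S (B1 @ B2))))"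
    by (subst sum.reindex[OF inj]) (simp add: split_def)
  also have "\<dots> = (\<Sum>(B1, B2)\<in>Omega a F \<times> Omega a' (X - F).
      tens ?t (cscale (f B1) (monomial a (?m (S \<inter> F) B1))) (cscale (h B2) (monomial a' (?m (S - F) B2))))"
  proof (rule sum.cong[OF refl])
    fix p assume "p \<in> Omega a F \<times> Omega a' (X - F)"
    then obtain B1 B2 where p: "p = (B1, B2)" "B1 \<in> Omega a F" "B2 \<in> Omega a' (X - F)" by auto
    show "(case p of (B1, B2) \<Rightarrow> cscale (tens ?t f h (B1 @ B2)) (monomial (a @ a') (?m S (B1 @ B2)))) = (case p of (B1, B2) \<Rightarrow>
      tens ?t (cscale (f B1) (monomial a (?m (S \<inter> F) B1))) (cscale (h B2) (monomial a' (?m (S - F) B2))))"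
      unfolding p(1) prod.case tens_cscale mon[OF p(2,3)] tens_apply_append[OF OmegaD(1)[OF p(2)]] ..
  qed
  also have "\<dots> = tens ?t (XS a F (S \<inter> F) f) (XS a' (X - F) (S - F) h)"
    unfolding XS_def by (simp add: fun_eq_iff tens_def sum_functions_apply sum_product sum.cartesian_product split_def)
  finally show ?thesis .
qed

lemma PsiS_in_M: "PsiS T X S \<in> M (parts T) X"
  by (simp add: PsiS_def M_def)

definition node_coeff :: "nat \<Rightarrow> ltree \<Rightarrow> ltree \<Rightarrow> nat \<Rightarrow> nat \<Rightarrow> int" where
  "node_coeff k L R m w = (if w \<in> w_range (weight L + weight R) (weight L) (label L) (label R) m
     then Ehahn (k - label L - label R) (int (weight R) - 2 * int (label R)) (int (weight L) - 2 * int (label L))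
            (int m - int (label L) - int (label R)) (int w - int (label R)) else 0)"

text \<open>
  The set \<open>F\<close> that contributes to a tuple is the union of its first blocks.
\<close>

lemma PsiS_Node:
  assumes X: "finite X" and S: "S \<subseteq> X" and card: "card X = weight L + weight R"
  shows "PsiS (Node k L R) X S = (\<Sum>F\<in>ksubsets (weight L) X. cscale (of_int (node_coeff k L R (card S) (card (S - F))))
     (tens (num_leaves L) (PsiS L F (S \<inter> F)) (PsiS R (X - F) (S - F))))"
proof
  fix B
  let ?t = "num_leaves L" and ?c = "\<lambda>S B. map (\<lambda>b. card (b \<inter> S)) B"
  let ?term = "\<lambda>F. cscale (of_int (node_coeff k L R (card S) (card (S - F)))) (tens ?t (PsiS L F (S \<inter> F)) (PsiS R (X - F) (S - F)))"
  have finK: "finite (ksubsets (weight L) X)" unfolding ksubsets_def using X by simp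
  show "PsiS (Node k L R) X S B = (\<Sum>F\<in>ksubsets (weight L) X. ?term F) B"
  proof (cases "B \<in> Omega (parts L @ parts R) X")
    case False
    have "tens ?t (PsiS L F (S \<inter> F)) (PsiS R (X - F) (S - F)) B = 0" if "F \<in> ksubsets (weight L) X" for F
    proof (rule ccontr)
      assume "tens ?t (PsiS L F (S \<inter> F)) (PsiS R (X - F) (S - F)) B \<noteq> 0"
      then have "take ?t B \<in> Omega (parts L) F" "drop ?t B \<in> Omega (parts R) (X - F)"
        by (auto simp: tens_def PsiS_def split: if_splits)
      from Omega_appendI[OF _ this] that False show False by (simp add: ksubsets_def)
    qed
    then show ?thesis using False by (simp add: PsiS_def sum_functions_apply)
  next
    case True
    define F0 where "F0 = \<Union> (set (take ?t B))"
    note sp = Omega_append_split[OF X True, unfolded length_parts, folded F0_def]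
    have F0: "F0 \<in> ksubsets (weight L) X" using sp(1,2) by (simp add: ksubsets_def)
    have "?term F B = 0" if F: "F \<in> ksubsets (weight L) X - {F0}" for F
    proof -
      have "take ?t B \<notin> Omega (parts L) F"
      proof
        assume "take ?t B \<in> Omega (parts L) F"
        moreover have "finite F" "sum_list (parts L) = card F" using F X finite_subset by (auto simp: ksubsets_def)
        ultimately have "F0 = F" unfolding F0_def by (intro Union_Omega)
        then show False using F by simp
      qed
      then show ?thesis by (simp add: tens_def PsiS_def)
    qed
    then have "(\<Sum>F\<in>ksubsets (weight L) X. ?term F B) = (\<Sum>F\<in>{F0}. ?term F B)"
      using F0 finK by (intro sum.mono_neutral_right) blast+
    then have "(\<Sum>F\<in>ksubsets (weight L) X. ?term F) B = ?term F0 B"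
      by (simp only: sum_functions_apply) simp
    also have "\<dots> = PsiS (Node k L R) X S B"
    proof -
      have U: "\<Union> (set B) = X" using Union_Omega[OF X True] card by simp
      have m: "sum_list (?c S B) = card S" using sum_card_Omega[OF X True, of S] S unfolding U by (simp add: Int_absorb1)
      have "finite (X - F0)" "sum_list (parts R) = card (X - F0)"
        using X sp(1,2) card finite_subset[OF sp(1) X] by (auto simp: card_Diff_subset)
      from Union_Omega[OF this(1) sp(4) this(2)] have UR: "\<Union> (set (drop ?t B)) = X - F0" .
      have "sum_list (?c S (drop ?t B)) = card ((X - F0) \<inter> S)" using sum_card_Omega[OF \<open>finite (X - F0)\<close> sp(4), of S] unfolding UR .
      moreover have "(X - F0) \<inter> S = S - F0" using S by auto
      ultimately have w: "sum_list (drop ?t (?c S B)) = card (S - F0)" by (simp add: drop_map)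
      have "b \<subseteq> F0" if "b \<in> set (take ?t B)" for b using that unfolding F0_def by auto
      then have cL: "?c (S \<inter> F0) (take ?t B) = take ?t (?c S B)" by (auto simp: take_map intro!: arg_cong[of _ _ card])
      have "b \<subseteq> X - F0" if "b \<in> set (drop ?t B)" for b using that unfolding UR[symmetric] by auto
      then have cR: "?c (S - F0) (drop ?t B) = drop ?t (?c S B)" by (fastforce simp: drop_map intro!: arg_cong[of _ _ card])
      show ?thesis
        unfolding cscale_apply tens_def PsiS_def cL cR using True sp(3,4)
        by (simp add: Let_def m w node_coeff_def)
    qed
    finally show ?thesis by simp
  qed
qed

text \<open>
  The complement of \<open>F\<close> is chosen separately inside and outside of \<open>S\<close>.
\<close>

lemma card_split_sets:
  assumes X: "finite X" and S: "S \<subseteq> X" and card: "card X = a + b" "w \<le> b"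
  shows "card {F \<in> ksubsets a X. card (S - F) = w} = (card S choose w) * ((a + b - card S) choose (b - w))"
proof -
  have finS: "finite S" using S X finite_subset by blast
  let ?P = "{A. A \<subseteq> S \<and> card A = w} \<times> {D. D \<subseteq> X - S \<and> card D = b - w}"
  have "card {F \<in> ksubsets a X. card (S - F) = w} = card ?P"
  proof (rule bij_betw_same_card[OF bij_betw_byWitness[where f' = "\<lambda>(A, D). X - (A \<union> D)"]])
    show "\<forall>F\<in>{F \<in> ksubsets a X. card (S - F) = w}. (\<lambda>(A, D). X - (A \<union> D)) ((\<lambda>F. (S - F, X - S - F)) F) = F"
      using S by (auto simp: ksubsets_def)
    show "\<forall>p\<in>?P. (\<lambda>F. (S - F, X - S - F)) ((\<lambda>(A, D). X - (A \<union> D)) p) = p" using S by auto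
    show "(\<lambda>F. (S - F, X - S - F)) ` {F \<in> ksubsets a X. card (S - F) = w} \<subseteq> ?P"
    proof
      fix p assume "p \<in> (\<lambda>F. (S - F, X - S - F)) ` {F \<in> ksubsets a X. card (S - F) = w}"
      then obtain F where F: "F \<subseteq> X" "card F = a" "card (S - F) = w" "p = (S - F, X - S - F)" by (auto simp: ksubsets_def)
      have "card (X - F) = b" using F X card finite_subset by (subst card_Diff_subset) auto
      moreover have "X - F = (S - F) \<union> (X - S - F)" "(S - F) \<inter> (X - S - F) = {}" using S by auto
      ultimately have "b = w + card (X - S - F)" using card_Un_disjoint[of "S - F" "X - S - F"] finS X F(3) by auto
      then show "p \<in> ?P" using F by auto
    qed
    show "(\<lambda>(A, D). X - (A \<union> D)) ` ?P \<subseteq> {F \<in> ksubsets a X. card (S - F) = w}"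
    proof
      fix F assume "F \<in> (\<lambda>(A, D). X - (A \<union> D)) ` ?P"
      then obtain A D where AD: "A \<subseteq> S" "card A = w" "D \<subseteq> X - S" "card D = b - w" "F = X - (A \<union> D)" by auto
      have fin: "finite A" "finite D" using AD finS X finite_subset by blast+
      have "A \<inter> D = {}" using AD by auto
      then have "card (A \<union> D) = b" using AD fin card(2) by (simp add: card_Un_disjoint)
      moreover have "A \<union> D \<subseteq> X" using AD S by auto
      ultimately have "card F = a" unfolding AD(5) using X fin card by (simp add: card_Diff_subset)
      moreover have "S - F = A" unfolding AD(5) using AD(1,3) S by auto
      ultimately show "F \<in> {F \<in> ksubsets a X. card (S - F) = w}" using AD by (auto simp: ksubsets_def)
    qed
  qed
  also have "\<dots> = (card S choose w) * ((a + b - card S) choose (b - w))"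
    using n_subsets[OF finS, of w] n_subsets[of "X - S" "b - w"] X S finS card by (simp add: card_cartesian_product card_Diff_subset)
  finally show ?thesis .
qed

subsection \<open>Hahn polynomials as transvectant coefficients\<close>

lemma pochhammer_times_fact: "pochhammer (int n + 1) r * fact n = fact (n + r)"
proof (induction r)
  case (Suc r)
  have "pochhammer (int n + 1) (Suc r) * fact n = (pochhammer (int n + 1) r * fact n) * (int n + 1 + int r)"
    by (simp only: pochhammer_Suc mult_ac)
  also have "\<dots> = fact (n + Suc r)" unfolding Suc.IH by (simp add: algebra_simps)
  finally show ?case .
qed simp

lemma pochhammer_minus_times_fact: "r \<le> p \<Longrightarrow> pochhammer (- int p) r * fact (p - r) = (-1) ^ r * fact p"
proof (induction r)
  case (Suc r)
  then have e: "p - r = Suc (p - Suc r)" by auto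
  have "(- int p + int r) * fact (p - Suc r) = - fact (p - r)"
    unfolding e using Suc.prems by (simp add: of_nat_diff algebra_simps)
  then have "pochhammer (- int p) (Suc r) * fact (p - Suc r) = - (pochhammer (- int p) r * fact (p - r))"
    by (simp add: pochhammer_Suc mult.assoc)
  then show ?case using Suc by simp
qed simp

lemma choose_times_fact:
  assumes "p1 \<le> n" "e \<le> p1" "e \<le> n"
  shows "int ((n - e) choose (n - p1)) * fact (n - p1) * fact (p1 - e) = fact (n - e)"
proof -
  have "n - p1 \<le> n - e" using assms by auto
  from binomial_fact_lemma[OF this] have "fact (n - p1) * fact (p1 - e) * ((n - e) choose (n - p1)) = fact (n - e)"
    using assms by (simp add: Suc_diff_le)
  then have "int (fact (n - p1) * fact (p1 - e) * ((n - e) choose (n - p1))) = int (fact (n - e))" by simp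
  then show ?thesis by (simp add: mult_ac)
qed

text \<open>
  Compared with \<open>hcoeff\<close>, the sums agree term by term: the Pochhammer symbols are quotients of
  factorials, and for \<open>r\<close> outside of the range a binomial coefficient vanishes.
\<close>

lemma Ehahn_eq_tcoeff:
  assumes p: "p1 \<le> \<alpha> + q" "p2 \<le> \<beta> + q"
  shows "Ehahn q (int (\<beta> + q)) (int (\<alpha> + q)) (int p1 + int p2) (int p2) * (fact \<alpha> * fact \<beta>) =
    tcoeff \<alpha> \<beta> q p1 p2 * (fact p1 * fact (\<alpha> + q - p1) * fact p2 * fact (\<beta> + q - p2))"
proof -
  let ?R = "{r. r \<le> q \<and> r \<le> p2 \<and> q - r \<le> p1}"
  have R: "{r. max 0 (int p2 - (int p1 + int p2) + int q) \<le> int r \<and> int r \<le> min (int q) (int p2)} = ?R" by auto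
  have "Ehahn q (int (\<beta> + q)) (int (\<alpha> + q)) (int p1 + int p2) (int p2) * (fact \<alpha> * fact \<beta>) =
    (\<Sum>r\<in>?R. (-1) ^ r * int (q choose r) * pochhammer (int \<alpha> + 1) r * pochhammer (- int p2) r *
        pochhammer (int \<beta> + 1) (q - r) * pochhammer (- int p1) (q - r) * (fact \<alpha> * fact \<beta>))"
    unfolding Ehahn_def R sum_distrib_right by (intro sum.cong refl) simp
  also have "\<dots> = (\<Sum>r\<in>?R. (-1) ^ (q - r) * int (q choose r) * int ((\<alpha> + r) choose (\<alpha> + q - p1)) * int ((\<beta> + (q - r)) choose (\<beta> + q - p2))
     * (fact p1 * fact (\<alpha> + q - p1) * fact p2 * fact (\<beta> + q - p2)))"
  proof (intro sum.cong refl)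
    fix r assume "r \<in> ?R"
    then have r: "r \<le> q" "r \<le> p2" "q - r \<le> p1" by auto
    have n: "\<alpha> + q - (q - r) = \<alpha> + r" "\<beta> + q - r = \<beta> + (q - r)" using r by auto
    have c1: "int ((\<alpha> + r) choose (\<alpha> + q - p1)) * fact (\<alpha> + q - p1) * fact (p1 - (q - r)) = fact (\<alpha> + r)"
      using choose_times_fact[of p1 "\<alpha> + q" "q - r"] p r unfolding n by simp
    have c2: "int ((\<beta> + (q - r)) choose (\<beta> + q - p2)) * fact (\<beta> + q - p2) * fact (p2 - r) = fact (\<beta> + (q - r))"
      using choose_times_fact[of p2 "\<beta> + q" r] p r unfolding n by simp
    have s: "(-1) ^ r * (-1) ^ r = (1 :: int)" by (simp flip: power_mult_distrib)
    let ?l = "(-1) ^ r * int (q choose r) * pochhammer (int \<alpha> + 1) r * pochhammer (- int p2) r *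
        pochhammer (int \<beta> + 1) (q - r) * pochhammer (- int p1) (q - r) * (fact \<alpha> * fact \<beta>)"
    let ?r = "(-1) ^ (q - r) * int (q choose r) * int ((\<alpha> + r) choose (\<alpha> + q - p1)) * int ((\<beta> + (q - r)) choose (\<beta> + q - p2))
     * (fact p1 * fact (\<alpha> + q - p1) * fact p2 * fact (\<beta> + q - p2))"
    let ?k = "fact (p2 - r) * fact (p1 - (q - r)) :: int"
    have "?l * ?k = (-1) ^ r * int (q choose r) * (pochhammer (int \<alpha> + 1) r * fact \<alpha>) * (pochhammer (int \<beta> + 1) (q - r) * fact \<beta>) *
       (pochhammer (- int p2) r * fact (p2 - r)) * (pochhammer (- int p1) (q - r) * fact (p1 - (q - r)))"
      by (simp only: mult_ac)
    also have "\<dots> = (-1) ^ r * int (q choose r) * fact (\<alpha> + r) * fact (\<beta> + (q - r)) * ((-1) ^ r * fact p2) * ((-1) ^ (q - r) * fact p1)"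
      unfolding pochhammer_times_fact pochhammer_minus_times_fact[OF r(2)] pochhammer_minus_times_fact[OF r(3)] ..
    also have "\<dots> = ((-1) ^ r * (-1) ^ r) * ((-1) ^ (q - r) * int (q choose r) * fact p1 * fact p2 * fact (\<alpha> + r) * fact (\<beta> + (q - r)))"
      by (simp only: mult_ac)
    also have "\<dots> = ?r * ?k"
      unfolding s c1[symmetric] c2[symmetric] by (simp only: mult_ac mult_1 mult_1_right)
    finally show "?l = ?r" by simp
  qed
  also have "\<dots> = (\<Sum>r\<le>q. (-1) ^ (q - r) * int (q choose r) * int ((\<alpha> + r) choose (\<alpha> + q - p1)) * int ((\<beta> + (q - r)) choose (\<beta> + q - p2))
     * (fact p1 * fact (\<alpha> + q - p1) * fact p2 * fact (\<beta> + q - p2)))"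
  proof (rule sum.mono_neutral_left)
    show "\<forall>r\<in>{..q} - ?R. (-1) ^ (q - r) * int (q choose r) * int ((\<alpha> + r) choose (\<alpha> + q - p1)) * int ((\<beta> + (q - r)) choose (\<beta> + q - p2))
     * (fact p1 * fact (\<alpha> + q - p1) * fact p2 * fact (\<beta> + q - p2)) = 0"
    proof
      fix r assume r: "r \<in> {..q} - ?R"
      then have "\<alpha> + r < \<alpha> + q - p1 \<or> \<beta> + (q - r) < \<beta> + q - p2" using p by auto
      then have "((\<alpha> + r) choose (\<alpha> + q - p1)) = 0 \<or> ((\<beta> + (q - r)) choose (\<beta> + q - p2)) = 0" by (metis binomial_eq_0)
      then show "(-1) ^ (q - r) * int (q choose r) * int ((\<alpha> + r) choose (\<alpha> + q - p1)) * int ((\<beta> + (q - r)) choose (\<beta> + q - p2))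
        * (fact p1 * fact (\<alpha> + q - p1) * fact p2 * fact (\<beta> + q - p2)) = 0" by auto
    qed
  qed auto
  also have "\<dots> = tcoeff \<alpha> \<beta> q p1 p2 * (fact p1 * fact (\<alpha> + q - p1) * fact p2 * fact (\<beta> + q - p2))"
    unfolding tcoeff_eq_hcoeff[OF p] hcoeff_def sum_distrib_right ..
  finally show ?thesis .
qed

subsection \<open>The proportionality constant\<close>

text \<open>
  The part of the constant that does not depend on \<open>m\<close>. Each vertex contributes the ratio between
  Hahn polynomials and the normalized Clebsch-Gordan map.
\<close>

primrec kappa :: "ltree \<Rightarrow> real" where
  "kappa (Leaf a) = 1"
| "kappa (Node k L R) = (let q = k - label L - label R; \<alpha> = tdim L - q; \<beta> = tdim R - q
     in kappa L * kappa R * fact (\<alpha> + \<beta>) * sqrt (tnorm \<alpha> \<beta> q 0) / (fact \<alpha> * fact \<beta>))"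

lemma kappa_Node:
  assumes "k = label L + label R + q" "tdim L = \<alpha> + q" "tdim R = \<beta> + q"
  shows "kappa (Node k L R) = kappa L * kappa R * fact (\<alpha> + \<beta>) * sqrt (tnorm \<alpha> \<beta> q 0) / (fact \<alpha> * fact \<beta>)"
  using assms by (simp add: Let_def)

lemma kappa_pos: "kappa T > 0"
  by (induction T) (auto simp: Let_def tnorm_0_pos)

definition chi :: "ltree \<Rightarrow> nat \<Rightarrow> real" where
  "chi T m = fact m * fact (weight T - m) * kappa T / (fact (m - label T) * fact (weight T - m - label T))"

lemma chi_pos: "chi T m > 0"
  by (simp add: chi_def kappa_pos)

lemma Omega_singleton:
  assumes "finite X" "card X = a"
  shows "Omega [a] X = {[X]}"
proof
  show "Omega [a] X \<subseteq> {[X]}"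
  proof
    fix B assume "B \<in> Omega [a] X"
    then obtain b where b: "B = [b]" "b \<subseteq> X" "card b = a"
      by (auto simp: Omega_def length_Suc_conv)
    then show "B \<in> {[X]}" using assms card_subset_eq[OF assms(1) b(2)] by simp
  qed
qed (use assms in \<open>auto simp: Omega_def\<close>)

lemma XS_cscale_sum:
  "XS a X S (\<Sum>i\<in>I. cscale (c i) (h i)) = (\<Sum>i\<in>I. cscale (c i) (XS a X S (h i)))"
  by (simp add: linear_cscale_sum[OF linear_XS] linear_cscale_scale[OF linear_XS])

text \<open>
  The cancellations between the factorials, isolated as identities of real numbers: in the first,
  \<open>A\<close>, \<open>B\<close>, \<open>C\<close>, \<open>D\<close> are the factorials from the multiplicity, which cancel against those in the
  constants of the sons.
\<close>

lemma constants_cancel: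
  fixes A B C D :: real
  assumes "A \<noteq> 0" "B \<noteq> 0" "C \<noteq> 0" "D \<noteq> 0" "u \<noteq> 0" "v \<noteq> 0" "P1 \<noteq> 0" "P2 \<noteq> 0"
  shows "m1 / (A * B) * (m2 / (C * D)) * (c * ((B * D * k1 / P1) * (A * C * k2 / P2))) =
    (c * (u * v)) * (m1 * m2 * k1 * k2 / (u * v * P1 * P2))"
  using assms by (simp add: field_simps)

lemma constants_cancel':
  fixes t :: real
  assumes "f1 \<noteq> 0" "f2 \<noteq> 0" "f3 \<noteq> 0" "f4 \<noteq> 0" "u \<noteq> 0" "v \<noteq> 0"
  shows "t * (f1 * f2 * f3 * f4) * (X / (u * v * (f1 * f2) * (f3 * f4))) = t * (X / (u * v))"
  using assms by (simp add: field_simps)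

lemma constants_cancel'':
  fixes t :: real
  assumes "d \<noteq> 0" "s \<noteq> 0" "P \<noteq> 0" "P' \<noteq> 0" "u \<noteq> 0" "v \<noteq> 0"
  shows "t * (m1 * m2 * k1 * k2 / (u * v)) = m1 * m2 * (k1 * k2 * d * s / (u * v)) / (P * P') * (t / (d / (P * P')) / s)"
  using assms by (simp add: field_simps)

text \<open>
  In the decomposition over \<open>F\<close> the summand depends on \<open>w = card (S - F)\<close> only. The number of such
  \<open>F\<close>, the Hahn polynomial and the constants of the sons multiply to a coefficient of the
  transvectant times a quantity independent of \<open>w\<close>.
\<close>

theorem XS_PsiS:
  assumes "rep_labeling T" "finite X" "card X = weight T" "S \<subseteq> X"
    "label T \<le> card S" "card S + label T \<le> weight T"
  shows "XS (parts T) X S (PsiS T X S) = cscale (of_real (chi T (card S))) (tree_emb T (mon1 (tdim T) (card S - label T)))"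
  using assms
proof (induction T arbitrary: X S)
  case (Leaf a)
  have "X \<inter> S = S" using Leaf.prems by auto
  then show ?case using Leaf.prems
    by (simp add: XS_def PsiS_def Omega_singleton chi_def tdim_def)
next
  case (Node k L R)
  note T = Node.prems(1) and X = Node.prems(2) and S = Node.prems(4)
  obtain \<alpha> \<beta> q where *: "k = label L + label R + q" "tdim L = \<alpha> + q" "tdim R = \<beta> + q" "tdim (Node k L R) = \<alpha> + \<beta>"
    "weight L = \<alpha> + q + 2 * label L" "weight R = \<beta> + q + 2 * label R" "rep_labeling L" "rep_labeling R"
    by (rule node_dims[OF T]) blast
  have eL: "equivariant_embedding (\<alpha> + q) (num_leaves L) (tree_emb L)" and eR: "equivariant_embedding (\<beta> + q) (num_leaves R) (tree_emb R)"
    using tree_emb_embedding[OF *(7)] tree_emb_embedding[OF *(8)] *(2,3) by auto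
  let ?\<theta> = "tensor_map (num_leaves L) (tree_emb L) (tree_emb R)"
  let ?m2 = "\<lambda>p1 p2. ?\<theta> (mon2 (\<alpha> + q) (\<beta> + q) p1 p2)"
  note lin = tensor_map_linear[OF eL eR]
  let ?a = "weight L" and ?b = "weight R" and ?i = "label L" and ?j = "label R" and ?m = "card S" and ?p = "card S - k"
  let ?I = "w_range (?a + ?b) ?a ?i ?j ?m"
  let ?n = "?a + ?b"
  have cX: "card X = ?a + ?b" and m: "k \<le> ?m" "?m + k \<le> ?n" using Node.prems(3,5,6) by auto
  have fS: "finite S" using S X finite_subset by blast
  let ?G = "\<lambda>w. of_int (node_coeff k L R ?m w) * of_real (chi L (?m - w) * chi R w) :: complex"
  have summand: "cscale (of_int (node_coeff k L R ?m (card (S - F))))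
       (XS (parts L @ parts R) X S (tens (num_leaves L) (PsiS L F (S \<inter> F)) (PsiS R (X - F) (S - F))))
     = cscale (?G (card (S - F))) (?m2 (?m - card (S - F) - ?i) (card (S - F) - ?j))"
    if F: "F \<in> ksubsets ?a X" for F
  proof (cases "card (S - F) \<in> ?I")
    case False
    then show ?thesis by (simp add: node_coeff_def)
  next
    case True
    have FX: "F \<subseteq> X" "card F = ?a" "finite F" using F X finite_subset by (auto simp: ksubsets_def)
    have w: "?j \<le> card (S - F)" "card (S - F) + ?j \<le> ?b" "card (S - F) + ?i \<le> ?m" "?m + ?i \<le> ?a + card (S - F)"
      using True unfolding w_range_iff by auto
    have cSF: "card (S \<inter> F) = ?m - card (S - F)"
      using fS card_Diff_subset_Int[of S F] card_mono[OF fS, of "S \<inter> F"] by auto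
    have "XS (parts L) F (S \<inter> F) (PsiS L F (S \<inter> F)) = cscale (of_real (chi L (card (S \<inter> F)))) (tree_emb L (mon1 (tdim L) (card (S \<inter> F) - ?i)))"
      by (rule Node.IH(1)[OF *(7)]) (use FX w cSF in auto)
    moreover have "XS (parts R) (X - F) (S - F) (PsiS R (X - F) (S - F)) = cscale (of_real (chi R (card (S - F)))) (tree_emb R (mon1 (tdim R) (card (S - F) - ?j)))"
      by (rule Node.IH(2)[OF *(8)]) (use FX w cX X S in \<open>auto simp: card_Diff_subset\<close>)
    ultimately have "XS (parts L @ parts R) X S (tens (num_leaves L) (PsiS L F (S \<inter> F)) (PsiS R (X - F) (S - F)))
      = cscale (of_real (chi L (?m - card (S - F)) * chi R (card (S - F)))) (?m2 (?m - card (S - F) - ?i) (card (S - F) - ?j))"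
      using XS_tens[OF X FX(1) PsiS_in_M[of L F "S \<inter> F"] PsiS_in_M[of R "X - F" "S - F"], of S]
      by (simp add: tens_cscale cSF *(2,3) tensor_map_mon2[OF eL eR])
    then show ?thesis by simp
  qed
  have "XS (parts (Node k L R)) X S (PsiS (Node k L R) X S) =
     (\<Sum>F\<in>ksubsets ?a X. cscale (?G (card (S - F))) (?m2 (?m - card (S - F) - ?i) (card (S - F) - ?j)))"
    unfolding PsiS_Node[OF X S cX] XS_cscale_sum parts.simps by (intro sum.cong refl summand)
  also have "\<dots> = (\<Sum>F\<in>{F \<in> ksubsets ?a X. card (S - F) \<in> ?I}. cscale (?G (card (S - F))) (?m2 (?m - card (S - F) - ?i) (card (S - F) - ?j)))"
    using X by (intro sum.mono_neutral_right) (auto simp: ksubsets_def node_coeff_def)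
  also have "\<dots> = (\<Sum>w\<in>?I. \<Sum>F\<in>{F \<in> {F \<in> ksubsets ?a X. card (S - F) \<in> ?I}. card (S - F) = w}.
      cscale (?G (card (S - F))) (?m2 (?m - card (S - F) - ?i) (card (S - F) - ?j)))"
    using X by (intro sum.group[symmetric]) (auto simp: ksubsets_def)
  also have "\<dots> = (\<Sum>w\<in>?I. cscale (of_nat (split_mult ?n ?a ?m w) * ?G w) (?m2 (?m - w - ?i) (w - ?j)))"
  proof (intro sum.cong refl)
    fix w assume w: "w \<in> ?I"
    then have wb: "w \<le> ?b" unfolding w_range_iff by auto
    have "(\<Sum>F\<in>{F \<in> {F \<in> ksubsets ?a X. card (S - F) \<in> ?I}. card (S - F) = w}.
      cscale (?G (card (S - F))) (?m2 (?m - card (S - F) - ?i) (card (S - F) - ?j)))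
      = (\<Sum>F\<in>{F \<in> ksubsets ?a X. card (S - F) = w}. cscale (?G w) (?m2 (?m - w - ?i) (w - ?j)))"
      using w by (intro sum.cong) auto
    also have "\<dots> = cscale (of_nat (card {F \<in> ksubsets ?a X. card (S - F) = w}) * ?G w) (?m2 (?m - w - ?i) (w - ?j))"
      by (simp add: fun_eq_iff sum_functions_apply)
    also have "card {F \<in> ksubsets ?a X. card (S - F) = w} = split_mult ?n ?a ?m w"
      unfolding card_split_sets[OF X S cX wb] split_mult_def by simp
    finally show "(\<Sum>F\<in>{F \<in> {F \<in> ksubsets ?a X. card (S - F) \<in> ?I}. card (S - F) = w}.
      cscale (?G (card (S - F))) (?m2 (?m - card (S - F) - ?i) (card (S - F) - ?j))) =
      cscale (of_nat (split_mult ?n ?a ?m w) * ?G w) (?m2 (?m - w - ?i) (w - ?j))" .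
  qed
  also have "\<dots> = (\<Sum>w\<in>?I. cscale (of_real (chi (Node k L R) ?m) * (of_int (tcoeff \<alpha> \<beta> q (?m - w - ?i) (w - ?j)) / of_nat ((\<alpha> + \<beta>) choose ?p) / of_real (sqrt (tnorm \<alpha> \<beta> q 0))))
      (?m2 (?m - w - ?i) (w - ?j)))"
  proof (intro sum.cong refl arg_cong[of _ _ "\<lambda>c. cscale c _"])
    fix w assume wI: "w \<in> ?I"
    then have w: "?j \<le> w" "w + ?j \<le> ?b" "w + ?i \<le> ?m" "?m + ?i \<le> ?a + w" unfolding w_range_iff by auto
    define p1 p2 where "p1 = ?m - w - ?i" and "p2 = w - ?j"
    have p: "p1 \<le> \<alpha> + q" "p2 \<le> \<beta> + q" "?m - w = p1 + ?i" "w = p2 + ?j" "?m = p1 + p2 + ?i + ?j" "p1 + p2 = ?p + q"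
      using w *(1,5,6) m unfolding p1_def p2_def by auto
    have E: "real_of_int (node_coeff k L R ?m w) * (fact \<alpha> * fact \<beta>) = of_int (tcoeff \<alpha> \<beta> q p1 p2) * (fact p1 * fact (\<alpha> + q - p1) * fact p2 * fact (\<beta> + q - p2))"
    proof -
      have i: "k - ?i - ?j = q" using *(1) by simp
      have i': "int ?b - 2 * int ?j = int (\<beta> + q)" using *(6) by simp
      have i'': "int ?a - 2 * int ?i = int (\<alpha> + q)" using *(5) by simp
      have m': "int ?m - int ?i - int ?j = int p1 + int p2" using p(5) by simp
      have w': "int w - int ?j = int p2" using p(4) by simp
      have "node_coeff k L R ?m w * (fact \<alpha> * fact \<beta>) = tcoeff \<alpha> \<beta> q p1 p2 * (fact p1 * fact (\<alpha> + q - p1) * fact p2 * fact (\<beta> + q - p2))"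
        unfolding node_coeff_def i i' i'' m' w' using wI Ehahn_eq_tcoeff[OF p(1,2)] by simp
      then have "real_of_int (node_coeff k L R ?m w * (fact \<alpha> * fact \<beta>)) = of_int (tcoeff \<alpha> \<beta> q p1 p2 * (fact p1 * fact (\<alpha> + q - p1) * fact p2 * fact (\<beta> + q - p2)))" by simp
      then show ?thesis by simp
    qed
    have split: "real (split_mult ?n ?a ?m w) = fact ?m / (fact w * fact (?m - w)) * (fact (?n - ?m) / (fact (?b - w) * fact (?a - (?m - w))))"
    proof -
      have "?n - ?m - (?b - w) = ?a - (?m - w)" using w m by auto
      moreover have "w \<le> ?m" "?b - w \<le> ?n - ?m" "?n - ?a - w = ?b - w" using w m by auto
      ultimately show ?thesis unfolding split_mult_def by (simp only: of_nat_mult binomial_fact)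
    qed
    have cL: "chi L (?m - w) = fact (?m - w) * fact (?a - (?m - w)) * kappa L / (fact p1 * fact (\<alpha> + q - p1))"
    proof -
      have "?a - (?m - w) - ?i = \<alpha> + q - p1" using p(3) *(5) by simp
      then show ?thesis unfolding chi_def p1_def[symmetric] by simp
    qed
    have cR: "chi R w = fact w * fact (?b - w) * kappa R / (fact p2 * fact (\<beta> + q - p2))"
    proof -
      have "?b - w - ?j = \<beta> + q - p2" using p(4) *(6) by simp
      then show ?thesis unfolding chi_def p2_def[symmetric] by simp
    qed
    have pd: "?p \<le> \<alpha> + \<beta>" using m *(1,5,6) by auto
    have cT: "chi (Node k L R) ?m = fact ?m * fact (?n - ?m) * kappa (Node k L R) / (fact ?p * fact (\<alpha> + \<beta> - ?p))"
    proof -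
      have "?n - ?m - k = \<alpha> + \<beta> - ?p" using m *(1,5,6) by auto
      then show ?thesis unfolding chi_def by simp
    qed
    have t: "sqrt (tnorm \<alpha> \<beta> q 0) > 0" using tnorm_0_pos by simp
    have "real (split_mult ?n ?a ?m w) * (real_of_int (node_coeff k L R ?m w) * (chi L (?m - w) * chi R w)) =
      (real_of_int (node_coeff k L R ?m w) * (fact \<alpha> * fact \<beta>)) * (fact ?m * fact (?n - ?m) * kappa L * kappa R /
        (fact \<alpha> * fact \<beta> * (fact p1 * fact (\<alpha> + q - p1)) * (fact p2 * fact (\<beta> + q - p2))))"
      unfolding split cL cR by (rule constants_cancel) simp_all
    also have "\<dots> = of_int (tcoeff \<alpha> \<beta> q p1 p2) * (fact ?m * fact (?n - ?m) * kappa L * kappa R / (fact \<alpha> * fact \<beta>))"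
      unfolding E by (rule constants_cancel') simp_all
    also have "\<dots> = chi (Node k L R) ?m * (of_int (tcoeff \<alpha> \<beta> q p1 p2) / real ((\<alpha> + \<beta>) choose ?p) / sqrt (tnorm \<alpha> \<beta> q 0))"
      unfolding cT kappa_Node[OF *(1-3)] binomial_fact[OF pd] using t by (intro constants_cancel'') simp_all
    finally have "real (split_mult ?n ?a ?m w) * (real_of_int (node_coeff k L R ?m w) * (chi L (?m - w) * chi R w)) =
      chi (Node k L R) ?m * (of_int (tcoeff \<alpha> \<beta> q p1 p2) / real ((\<alpha> + \<beta>) choose ?p) / sqrt (tnorm \<alpha> \<beta> q 0))" .
    from arg_cong[OF this, of complex_of_real]
    show "of_nat (split_mult ?n ?a ?m w) * ?G w = of_real (chi (Node k L R) ?m) * (of_int (tcoeff \<alpha> \<beta> q (?m - w - ?i) (w - ?j)) / of_nat ((\<alpha> + \<beta>) choose ?p) / of_real (sqrt (tnorm \<alpha> \<beta> q 0)))"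
      unfolding p1_def p2_def by simp
  qed
  also have "\<dots> = (\<Sum>(p1, p2)\<in>(\<lambda>w. (?m - w - ?i, w - ?j)) ` ?I. cscale (of_real (chi (Node k L R) ?m) * (of_int (tcoeff \<alpha> \<beta> q p1 p2) / of_nat ((\<alpha> + \<beta>) choose ?p) / of_real (sqrt (tnorm \<alpha> \<beta> q 0))))
      (?m2 p1 p2))"
  proof (subst sum.reindex)
    show "inj_on (\<lambda>w. (?m - w - ?i, w - ?j)) ?I"
      unfolding inj_on_def by (auto simp: w_range_iff)
  qed simp
  also have "\<dots> = (\<Sum>(p1, p2)\<in>{..\<alpha> + q} \<times> {..\<beta> + q}. cscale (of_real (chi (Node k L R) ?m) * (if p1 + p2 = ?p + q then of_int (tcoeff \<alpha> \<beta> q p1 p2) / of_nat ((\<alpha> + \<beta>) choose ?p) / of_real (sqrt (tnorm \<alpha> \<beta> q 0)) else 0))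
      (?m2 p1 p2))"
  proof -
    have im: "(\<lambda>w. (?m - w - ?i, w - ?j)) ` ?I = {(p1, p2) \<in> {..\<alpha> + q} \<times> {..\<beta> + q}. p1 + p2 = ?p + q}"
    proof
      show "(\<lambda>w. (?m - w - ?i, w - ?j)) ` ?I \<subseteq> {(p1, p2) \<in> {..\<alpha> + q} \<times> {..\<beta> + q}. p1 + p2 = ?p + q}"
      proof (rule image_subsetI)
        fix w assume "w \<in> ?I"
        then show "(?m - w - ?i, w - ?j) \<in> {(p1, p2) \<in> {..\<alpha> + q} \<times> {..\<beta> + q}. p1 + p2 = ?p + q}"
          unfolding w_range_iff using *(1,5,6) m by auto
      qed
      show "{(p1, p2) \<in> {..\<alpha> + q} \<times> {..\<beta> + q}. p1 + p2 = ?p + q} \<subseteq> (\<lambda>w. (?m - w - ?i, w - ?j)) ` ?I"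
      proof
        fix x assume "x \<in> {(p1, p2) \<in> {..\<alpha> + q} \<times> {..\<beta> + q}. p1 + p2 = ?p + q}"
        then obtain p1 p2 where x: "x = (p1, p2)" "p1 \<le> \<alpha> + q" "p2 \<le> \<beta> + q" "p1 + p2 = ?p + q" by auto
        have "p2 + ?j \<in> ?I" unfolding w_range_iff using x m *(1,5,6) by auto
        moreover have "x = (?m - (p2 + ?j) - ?i, p2 + ?j - ?j)" using x m *(1) by auto
        ultimately show "x \<in> (\<lambda>w. (?m - w - ?i, w - ?j)) ` ?I" by blast
      qed
    qed
    show ?thesis unfolding im by (rule sum.mono_neutral_cong_left) auto
  qed
  also have "\<dots> = cscale (of_real (chi (Node k L R) ?m)) (?\<theta> (cg_image \<alpha> \<beta> q ?p))"
    unfolding cg_image_def linear_cscale_sum[OF lin] cfun.scale_sum_right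
    by (intro sum.cong refl) (simp add: linear_cscale_scale[OF lin] split_def)
  also have "\<dots> = cscale (of_real (chi (Node k L R) ?m)) (tree_emb (Node k L R) (mon1 (\<alpha> + \<beta>) ?p))"
  proof -
    have "?p \<le> \<alpha> + \<beta>" using m *(1,5,6) by auto
    then show ?thesis unfolding tree_emb_Node[OF *(1-3)] by (simp only: cg_map_mon1)
  qed
  finally show ?case unfolding *(4) by simp
qed

section \<open>Specht modules of two-row shape\<close>

lemma finite_ksubsets [simp]: "finite X \<Longrightarrow> finite (ksubsets k X)"
  by (simp add: ksubsets_def)

lemma dmap_sum_over:
  assumes X: "finite X"
  shows "dmap k X f D = (\<Sum>C\<in>ksubsets k X. f C * of_nat (card {x \<in> C. D = C - {x}}))"
  unfolding dmap_def
proof (intro sum.cong refl arg_cong[of _ _ "times _"])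
  fix C assume "C \<in> ksubsets k X"
  then have "finite C" using X finite_subset by (auto simp: ksubsets_def)
  then show "(\<Sum>x\<in>C. if D = C - {x} then 1 else 0) = (of_nat (card {x \<in> C. D = C - {x}}) :: complex)"
    by (simp add: sum.If_cases Int_def conj_commute)
qed

lemma dmap_insert:
  assumes X: "finite X" and D: "D \<subseteq> X" "card D + 1 = k"
  shows "dmap k X f D = (\<Sum>x\<in>X - D. f (insert x D))"
proof -
  have finD: "finite D" using D X finite_subset by blast
  have "dmap k X f D = (\<Sum>C\<in>ksubsets k X. \<Sum>x\<in>C. if D = C - {x} then f C else 0)"
    unfolding dmap_def by (intro sum.cong refl) (simp add: sum_distrib_left if_distrib[of "times _"] cong: if_cong)
  also have "\<dots> = (\<Sum>(C, x)\<in>Sigma (ksubsets k X) (\<lambda>C. C). if D = C - {x} then f C else 0)"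
    by (subst sum.Sigma) (use X in \<open>auto simp: ksubsets_def intro: finite_subset\<close>)
  also have "\<dots> = (\<Sum>(C, x)\<in>(\<lambda>x. (insert x D, x)) ` (X - D). if D = C - {x} then f C else 0)"
  proof (rule sum.mono_neutral_right)
    show "finite (Sigma (ksubsets k X) (\<lambda>C. C))"
      using X by (intro finite_SigmaI) (auto simp: ksubsets_def intro: finite_subset)
    show "(\<lambda>x. (insert x D, x)) ` (X - D) \<subseteq> Sigma (ksubsets k X) (\<lambda>C. C)"
      using D finD by (auto simp: ksubsets_def)
    show "\<forall>i\<in>Sigma (ksubsets k X) (\<lambda>C. C) - (\<lambda>x. (insert x D, x)) ` (X - D).
        (case i of (C, x) \<Rightarrow> if D = C - {x} then f C else 0) = 0"
    proof (rule ballI)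
      fix i assume i: "i \<in> Sigma (ksubsets k X) (\<lambda>C. C) - (\<lambda>x. (insert x D, x)) ` (X - D)"
      obtain C x where Cx: "i = (C, x)" by (cases i)
      have "x \<in> C" "C \<subseteq> X" using i unfolding Cx by (auto simp: ksubsets_def)
      have "D \<noteq> C - {x}"
      proof
        assume "D = C - {x}"
        then have "(C, x) = (insert x D, x)" "x \<in> X - D" using \<open>x \<in> C\<close> \<open>C \<subseteq> X\<close> by auto
        then show False using i unfolding Cx by blast
      qed
      then show "(case i of (C, x) \<Rightarrow> if D = C - {x} then f C else 0) = 0" unfolding Cx by simp
    qed
  qed
  also have "\<dots> = (\<Sum>x\<in>X - D. if D = insert x D - {x} then f (insert x D) else 0)"
    by (subst sum.reindex) (auto simp: inj_on_def)
  also have "\<dots> = (\<Sum>x\<in>X - D. f (insert x D))" by (intro sum.cong) auto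
  finally show ?thesis .
qed

lemma Specht_iff:
  assumes X: "finite X"
  shows "f \<in> Specht k X \<longleftrightarrow> (\<forall>C. C \<notin> ksubsets k X \<longrightarrow> f C = 0) \<and>
    (\<forall>D. D \<subseteq> X \<and> card D + 1 = k \<longrightarrow> (\<Sum>x\<in>X - D. f (insert x D)) = 0)"
proof -
  have "dmap k X f = 0 \<longleftrightarrow> (\<forall>D. D \<subseteq> X \<and> card D + 1 = k \<longrightarrow> (\<Sum>x\<in>X - D. f (insert x D)) = 0)"
  proof
    assume "dmap k X f = 0"
    then show "\<forall>D. D \<subseteq> X \<and> card D + 1 = k \<longrightarrow> (\<Sum>x\<in>X - D. f (insert x D)) = 0"
      by (metis dmap_insert[OF X] zero_fun_apply)
  next
    assume *: "\<forall>D. D \<subseteq> X \<and> card D + 1 = k \<longrightarrow> (\<Sum>x\<in>X - D. f (insert x D)) = 0"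
    show "dmap k X f = 0"
    proof
      fix D
      show "dmap k X f D = 0 D"
      proof (cases "D \<subseteq> X \<and> card D + 1 = k")
        case True
        then show ?thesis using * dmap_insert[OF X] by simp
      next
        case False
        have "card {x \<in> C. D = C - {x}} = 0" if C: "C \<in> ksubsets k X" for C
        proof -
          have "finite C" using C X finite_subset by (auto simp: ksubsets_def)
          then have "D \<noteq> C - {x}" if "x \<in> C" for x
            using that False C card_Suc_Diff1[of C x] by (auto simp: ksubsets_def)
          then have "{x \<in> C. D = C - {x}} = {}" by blast
          then show ?thesis by (simp only: card.empty)
        qed
        then show ?thesis unfolding dmap_sum_over[OF X] by simp
      qed
    qed
  qed
  then show ?thesis unfolding Specht_def by auto
qed

lemma Specht_sum_insert:
  "finite X \<Longrightarrow> f \<in> Specht k X \<Longrightarrow> D \<subseteq> X \<Longrightarrow> card D + 1 = k \<Longrightarrow> (\<Sum>x\<in>X - D. f (insert x D)) = 0"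
  by (simp add: Specht_iff)

lemma Specht_support: "f \<in> Specht k X \<Longrightarrow> C \<notin> ksubsets k X \<Longrightarrow> f C = 0"
  by (simp add: Specht_def)

lemma subspace_Specht: "finite X \<Longrightarrow> cfun.subspace (Specht k X)"
  unfolding cfun.subspace_def
  by (auto simp: Specht_iff sum.distrib sum_distrib_left[symmetric])

text \<open>
  If \<open>C\<close> has a point \<open>y\<close> outside of \<open>S\<close>, then the defining equation at \<open>C - {y}\<close> expresses a positive
  multiple of \<open>f C\<close> through values of \<open>f\<close> at sets that meet \<open>S\<close> in one more point. So everything is
  determined by the values at the subsets of \<open>S\<close>. This is what makes spaces of invariant vectors
  at most one-dimensional, and zero if \<open>S\<close> has fewer than \<open>k\<close> points.
\<close>

lemma Specht_invariant_zero:
  assumes X: "finite X" and S: "S \<subseteq> X" and f: "f \<in> Specht k X"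
    and dep: "\<And>C C'. C \<in> ksubsets k X \<Longrightarrow> C' \<in> ksubsets k X \<Longrightarrow> card (C \<inter> S) = card (C' \<inter> S) \<Longrightarrow> f C = f C'"
    and top: "\<And>C. C \<in> ksubsets k X \<Longrightarrow> C \<subseteq> S \<Longrightarrow> f C = 0"
  shows "f = 0"
proof
  fix C
  have finS: "finite S" using S X finite_subset by blast
  have "f C = 0" if "C \<in> ksubsets k X" using that
  proof (induction "card S - card (C \<inter> S)" arbitrary: C rule: less_induct)
    case less
    have C: "C \<subseteq> X" "card C = k" "finite C" using less.prems X finite_subset by (auto simp: ksubsets_def)
    show ?case
    proof (cases "C \<subseteq> S")
      case True then show ?thesis using top less.prems by blast
    next
      case False
      then obtain y where y: "y \<in> C" "y \<notin> S" by blast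
      define D where "D = C - {y}"
      have D: "D \<subseteq> X" "finite D" "D \<inter> S = C \<inter> S" using C y by (auto simp: D_def)
      have cD: "card D + 1 = k" using card_Suc_Diff1[OF C(3) y(1)] C(2) by (simp add: D_def)
      have z: "f (insert x D) = 0" if x: "x \<in> S - D" for x
      proof (rule less.hyps)
        have "insert x D \<inter> S = insert x (C \<inter> S)" "x \<notin> C \<inter> S" using D(3) x y unfolding D_def by auto
        then have "card (insert x D \<inter> S) = Suc (card (C \<inter> S))" using C(3) by simp
        moreover have "card (insert x D \<inter> S) \<le> card S" using finS by (intro card_mono) auto
        ultimately show "card S - card (insert x D \<inter> S) < card S - card (C \<inter> S)" by auto
        show "insert x D \<in> ksubsets k X" using D cD x S by (auto simp: ksubsets_def)
      qed
      have e: "f (insert x D) = f C" if x: "x \<in> X - D - S" for x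
      proof (rule dep[OF _ less.prems])
        show "insert x D \<in> ksubsets k X" using D cD x by (auto simp: ksubsets_def)
        have "insert x D \<inter> S = C \<inter> S" using D(3) x by auto
        then show "card (insert x D \<inter> S) = card (C \<inter> S)" by simp
      qed
      have "0 = (\<Sum>x\<in>X - D. f (insert x D))" using Specht_sum_insert[OF X f D(1) cD] by simp
      also have "X - D = (S - D) \<union> (X - D - S)" using S by auto
      also have "(\<Sum>x\<in>(S - D) \<union> (X - D - S). f (insert x D)) = (\<Sum>x\<in>S - D. f (insert x D)) + (\<Sum>x\<in>X - D - S. f (insert x D))"
        using X finS by (intro sum.union_disjoint) auto
      also have "\<dots> = of_nat (card (X - D - S)) * f C" by (simp add: z e)
      finally have "of_nat (card (X - D - S)) * f C = 0" by simp
      moreover have "y \<in> X - D - S" using y C by (auto simp: D_def)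
      then have "card (X - D - S) \<noteq> 0" using X by auto
      ultimately show ?thesis by simp
    qed
  qed
  then show "f C = 0 C" using Specht_support[OF f] by (cases "C \<in> ksubsets k X") auto
qed

subsection \<open>The spherical vectors\<close>

text \<open>
  The solution of \<open>(k - s) * kap n k (s + 1) + (n - 2 * k + s + 1) * kap n k s = 0\<close>, which is the
  defining equation of the Specht module for functions of \<open>s = card (C \<inter> C')\<close>.
\<close>

definition kap :: "nat \<Rightarrow> nat \<Rightarrow> nat \<Rightarrow> real" where
  "kap n k s = (-1) ^ s * fact (k - s) * fact (n - 2 * k + s)"

definition spherical :: "nat \<Rightarrow> 'x set \<Rightarrow> 'x set \<Rightarrow> 'x set \<Rightarrow> complex" where
  "spherical k X C = (\<lambda>C'. if C' \<in> ksubsets k X then of_real (kap (card X) k (card (C \<inter> C'))) else 0)"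

lemma kap_nonzero: "kap n k s \<noteq> 0"
  by (simp add: kap_def)

lemma spherical_in_Specht:
  assumes X: "finite X" and C: "C \<in> ksubsets k X" and k: "2 * k \<le> card X"
  shows "spherical k X C \<in> Specht k X"
  unfolding Specht_iff[OF X]
proof (intro conjI allI impI)
  show "C' \<notin> ksubsets k X \<Longrightarrow> spherical k X C C' = 0" for C' by (simp add: spherical_def)
  fix D assume D: "D \<subseteq> X \<and> card D + 1 = k"
  let ?n = "card X" and ?s = "card (C \<inter> D)"
  have C': "C \<subseteq> X" "card C = k" "finite C" using C X finite_subset by (auto simp: ksubsets_def)
  have finD: "finite D" using D X finite_subset by blast
  have s: "?s < k" using D card_mono[OF finD, of "C \<inter> D"] by auto
  have cCD: "card (C - D) = k - ?s" using C' by (simp add: card_Diff_subset_Int)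
  have cR: "card (X - D - C) = ?n - 2 * k + ?s + 1"
  proof -
    have "X - D = (C - D) \<union> (X - D - C)" "(C - D) \<inter> (X - D - C) = {}" using C' by auto
    then have "card (X - D) = card (C - D) + card (X - D - C)" using X C'(3) by (metis card_Un_disjoint finite_Diff)
    moreover have "card (X - D) = ?n - (k - 1)"
    proof -
      have "card D = k - 1" using D by auto
      then show ?thesis using D finD by (simp add: card_Diff_subset)
    qed
    ultimately show ?thesis using cCD s k by linarith
  qed
  have mem: "insert x D \<in> ksubsets k X" if "x \<in> X - D" for x using that D finD by (auto simp: ksubsets_def)
  have "(\<Sum>x\<in>X - D. spherical k X C (insert x D)) = (\<Sum>x\<in>X - D. complex_of_real (kap ?n k (card (C \<inter> insert x D))))"
    by (intro sum.cong refl) (simp add: spherical_def mem)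
  also have "\<dots> = (\<Sum>x\<in>C - D. complex_of_real (kap ?n k (card (C \<inter> insert x D)))) + (\<Sum>x\<in>X - D - C. complex_of_real (kap ?n k (card (C \<inter> insert x D))))"
  proof -
    have "X - D - (C - D) = X - D - C" by auto
    then show ?thesis using sum.subset_diff[of "C - D" "X - D"] C'(1) X by (metis Diff_mono add.commute finite_Diff order_refl)
  qed
  also have "(\<Sum>x\<in>C - D. complex_of_real (kap ?n k (card (C \<inter> insert x D)))) = (\<Sum>x\<in>C - D. complex_of_real (kap ?n k (Suc ?s)))"
  proof (intro sum.cong refl)
    fix x assume x: "x \<in> C - D"
    then have "C \<inter> insert x D = insert x (C \<inter> D)" "x \<notin> C \<inter> D" by auto
    then show "complex_of_real (kap ?n k (card (C \<inter> insert x D))) = complex_of_real (kap ?n k (Suc ?s))" using finD by simp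
  qed
  also have "(\<Sum>x\<in>X - D - C. complex_of_real (kap ?n k (card (C \<inter> insert x D)))) = (\<Sum>x\<in>X - D - C. complex_of_real (kap ?n k ?s))"
    by (intro sum.cong refl) auto
  also have "(\<Sum>x\<in>C - D. complex_of_real (kap ?n k (Suc ?s))) + (\<Sum>x\<in>X - D - C. complex_of_real (kap ?n k ?s)) =
     complex_of_real (real (k - ?s) * kap ?n k (Suc ?s) + real (?n - 2 * k + ?s + 1) * kap ?n k ?s)"
    by (simp only: sum_constant cCD cR) simp
  also have "real (k - ?s) * kap ?n k (Suc ?s) + real (?n - 2 * k + ?s + 1) * kap ?n k ?s = 0"
  proof -
    obtain e where e: "k - ?s = Suc e" using s by (metis Suc_diff_Suc)
    then have e': "k - Suc ?s = e" by auto
    show ?thesis unfolding kap_def e e' by (simp add: algebra_simps)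
  qed
  finally show "(\<Sum>x\<in>X - D. spherical k X C (insert x D)) = 0" by simp
qed

lemma spherical_symmetric:
  "C \<in> ksubsets k X \<Longrightarrow> C' \<in> ksubsets k X \<Longrightarrow> spherical k X C C' = spherical k X C' C"
  by (simp add: spherical_def Int_commute)

lemma sum_spherical_insert:
  assumes X: "finite X" and k: "2 * k \<le> card X" and D: "D \<subseteq> X" "card D + 1 = k"
  shows "(\<Sum>x\<in>X - D. spherical k X (insert x D)) = 0"
proof
  fix C
  show "(\<Sum>x\<in>X - D. spherical k X (insert x D)) C = 0 C"
  proof (cases "C \<in> ksubsets k X")
    case True
    have finD: "finite D" using D X finite_subset by blast
    have "(\<Sum>x\<in>X - D. spherical k X (insert x D)) C = (\<Sum>x\<in>X - D. spherical k X C (insert x D))"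
      unfolding sum_functions_apply
      by (intro sum.cong refl spherical_symmetric True) (use D finD in \<open>auto simp: ksubsets_def\<close>)
    also have "\<dots> = 0" by (rule Specht_sum_insert[OF X spherical_in_Specht[OF X True k] D])
    finally show ?thesis by simp
  qed (simp add: sum_functions_apply spherical_def)
qed

lemma spherical_permute:
  assumes "\<sigma> permutes X"
  shows "act_subsets \<sigma> (spherical k X C) = spherical k X (\<sigma> ` C)"
proof
  fix C'
  have inj: "inj \<sigma>" and inj': "inj (inv \<sigma>)" using permutes_inj[OF assms] permutes_inj[OF permutes_inv[OF assms]] by auto
  have "\<sigma> ` (C \<inter> inv \<sigma> ` C') = \<sigma> ` C \<inter> C'"
    using permutes_inverses[OF assms] by (auto simp: image_Int[OF inj] image_image)
  then have "card (C \<inter> inv \<sigma> ` C') = card (\<sigma> ` C \<inter> C')"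
    using card_image[of \<sigma> "C \<inter> inv \<sigma> ` C'"] inj_on_subset[OF inj] by (metis subset_UNIV)
  moreover have "inv \<sigma> ` C' \<in> ksubsets k X \<longleftrightarrow> C' \<in> ksubsets k X"
  proof -
    have "card (inv \<sigma> ` C') = card C'" by (rule card_image) (meson inj' inj_on_subset subset_UNIV)
    moreover have "inv \<sigma> ` C' \<subseteq> X \<longleftrightarrow> C' \<subseteq> X" using permutes_in_image[OF permutes_inv[OF assms]] by auto
    ultimately show ?thesis by (simp add: ksubsets_def)
  qed
  ultimately show "act_subsets \<sigma> (spherical k X C) C' = spherical k X (\<sigma> ` C) C'"
    by (simp add: act_subsets_def spherical_def)
qed

subsection \<open>The spherical vectors span the Specht module\<close>

text \<open>
  The sum of the defining equations over all \<open>D\<close> with \<open>card (D \<inter> C') = s\<close>, sorted by the sets \<open>C\<close>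
  from which \<open>D\<close> arises by removing a point.
\<close>

lemma Specht_shell_recursion:
  assumes X: "finite X" and f: "f \<in> Specht k X" and C': "C' \<in> ksubsets k X" and s: "s < k"
  shows "of_nat (k - s) * (\<Sum>C\<in>{C \<in> ksubsets k X. card (C \<inter> C') = s}. f C) +
     of_nat (Suc s) * (\<Sum>C\<in>{C \<in> ksubsets k X. card (C \<inter> C') = Suc s}. f C) = 0"
proof -
  let ?D = "{D \<in> ksubsets (k - 1) X. card (D \<inter> C') = s}"
  have fC': "finite C'" using C' X finite_subset by (auto simp: ksubsets_def)
  have cnt: "(\<Sum>D\<in>?D. of_nat (card {x \<in> C. D = C - {x}})) = (if card (C \<inter> C') = s then of_nat (k - s) else if card (C \<inter> C') = Suc s then of_nat (Suc s) else (0 :: complex))"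
    if C: "C \<in> ksubsets k X" for C
  proof -
    have C1: "C \<subseteq> X" "card C = k" "finite C" using C X finite_subset by (auto simp: ksubsets_def)
    have mem: "C - {x} \<in> ?D \<longleftrightarrow> card ((C - {x}) \<inter> C') = s" if "x \<in> C" for x
      using C1 that by (auto simp: ksubsets_def)
    have c1: "card ((C - {x}) \<inter> C') = (if x \<in> C' then card (C \<inter> C') - 1 else card (C \<inter> C'))" if "x \<in> C" for x
    proof -
      have "(C - {x}) \<inter> C' = C \<inter> C' - {x}" by auto
      then show ?thesis using that C1 by auto
    qed
    have "(\<Sum>D\<in>?D. card {x \<in> C. D = C - {x}}) = card (\<Union>D\<in>?D. {x \<in> C. D = C - {x}})"
      using X C1 by (intro card_UN_disjoint[symmetric]) auto
    also have "(\<Union>D\<in>?D. {x \<in> C. D = C - {x}}) = {x \<in> C. C - {x} \<in> ?D}" by auto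
    also have "\<dots> = {x \<in> C. card ((C - {x}) \<inter> C') = s}" using mem by auto
    also have "card \<dots> = (if card (C \<inter> C') = s then k - s else if card (C \<inter> C') = Suc s then Suc s else 0)"
    proof -
      have "{x \<in> C. card ((C - {x}) \<inter> C') = s} = (if card (C \<inter> C') = s then C - C' else if card (C \<inter> C') = Suc s then C \<inter> C' else {})"
      proof -
        have pos: "card (C \<inter> C') \<noteq> 0" if "x \<in> C" "x \<in> C'" for x using that C1 by auto
        show ?thesis
        proof (intro set_eqI)
          fix x
          show "x \<in> {x \<in> C. card ((C - {x}) \<inter> C') = s} \<longleftrightarrow> x \<in> (if card (C \<inter> C') = s then C - C' else if card (C \<inter> C') = Suc s then C \<inter> C' else {})"
            using c1[of x] pos[of x] by (cases "x \<in> C"; cases "x \<in> C'") auto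
        qed
      qed
      moreover have "card (C - C') = k - card (C \<inter> C')" using C1 by (simp add: card_Diff_subset_Int)
      ultimately show ?thesis by simp
    qed
    finally have "(\<Sum>D\<in>?D. card {x \<in> C. D = C - {x}}) = (if card (C \<inter> C') = s then k - s else if card (C \<inter> C') = Suc s then Suc s else 0)" .
    then have "(of_nat (\<Sum>D\<in>?D. card {x \<in> C. D = C - {x}}) :: complex) = of_nat (if card (C \<inter> C') = s then k - s else if card (C \<inter> C') = Suc s then Suc s else 0)" by (rule arg_cong)
    then show ?thesis by (simp split: if_splits)
  qed
  have "0 = (\<Sum>D\<in>?D. dmap k X f D)" using f by (simp add: Specht_def)
  also have "\<dots> = (\<Sum>C\<in>ksubsets k X. f C * (\<Sum>D\<in>?D. of_nat (card {x \<in> C. D = C - {x}})))"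
    unfolding dmap_sum_over[OF X] by (subst sum.swap) (simp add: sum_distrib_left)
  also have "\<dots> = (\<Sum>C\<in>ksubsets k X. (if card (C \<inter> C') = s then of_nat (k - s) * f C else 0) + (if card (C \<inter> C') = Suc s then of_nat (Suc s) * f C else 0))"
    by (rule sum.cong[OF refl], subst cnt, assumption) simp
  also have "\<dots> = of_nat (k - s) * (\<Sum>C\<in>{C \<in> ksubsets k X. card (C \<inter> C') = s}. f C) +
     of_nat (Suc s) * (\<Sum>C\<in>{C \<in> ksubsets k X. card (C \<inter> C') = Suc s}. f C)"
    using X by (simp only: sum.distrib sum_distrib_left sum.inter_filter[symmetric] finite_ksubsets)
  finally show ?thesis by simp
qed

lemma Specht_shell:
  assumes X: "finite X" and f: "f \<in> Specht k X" and C': "C' \<in> ksubsets k X" and s: "s \<le> k"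
  shows "(\<Sum>C\<in>{C \<in> ksubsets k X. card (C \<inter> C') = s}. f C) = (-1) ^ (k - s) * of_nat (k choose s) * f C'"
  using s
proof (induction "k - s" arbitrary: s)
  case 0
  then have "s = k" by simp
  have "{C \<in> ksubsets k X. card (C \<inter> C') = k} = {C'}"
  proof -
    have "C = C'" if "C \<in> ksubsets k X" "card (C \<inter> C') = k" for C
    proof -
      have fin: "finite C" "finite C'" "card C = k" "card C' = k" using that C' X finite_subset by (auto simp: ksubsets_def)
      have "C \<inter> C' = C" by (rule card_subset_eq) (use fin that(2) in auto)
      moreover have "C \<inter> C' = C'" by (rule card_subset_eq) (use fin that(2) in auto)
      ultimately show ?thesis by simp
    qed
    moreover have "card (C' \<inter> C') = k" using C' by (simp add: ksubsets_def)
    ultimately show ?thesis using C' by auto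
  qed
  then show ?case using \<open>s = k\<close> by simp
next
  case (Suc d)
  then have s: "s < k" and d: "d = k - Suc s" by auto
  let ?M = "\<lambda>s. \<Sum>C\<in>{C \<in> ksubsets k X. card (C \<inter> C') = s}. f C"
  have IH: "?M (Suc s) = (-1) ^ (k - Suc s) * of_nat (k choose Suc s) * f C'" using Suc.hyps(1)[OF d] s by simp
  have b: "of_nat (Suc s) * of_nat (k choose Suc s) = (of_nat (k - s) * of_nat (k choose s) :: complex)"
  proof -
    have "Suc s * (k choose Suc s) = (k - s) * (k choose s)" 
      using binomial_absorb_comp[of k s] binomial_absorption[of s k] by (cases k) (auto simp: Suc_times_binomial_eq)
    then show ?thesis by (metis of_nat_mult)
  qed
  have "of_nat (k - s) * ?M s = - (of_nat (Suc s) * ?M (Suc s))"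
    using Specht_shell_recursion[OF X f C' s] by (simp only: eq_neg_iff_add_eq_0)
  also have "\<dots> = - ((of_nat (Suc s) * of_nat (k choose Suc s)) * ((-1) ^ (k - Suc s) * f C'))" unfolding IH by (simp only: mult_ac)
  also have "\<dots> = of_nat (k - s) * ((-1) ^ (k - s) * of_nat (k choose s) * f C')"
  proof -
    have "k - s = Suc (k - Suc s)" using s by simp
    then have "(-1) ^ (k - s) = - ((-1) ^ (k - Suc s) :: complex)" by simp
    then show ?thesis unfolding b by simp
  qed
  finally show ?case using s by simp
qed

definition kap_total :: "nat \<Rightarrow> nat \<Rightarrow> real" where
  "kap_total n k = (\<Sum>s\<le>k. kap n k s * ((-1) ^ (k - s) * real (k choose s)))"

text \<open>
  The signs of \<open>kap\<close> cancel those of the alternating binomial coefficients.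
\<close>

lemma kap_total_nonzero: "kap_total n k \<noteq> 0"
proof -
  have "kap_total n k = (-1) ^ k * (\<Sum>s\<le>k. fact (k - s) * fact (n - 2 * k + s) * real (k choose s))"
    unfolding kap_total_def sum_distrib_left
  proof (intro sum.cong refl)
    fix s assume "s \<in> {..k}"
    then have "(-1) ^ k = ((-1) ^ s * (-1) ^ (k - s) :: real)" by (simp flip: power_add)
    then show "kap n k s * ((-1) ^ (k - s) * real (k choose s)) = (-1) ^ k * (fact (k - s) * fact (n - 2 * k + s) * real (k choose s))"
      unfolding kap_def by simp
  qed
  moreover have "(\<Sum>s\<le>k. fact (k - s) * fact (n - 2 * k + s) * real (k choose s)) > 0"
    by (intro sum_pos) auto
  ultimately show ?thesis by simp
qed

text \<open>
  Convolution with the spherical function is a nonzero multiple of the identity on the Specht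
  module. This makes the spherical vectors span it and gives isomorphisms onto its copies.
\<close>

lemma Specht_convolution:
  assumes X: "finite X" and f: "f \<in> Specht k X" and C': "C' \<in> ksubsets k X"
  shows "(\<Sum>C\<in>ksubsets k X. f C * of_real (kap (card X) k (card (C \<inter> C')))) = of_real (kap_total (card X) k) * f C'"
proof -
  have le: "card (C \<inter> C') \<le> k" if "C \<in> ksubsets k X" for C
    using that X by (auto simp: ksubsets_def) (metis card_mono finite_subset Int_lower1)
  have "(\<Sum>C\<in>ksubsets k X. f C * of_real (kap (card X) k (card (C \<inter> C')))) =
    (\<Sum>s\<le>k. \<Sum>C\<in>{C \<in> ksubsets k X. card (C \<inter> C') = s}. f C * of_real (kap (card X) k (card (C \<inter> C'))))"
    using X le by (intro sum.group[symmetric]) auto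
  also have "\<dots> = (\<Sum>s\<le>k. of_real (kap (card X) k s) * (\<Sum>C\<in>{C \<in> ksubsets k X. card (C \<inter> C') = s}. f C))"
    unfolding sum_distrib_left by (intro sum.cong refl) auto
  also have "\<dots> = (\<Sum>s\<le>k. of_real (kap (card X) k s) * ((-1) ^ (k - s) * of_nat (k choose s) * f C'))"
    by (intro sum.cong refl) (simp add: Specht_shell[OF X f C'])
  also have "\<dots> = of_real (kap_total (card X) k) * f C'"
    unfolding kap_total_def by (simp add: sum_distrib_left mult_ac)
  finally show ?thesis .
qed

lemma Specht_expand:
  assumes X: "finite X" and f: "f \<in> Specht k X"
  shows "f = (\<Sum>C\<in>ksubsets k X. cscale (f C / of_real (kap_total (card X) k)) (spherical k X C))"
proof
  fix C'
  show "f C' = (\<Sum>C\<in>ksubsets k X. cscale (f C / of_real (kap_total (card X) k)) (spherical k X C)) C'"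
  proof (cases "C' \<in> ksubsets k X")
    case True
    have "(\<Sum>C\<in>ksubsets k X. cscale (f C / of_real (kap_total (card X) k)) (spherical k X C)) C' =
      (\<Sum>C\<in>ksubsets k X. f C * of_real (kap (card X) k (card (C \<inter> C')))) / of_real (kap_total (card X) k)"
      unfolding sum_functions_apply sum_divide_distrib using True by (intro sum.cong refl) (simp add: spherical_def)
    then show ?thesis unfolding Specht_convolution[OF X f True] using kap_total_nonzero by simp
  next
    case False
    then show ?thesis using Specht_support[OF f False] by (simp add: sum_functions_apply spherical_def)
  qed
qed

lemma Specht_span:
  assumes X: "finite X" and k: "2 * k \<le> card X"
  shows "Specht k X = cfun.span (spherical k X ` ksubsets k X)"
proof
  show "Specht k X \<subseteq> cfun.span (spherical k X ` ksubsets k X)"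
  proof
    fix f assume f: "f \<in> Specht k X"
    show "f \<in> cfun.span (spherical k X ` ksubsets k X)"
      by (subst Specht_expand[OF X f]) (intro cfun.span_sum cfun.span_scale cfun.span_base, auto)
  qed
  show "cfun.span (spherical k X ` ksubsets k X) \<subseteq> Specht k X"
    by (rule cfun.span_minimal[OF _ subspace_Specht[OF X]]) (auto intro: spherical_in_Specht[OF X _ k])
qed

section \<open>Equivariant families and the subspaces attached to a tree\<close>

text \<open>
  What is common to the images of the spherical vectors under an equivariant map and to the
  functions \<open>\<Psi>\<close> attached to \<open>C\<close>; both families have to be compared.
\<close>

definition Specht_family :: "nat \<Rightarrow> 'x set \<Rightarrow> ('x set \<Rightarrow> 'x set list \<Rightarrow> complex) \<Rightarrow> bool" where
  "Specht_family k X u \<longleftrightarrow>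
     (\<forall>D. D \<subseteq> X \<and> card D + 1 = k \<longrightarrow> (\<Sum>x\<in>X - D. u (insert x D)) = 0) \<and>
     (\<forall>\<sigma> C. \<sigma> permutes X \<longrightarrow> C \<in> ksubsets k X \<longrightarrow> act_tuples \<sigma> (u C) = u (\<sigma> ` C))"

lemma
  assumes "Specht_family k X u"
  shows Specht_family_sum: "D \<subseteq> X \<Longrightarrow> card D + 1 = k \<Longrightarrow> (\<Sum>x\<in>X - D. u (insert x D)) = 0"
    and Specht_family_permute: "\<sigma> permutes X \<Longrightarrow> C \<in> ksubsets k X \<Longrightarrow> act_tuples \<sigma> (u C) = u (\<sigma> ` C)"
  using assms by (auto simp: Specht_family_def)

text \<open>
  As a function of \<open>C\<close>, the value at a point \<open>z\<close> belongs to the Specht module and depends on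
  \<open>card (C \<inter> S)\<close> only, which brings \<open>Specht_invariant_zero\<close> to bear.
\<close>

definition evaluation :: "nat list \<Rightarrow> nat \<Rightarrow> 'x set \<Rightarrow> ('x set \<Rightarrow> 'x set list \<Rightarrow> complex) \<Rightarrow> 'x set \<Rightarrow>
    (complex \<times> complex) list \<Rightarrow> 'x set \<Rightarrow> complex" where
  "evaluation a k X u S z = (\<lambda>C. if C \<in> ksubsets k X then XS a X S (u C) z else 0)"

lemma evaluation_Specht:
  assumes X: "finite X" and u: "Specht_family k X u"
  shows "evaluation a k X u S z \<in> Specht k X"
  unfolding Specht_iff[OF X]
proof (intro conjI allI impI)
  show "C \<notin> ksubsets k X \<Longrightarrow> evaluation a k X u S z C = 0" for C by (simp add: evaluation_def)
  fix D assume D: "D \<subseteq> X \<and> card D + 1 = k"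
  have finD: "finite D" using D X finite_subset by blast
  have "insert x D \<in> ksubsets k X" if "x \<in> X - D" for x using that D finD by (auto simp: ksubsets_def)
  then have "(\<Sum>x\<in>X - D. evaluation a k X u S z (insert x D)) = XS a X S (\<Sum>x\<in>X - D. u (insert x D)) z"
    unfolding linear_cscale_sum[OF linear_XS] sum_functions_apply by (intro sum.cong refl) (simp add: evaluation_def)
  also have "\<dots> = 0" using Specht_family_sum[OF u] D by (simp add: linear_cscale_zero[OF linear_XS])
  finally show "(\<Sum>x\<in>X - D. evaluation a k X u S z (insert x D)) = 0" .
qed

lemma evaluation_invariant:
  assumes X: "finite X" and u: "Specht_family k X u" and S: "S \<subseteq> X"
    and C: "C \<in> ksubsets k X" "C' \<in> ksubsets k X" and card: "card (C \<inter> S) = card (C' \<inter> S)"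
  shows "evaluation a k X u S z C = evaluation a k X u S z C'"
proof -
  have "C \<subseteq> X" "C' \<subseteq> X" "card C = card C'" using C by (auto simp: ksubsets_def)
  then obtain \<sigma> where \<sigma>: "\<sigma> permutes X" "\<sigma> ` S = S" "\<sigma> ` C = C'"
    using exists_permutation_pair[OF X S _ S, of C C'] card by metis
  have "XS a X S (u C) = XS a X (\<sigma> ` S) (act_tuples \<sigma> (u C))" by (rule XS_permute[OF \<sigma>(1), symmetric])
  also have "\<dots> = XS a X S (u C')" unfolding Specht_family_permute[OF u \<sigma>(1) C(1)] \<sigma>(2,3) ..
  finally show ?thesis using C by (simp add: evaluation_def)
qed

text \<open>
  If \<open>S\<close> has fewer than \<open>k\<close> points then no \<open>C\<close> lies in \<open>S\<close>; if its complement has fewer than \<open>k\<close>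
  points, the complement takes the place of \<open>S\<close>.
\<close>

lemma XS_family_zero:
  assumes X: "finite X" and u: "Specht_family k X u" and S: "S \<subseteq> X" and C: "C \<in> ksubsets k X"
    and card: "card S < k \<or> card X < card S + k"
  shows "XS a X S (u C) = 0"
proof
  fix z
  have finS: "finite S" using S X finite_subset by blast
  have "evaluation a k X u S z = 0"
  proof (cases "card S < k")
    case True
    show ?thesis
    proof (rule Specht_invariant_zero[OF X S evaluation_Specht[OF X u]])
      show "evaluation a k X u S z C = 0" if "C \<in> ksubsets k X" "C \<subseteq> S" for C
        using that True card_mono[OF finS that(2)] by (simp add: ksubsets_def)
    qed (rule evaluation_invariant[OF X u S])
  next
    case False
    then have c: "card (X - S) < k" using card S finS card_mono[OF X S] by (simp add: card_Diff_subset)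
    show ?thesis
    proof (rule Specht_invariant_zero[OF X _ evaluation_Specht[OF X u]])
      show "evaluation a k X u S z C = 0" if "C \<in> ksubsets k X" "C \<subseteq> X - S" for C
        using that c card_mono[OF finite_Diff[OF X] that(2)] by (simp add: ksubsets_def)
      fix C C' assume C: "C \<in> ksubsets k X" "C' \<in> ksubsets k X" "card (C \<inter> (X - S)) = card (C' \<inter> (X - S))"
      have "card (A \<inter> S) = k - card (A \<inter> (X - S))" if "A \<in> ksubsets k X" for A
      proof -
        have A: "A \<subseteq> X" "card A = k" "finite A" using that X finite_subset by (auto simp: ksubsets_def)
        have "A = (A \<inter> S) \<union> (A \<inter> (X - S))" "(A \<inter> S) \<inter> (A \<inter> (X - S)) = {}" using A(1) by auto
        then have "card A = card (A \<inter> S) + card (A \<inter> (X - S))" using A(3) by (metis card_Un_disjoint finite_Int)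
        then show ?thesis using A(2) by simp
      qed
      then show "evaluation a k X u S z C = evaluation a k X u S z C'"
        using C by (intro evaluation_invariant[OF X u S]) auto
    qed auto
  qed
  then show "XS a X S (u C) z = 0 z" using C by (simp add: evaluation_def fun_eq_iff) metis
qed

text \<open>
  For any two points the evaluations are proportional, with the factor given by their values at
  \<open>C0\<close>; hence the ratio of the values at \<open>C\<close> and \<open>C0\<close> does not depend on the point.
\<close>

lemma XS_family_multiple:
  assumes X: "finite X" and u: "Specht_family k X u" and S: "S \<subseteq> X" and C: "C \<in> ksubsets k X"
    and C0: "C0 \<in> ksubsets k X" "C0 \<subseteq> S" and nz: "XS a X S (u C0) \<noteq> 0"
  obtains r where "XS a X S (u C) = cscale r (XS a X S (u C0))"
proof -
  let ?h = "evaluation a k X u S"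
  from nz obtain z0 where z0: "XS a X S (u C0) z0 \<noteq> 0" by (auto simp: fun_eq_iff)
  have C0S: "C0 \<inter> S = C0" using C0 by auto
  have zero: "?h z - cscale (?h z C0 / ?h z0 C0) (?h z0) = 0" for z
  proof (rule Specht_invariant_zero[OF X S])
    show "?h z - cscale (?h z C0 / ?h z0 C0) (?h z0) \<in> Specht k X"
      by (intro cfun.subspace_diff subspace_Specht[OF X] cfun.subspace_scale evaluation_Specht[OF X u])
    show "(?h z - cscale (?h z C0 / ?h z0 C0) (?h z0)) C = (?h z - cscale (?h z C0 / ?h z0 C0) (?h z0)) C'"
      if "C \<in> ksubsets k X" "C' \<in> ksubsets k X" "card (C \<inter> S) = card (C' \<inter> S)" for C C'
      using evaluation_invariant[OF X u S that] by simp
    show "(?h z - cscale (?h z C0 / ?h z0 C0) (?h z0)) C = 0" if "C \<in> ksubsets k X" "C \<subseteq> S" for C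
    proof -
      have "C \<inter> S = C" using that by auto
      then have "?h z C = ?h z C0" for z using that(1) C0S C0(1) by (intro evaluation_invariant[OF X u S]) (auto simp: ksubsets_def)
      moreover have "?h z0 C0 \<noteq> 0" using z0 C0 by (simp add: evaluation_def)
      ultimately show ?thesis by simp
    qed
  qed
  have E: "?h z C = ?h z0 C / ?h z0 C0 * ?h z C0" for z
    using fun_cong[OF zero[of z], of C] by simp
  have h: "?h z A = XS a X S (u A) z" if "A \<in> ksubsets k X" for z A using that by (simp add: evaluation_def)
  have "XS a X S (u C) = cscale (?h z0 C / ?h z0 C0) (XS a X S (u C0))"
  proof
    fix z
    have "XS a X S (u C) z = ?h z C" by (rule h[OF C, symmetric])
    also have "\<dots> = ?h z0 C / ?h z0 C0 * ?h z C0" by (rule E)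
    also have "?h z C0 = XS a X S (u C0) z" by (rule h[OF C0(1)])
    finally show "XS a X S (u C) z = cscale (?h z0 C / ?h z0 C0) (XS a X S (u C0)) z" by (simp only: cscale_apply)
  qed
  then show ?thesis by (rule that)
qed

lemma XS_family_spherical:
  assumes X: "finite X" and u: "Specht_family k X u" and k: "2 * k \<le> card X"
    and C: "C \<in> ksubsets k X" and S: "S \<in> ksubsets k X"
  shows "XS a X S (u C) = cscale (of_real (kap (card X) k (card (C \<inter> S)) / kap (card X) k k)) (XS a X S (u S))"
proof
  fix z
  let ?h = "evaluation a k X u S z" and ?c = "complex_of_real (kap (card X) k k)"
  have S': "S \<subseteq> X" "card S = k" "finite S" using S X finite_subset by (auto simp: ksubsets_def)
  have "?h - cscale (?h S / ?c) (spherical k X S) = 0"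
  proof (rule Specht_invariant_zero[OF X S'(1)])
    show "?h - cscale (?h S / ?c) (spherical k X S) \<in> Specht k X"
      by (intro cfun.subspace_diff subspace_Specht[OF X] cfun.subspace_scale evaluation_Specht[OF X u] spherical_in_Specht[OF X S k])
    show "(?h - cscale (?h S / ?c) (spherical k X S)) C = (?h - cscale (?h S / ?c) (spherical k X S)) C'"
      if "C \<in> ksubsets k X" "C' \<in> ksubsets k X" "card (C \<inter> S) = card (C' \<inter> S)" for C C'
      using evaluation_invariant[OF X u S'(1) that] that by (simp add: spherical_def Int_commute)
    show "(?h - cscale (?h S / ?c) (spherical k X S)) C = 0" if C: "C \<in> ksubsets k X" "C \<subseteq> S" for C
    proof -
      have "C = S" using C S' card_subset_eq[of S C] by (simp add: ksubsets_def)
      then show ?thesis using S S' kap_nonzero by (simp add: spherical_def)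
    qed
  qed
  from fun_cong[OF this, of C] have "?h C = ?h S / ?c * spherical k X S C" by simp
  then show "XS a X S (u C) z = cscale (of_real (kap (card X) k (card (C \<inter> S)) / kap (card X) k k)) (XS a X S (u S)) z"
    using C S by (simp add: evaluation_def spherical_def Int_commute)
qed

subsection \<open>The functions \<open>\<Psi>\<close> form such a family\<close>

lemma exists_upper_unipotent:
  obtains g :: "complex^2^2" where "g$1$1 = 1" "g$1$2 = a" "g$2$1 = 0" "g$2$2 = 1" "det g = 1"
  by (rule that[of "\<chi> p q. if p = q then 1 else if p = 1 then a else 0"]) (auto simp: det_2)

lemma exists_lower_unipotent:
  obtains g :: "complex^2^2" where "g$1$1 = 1" "g$1$2 = 0" "g$2$1 = a" "g$2$2 = 1" "det g = 1"
  by (rule that[of "\<chi> p q. if p = q then 1 else if p = 2 then a else 0"]) (auto simp: det_2)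

lemma mon1_0_eq_pw: "mon1 d 0 = pw d 0 1"
  by (rule ext_length1) (auto simp: monomial_wrong_length pw_def)

lemma sum_over_subsets_by_card:
  fixes f :: "'a set \<Rightarrow> complex"
  assumes "finite \<A>" "\<And>S'. S' \<in> \<A> \<Longrightarrow> e S' \<le> n"
  shows "(\<Sum>S'\<in>\<A>. \<tau> ^ e S' * f S') = (\<Sum>j\<le>n. (\<Sum>S'\<in>{S' \<in> \<A>. e S' = j}. f S') * \<tau> ^ j)"
proof -
  have "(\<Sum>S'\<in>\<A>. \<tau> ^ e S' * f S') = (\<Sum>j\<le>n. \<Sum>S'\<in>{S' \<in> \<A>. e S' = j}. \<tau> ^ e S' * f S')"
    using assms by (intro sum.group[symmetric]) auto
  also have "\<dots> = (\<Sum>j\<le>n. (\<Sum>S'\<in>{S' \<in> \<A>. e S' = j}. f S') * \<tau> ^ j)"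
    unfolding sum_distrib_right by (intro sum.cong refl) auto
  finally show ?thesis .
qed

definition Psi_span :: "ltree \<Rightarrow> 'x set \<Rightarrow> ('x set list \<Rightarrow> complex) set" where
  "Psi_span T X = cfun.span (PsiS T X ` ksubsets (label T) X)"

context
  fixes T :: ltree and X :: "'x set"
  assumes T: "rep_labeling T" and X: "finite X" and cX: "card X = weight T"
begin

abbreviation (input) "lab \<equiv> label T"
abbreviation (input) "XT \<equiv> XS (parts T) X"
abbreviation (input) "PT \<equiv> PsiS T X"
abbreviation (input) "bT p \<equiv> tree_emb T (mon1 (tdim T) p)"

lemma label_bound: "2 * lab \<le> card X"
  using rep_labeling_label_le[OF T] cX by simp

lemma sum_parts_card: "sum_list (parts T) = card X"
  using cX by simp

lemma bT_nonzero: "p \<le> tdim T \<Longrightarrow> bT p \<noteq> 0"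
  using independent_familyD[OF tree_emb_independent[OF T], of "\<lambda>i. if i = p then 1 else 0" p]
  by (auto simp: if_distrib[of "\<lambda>c. cscale c _"] cong: if_cong)

lemma XT_Psi_self:
  assumes "C \<in> ksubsets lab X"
  shows "XT C (PT C) = cscale (of_real (chi T lab)) (bT 0)"
proof -
  have "C \<subseteq> X" "card C = lab" using assms by (auto simp: ksubsets_def)
  then show ?thesis using XS_PsiS[OF T X cX, of C] label_bound cX by simp
qed

text \<open>Lowering: the vector \<open>bT 0\<close> of lowest degree is fixed by the unipotent matrices, and the
  coefficient of the parameter in the action on \<open>XT C (PT C)\<close> is the sum of the vectors below.\<close>

lemma XT_Psi_remove:
  assumes C: "C \<in> ksubsets lab X" and y: "y \<in> C"
  shows "XT (C - {y}) (PT C) = 0"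
proof
  fix z
  have C': "C \<subseteq> X" "card C = lab" "finite C" using C X finite_subset by (auto simp: ksubsets_def)
  let ?f = "\<lambda>S'. XT S' (PT C) z"
  let ?c = "\<lambda>j. (\<Sum>S'\<in>{S' \<in> Pow C. card (C - S') = j}. ?f S')"
  have "(\<Sum>j\<le>card C. (?c j - (if j = 0 then ?f C else 0)) * of_real \<tau> ^ j) = 0" for \<tau> :: real
  proof -
    obtain g :: "complex^2^2" where g: "g$1$1 = 1" "g$1$2 = 0" "g$2$1 = of_real \<tau>" "g$2$2 = 1" "det g = 1"
      by (rule exists_lower_unipotent)
    have "act_SU2 g (XT C (PT C)) = XT C (PT C)"
      unfolding XT_Psi_self[OF C] linear_cscale_scale[OF linear_act_SU2]
        mon1_0_eq_pw tree_emb_equivariant[OF T g(5) pw_in_V] act_SU2_pw g by simp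
    moreover have "act_SU2 g (XT C (PT C)) z = (\<Sum>S'\<in>Pow X. act_coeff g X C S' * ?f S')"
      unfolding act_XS[OF X sum_parts_card] by (simp add: sum_functions_apply)
    moreover have "(\<Sum>S'\<in>Pow X. act_coeff g X C S' * ?f S') = (\<Sum>S'\<in>Pow C. of_real \<tau> ^ card (C - S') * ?f S')"
      using X C'(1) by (intro sum.mono_neutral_cong_right) (auto simp: act_coeff_lower[OF X C'(1) _ g(1-4)])
    moreover have "\<dots> = (\<Sum>j\<le>card C. ?c j * of_real \<tau> ^ j)"
      using C'(3) by (intro sum_over_subsets_by_card) (auto intro!: card_mono)
    ultimately have "(\<Sum>j\<le>card C. ?c j * of_real \<tau> ^ j) = ?f C" by simp
    moreover have "(\<Sum>j\<le>card C. (if j = 0 then ?f C else 0) * complex_of_real \<tau> ^ j) = ?f C"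
      by (simp add: if_distrib[of "\<lambda>c. c * _"] cong: if_cong)
    ultimately show ?thesis by (simp add: left_diff_distrib sum_subtractf)
  qed
  moreover have "1 \<le> card C" using y C'(3) by (metis One_nat_def Suc_leI card_gt_0_iff empty_iff)
  ultimately have "?c 1 - (if (1 :: nat) = 0 then ?f C else 0) = 0" by (rule real_polynomial_zero)
  then have "?c 1 = 0" by simp
  moreover have "{S' \<in> Pow C. card (C - S') = 1} = (\<lambda>x. C - {x}) ` C"
  proof
    show "{S' \<in> Pow C. card (C - S') = 1} \<subseteq> (\<lambda>x. C - {x}) ` C"
    proof
      fix S' assume S': "S' \<in> {S' \<in> Pow C. card (C - S') = 1}"
      then obtain x where "C - S' = {x}" by (auto simp: card_1_singleton_iff)
      then have "S' = C - {x}" "x \<in> C" using S' by auto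
      then show "S' \<in> (\<lambda>x. C - {x}) ` C" by blast
    qed
    show "(\<lambda>x. C - {x}) ` C \<subseteq> {S' \<in> Pow C. card (C - S') = 1}"
    proof (rule image_subsetI)
      fix x assume "x \<in> C"
      then have "C - (C - {x}) = {x}" by auto
      then show "C - {x} \<in> {S' \<in> Pow C. card (C - S') = 1}" by auto
    qed
  qed
  moreover have "inj_on (\<lambda>x. C - {x}) C" by (auto simp: inj_on_def)
  ultimately have "(\<Sum>x\<in>C. ?f (C - {x})) = 0" by (simp add: sum.reindex)
  moreover have "?f (C - {x}) = ?f (C - {y})" if x: "x \<in> C" for x
  proof -
    have c1: "card (C - {x}) = card (C - {y})" using x y C'(3) by simp
    have "C \<inter> (C - {x}) = C - {x}" "C \<inter> (C - {y}) = C - {y}" by auto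
    then have c2: "card (C \<inter> (C - {x})) = card (C \<inter> (C - {y}))" using c1 by simp
    have sub: "C - {x} \<subseteq> X" "C - {y} \<subseteq> X" using C'(1) by auto
    obtain \<sigma> where \<sigma>: "\<sigma> permutes X" "\<sigma> ` (C - {x}) = C - {y}" "\<sigma> ` C = C"
      by (rule exists_permutation_pair[OF X sub(1) C'(1) sub(2) C'(1) c1 refl c2])
    have "XT (C - {x}) (PT C) = XT (\<sigma> ` (C - {x})) (act_tuples \<sigma> (PT C))" by (rule XS_permute[OF \<sigma>(1), symmetric])
    then show ?thesis unfolding PsiS_permute[OF \<sigma>(1)] \<sigma>(2,3) by simp
  qed
  ultimately have "of_nat (card C) * ?f (C - {y}) = 0" by simp
  moreover have "card C \<noteq> 0" using y C'(3) by auto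
  ultimately show "XT (C - {y}) (PT C) z = 0 z" by simp
qed

text \<open>
  The sum over \<open>x\<close> is invariant under the stabilizer of \<open>D\<close>, and \<open>XT D\<close> maps it to zero term by term
  because of \<open>XT_Psi_remove\<close>.
\<close>

lemma Psi_Specht_family: "Specht_family lab X PT"
  unfolding Specht_family_def
proof (intro conjI allI impI)
  show "act_tuples \<sigma> (PT C) = PT (\<sigma> ` C)" if "\<sigma> permutes X" for \<sigma> C by (rule PsiS_permute[OF that])
  fix D assume D: "D \<subseteq> X \<and> card D + 1 = lab"
  have finD: "finite D" using D X finite_subset by blast
  let ?v = "\<Sum>x\<in>X - D. PT (insert x D)"
  show "?v = 0"
  proof (rule XS_injective_on_invariants[OF X _ sum_parts_card])
    show "D \<subseteq> X" using D by simp
    show "?v \<in> M (parts T) X" by (simp add: M_def sum_functions_apply PsiS_def)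
    show "act_tuples \<sigma> ?v = ?v" if \<sigma>: "\<sigma> permutes X" "\<sigma> ` D = D" for \<sigma>
    proof -
      have "act_tuples \<sigma> ?v = (\<Sum>x\<in>X - D. act_tuples \<sigma> (PT (insert x D)))"
        by (simp add: fun_eq_iff act_tuples_def sum_functions_apply)
      also have "\<dots> = (\<Sum>x\<in>X - D. PT (insert (\<sigma> x) D))"
        by (intro sum.cong refl) (simp add: PsiS_permute[OF \<sigma>(1)] \<sigma>(2))
      also have "\<dots> = ?v"
      proof (rule sum.reindex_bij_betw[where h = \<sigma> and g = "\<lambda>x. PT (insert x D)"])
        have inj: "inj \<sigma>" by (rule permutes_inj[OF \<sigma>(1)])
        have "\<sigma> ` (X - D) = X - D" using image_set_diff[OF inj, of X D] permutes_image[OF \<sigma>(1)] \<sigma>(2) by simp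
        then show "bij_betw \<sigma> (X - D) (X - D)" using inj by (auto simp: bij_betw_def inj_on_def)
      qed
      finally show ?thesis .
    qed
    have "XT D (PT (insert x D)) = 0" if x: "x \<in> X - D" for x
    proof -
      have "insert x D \<in> ksubsets lab X" using x D finD by (auto simp: ksubsets_def)
      from XT_Psi_remove[OF this, of x] show ?thesis using x by simp
    qed
    then show "XT D ?v = 0" by (simp add: linear_cscale_sum[OF linear_XS])
  qed
qed

text \<open>Raising: all subsets \<open>S\<close> of the same size above \<open>C\<close> contribute equally to the action of the
  transposed unipotent matrices.\<close>

lemma XT_Psi_above:
  assumes C: "C \<in> ksubsets lab X" and S: "S \<subseteq> X" "C \<subseteq> S" "card S + lab \<le> weight T"
  obtains c where "c \<noteq> 0" "XT S (PT C) = cscale c (bT (card S - lab))"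
proof -
  have C': "C \<subseteq> X" "card C = lab" "finite C" using C X finite_subset by (auto simp: ksubsets_def)
  have finS: "finite S" using S X finite_subset by blast
  let ?A = "{S'. C \<subseteq> S' \<and> S' \<subseteq> X}" and ?d = "tdim T" and ?j = "card S - lab"
  have finA: "finite ?A" by (rule finite_subset[of _ "Pow X"]) (use X in auto)
  have lS: "lab \<le> card S" using card_mono[OF finS S(2)] C' by simp
  have jd: "?j \<le> ?d" using S(3) lS by (simp add: tdim_def)
  let ?N = "card {S' \<in> ?A. card (S' - C) = ?j}"
  have main: "of_nat ?N * XT S (PT C) z = of_real (chi T lab) * of_nat (?d choose ?j) * bT ?j z" for z
  proof -
    let ?f = "\<lambda>S'. XT S' (PT C) z"
    let ?c = "\<lambda>j. (\<Sum>S'\<in>{S' \<in> ?A. card (S' - C) = j}. ?f S')"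
    let ?e = "\<lambda>j. if j \<le> ?d then of_real (chi T lab) * of_nat (?d choose j) * bT j z else 0"
    have "(\<Sum>j\<le>card X. (?c j - ?e j) * of_real \<tau> ^ j) = 0" for \<tau> :: real
    proof -
      obtain g :: "complex^2^2" where g: "g$1$1 = 1" "g$1$2 = of_real \<tau>" "g$2$1 = 0" "g$2$2 = 1" "det g = 1"
        by (rule exists_upper_unipotent)
      have "act_SU2 g (XT C (PT C)) = cscale (of_real (chi T lab)) (tree_emb T (pw ?d (of_real \<tau>) 1))"
        unfolding XT_Psi_self[OF C] linear_cscale_scale[OF linear_act_SU2]
          mon1_0_eq_pw tree_emb_equivariant[OF T g(5) pw_in_V] act_SU2_pw g by simp
      then have "act_SU2 g (XT C (PT C)) z = (\<Sum>j\<le>?d. ?e j * of_real \<tau> ^ j)"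
        unfolding pw_expand linear_cscale_sum[OF linear_tree_emb[OF T]] linear_cscale_scale[OF linear_tree_emb[OF T]]
        by (simp add: sum_functions_apply sum_distrib_left mult_ac)
      also have "\<dots> = (\<Sum>j\<le>card X. ?e j * of_real \<tau> ^ j)"
        using cX by (intro sum.mono_neutral_left) (auto simp: tdim_def)
      finally have 1: "act_SU2 g (XT C (PT C)) z = (\<Sum>j\<le>card X. ?e j * of_real \<tau> ^ j)" .
      have "act_SU2 g (XT C (PT C)) z = (\<Sum>S'\<in>Pow X. act_coeff g X C S' * ?f S')"
        unfolding act_XS[OF X sum_parts_card] by (simp add: sum_functions_apply)
      also have "\<dots> = (\<Sum>S'\<in>?A. of_real \<tau> ^ card (S' - C) * ?f S')"
        using X C'(1) by (intro sum.mono_neutral_cong_right) (auto simp: act_coeff_raise[OF X C'(1) _ g(1-4)])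
      also have "\<dots> = (\<Sum>j\<le>card X. ?c j * of_real \<tau> ^ j)"
        using X finA by (intro sum_over_subsets_by_card) (auto intro!: card_mono)
      finally show ?thesis using 1 by (simp add: left_diff_distrib sum_subtractf)
    qed
    moreover have "?j \<le> card X" using card_mono[OF X S(1)] by simp
    ultimately have "?c ?j - ?e ?j = 0" by (rule real_polynomial_zero)
    then have cj: "?c ?j = of_real (chi T lab) * of_nat (?d choose ?j) * bT ?j z" using jd by simp
    have "?f S' = ?f S" if S': "S' \<in> {S' \<in> ?A. card (S' - C) = ?j}" for S'
    proof -
      have fS': "finite S'" "S' \<subseteq> X" "C \<subseteq> S'" using S' X finite_subset by auto
      have c1: "card S' = card S"
        using S' lS card_Diff_subset[OF C'(3) fS'(3)] card_mono[OF fS'(1,3)] C'(2) by (simp; arith)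
      have "C \<inter> S' = C" "C \<inter> S = C" using fS' S by auto
      then have c2: "card (C \<inter> S') = card (C \<inter> S)" by simp
      obtain \<sigma> where \<sigma>: "\<sigma> permutes X" "\<sigma> ` S' = S" "\<sigma> ` C = C"
        by (rule exists_permutation_pair[OF X fS'(2) C'(1) S(1) C'(1) c1 refl c2])
      have "XT S' (PT C) = XT (\<sigma> ` S') (act_tuples \<sigma> (PT C))" by (rule XS_permute[OF \<sigma>(1), symmetric])
      then show ?thesis unfolding PsiS_permute[OF \<sigma>(1)] \<sigma>(2,3) by simp
    qed
    then have "?c ?j = of_nat ?N * ?f S" by simp
    with cj show ?thesis by simp
  qed
  have N: "?N \<noteq> 0"
  proof -
    have "S \<in> {S' \<in> ?A. card (S' - C) = ?j}" using S C' by (auto simp: card_Diff_subset)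
    then have ne: "{S' \<in> ?A. card (S' - C) = ?j} \<noteq> {}" by (rule ex_in_conv[THEN iffD1, OF exI])
    have "finite {S' \<in> ?A. card (S' - C) = ?j}" by (rule finite_subset[OF _ finA]) (rule Collect_restrict)
    with ne show ?thesis by (simp only: card_eq_0_iff) simp
  qed
  let ?k = "of_real (chi T lab) * of_nat (?d choose ?j) / of_nat ?N :: complex"
  have "?k \<noteq> 0" using chi_pos[of T lab] jd N by auto
  moreover have "XT S (PT C) = cscale ?k (bT ?j)"
    using main N by (simp add: fun_eq_iff field_simps)
  ultimately show ?thesis by (rule that)
qed

text \<open>
  \<open>PT S\<close> and the sum of the \<open>PT C\<close> with \<open>C \<subseteq> S\<close> are both invariant under the stabilizer of \<open>S\<close>, and
  \<open>XT S\<close> maps both to nonzero multiples of the same vector.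
\<close>

lemma Psi_in_span:
  assumes S: "S \<subseteq> X" "lab \<le> card S" "card S + lab \<le> weight T"
  shows "PT S \<in> (Psi_span T X)"
proof -
  have finS: "finite S" using S X finite_subset by blast
  let ?K = "{C \<in> ksubsets lab X. C \<subseteq> S}" and ?j = "card S - lab"
  have finK: "finite ?K" using X by simp
  obtain C0 where "C0 \<subseteq> S" "card C0 = lab" by (rule obtain_subset_with_card_n[OF S(2)])
  then have C0: "C0 \<in> ?K" using S(1) by (auto simp: ksubsets_def)
  obtain c where c: "c \<noteq> 0" "XT S (PT C0) = cscale c (bT ?j)" using XT_Psi_above[of C0 S] C0 S by auto
  let ?w = "\<Sum>C\<in>?K. PT C"
  have same: "XT S (PT C) = XT S (PT C0)" if C: "C \<in> ?K" for C
  proof -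
    have CS: "C \<subseteq> X" "C0 \<subseteq> X" "card C = card C0" using C C0 by (simp_all add: ksubsets_def)
    have "C \<inter> S = C" "C0 \<inter> S = C0" using C C0 by auto
    then have c: "card (C \<inter> S) = card (C0 \<inter> S)" using CS(3) by simp
    obtain \<sigma> where \<sigma>: "\<sigma> permutes X" "\<sigma> ` S = S" "\<sigma> ` C = C0"
      by (rule exists_permutation_pair[OF X S(1) CS(1) S(1) CS(2) refl CS(3) c])
    have "XT S (PT C) = XT (\<sigma> ` S) (act_tuples \<sigma> (PT C))" by (rule XS_permute[OF \<sigma>(1), symmetric])
    then show ?thesis unfolding PsiS_permute[OF \<sigma>(1)] \<sigma>(2,3) by simp
  qed
  let ?N = "of_nat (card ?K) :: complex"
  have N: "?N \<noteq> 0" using C0 finK by auto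
  have Xw: "XT S ?w = cscale (?N * c) (bT ?j)"
    by (simp add: linear_cscale_sum[OF linear_XS] same c fun_eq_iff sum_functions_apply)
  let ?e = "of_real (chi T (card S)) / (?N * c)"
  have "PT S - cscale ?e ?w = 0"
  proof (rule XS_injective_on_invariants[OF X S(1) sum_parts_card])
    show "PT S - cscale ?e ?w \<in> M (parts T) X" by (simp add: M_def sum_functions_apply PsiS_def)
    have "XT S (PT S) = cscale (of_real (chi T (card S))) (bT ?j)" by (rule XS_PsiS[OF T X cX S])
    then show "XT S (PT S - cscale ?e ?w) = 0"
      using N c(1) by (simp add: linear_cscale_diff[OF linear_XS] linear_cscale_scale[OF linear_XS] Xw)
    show "act_tuples \<sigma> (PT S - cscale ?e ?w) = PT S - cscale ?e ?w" if \<sigma>: "\<sigma> permutes X" "\<sigma> ` S = S" for \<sigma>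
    proof -
      have "act_tuples \<sigma> ?w = (\<Sum>C\<in>?K. act_tuples \<sigma> (PT C))"
        by (simp add: fun_eq_iff act_tuples_def sum_functions_apply)
      also have "\<dots> = (\<Sum>C\<in>?K. PT (\<sigma> ` C))" by (intro sum.cong refl PsiS_permute[OF \<sigma>(1)])
      also have "\<dots> = ?w"
      proof (rule sum.reindex_bij_witness[of _ "(`) (inv \<sigma>)" "(`) \<sigma>"])
        have inj: "inj \<sigma>" and inj': "inj (inv \<sigma>)" using permutes_inj[OF \<sigma>(1)] permutes_inj[OF permutes_inv[OF \<sigma>(1)]] by auto
        have iS: "inv \<sigma> ` S = S" using \<sigma>(2) permutes_inverses[OF \<sigma>(1)] by (metis image_inv_f_f inj)
        fix C assume C: "C \<in> ?K"
        have cc: "card (\<sigma> ` C) = card C" "card (inv \<sigma> ` C) = card C"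
          by (rule card_image, meson inj inj' inj_on_subset subset_UNIV)+
        show "inv \<sigma> ` \<sigma> ` C = C" "\<sigma> ` inv \<sigma> ` C = C" using permutes_inverses[OF \<sigma>(1)] by (simp_all add: image_image)
        have "\<sigma> ` C \<subseteq> S" "inv \<sigma> ` C \<subseteq> S" using C \<sigma>(2) iS by blast+
        then show "\<sigma> ` C \<in> ?K" "inv \<sigma> ` C \<in> ?K" using C S(1) cc by (auto simp: ksubsets_def)
      qed auto
      finally have "act_tuples \<sigma> ?w = ?w" .
      moreover have "act_tuples \<sigma> (PT S) = PT S" using PsiS_permute[OF \<sigma>(1)] \<sigma>(2) by simp
      ultimately show ?thesis by (simp add: act_tuples_def fun_eq_iff)
    qed
  qed
  then have "PT S = cscale ?e ?w" by simp
  then show ?thesis unfolding Psi_span_def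
    by (simp only:) (intro cfun.span_scale cfun.span_sum cfun.span_base, auto)
qed

text \<open>
  All \<open>XT S (PT C)\<close> are multiples of one of them, and that one is nonzero if \<open>C \<subseteq> S\<close>.
\<close>

lemma XT_Psi_span:
  assumes S: "S \<subseteq> X" "lab \<le> card S" "card S + lab \<le> weight T"
  shows "XT S ` (Psi_span T X) = {cscale c (bT (card S - lab)) |c. True}"
proof -
  have finS: "finite S" using S X finite_subset by blast
  obtain C0 where "C0 \<subseteq> S" "card C0 = lab" by (rule obtain_subset_with_card_n[OF S(2)])
  then have C0: "C0 \<in> ksubsets lab X" "C0 \<subseteq> S" using S(1) by (auto simp: ksubsets_def)
  let ?j = "card S - lab"
  obtain c where c: "c \<noteq> 0" "XT S (PT C0) = cscale c (bT ?j)" using XT_Psi_above[OF C0(1) S(1) C0(2) S(3)] by blast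
  have "bT ?j \<noteq> 0" using S by (intro bT_nonzero) (auto simp: tdim_def)
  then have nz: "XT S (PT C0) \<noteq> 0" using c by (auto simp: fun_eq_iff)
  have mult: "\<exists>r. XT S (PT C) = cscale r (bT ?j)" if C: "C \<in> ksubsets lab X" for C
  proof -
    obtain r where "XT S (PT C) = cscale r (XT S (PT C0))"
      by (rule XS_family_multiple[OF X Psi_Specht_family S(1) C C0 nz])
    then show ?thesis using c by auto
  qed
  have line: "{cscale c (bT ?j) |c. True} = cfun.span {bT ?j}"
    by (auto simp: cfun.span_singleton)
  have "XT S ` (Psi_span T X) = cfun.span (XT S ` PT ` ksubsets lab X)"
    unfolding Psi_span_def by (rule linear_cscale_image_span[OF linear_XS])
  also have "\<dots> = cfun.span {bT ?j}"
  proof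
    show "cfun.span (XT S ` PT ` ksubsets lab X) \<subseteq> cfun.span {bT ?j}"
      by (rule cfun.span_minimal[OF _ cfun.subspace_span]) (use mult in \<open>auto simp: cfun.span_singleton\<close>)
    have "bT ?j = cscale (1 / c) (XT S (PT C0))" using c by simp
    then have "bT ?j \<in> cfun.span (XT S ` PT ` ksubsets lab X)"
      using C0(1) by (auto intro!: cfun.span_scale intro: cfun.span_base)
    then show "cfun.span {bT ?j} \<subseteq> cfun.span (XT S ` PT ` ksubsets lab X)"
      by (intro cfun.span_minimal) auto
  qed
  finally show ?thesis unfolding line .
qed

lemma XT_Psi_span_in_image:
  assumes S: "S \<subseteq> X" and f: "f \<in> (Psi_span T X)"
  shows "XT S f \<in> tree_emb T ` V [tdim T]"
proof (cases "lab \<le> card S \<and> card S + lab \<le> weight T")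
  case True
  then obtain c where "XT S f = cscale c (bT (card S - lab))" using XT_Psi_span[OF S] f by blast
  also have "\<dots> = tree_emb T (cscale c (mon1 (tdim T) (card S - lab)))"
    by (simp add: linear_cscale_scale[OF linear_tree_emb[OF T]])
  finally show ?thesis using True by (auto simp: tdim_def intro!: imageI cfun.subspace_scale subspace_V mon1_in_V)
next
  case False
  then have "XT S (PT C) = 0" if "C \<in> ksubsets lab X" for C
    using cX by (intro XS_family_zero[OF X Psi_Specht_family S that]) auto
  then have "XT S ` PT ` ksubsets lab X \<subseteq> {0}" by auto
  then have "XT S ` (Psi_span T X) \<subseteq> {0}"
    unfolding Psi_span_def linear_cscale_image_span[OF linear_XS]
    by (intro cfun.span_minimal) (auto simp: cfun.subspace_def)
  then have "XT S f = 0" using f by blast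
  moreover have "0 \<in> tree_emb T ` V [tdim T]"
    by (intro cfun.subspace_0 linear_cscale_image_subspace[OF linear_tree_emb[OF T] subspace_V])
  ultimately show ?thesis by simp
qed

lemma Psi_span_subset_M: "Psi_span T X \<subseteq> M (parts T) X"
  unfolding Psi_span_def
  by (intro cfun.span_minimal) (auto simp: cfun.subspace_def M_def PsiS_def)

lemma subspace_Psi_span: "cfun.subspace (Psi_span T X)"
  unfolding Psi_span_def by simp

lemma Psi_span_invariant: "invariant_under (Sym X) act_tuples (Psi_span T X)"
  unfolding invariant_under_def Sym_def
proof (intro ballI)
  fix \<sigma> u assume "\<sigma> \<in> {\<sigma>. \<sigma> permutes X}" and u: "u \<in> (Psi_span T X)"
  then have \<sigma>: "\<sigma> permutes X" by simp
  have lin: "clinear (act_tuples \<sigma>)" by (simp add: linear_cscale_iff act_tuples_def fun_eq_iff)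
  have "act_tuples \<sigma> ` (Psi_span T X) = cfun.span (act_tuples \<sigma> ` PT ` ksubsets lab X)"
    unfolding Psi_span_def by (rule linear_cscale_image_span[OF lin])
  also have "\<dots> \<subseteq> (Psi_span T X)" unfolding Psi_span_def
  proof (rule cfun.span_mono, rule subsetI)
    fix v assume "v \<in> act_tuples \<sigma> ` PT ` ksubsets lab X"
    then obtain C where C: "C \<in> ksubsets lab X" "v = PT (\<sigma> ` C)" by (auto simp: PsiS_permute[OF \<sigma>])
    have "card (\<sigma> ` C) = card C" by (rule card_image) (meson permutes_inj[OF \<sigma>] inj_on_subset subset_UNIV)
    then have "\<sigma> ` C \<in> ksubsets lab X" using C(1) permutes_in_image[OF \<sigma>] by (auto simp: ksubsets_def)
    then show "v \<in> PT ` ksubsets lab X" using C by blast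
  qed
  finally show "act_tuples \<sigma> u \<in> (Psi_span T X)" using u by blast
qed

text \<open>
  The map that takes the Dirac function of \<open>C\<close> to \<open>PT C\<close> is equivariant. It multiplies spherical
  vectors by \<open>kap_total\<close>, and it is injective on the Specht module since \<open>f C'\<close> can be recovered by
  applying \<open>XT C'\<close> to the image of \<open>f\<close>.
\<close>

lemma Psi_span_isomorphic: "isomorphic_reps (Sym X) act_subsets (Specht lab X) act_tuples (Psi_span T X)"
proof -
  define A where "A f = (\<Sum>C\<in>ksubsets lab X. cscale (f C) (PT C))" for f :: "'x set \<Rightarrow> complex"
  have lin: "clinear A"
    by (simp add: linear_cscale_iff A_def cfun.scale_left_distrib sum.distrib cfun.scale_sum_right)
  let ?c = "complex_of_real (kap_total (card X) lab)"
  have c: "?c \<noteq> 0" using kap_total_nonzero by simp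
  have Asph: "A (spherical lab X C') = cscale ?c (PT C')" if C': "C' \<in> ksubsets lab X" for C'
  proof
    fix B
    define h where "h C = (if C \<in> ksubsets lab X then PT C B else 0)" for C
    have "h \<in> Specht lab X"
      unfolding Specht_iff[OF X]
    proof (intro conjI allI impI)
      show "C \<notin> ksubsets lab X \<Longrightarrow> h C = 0" for C by (simp add: h_def)
      fix D assume D: "D \<subseteq> X \<and> card D + 1 = lab"
      have "finite D" using D X finite_subset by blast
      then have "insert x D \<in> ksubsets lab X" if "x \<in> X - D" for x using that D by (auto simp: ksubsets_def)
      then have "(\<Sum>x\<in>X - D. h (insert x D)) = (\<Sum>x\<in>X - D. PT (insert x D)) B"
        unfolding sum_functions_apply by (intro sum.cong) (auto simp: h_def)
      then show "(\<Sum>x\<in>X - D. h (insert x D)) = 0" using Specht_family_sum[OF Psi_Specht_family] D by simp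
    qed
    from Specht_convolution[OF X this C']
    show "A (spherical lab X C') B = cscale ?c (PT C') B"
      unfolding A_def sum_functions_apply using C'
      by (auto simp: h_def spherical_def Int_commute mult_ac cong: sum.cong)
  qed
  have inj: "inj_on A (Specht lab X)"
  proof (rule inj_onI)
    fix f f' assume ff': "f \<in> Specht lab X" "f' \<in> Specht lab X" "A f = A f'"
    let ?g = "f - f'"
    have g: "?g \<in> Specht lab X" by (rule cfun.subspace_diff[OF subspace_Specht[OF X] ff'(1,2)])
    have A0: "A ?g = 0" using ff'(3) by (simp add: linear_cscale_diff[OF lin])
    have "?g C' = 0" if C': "C' \<in> ksubsets lab X" for C'
    proof -
      have "0 = XT C' (A ?g)" by (simp add: A0 linear_cscale_zero[OF linear_XS])
      also have "\<dots> = (\<Sum>C\<in>ksubsets lab X. cscale (?g C) (XT C' (PT C)))"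
        unfolding A_def by (rule XS_cscale_sum)
      also have "\<dots> = (\<Sum>C\<in>ksubsets lab X. cscale (?g C * of_real (kap (card X) lab (card (C \<inter> C')))) (cscale (1 / of_real (kap (card X) lab lab)) (XT C' (PT C'))))"
        by (intro sum.cong refl) (simp add: XS_family_spherical[OF X Psi_Specht_family label_bound _ C'])
      also have "\<dots> = cscale (?c * ?g C') (cscale (1 / of_real (kap (card X) lab lab)) (XT C' (PT C')))"
        unfolding cfun.scale_sum_left[symmetric] Specht_convolution[OF X g C'] ..
      finally have "cscale (?c * ?g C' / of_real (kap (card X) lab lab) * of_real (chi T lab)) (bT 0) = 0"
        unfolding XT_Psi_self[OF C'] by simp
      then have "?c * ?g C' / of_real (kap (card X) lab lab) * of_real (chi T lab) = 0"
        using bT_nonzero[of 0] by (simp only: cfun.scale_eq_0_iff) auto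
      then show ?thesis using c kap_nonzero chi_pos[of T lab] by auto
    qed
    then have "?g C' = 0" for C' using Specht_support[OF g] by blast
    then show "f = f'" by (auto simp: fun_eq_iff)
  qed
  have im: "A ` Specht lab X = (Psi_span T X)"
  proof -
    have "A ` Specht lab X = cfun.span (A ` spherical lab X ` ksubsets lab X)"
      unfolding Specht_span[OF X label_bound] by (rule linear_cscale_image_span[OF lin])
    also have "A ` spherical lab X ` ksubsets lab X = cscale ?c ` PT ` ksubsets lab X"
      unfolding image_image by (rule image_cong) (auto simp: Asph)
    also have "cfun.span (cscale ?c ` PT ` ksubsets lab X) = cscale ?c ` (Psi_span T X)"
    proof -
      have "clinear (cscale ?c :: ('x set list \<Rightarrow> complex) \<Rightarrow> _)"
        by (simp add: linear_cscale_iff cfun.scale_right_distrib mult.commute)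
      from linear_cscale_image_span[OF this] show ?thesis unfolding Psi_span_def by simp
    qed
    also have "\<dots> = (Psi_span T X)"
    proof
      show "cscale ?c ` (Psi_span T X) \<subseteq> (Psi_span T X)" using cfun.subspace_scale[OF subspace_Psi_span] by blast
      show "(Psi_span T X) \<subseteq> cscale ?c ` (Psi_span T X)"
      proof
        fix v assume "v \<in> (Psi_span T X)"
        then have "cscale (1 / ?c) v \<in> (Psi_span T X)" by (rule cfun.subspace_scale[OF subspace_Psi_span])
        moreover have "v = cscale ?c (cscale (1 / ?c) v)" using c by simp
        ultimately show "v \<in> cscale ?c ` (Psi_span T X)" by blast
      qed
    qed
    finally show ?thesis .
  qed
  have eq: "A (act_subsets \<sigma> f) = act_tuples \<sigma> (A f)" if \<sigma>: "\<sigma> permutes X" for \<sigma> f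
  proof -
    have inj: "inj \<sigma>" and inj': "inj (inv \<sigma>)" using permutes_inj[OF \<sigma>] permutes_inj[OF permutes_inv[OF \<sigma>]] by auto
    have "act_tuples \<sigma> (A f) = (\<Sum>C\<in>ksubsets lab X. cscale (f C) (act_tuples \<sigma> (PT C)))"
      by (simp add: A_def fun_eq_iff act_tuples_def sum_functions_apply)
    also have "\<dots> = (\<Sum>C\<in>ksubsets lab X. cscale (f C) (PT (\<sigma> ` C)))" by (simp add: PsiS_permute[OF \<sigma>])
    also have "\<dots> = (\<Sum>C\<in>ksubsets lab X. cscale (f (inv \<sigma> ` C)) (PT C))"
    proof (rule sum.reindex_bij_witness[of _ "(`) (inv \<sigma>)" "(`) \<sigma>"])
      fix C assume C: "C \<in> ksubsets lab X"
      have cc: "card (\<sigma> ` C) = card C" "card (inv \<sigma> ` C) = card C"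
        by (rule card_image, meson inj inj' inj_on_subset subset_UNIV)+
      show "\<sigma> ` C \<in> ksubsets lab X" "inv \<sigma> ` C \<in> ksubsets lab X"
        using C cc permutes_in_image[OF \<sigma>] permutes_in_image[OF permutes_inv[OF \<sigma>]] by (auto simp: ksubsets_def)
      show "inv \<sigma> ` \<sigma> ` C = C" "\<sigma> ` inv \<sigma> ` C = C" using permutes_inverses[OF \<sigma>] by (simp_all add: image_image)
      then show "cscale (f (inv \<sigma> ` \<sigma> ` C)) (PT (\<sigma> ` C)) = cscale (f C) (PT (\<sigma> ` C))" by simp
    qed
    also have "\<dots> = A (act_subsets \<sigma> f)" by (simp add: A_def act_subsets_def)
    finally show ?thesis ..
  qed
  show ?thesis
    unfolding isomorphic_reps_def bij_betw_def Sym_def using lin inj im eq by blast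
qed

end

subsection \<open>Characterization inside the induced space\<close>

definition node_space :: "ltree \<Rightarrow> ltree \<Rightarrow> 'x set \<Rightarrow> ('x set list \<Rightarrow> complex) set" where
  "node_space L R X = cfun.span (\<Union>F\<in>ksubsets (weight L) X.
     tens_space (num_leaves L) (Psi_span L F) (Psi_span R (X - F)))"

context
  fixes k :: nat and L R :: ltree and X :: "'x set"
  assumes T: "rep_labeling (Node k L R)" and X: "finite X" and cX: "card X = weight (Node k L R)"
begin

abbreviation (input) "TT \<equiv> Node k L R"
abbreviation (input) "aa \<equiv> parts L @ parts R"

lemma TL: "rep_labeling L" and TR: "rep_labeling R"
  using T by auto

lemma F_facts:
  assumes "F \<in> ksubsets (weight L) X"
  shows "F \<subseteq> X" "finite F" "card F = weight L" "finite (X - F)" "card (X - F) = weight R"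
proof -
  show 1: "F \<subseteq> X" "finite F" "card F = weight L" "finite (X - F)"
    using assms X finite_subset by (auto simp: ksubsets_def)
  show "card (X - F) = weight R" using 1 cX by (simp add: card_Diff_subset)
qed

lemma node_space_subset_M: "node_space L R X \<subseteq> M aa X"
  unfolding node_space_def
proof (rule cfun.span_minimal)
  show sub: "cfun.subspace (M aa X)" by (auto simp: cfun.subspace_def M_def)
  have "tens_space (num_leaves L) (Psi_span L F) (Psi_span R (X - F)) \<subseteq> M aa X" if F: "F \<in> ksubsets (weight L) X" for F
    unfolding tens_space_def
  proof (rule cfun.span_minimal[OF _ sub], rule subsetI)
    fix v assume "v \<in> {tens (num_leaves L) f g |f g. f \<in> Psi_span L F \<and> g \<in> Psi_span R (X - F)}"
    then obtain f g where v: "v = tens (num_leaves L) f g" "f \<in> Psi_span L F" "g \<in> Psi_span R (X - F)" by blast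
    note FF = F_facts[OF F]
    have fg: "f \<in> M (parts L) F" "g \<in> M (parts R) (X - F)"
      using v Psi_span_subset_M[OF TL FF(2,3)] Psi_span_subset_M[OF TR FF(4,5)] by blast+
    have "tens (num_leaves L) f g B = 0" if B: "B \<notin> Omega aa X" for B
    proof (rule ccontr)
      assume "tens (num_leaves L) f g B \<noteq> 0"
      then have "take (num_leaves L) B \<in> Omega (parts L) F" "drop (num_leaves L) B \<in> Omega (parts R) (X - F)"
        using fg by (auto simp: tens_def M_def)
      from Omega_appendI[OF FF(1) this] B show False by simp
    qed
    then show "v \<in> M aa X" unfolding v M_def by blast
  qed
  then show "(\<Union>F\<in>ksubsets (weight L) X. tens_space (num_leaves L) (Psi_span L F) (Psi_span R (X - F))) \<subseteq> M aa X" by blast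
qed

lemma XS_node_space:
  assumes S: "S \<subseteq> X" and v: "v \<in> node_space L R X"
  shows "XS aa X S v \<in> tens_space (num_leaves L) (tree_emb L ` V [tdim L]) (tree_emb R ` V [tdim R])"
proof -
  let ?W = "tens_space (num_leaves L) (tree_emb L ` V [tdim L]) (tree_emb R ` V [tdim R])"
  have sub: "cfun.subspace ?W" unfolding tens_space_def by simp
  have "XS aa X S ` tens_space (num_leaves L) (Psi_span L F) (Psi_span R (X - F)) \<subseteq> ?W" if F: "F \<in> ksubsets (weight L) X" for F
  proof -
    note FF = F_facts[OF F]
    have "XS aa X S (tens (num_leaves L) f g) \<in> ?W" if fg: "f \<in> Psi_span L F" "g \<in> Psi_span R (X - F)" for f g
    proof -
      have M: "f \<in> M (parts L) F" "g \<in> M (parts R) (X - F)"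
        using fg Psi_span_subset_M[OF TL FF(2,3)] Psi_span_subset_M[OF TR FF(4,5)] by blast+
      have "XS (parts L) F (S \<inter> F) f \<in> tree_emb L ` V [tdim L]"
        by (rule XT_Psi_span_in_image[OF TL FF(2,3) _ fg(1)]) blast
      moreover have "XS (parts R) (X - F) (S - F) g \<in> tree_emb R ` V [tdim R]"
        by (rule XT_Psi_span_in_image[OF TR FF(4,5) _ fg(2)]) (use S in blast)
      ultimately show ?thesis
        using XS_tens[OF X FF(1) M, of S] unfolding tens_space_def by (auto intro!: cfun.span_base)
    qed
    then have "XS aa X S ` {tens (num_leaves L) f g |f g. f \<in> Psi_span L F \<and> g \<in> Psi_span R (X - F)} \<subseteq> ?W" by blast
    then show ?thesis unfolding tens_space_def[of _ "Psi_span L F"] linear_cscale_image_span[OF linear_XS]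
      by (rule cfun.span_minimal[OF _ sub])
  qed
  then have "XS aa X S ` (\<Union>F\<in>ksubsets (weight L) X. tens_space (num_leaves L) (Psi_span L F) (Psi_span R (X - F))) \<subseteq> ?W" by blast
  then have "XS aa X S ` node_space L R X \<subseteq> ?W"
    unfolding node_space_def linear_cscale_image_span[OF linear_XS] by (rule cfun.span_minimal[OF _ sub])
  then show ?thesis using v by blast
qed

lemma Psi_span_subset_node_space: "Psi_span TT X \<subseteq> node_space L R X"
  unfolding Psi_span_def
proof (rule cfun.span_minimal)
  show sub: "cfun.subspace (node_space L R X)" unfolding node_space_def by simp
  show "PsiS TT X ` ksubsets (label TT) X \<subseteq> node_space L R X"
  proof (rule image_subsetI)
    fix S assume "S \<in> ksubsets (label TT) X"
    then have S: "S \<subseteq> X" "finite S" using X finite_subset by (auto simp: ksubsets_def)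
    have c: "card X = weight L + weight R" using cX by simp
    have "cscale (of_int (node_coeff k L R (card S) (card (S - F)))) (tens (num_leaves L) (PsiS L F (S \<inter> F)) (PsiS R (X - F) (S - F))) \<in> node_space L R X"
      if F: "F \<in> ksubsets (weight L) X" for F
    proof (cases "card (S - F) \<in> w_range (weight L + weight R) (weight L) (label L) (label R) (card S)")
      case False
      then show ?thesis using cfun.subspace_0[OF sub] by (simp add: node_coeff_def)
    next
      case True
      note FF = F_facts[OF F]
      have w: "label R \<le> card (S - F)" "card (S - F) + label R \<le> weight R" "card (S - F) + label L \<le> card S" "card S + label L \<le> weight L + card (S - F)"
        using True unfolding w_range_iff by auto
      have cSF: "card (S \<inter> F) = card S - card (S - F)"
        using S(2) card_Diff_subset_Int[of S F] card_mono[OF S(2), of "S \<inter> F"] by auto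
      have "PsiS L F (S \<inter> F) \<in> Psi_span L F"
        by (rule Psi_in_span[OF TL FF(2,3)]) (use w cSF in auto)
      moreover have "PsiS R (X - F) (S - F) \<in> Psi_span R (X - F)"
        by (rule Psi_in_span[OF TR FF(4,5)]) (use w S in auto)
      ultimately have "tens (num_leaves L) (PsiS L F (S \<inter> F)) (PsiS R (X - F) (S - F)) \<in> tens_space (num_leaves L) (Psi_span L F) (Psi_span R (X - F))"
        unfolding tens_space_def by (intro cfun.span_base) blast
      then have "tens (num_leaves L) (PsiS L F (S \<inter> F)) (PsiS R (X - F) (S - F)) \<in> node_space L R X"
        unfolding node_space_def using F by (intro cfun.span_base) blast
      then show ?thesis by (rule cfun.subspace_scale[OF sub])
    qed
    then show "PsiS TT X S \<in> node_space L R X"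
      unfolding PsiS_Node[OF X S(1) c] by (intro cfun.subspace_sum[OF sub])
  qed
qed

text \<open>
  All \<open>XS aa X S' (u Y)\<close> with \<open>S'\<close> smaller than \<open>Y\<close> vanish. Hence the unipotent matrices fix
  \<open>XS aa X Y (u Y)\<close>, which is therefore a highest weight vector in the tensor product of the spaces
  of the sons; these are unique up to a factor.
\<close>

lemma XS_highest_weight:
  assumes u: "Specht_family k X u" and W: "u Y \<in> node_space L R X" and Y: "Y \<in> ksubsets k X"
  obtains c where "XS aa X Y (u Y) = cscale c (XS aa X Y (PsiS TT X Y))"
proof -
  obtain \<alpha> \<beta> q where *: "k = label L + label R + q" "tdim L = \<alpha> + q" "tdim R = \<beta> + q" "tdim TT = \<alpha> + \<beta>"
    "weight L = \<alpha> + q + 2 * label L" "weight R = \<beta> + q + 2 * label R"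
    by (rule node_dims[OF T]) blast
  have eL: "equivariant_embedding (\<alpha> + q) (num_leaves L) (tree_emb L)" and eR: "equivariant_embedding (\<beta> + q) (num_leaves R) (tree_emb R)"
    using tree_emb_embedding[OF TL] tree_emb_embedding[OF TR] *(2,3) by auto
  let ?\<theta> = "tensor_map (num_leaves L) (tree_emb L) (tree_emb R)" and ?W = "V [\<alpha> + q, \<beta> + q]" and ?I = "{..\<alpha> + q} \<times> {..\<beta> + q}"
  let ?m = "mon2 (\<alpha> + q) (\<beta> + q)"
  note lin = tensor_map_linear[OF eL eR]
  have sum: "sum_list aa = card X" using cX by simp
  have Y': "Y \<subseteq> X" "card Y = k" "finite Y" using Y X finite_subset by (auto simp: ksubsets_def)
  have "XS aa X Y (u Y) \<in> ?\<theta> ` ?W"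
    using XS_node_space[OF Y'(1) W] unfolding *(2,3) tens_space_eq_image[OF eL eR] .
  then obtain P where P: "P \<in> ?W" "XS aa X Y (u Y) = ?\<theta> P" by blast
  obtain e where e: "P = (\<Sum>(p1, p2)\<in>?I. cscale (e p1 p2) (?m p1 p2))" using P(1) unfolding V2_eq by blast
  \<comment> \<open>The diagonal matrix with entries 2 and 1/2 detects the weight.\<close>
  have weight: "p1 + p2 = q" if I: "(p1, p2) \<in> ?I" and nz: "e p1 p2 \<noteq> 0" for p1 p2
  proof -
    define g :: "complex^2^2" where "g = (\<chi> p q. if p = q then (if p = 1 then 2 else 1/2) else 0)"
    have g: "g$1$1 = 2" "g$1$2 = 0" "g$2$1 = 0" "g$2$2 = 1/2" by (simp_all add: g_def)
    have det: "det g = 1" by (simp add: det_2 g)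
    let ?D = "\<alpha> + \<beta> + 2 * q" and ?n = "card X"
    have "act_SU2 g (XS aa X Y (u Y)) = (\<Sum>S'\<in>Pow X. cscale (if S' = Y then 2 ^ k * (1/2) ^ (?n - k) else 0) (XS aa X S' (u Y)))"
      unfolding act_XS[OF X sum]
      by (intro sum.cong refl) (use X Y' in \<open>auto simp: act_coeff_torus[OF X Y'(1) _ g(2,3)] g card_Diff_subset\<close>)
    also have "\<dots> = cscale (2 ^ k * (1/2) ^ (?n - k)) (XS aa X Y (u Y))"
      using X Y'(1) by (simp add: if_distrib[of "\<lambda>c. cscale c _"] cong: if_cong)
    finally have a: "act_SU2 g (?\<theta> P) = cscale (2 ^ k * (1/2) ^ (?n - k)) (?\<theta> P)" unfolding P(2) .
    have "(\<Sum>x\<in>?I. cscale (2 ^ k * (1/2) ^ (?n - k) * e (fst x) (snd x)) (case x of (p1, p2) \<Rightarrow> ?\<theta> (?m p1 p2)))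
       = cscale (2 ^ k * (1/2) ^ (?n - k)) (?\<theta> P)"
      unfolding e linear_cscale_sum[OF lin] cfun.scale_sum_right
      by (intro sum.cong refl) (auto simp: linear_cscale_scale[OF lin])
    also have "\<dots> = ?\<theta> (act_SU2 g P)" unfolding a[symmetric] by (rule tensor_map_equivariant[OF eL eR det P(1)])
    also have "\<dots> = (\<Sum>x\<in>?I. cscale (e (fst x) (snd x) * (2 ^ (fst x + snd x) * (1/2) ^ (?D - (fst x + snd x)))) (case x of (p1, p2) \<Rightarrow> ?\<theta> (?m p1 p2)))"
      unfolding e linear_cscale_sum[OF linear_act_SU2] linear_cscale_sum[OF lin]
    proof (intro sum.cong refl)
      fix x assume x: "x \<in> ?I"
      have n: "\<alpha> + q + (\<beta> + q) = ?D" by simp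
      show "?\<theta> (act_SU2 g (case x of (p1, p2) \<Rightarrow> cscale (e p1 p2) (?m p1 p2))) =
         cscale (e (fst x) (snd x) * (2 ^ (fst x + snd x) * (1/2) ^ (?D - (fst x + snd x)))) (case x of (p1, p2) \<Rightarrow> ?\<theta> (?m p1 p2))"
        using x act_torus(2)[OF g, of "fst x" "\<alpha> + q" "snd x" "\<beta> + q", unfolded n]
        by (auto simp: linear_cscale_scale[OF linear_act_SU2] linear_cscale_scale[OF lin])
    qed
    finally have sums: "(\<Sum>x\<in>?I. cscale (2 ^ k * (1/2) ^ (?n - k) * e (fst x) (snd x)) (case x of (p1, p2) \<Rightarrow> ?\<theta> (?m p1 p2))) =
       (\<Sum>x\<in>?I. cscale (e (fst x) (snd x) * (2 ^ (fst x + snd x) * (1/2) ^ (?D - (fst x + snd x)))) (case x of (p1, p2) \<Rightarrow> ?\<theta> (?m p1 p2)))" .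
    have "(2::complex) ^ k * (1/2) ^ (?n - k) = 2 ^ (p1 + p2) * (1/2) ^ (?D - (p1 + p2))"
      using independent_family_eqD[OF tensor_map_independent[OF eL eR] sums I] nz by simp
    then have "(2::complex) ^ k * 2 ^ (?D - (p1 + p2)) = 2 ^ (p1 + p2) * 2 ^ (?n - k)"
      by (simp add: power_one_over field_simps)
    then have "(2::complex) ^ (k + (?D - (p1 + p2))) = 2 ^ (p1 + p2 + (?n - k))" by (simp only: power_add)
    then have "of_nat (2 ^ (k + (?D - (p1 + p2)))) = (of_nat (2 ^ (p1 + p2 + (?n - k))) :: complex)" by simp
    then have "(2::nat) ^ (k + (?D - (p1 + p2))) = 2 ^ (p1 + p2 + (?n - k))" by (simp only: of_nat_eq_iff)
    then have eq: "k + (?D - (p1 + p2)) = p1 + p2 + (?n - k)" by (simp only: power_inject_exp)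
    have "p1 + p2 \<le> ?D" using I by auto
    moreover have "?n = ?D + 2 * label L + 2 * label R" using cX *(5,6) by simp
    ultimately show ?thesis using eq *(1) by linarith
  qed
  have unip: "P [(x1 + \<tau> * y1, y1), (x2 + \<tau> * y2, y2)] = P [(x1, y1), (x2, y2)]" for \<tau> x1 y1 x2 y2
  proof -
    obtain g :: "complex^2^2" where g: "g$1$1 = 1" "g$1$2 = 0" "g$2$1 = \<tau>" "g$2$2 = 1" "det g = 1"
      by (rule exists_lower_unipotent)
    have "act_SU2 g (XS aa X Y (u Y)) = (\<Sum>S'\<in>Pow X. cscale (if S' = Y then 1 else 0) (XS aa X S' (u Y)))"
      unfolding act_XS[OF X sum]
    proof (intro sum.cong refl)
      fix S' assume S': "S' \<in> Pow X"
      show "cscale (act_coeff g X Y S') (XS aa X S' (u Y)) = cscale (if S' = Y then 1 else 0) (XS aa X S' (u Y))"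
      proof (cases "S' \<subset> Y")
        case True
        then have "card S' < k" using psubset_card_mono[OF Y'(3)] Y'(2) by blast
        then have "XS aa X S' (u Y) = 0" using S' by (intro XS_family_zero[OF X u _ Y]) auto
        then show ?thesis by simp
      next
        case False
        then show ?thesis using S' by (auto simp: act_coeff_lower[OF X Y'(1) _ g(1-4)])
      qed
    qed
    also have "\<dots> = XS aa X Y (u Y)"
      using X Y'(1) by (simp add: if_distrib[of "\<lambda>c. cscale c _"] cong: if_cong)
    finally have "?\<theta> (act_SU2 g P) = ?\<theta> P" unfolding P(2) tensor_map_equivariant[OF eL eR g(5) P(1)] .
    then have "act_SU2 g P = P"
      using inj_onD[OF linear_inj_on_V2[OF lin tensor_map_independent[OF eL eR]] _ act_SU2_in_V2[OF P(1)] P(1)] by blast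
    then have "act_SU2 g P [(x1, y1), (x2, y2)] = P [(x1, y1), (x2, y2)]" by simp
    then show ?thesis by (simp add: act_SU2_def g)
  qed
  define e' where "e' p1 p2 = (if (p1, p2) \<in> ?I then e p1 p2 else 0)" for p1 p2
  have Pe': "P = (\<Sum>(p1, p2)\<in>?I. cscale (e' p1 p2) (?m p1 p2))"
    unfolding e by (intro sum.cong refl) (auto simp: e'_def)
  have e'w: "p1 + p2 = q" if "e' p1 p2 \<noteq> 0" for p1 p2 using that weight[of p1 p2] unfolding e'_def by meson
  have "\<exists>c. P = cscale c (transvectant \<alpha> \<beta> q 0 1)"
  proof (rule highest_weight_vector[OF P(1)])
    show "P [(of_real \<epsilon> * x1, y1), (of_real \<epsilon> * x2, y2)] = of_real \<epsilon> ^ q * P [(x1, y1), (x2, y2)]" for \<epsilon> x1 y1 x2 y2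
      unfolding Pe' by (rule homogeneous_scale[OF e'w])
    show "P [(x1 - of_real \<tau> * y1, y1), (x2 - of_real \<tau> * y2, y2)] = P [(x1, y1), (x2, y2)]" for \<tau> x1 y1 x2 y2
      using unip[of x1 "- of_real \<tau>" y1 x2 y2] by simp
  qed
  then obtain c where c: "P = cscale c (transvectant \<alpha> \<beta> q 0 1)" by blast
  have Y2: "Y \<in> ksubsets (label TT) X" using Y by simp
  let ?N = "complex_of_real (sqrt (tnorm \<alpha> \<beta> q 0))" and ?h = "complex_of_real (chi TT k)"
  have nz: "?N \<noteq> 0" "?h \<noteq> 0" using tnorm_0_pos[of \<alpha> \<beta> q] chi_pos[of TT k] by auto
  have "XS aa X Y (PsiS TT X Y) = cscale ?h (?\<theta> (cg_map \<alpha> \<beta> q (pw (\<alpha> + \<beta>) 0 1)))"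
    using XT_Psi_self[OF T X cX Y2] unfolding tree_emb_Node[OF *(1-3)] *(4) mon1_0_eq_pw parts.simps label.simps .
  also have "\<dots> = cscale (?h / ?N) (?\<theta> (transvectant \<alpha> \<beta> q 0 1))"
    unfolding cg_map_pw linear_cscale_scale[OF lin] by simp
  finally have Psi: "XS aa X Y (PsiS TT X Y) = cscale (?h / ?N) (?\<theta> (transvectant \<alpha> \<beta> q 0 1))" .
  have "XS aa X Y (u Y) = cscale (c * ?N / ?h) (XS aa X Y (PsiS TT X Y))"
    unfolding P(2) c Psi linear_cscale_scale[OF lin] using nz by simp
  then show ?thesis by (rule that)
qed

text \<open>
  The image of the spherical vector of \<open>Y\<close> in \<open>U\<close> is invariant under the stabilizer of \<open>Y\<close>, and \<open>XS aa X Y\<close>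
  maps it to a highest weight vector. By injectivity on invariants it is a multiple of the
  function \<open>\<Psi>\<close> of \<open>Y\<close>, and permutations extend this to all \<open>k\<close>-subsets.
\<close>

lemma node_subspace_unique:
  assumes U: "U \<subseteq> node_space L R X"
    and iso: "isomorphic_reps (Sym X) act_subsets (Specht k X) act_tuples U"
  shows "U = Psi_span TT X"
proof -
  have k: "2 * k \<le> card X" using label_bound[OF T X cX] by simp
  obtain \<Phi> where \<Phi>: "clinear \<Phi>" "bij_betw \<Phi> (Specht k X) U"
    "\<And>\<sigma> f. \<sigma> permutes X \<Longrightarrow> f \<in> Specht k X \<Longrightarrow> \<Phi> (act_subsets \<sigma> f) = act_tuples \<sigma> (\<Phi> f)"
    using iso unfolding isomorphic_reps_def Sym_def by blast
  define u where "u C = \<Phi> (spherical k X C)" for C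
  have fam: "Specht_family k X u"
    unfolding Specht_family_def
  proof (intro conjI allI impI)
    fix D assume D: "D \<subseteq> X \<and> card D + 1 = k"
    have "(\<Sum>x\<in>X - D. u (insert x D)) = \<Phi> (\<Sum>x\<in>X - D. spherical k X (insert x D))"
      unfolding u_def linear_cscale_sum[OF \<Phi>(1)] ..
    also have "\<dots> = 0" using sum_spherical_insert[OF X k] D by (simp add: linear_cscale_zero[OF \<Phi>(1)])
    finally show "(\<Sum>x\<in>X - D. u (insert x D)) = 0" .
  next
    fix \<sigma> C assume \<sigma>: "\<sigma> permutes X" and C: "C \<in> ksubsets k X"
    show "act_tuples \<sigma> (u C) = u (\<sigma> ` C)"
      unfolding u_def \<Phi>(3)[OF \<sigma> spherical_in_Specht[OF X C k], symmetric] spherical_permute[OF \<sigma>] ..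
  qed
  have uU: "u C \<in> U" if "C \<in> ksubsets k X" for C
    unfolding u_def using bij_betwE[OF \<Phi>(2)] spherical_in_Specht[OF X that k] by blast
  obtain Y where "Y \<subseteq> X" "card Y = k" using obtain_subset_with_card_n[of k X] k by auto
  then have Y: "Y \<in> ksubsets k X" by (simp add: ksubsets_def)
  have Y': "Y \<subseteq> X" using Y by (simp add: ksubsets_def)
  have sum: "sum_list aa = card X" using cX by simp
  obtain c where c: "XS aa X Y (u Y) = cscale c (XS aa X Y (PsiS TT X Y))"
    by (rule XS_highest_weight[OF fam _ Y]) (use uU[OF Y] U in blast)+
  have "u Y - cscale c (PsiS TT X Y) = 0"
  proof (rule XS_injective_on_invariants[OF X Y' sum])
    have "u Y \<in> M aa X" using uU[OF Y] U node_space_subset_M by blast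
    then show "u Y - cscale c (PsiS TT X Y) \<in> M aa X" by (simp add: M_def PsiS_def)
    show "XS aa X Y (u Y - cscale c (PsiS TT X Y)) = 0"
      by (simp add: linear_cscale_diff[OF linear_XS] linear_cscale_scale[OF linear_XS] c)
    show "act_tuples \<sigma> (u Y - cscale c (PsiS TT X Y)) = u Y - cscale c (PsiS TT X Y)" if \<sigma>: "\<sigma> permutes X" "\<sigma> ` Y = Y" for \<sigma>
    proof -
      have "act_tuples \<sigma> (u Y - cscale c (PsiS TT X Y)) = act_tuples \<sigma> (u Y) - cscale c (act_tuples \<sigma> (PsiS TT X Y))"
        by (simp add: act_tuples_def fun_eq_iff)
      then show ?thesis unfolding Specht_family_permute[OF fam \<sigma>(1) Y] PsiS_permute[OF \<sigma>(1)] \<sigma>(2) .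
    qed
  qed
  then have uY: "u Y = cscale c (PsiS TT X Y)" by simp
  have uC: "u C = cscale c (PsiS TT X C)" if C: "C \<in> ksubsets k X" for C
  proof -
    have CY: "C \<subseteq> X" "card Y = card C" using C Y by (auto simp: ksubsets_def)
    obtain \<sigma> where \<sigma>: "\<sigma> permutes X" "\<sigma> ` X = X" "\<sigma> ` Y = C"
    proof (rule exists_permutation_pair[OF X subset_refl Y' subset_refl CY(1) refl CY(2)])
      show "card (Y \<inter> X) = card (C \<inter> X)" using CY Y' by (simp add: Int_absorb2)
    qed
    have "u C = act_tuples \<sigma> (u Y)" unfolding Specht_family_permute[OF fam \<sigma>(1) Y] \<sigma>(3) ..
    also have "\<dots> = cscale c (act_tuples \<sigma> (PsiS TT X Y))" unfolding uY by (simp add: act_tuples_def fun_eq_iff)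
    also have "act_tuples \<sigma> (PsiS TT X Y) = PsiS TT X C" unfolding PsiS_permute[OF \<sigma>(1)] \<sigma>(3) ..
    finally show ?thesis .
  qed
  have c0: "c \<noteq> 0"
  proof
    assume "c = 0"
    then have "\<Phi> (spherical k X Y) = \<Phi> 0" using uY unfolding u_def by (simp add: linear_cscale_zero[OF \<Phi>(1)])
    moreover have "inj_on \<Phi> (Specht k X)" using \<Phi>(2) by (simp add: bij_betw_def)
    ultimately have "spherical k X Y = 0"
      using inj_onD spherical_in_Specht[OF X Y k] cfun.subspace_0[OF subspace_Specht[OF X]] by metis
    then have "spherical k X Y Y = 0" by simp
    then show False using Y kap_nonzero by (simp add: spherical_def)
  qed
  have "U = \<Phi> ` Specht k X" using \<Phi>(2) by (simp add: bij_betw_def)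
  also have "\<dots> = cfun.span (u ` ksubsets k X)"
    unfolding Specht_span[OF X k] linear_cscale_image_span[OF \<Phi>(1)] u_def image_image ..
  also have "\<dots> = cfun.span (PsiS TT X ` ksubsets k X)"
  proof
    show "cfun.span (u ` ksubsets k X) \<subseteq> cfun.span (PsiS TT X ` ksubsets k X)"
      by (rule cfun.span_minimal) (auto simp: uC intro!: cfun.span_scale intro: cfun.span_base)
    have "PsiS TT X C \<in> cfun.span (u ` ksubsets k X)" if C: "C \<in> ksubsets k X" for C
    proof -
      have "PsiS TT X C = cscale (1 / c) (u C)" using uC[OF C] c0 by simp
      then show ?thesis using C by (auto intro!: cfun.span_scale intro: cfun.span_base)
    qed
    then show "cfun.span (PsiS TT X ` ksubsets k X) \<subseteq> cfun.span (u ` ksubsets k X)"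
      by (intro cfun.span_minimal) auto
  qed
  finally show ?thesis by (simp add: Psi_span_def)
qed

end

lemma S_tree_eq:
  "rep_labeling T \<Longrightarrow> finite X \<Longrightarrow> card X = weight T \<Longrightarrow> S_tree T X = Psi_span T X"
proof (induction T arbitrary: X)
  case (Leaf a)
  have O: "Omega [a] X = {[X]}" using Leaf.prems by (simp add: Omega_singleton)
  have K: "ksubsets 0 X = {{}}"
  proof -
    have "C = {}" if "C \<subseteq> X" "card C = 0" for C
      using that finite_subset[OF that(1) Leaf.prems(2)] by simp
    then show ?thesis by (auto simp: ksubsets_def)
  qed
  let ?e = "PsiS (Leaf a) X {}"
  have "M [a] X = {cscale c ?e |c. True}"
  proof (intro set_eqI iffI)
    fix f assume f: "f \<in> M [a] X"
    have "f = cscale (f [X]) ?e" using f O by (auto simp: fun_eq_iff M_def PsiS_def)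
    then show "f \<in> {cscale c ?e |c. True}" by blast
  next
    fix f assume "f \<in> {cscale c ?e |c. True}"
    then show "f \<in> M [a] X" by (auto simp: M_def PsiS_def)
  qed
  then show ?case by (auto simp: Psi_span_def K cfun.span_singleton)
next
  case (Node k L R)
  note T = Node.prems(1) and X = Node.prems(2) and cX = Node.prems(3)
  have W: "cfun.span (\<Union>F\<in>ksubsets (weight L) X. tens_space (num_leaves L) (S_tree L F) (S_tree R (X - F))) = node_space L R X"
    unfolding node_space_def
  proof (intro arg_cong[of _ _ cfun.span] SUP_cong refl)
    fix F assume F: "F \<in> ksubsets (weight L) X"
    note FF = F_facts[OF T X cX F]
    have "S_tree L F = Psi_span L F" by (rule Node.IH(1)[OF _ FF(2,3)]) (use T in simp)
    moreover have "S_tree R (X - F) = Psi_span R (X - F)" by (rule Node.IH(2)[OF _ FF(4,5)]) (use T in simp)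
    ultimately show "tens_space (num_leaves L) (S_tree L F) (S_tree R (X - F)) = tens_space (num_leaves L) (Psi_span L F) (Psi_span R (X - F))" by simp
  qed
  show ?case
    unfolding S_tree.simps W
  proof (rule the_equality)
    show "cfun.subspace (Psi_span (Node k L R) X) \<and> Psi_span (Node k L R) X \<subseteq> node_space L R X \<and>
      invariant_under (Sym X) act_tuples (Psi_span (Node k L R) X) \<and>
      isomorphic_reps (Sym X) act_subsets (Specht k X) act_tuples (Psi_span (Node k L R) X)"
      using subspace_Psi_span[OF T X cX] Psi_span_subset_node_space[OF T X cX] Psi_span_invariant[OF T X cX]
        Psi_span_isomorphic[OF T X cX] by simp
  qed (use node_subspace_unique[OF T X cX] in blast)
qed

section \<open>The constants and the decomposition\<close>

lemma sqrt_identity: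
  fixes d q a b Z d1 d2 e p p' p1 p1' p2 p2' :: real
  assumes "d > 0" "q > 0" "a > 0" "b > 0" "Z > 0" "d1 > 0" "d2 > 0" "e > 0" "p > 0" "p' > 0" "p1 > 0" "p1' > 0" "p2 > 0" "p2' > 0"
  shows "d * sqrt (q * a * b * Z / (d1 * d2 * (e * d))) / (a * b) / sqrt (d * (p * p')) =
    1 / sqrt (d1 * (p1 * p1')) * (1 / sqrt (d2 * (p2 * p2'))) * sqrt ((p2 * p1 * p1' * p2' * Z * q) / (p * p' * b * a * e))"
proof (rule power2_eq_imp_eq)
  show "(d * sqrt (q * a * b * Z / (d1 * d2 * (e * d))) / (a * b) / sqrt (d * (p * p')))\<^sup>2 =
    (1 / sqrt (d1 * (p1 * p1')) * (1 / sqrt (d2 * (p2 * p2'))) * sqrt ((p2 * p1 * p1' * p2' * Z * q) / (p * p' * b * a * e)))\<^sup>2"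
    using assms by (simp add: power_mult_distrib power_divide) (simp add: field_simps power2_eq_square)
qed (use assms in auto)

lemma lambda_cancel:
  fixes A B C D :: real
  assumes "A \<noteq> 0" "B \<noteq> 0" "C \<noteq> 0" "D \<noteq> 0"
  shows "m1 * m2 * (k1 * k2) * (1 / r1 * (1 / r2) * s) =
    (B * D * k1 / r1) * (A * C * k2 / r2) * (m1 / (A * B) * (m2 / (C * D))) * s"
  using assms by simp

definition lambda :: "ltree \<Rightarrow> nat \<Rightarrow> real" where
  "lambda T m = chi T m / sqrt (real (tdim T choose (m - label T)))"

lemma lambda_eq:
  assumes "label T \<le> m" "m + label T \<le> weight T"
  shows "lambda T m = fact m * fact (weight T - m) * kappa T / sqrt (fact (tdim T) * (fact (m - label T) * fact (weight T - m - label T)))"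
proof -
  have *: "x / P / sqrt (d / P) = x / sqrt (d * P)" if "P > 0" "d > 0" for x P d :: real
  proof -
    have "P * sqrt (d / P) = sqrt (P\<^sup>2) * sqrt (d / P)" using that by simp
    also have "\<dots> = sqrt (P\<^sup>2 * (d / P))" by (simp only: real_sqrt_mult)
    also have "P\<^sup>2 * (d / P) = d * P" using that by (simp add: power2_eq_square)
    finally show ?thesis using that by (simp add: field_simps)
  qed
  have le: "m - label T \<le> tdim T" and e: "tdim T - (m - label T) = weight T - m - label T"
    using assms by (auto simp: tdim_def)
  show ?thesis
    unfolding lambda_def chi_def binomial_fact[OF le] e by (rule *) simp_all
qed

lemma Xmap_Psi:
  assumes T: "rep_labeling T" and m: "label T \<le> m" "m + label T \<le> weight T"
  shows "Xmap (parts T) m (Psi T m) = cscale (of_real (lambda T m)) (psi_tree T m)"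
proof -
  let ?X = "{1..weight T}" and ?S = "{1..m}" and ?d = "tdim T" and ?p = "m - label T"
  have "Xmap (parts T) m (Psi T m) = cscale (of_real (chi T m)) (tree_emb T (mon1 ?d ?p))"
    unfolding Xmap_eq_XS Psi_eq_PsiS sum_list_parts
    using XS_PsiS[OF T, of ?X ?S] m by simp
  also have "?p \<le> ?d" using m by (auto simp: tdim_def)
  then have "tree_emb T (mon1 ?d ?p) = cscale (of_real (1 / sqrt (real (?d choose ?p)))) (psi_tree T m)"
    unfolding psi_tree_eq[OF T m] by (subst mon1_psi1) (simp_all only: linear_cscale_scale[OF linear_tree_emb[OF T]])
  finally show ?thesis by (simp add: lambda_def fun_eq_iff)
qed

text \<open>
  In closed form, \<open>m! * (n - m)!\<close> cancels against the multiplicity, and the remaining square roots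
  combine by \<open>sqrt_identity\<close>; the factor \<open>tnorm\<close> in \<open>kappa\<close> accounts for the factorials that
  depend on the labels only.
\<close>

lemma lambda_recursion:
  assumes T: "rep_labeling (Node k L R)" and m: "k \<le> m" "m + k \<le> weight L + weight R"
    and w: "w \<in> w_range (weight L + weight R) (weight L) (label L) (label R) m"
  shows "lambda (Node k L R) m = lambda L (m - w) * lambda R w * real (split_mult (weight L + weight R) (weight L) m w) *
           sqrt ((fact (w - label R) * fact (m - label L - w) * fact (weight L + w - m - label L) * fact (weight R - w - label R) *
                  fact (weight L + weight R - k - label L - label R + 1) * fact (k - label L - label R)) /
                 (fact (m - k) * fact (weight L + weight R - m - k) * fact (weight R + label L - k - label R) *
                  fact (weight L + label R - k - label L) * real (weight L + weight R - 2 * k + 1)))"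
proof -
  obtain \<alpha> \<beta> q where *: "k = label L + label R + q" "tdim L = \<alpha> + q" "tdim R = \<beta> + q" "tdim (Node k L R) = \<alpha> + \<beta>"
    "weight L = \<alpha> + q + 2 * label L" "weight R = \<beta> + q + 2 * label R"
    by (rule node_dims[OF T]) blast
  let ?i = "label L" and ?j = "label R" and ?a = "weight L" and ?b = "weight R"
  have ww: "?j \<le> w" "w + ?j \<le> ?b" "w + ?i \<le> m" "m + ?i \<le> ?a + w" using w unfolding w_range_iff by auto
  define p1 p2 p1' p2' p p' where "p1 = m - w - ?i" and "p2 = w - ?j" and "p1' = ?a - (m - w) - ?i" and "p2' = ?b - w - ?j"
    and "p = m - k" and "p' = ?a + ?b - m - k"
  have args: "w - ?j = p2" "m - ?i - w = p1" "?a + w - m - ?i = p1'" "?b - w - ?j = p2'" "m - k = p" "?a + ?b - m - k = p'"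
    unfolding p1_def p2_def p1'_def p2'_def p_def p'_def using ww by auto
  have args2: "?a + ?b - k - ?i - ?j + 1 = \<alpha> + \<beta> + q + 1" "k - ?i - ?j = q" "?b + ?i - k - ?j = \<beta>" "?a + ?j - k - ?i = \<alpha>" "?a + ?b - 2 * k + 1 = \<alpha> + \<beta> + 1"
    using * by auto
  have lT: "lambda (Node k L R) m = fact m * fact (?a + ?b - m) * kappa (Node k L R) / sqrt (fact (\<alpha> + \<beta>) * (fact p * fact p'))"
  proof -
    have le: "label (Node k L R) \<le> m" "m + label (Node k L R) \<le> weight (Node k L R)" using m by auto
    show ?thesis using lambda_eq[OF le] unfolding *(4) weight_simps label.simps args .
  qed
  have lL: "lambda L (m - w) = fact (m - w) * fact (?a - (m - w)) * kappa L / sqrt (fact (\<alpha> + q) * (fact p1 * fact p1'))"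
  proof -
    have "?i \<le> m - w" "m - w + ?i \<le> ?a" using ww by auto
    then show ?thesis unfolding p1_def p1'_def by (simp only: lambda_eq *(2))
  qed
  have lR: "lambda R w = fact w * fact (?b - w) * kappa R / sqrt (fact (\<beta> + q) * (fact p2 * fact p2'))"
    unfolding p2_def p2'_def using ww by (simp only: lambda_eq *(3))
  have sp: "real (split_mult (?a + ?b) ?a m w) = fact m / (fact w * fact (m - w)) * (fact (?a + ?b - m) / (fact (?b - w) * fact (?a - (m - w))))"
  proof -
    have "?a + ?b - m - (?b - w) = ?a - (m - w)" using ww m by auto
    moreover have "w \<le> m" "?b - w \<le> ?a + ?b - m" "?a + ?b - ?a - w = ?b - w" using ww m by auto
    ultimately show ?thesis unfolding split_mult_def by (simp only: of_nat_mult binomial_fact)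
  qed
  let ?s = "sqrt ((fact p2 * fact p1 * fact p1' * fact p2' * fact (\<alpha> + \<beta> + q + 1) * fact q) / (fact p * fact p' * fact \<beta> * fact \<alpha> * real (\<alpha> + \<beta> + 1)))"
  have kT: "kappa (Node k L R) = kappa L * kappa R * (fact (\<alpha> + \<beta>) * sqrt (fact q * fact \<alpha> * fact \<beta> * fact (\<alpha> + \<beta> + q + 1) / (fact (\<alpha> + q) * fact (\<beta> + q) * (real (\<alpha> + \<beta> + 1) * fact (\<alpha> + \<beta>)))) / (fact \<alpha> * fact \<beta>))"
  proof -
    have "fact (\<alpha> + \<beta> + 1) = real (\<alpha> + \<beta> + 1) * fact (\<alpha> + \<beta>)" by simp
    then show ?thesis unfolding kappa_Node[OF *(1-3)] tnorm_0 by (simp only: times_divide_eq_right mult.assoc)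
  qed
  have "lambda (Node k L R) m = fact m * fact (?a + ?b - m) * (kappa L * kappa R) *
     (fact (\<alpha> + \<beta>) * sqrt (fact q * fact \<alpha> * fact \<beta> * fact (\<alpha> + \<beta> + q + 1) / (fact (\<alpha> + q) * fact (\<beta> + q) * (real (\<alpha> + \<beta> + 1) * fact (\<alpha> + \<beta>)))) / (fact \<alpha> * fact \<beta>)
       / sqrt (fact (\<alpha> + \<beta>) * (fact p * fact p')))"
    unfolding lT kT by (simp only: times_divide_eq_right mult.assoc)
  also have "\<dots> = fact m * fact (?a + ?b - m) * (kappa L * kappa R) *
     (1 / sqrt (fact (\<alpha> + q) * (fact p1 * fact p1')) * (1 / sqrt (fact (\<beta> + q) * (fact p2 * fact p2'))) * ?s)"
    by (subst sqrt_identity[where ?p1.0 = "fact p1" and ?p1' = "fact p1'" and ?p2.0 = "fact p2" and ?p2' = "fact p2'"]) simp_all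
  also have "\<dots> = lambda L (m - w) * lambda R w * real (split_mult (?a + ?b) ?a m w) * ?s"
    unfolding lL lR sp by (rule lambda_cancel) simp_all
  finally show ?thesis unfolding args args2 .
qed

theorem proposition4p5:
  fixes T L R :: ltree and a :: "nat list" and n k i j a_t :: nat
  assumes T: "T = Node k L R"
    and a: "parts T = a" "\<forall>r<length a. 0 < a ! r" "sum_list a = n"
    and labeling: "rep_labeling T"
    and i: "i = label L" and j: "j = label R" and a_t: "a_t = weight L"
  shows "internal_direct_sum {k..n - k} (\<lambda>m. Xmap a m ` S_tree T {1..n}) (V_tree T) \<and>
    (\<exists>lam lam' lam'' :: nat \<Rightarrow> real.
      (\<forall>m\<le>n. k \<le> min (n - m) m \<longrightarrow>
         Xmap a m (Psi T m) = cscale (of_real (lam m)) (psi_tree T m)) \<and>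
      (\<forall>m\<le>a_t. i \<le> min (a_t - m) m \<longrightarrow>
         Xmap (parts L) m (Psi L m) = cscale (of_real (lam' m)) (psi_tree L m)) \<and>
      (\<forall>m\<le>n - a_t. j \<le> min (n - a_t - m) m \<longrightarrow>
         Xmap (parts R) m (Psi R m) = cscale (of_real (lam'' m)) (psi_tree R m)) \<and>
      (\<forall>m\<le>n. k \<le> min (n - m) m \<longrightarrow> (\<forall>w\<in>w_range n a_t i j m.
         lam m = lam' (m - w) * lam'' w * real (split_mult n a_t m w) *
           sqrt ((fact (w - j) * fact (m - i - w) * fact (a_t + w - m - i) * fact (n - a_t - w - j) *
                  fact (n - k - i - j + 1) * fact (k - i - j)) /
                 (fact (m - k) * fact (n - m - k) * fact (n - a_t + i - k - j) *
                  fact (a_t + j - k - i) * real (n - 2 * k + 1))))))"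
proof -
  have n: "n = weight T" "n = weight L + weight R" using a T by auto
  have b: "n - a_t = weight R" using n(2) a_t by simp
  have TL: "rep_labeling L" and TR: "rep_labeling R" using labeling T by auto
  have lab: "label T = k" using T by simp
  have k: "2 * k \<le> n" using rep_labeling_label_le[OF labeling] n lab by simp
  let ?X = "{1..n}" and ?d = "tdim T"
  let ?b = "\<lambda>p. tree_emb T (mon1 ?d p)"
  have d: "?d = n - 2 * k" using n lab by (simp add: tdim_def)
  have lines: "Xmap a m ` S_tree T ?X = {cscale c (?b (m - k)) |c. True}" if m: "m \<in> {k..n - k}" for m
  proof -
    have X: "finite ?X" "card ?X = weight T" using n by auto
    have "Xmap a m ` S_tree T ?X = XS (parts T) ?X {1..m} ` Psi_span T ?X"
      unfolding S_tree_eq[OF labeling X] Xmap_eq_XS a(1)[symmetric] using n(1) by simp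
    also have "\<dots> = {cscale c (?b (card {1..m} - label T)) |c. True}"
      by (rule XT_Psi_span[OF labeling X]) (use m lab n k in auto)
    finally show ?thesis using lab by simp
  qed
  have direct: "internal_direct_sum {k..n - k} (\<lambda>m. Xmap a m ` S_tree T ?X) (V_tree T)"
    unfolding internal_direct_sum_def
  proof (intro conjI)
    have bij: "(\<Sum>m\<in>{k..n - k}. f (m - k)) = (\<Sum>p\<le>?d. f p)" for f :: "nat \<Rightarrow> (complex \<times> complex) list \<Rightarrow> complex"
      by (rule sum.reindex_bij_witness[of _ "\<lambda>p. p + k" "\<lambda>m. m - k"]) (use d k in auto)
    have e: "tree_emb T (\<Sum>p\<le>?d. cscale (c p) (mon1 ?d p)) = (\<Sum>p\<le>?d. cscale (c p) (?b p))" for c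
      by (simp only: linear_cscale_sum[OF linear_tree_emb[OF labeling]] linear_cscale_scale[OF linear_tree_emb[OF labeling]])
    have vt: "V_tree T = {\<Sum>p\<le>?d. cscale (c p) (?b p) |c. True}"
    proof (intro set_eqI iffI)
      fix v assume "v \<in> V_tree T"
      then obtain c where "v = tree_emb T (\<Sum>p\<le>?d. cscale (c p) (mon1 ?d p))"
        unfolding V_tree_eq[OF labeling] V1_eq by blast
      then show "v \<in> {\<Sum>p\<le>?d. cscale (c p) (?b p) |c. True}" unfolding e by blast
    next
      fix v assume "v \<in> {\<Sum>p\<le>?d. cscale (c p) (?b p) |c. True}"
      then obtain c where "v = (\<Sum>p\<le>?d. cscale (c p) (?b p))" by blast
      then show "v \<in> V_tree T" unfolding V_tree_eq[OF labeling] V1_eq e[symmetric] by blast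
    qed
    show "V_tree T = {\<Sum>m\<in>{k..n - k}. v m |v. \<forall>m\<in>{k..n - k}. v m \<in> Xmap a m ` S_tree T ?X}"
    proof
      show "V_tree T \<subseteq> {\<Sum>m\<in>{k..n - k}. v m |v. \<forall>m\<in>{k..n - k}. v m \<in> Xmap a m ` S_tree T ?X}"
      proof
        fix v assume "v \<in> V_tree T"
        then obtain c where "v = (\<Sum>p\<le>?d. cscale (c p) (?b p))" unfolding vt by blast
        then have "v = (\<Sum>m\<in>{k..n - k}. cscale (c (m - k)) (?b (m - k)))" using bij[of "\<lambda>p. cscale (c p) (?b p)"] by simp
        moreover have "\<forall>m\<in>{k..n - k}. cscale (c (m - k)) (?b (m - k)) \<in> Xmap a m ` S_tree T ?X" using lines by blast
        ultimately show "v \<in> {\<Sum>m\<in>{k..n - k}. v m |v. \<forall>m\<in>{k..n - k}. v m \<in> Xmap a m ` S_tree T ?X}" by blast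
      qed
      show "{\<Sum>m\<in>{k..n - k}. v m |v. \<forall>m\<in>{k..n - k}. v m \<in> Xmap a m ` S_tree T ?X} \<subseteq> V_tree T"
      proof
        fix s assume "s \<in> {\<Sum>m\<in>{k..n - k}. v m |v. \<forall>m\<in>{k..n - k}. v m \<in> Xmap a m ` S_tree T ?X}"
        then obtain v where v: "s = (\<Sum>m\<in>{k..n - k}. v m)" "\<forall>m\<in>{k..n - k}. v m \<in> Xmap a m ` S_tree T ?X" by blast
        have "\<forall>m\<in>{k..n - k}. \<exists>c. v m = cscale c (?b (m - k))" using v(2) lines by blast
        then obtain c where c: "\<And>m. m \<in> {k..n - k} \<Longrightarrow> v m = cscale (c m) (?b (m - k))" by metis
        have "s = (\<Sum>m\<in>{k..n - k}. cscale (c ((m - k) + k)) (?b (m - k)))" unfolding v(1) by (intro sum.cong refl) (simp add: c)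
        also have "\<dots> = (\<Sum>p\<le>?d. cscale (c (p + k)) (?b p))" by (rule bij)
        finally show "s \<in> V_tree T" unfolding vt by (auto intro!: exI[of _ "\<lambda>p. c (p + k)"])
      qed
    qed
    show "\<forall>v. (\<forall>m\<in>{k..n - k}. v m \<in> Xmap a m ` S_tree T ?X) \<and> (\<Sum>m\<in>{k..n - k}. v m) = 0 \<longrightarrow> (\<forall>m\<in>{k..n - k}. v m = 0)"
    proof (intro allI impI)
      fix v assume v: "(\<forall>m\<in>{k..n - k}. v m \<in> Xmap a m ` S_tree T ?X) \<and> (\<Sum>m\<in>{k..n - k}. v m) = 0"
      have "\<forall>m\<in>{k..n - k}. \<exists>c. v m = cscale c (?b (m - k))" using v lines by blast
      then obtain c where c: "\<And>m. m \<in> {k..n - k} \<Longrightarrow> v m = cscale (c m) (?b (m - k))" by metis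
      have "0 = (\<Sum>m\<in>{k..n - k}. cscale (c ((m - k) + k)) (?b (m - k)))" using v c by simp
      also have "\<dots> = (\<Sum>p\<le>?d. cscale (c (p + k)) (?b p))" by (rule bij)
      finally have "(\<Sum>p\<le>?d. cscale (c (p + k)) (?b p)) = 0" by simp
      from independent_familyD[OF tree_emb_independent[OF labeling] this]
      have "c (p + k) = 0" if "p \<le> ?d" for p using that by simp
      then have "c m = 0" if "m \<in> {k..n - k}" for m
        using that d k by (metis (no_types, lifting) atLeastAtMost_iff diff_le_mono le_add_diff_inverse2 diff_diff_left mult_2)
      then show "\<forall>m\<in>{k..n - k}. v m = 0" using c by simp
    qed
  qed
  have 1: "\<forall>m\<le>n. k \<le> min (n - m) m \<longrightarrow> Xmap a m (Psi T m) = cscale (of_real (lambda T m)) (psi_tree T m)"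
    using Xmap_Psi[OF labeling] a(1) n(1) lab by auto
  have 2: "\<forall>m\<le>a_t. i \<le> min (a_t - m) m \<longrightarrow> Xmap (parts L) m (Psi L m) = cscale (of_real (lambda L m)) (psi_tree L m)"
    using Xmap_Psi[OF TL] a_t i by auto
  have 3: "\<forall>m\<le>n - a_t. j \<le> min (n - a_t - m) m \<longrightarrow> Xmap (parts R) m (Psi R m) = cscale (of_real (lambda R m)) (psi_tree R m)"
    unfolding b using Xmap_Psi[OF TR] j by auto
  have 4: "\<forall>m\<le>n. k \<le> min (n - m) m \<longrightarrow> (\<forall>w\<in>w_range n a_t i j m.
         lambda T m = lambda L (m - w) * lambda R w * real (split_mult n a_t m w) *
           sqrt ((fact (w - j) * fact (m - i - w) * fact (a_t + w - m - i) * fact (n - a_t - w - j) *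
                  fact (n - k - i - j + 1) * fact (k - i - j)) /
                 (fact (m - k) * fact (n - m - k) * fact (n - a_t + i - k - j) *
                  fact (a_t + j - k - i) * real (n - 2 * k + 1))))"
  proof (intro allI impI ballI)
    fix m w assume m: "m \<le> n" "k \<le> min (n - m) m" and w: "w \<in> w_range n a_t i j m"
    have "k \<le> m" "m + k \<le> weight L + weight R" using m n(2) by auto
    from lambda_recursion[OF labeling[unfolded T] this w[unfolded n(2) a_t i j]]
    show "lambda T m = lambda L (m - w) * lambda R w * real (split_mult n a_t m w) *
           sqrt ((fact (w - j) * fact (m - i - w) * fact (a_t + w - m - i) * fact (n - a_t - w - j) *
                  fact (n - k - i - j + 1) * fact (k - i - j)) /
                 (fact (m - k) * fact (n - m - k) * fact (n - a_t + i - k - j) *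
                  fact (a_t + j - k - i) * real (n - 2 * k + 1)))"
      unfolding b unfolding T n(2) a_t i j .
  qed
  show ?thesis using direct 1 2 3 4 by blast
qed

end
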